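(* Let $f\in H^1(\mathbb{T})$ (complex-valued) with Fourier coefficients $\hat f_k$, and let $0<\beta\le2$. Then for every $n\in\mathbb{N}$ \[ \left|\mathbb{E}_\beta^{2n}\left\{\prod_{j=1}^{2n}e^{f(\theta_j)}\right\}\exp\left(-2n\hat f_0-\frac2\beta\sum_{k\ge1}k\hat f_k\hat f_{-k}\right)-1\right| \le\frac{4}{\beta^2n}\exp\left(\frac1\beta\|f\|_{\dot H^{1/2}(\mathbb{T})}^2-\frac2\beta\,\Re\sum_{k\ge1}k\hat f_k\hat f_{-k}\right)\|f\|_{\dot H^1(\mathbb{T})}^2 . \]
   Context: Circular $\beta$-ensemble: for $\beta>0$, $\mathbb{E}_\beta^n$ is expectation with respect to the probability measure $d\mathbb{P}_\beta^n(\theta_1,\dots,\theta_n)=Z_{n,\beta}^{-1}\prod_{1\le l<m\le n}|e^{i\theta_l}-e^{i\theta_m}|^\beta\prod_{k=1}^n d\theta_k$, $\theta_j\in(-\pi,\pi)$, where $Z_{n,\beta}$ is the normalization constant. For a function $f(\theta)=\sum_{k\in\mathbb{Z}}\hat f_ke^{ik\theta}$ in $L^2(\mathbb{T})$ set $\|f\|_{\dot H^p(\mathbb{T})}^2=\sum_{k\in\mathbb{Z}}|k|^{2p}|\hat f_k|^2$, and $H^p(\mathbb{T})=\{f\in L^2(\mathbb{T}):\|f\|_{\dot H^p(\mathbb{T})}<+\infty\}$. *)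

theory Defs
  imports "HOL-Analysis.Analysis"
begin

text \<open>Functions on the circle are given in the angular coordinate \<open>\<theta> \<in> (-\<pi>, \<pi>)\<close>; their values
  outside this interval play no role. Elements of \<open>L\<^sup>2\<close> are given by Borel measurable
  representatives.\<close>

definition arc_measure :: "real measure" where
  "arc_measure = restrict_space lborel {-pi<..<pi}"

definition L2_circle :: "(real \<Rightarrow> complex) set" where
  "L2_circle = {f \<in> borel_measurable arc_measure. integrable arc_measure (\<lambda>\<theta>. (cmod (f \<theta>))\<^sup>2)}"

definition fourier_coeff :: "(real \<Rightarrow> complex) \<Rightarrow> int \<Rightarrow> complex" where
  "fourier_coeff f k =
     (\<integral>\<theta>. f \<theta> * exp (- (\<i> * of_int k * complex_of_real \<theta>)) \<partial>arc_measure) / complex_of_real (2 * pi)"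

text \<open>Since \<open>0 powr (2 * p) = 0\<close>, the term \<open>k = 0\<close> vanishes for every \<open>p\<close>, so the definition agrees
  with the usual one for \<open>p > 0\<close>. If the series diverges, \<open>infsum\<close> returns \<open>0\<close>; finiteness of
  the seminorm is therefore expressed by summability in \<open>sobolev_circle\<close>.\<close>

definition sobolev_seminorm :: "real \<Rightarrow> (real \<Rightarrow> complex) \<Rightarrow> real" where
  "sobolev_seminorm p f =
     sqrt (\<Sum>\<^sub>\<infinity>k\<in>UNIV. \<bar>real_of_int k\<bar> powr (2 * p) * (cmod (fourier_coeff f k))\<^sup>2)"

definition sobolev_circle :: "real \<Rightarrow> (real \<Rightarrow> complex) set" where
  "sobolev_circle p =
     {f \<in> L2_circle.
        (\<lambda>k::int. \<bar>real_of_int k\<bar> powr (2 * p) * (cmod (fourier_coeff f k))\<^sup>2) summable_on UNIV}"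

definition circular_weight :: "real \<Rightarrow> nat \<Rightarrow> (nat \<Rightarrow> real) \<Rightarrow> real" where
  "circular_weight \<beta> n \<theta> =
     (\<Prod>(l, m) \<in> {(l, m). l < m \<and> m < n}. cmod (exp (\<i> * \<theta> l) - exp (\<i> * \<theta> m)) powr \<beta>)"

definition circular_partition :: "real \<Rightarrow> nat \<Rightarrow> real" where
  "circular_partition \<beta> n =
     (\<integral>\<theta>. circular_weight \<beta> n \<theta> \<partial>(\<Pi>\<^sub>M j\<in>{..<n}. arc_measure))"

definition circular_ensemble :: "real \<Rightarrow> nat \<Rightarrow> (nat \<Rightarrow> real) measure" where
  "circular_ensemble \<beta> n =
     density (\<Pi>\<^sub>M j\<in>{..<n}. arc_measure)
       (\<lambda>\<theta>. ennreal (circular_weight \<beta> n \<theta> / circular_partition \<beta> n))"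

definition circular_expectation ::
    "real \<Rightarrow> nat \<Rightarrow> ((nat \<Rightarrow> real) \<Rightarrow> complex) \<Rightarrow> complex" where
  "circular_expectation \<beta> n F = (\<integral>\<theta>. F \<theta> \<partial>circular_ensemble \<beta> n)"

end

theory Submission
  imports Defs "HOL-Library.Function_Algebras" "HOL-Library.Multiset" "HOL-Library.Fun_Lexorder"
    "HOL-Computational_Algebra.Fundamental_Theorem_Algebra" "HOL-Computational_Algebra.Formal_Power_Series"
begin

text \<open>Let \<open>\<alpha> = 2 / \<beta>\<close> and \<open>N = 2 * n\<close>. On polynomials in the power sums \<open>p\<^sub>k\<close> there are two inner
  products: the Gaussian one, for which the \<open>p\<^sub>k\<close> are independent complex Gaussians of variance \<open>\<alpha> * k\<close>, and the
  expectation over the ensemble. The Laplace--Beltrami operator is self-adjoint for both, so it commutes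
  with the Gram operator of the second inner product relative to the first. The adjoints of the vector
  field \<open>\<Sum>\<^sub>i \<partial>\<^sub>i\<close> for the two products differ only in that \<open>N\<close> becomes \<open>N + \<alpha> - 1\<close>, so the Gram
  operator intertwines the corresponding lowering operators. Hence the Gram
  eigenvalue of a joint eigenvector is that of one of the next lower degree times
  \<open>(N + \<alpha> * m - q) / (N + \<alpha> * m - q + \<alpha> - 1)\<close>, where \<open>\<alpha> * m - q\<close> is the content of a removable box,
  and for \<open>\<alpha> \<ge> 1\<close> this puts all eigenvalues in degree \<open>d\<close> between \<open>1 - \<alpha> * d / n\<close> and \<open>1\<close>.
  Applied to exponentials of power sums, whose Gaussian inner products are explicit, this is the bound for
  trigonometric polynomials. Partial Fourier sums of an \<open>H\<^sup>1\<close> function converge absolutely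
  and uniformly, so the bound passes to the limit.\<close>

text \<open>Jack functions are never constructed: eigenvalues of \<open>lap\<close> can coincide
  within one degree (already for \<alpha> = 1), and \<open>dp 1\<close> of an eigenvector mixes the
  contents of several removable boxes. To bound a Gram eigenvalue it is enough to follow a single
  chain of boxes down to degree 0, and the lexicographically leading monomial in N variables
  supplies one box at each stage. Taking N = 2 * n leaves room for this: for d \<le> n every content
  met is at least 1 - n, so every factor is at least 1 - (\<alpha> - 1) / (n + \<alpha>), and
  Bernoulli's inequality gives 1 - \<alpha> * d / n. For d > n that bound is nonpositive and follows
  from positivity of the Gram operator. Splitting f into positive and negative frequencies turns the
  expectation into an inner product of two exponentials. Different degrees are orthogonal for both
  products, and the loss \<alpha> * d / n in degree d, summed against the Gaussian norms of the
  degree parts, produces the square of the H^1 norm. The comparison yields 2 / (\<beta>^2 * n); the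
  constant 4 is twice that.\<close>

declare plus_fun_apply [simp del] zero_fun_apply [simp del] times_fun_apply [simp del]
  one_fun_apply [simp del] minus_apply [simp del] uminus_apply [simp del]

section \<open>Vector space of complex-valued functions and linear operators on it\<close>

lemma sum_fun_apply: "(\<Sum>i\<in>A. F i) x = (\<Sum>i\<in>A. F i x)"
  by (induction A rule: infinite_finite_induct) (simp_all add: zero_fun_apply plus_fun_apply)

definition cscale :: "complex \<Rightarrow> ('a \<Rightarrow> complex) \<Rightarrow> 'a \<Rightarrow> complex" where
  "cscale c F = (\<lambda>x. c * F x)"

lemma cscale_apply: "cscale c F x = c * F x"
  by (simp add: cscale_def)

lemmas pointwise = fun_eq_iff plus_fun_apply minus_apply zero_fun_apply uminus_apply cscale_apply sum_fun_apply

interpretation cfun: vector_space "cscale :: complex \<Rightarrow> ('a \<Rightarrow> complex) \<Rightarrow> 'a \<Rightarrow> complex"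
  by unfold_locales (auto simp: pointwise algebra_simps)

abbreviation clinear_op :: "(('a \<Rightarrow> complex) \<Rightarrow> 'b \<Rightarrow> complex) \<Rightarrow> bool" where
  "clinear_op \<equiv> Vector_Spaces.linear cscale cscale"

lemma clinear_opI:
  assumes "\<And>F G. S (F + G) = S F + S G" "\<And>c F. S (cscale c F) = cscale c (S F)"
  shows "clinear_op S"
  using assms by unfold_locales auto

context
  fixes S :: "('a \<Rightarrow> complex) \<Rightarrow> 'b \<Rightarrow> complex"
  assumes S: "clinear_op S"
begin

interpretation Vector_Spaces.linear cscale cscale S by (rule S)

lemma clinear_op_add: "S (F + G) = S F + S G" by (rule add)
lemma clinear_op_diff: "S (F - G) = S F - S G" by (rule diff)
lemma clinear_op_scale: "S (cscale c F) = cscale c (S F)" by (rule scale)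
lemma clinear_op_0: "S 0 = 0" by (rule zero)
lemma clinear_op_sum: "S (\<Sum>i\<in>A. H i) = (\<Sum>i\<in>A. S (H i))" by (rule sum)

end

lemma clinear_op_ident: "clinear_op (\<lambda>F. F)"
  by (rule clinear_opI) (rule refl)+

lemma clinear_op_comp:
  assumes "clinear_op S" "clinear_op R"
  shows "clinear_op (\<lambda>F. S (R F))"
  by (rule clinear_opI)
    (simp_all only: assms[THEN clinear_op_add] assms[THEN clinear_op_scale])

lemma clinear_op_plus:
  assumes "clinear_op S" "clinear_op R"
  shows "clinear_op (\<lambda>F. S F + R F)"
  by (rule clinear_opI)
    (simp_all only: assms[THEN clinear_op_add] assms[THEN clinear_op_scale] add.assoc add.left_commute
      cfun.scale_right_distrib)

lemma clinear_op_minus: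
  assumes "clinear_op S" "clinear_op R"
  shows "clinear_op (\<lambda>F. S F - R F)"
  by (rule clinear_opI)
    (simp_all add: assms[THEN clinear_op_add] assms[THEN clinear_op_scale] cfun.scale_right_diff_distrib)

lemma clinear_op_cscale:
  assumes "clinear_op S"
  shows "clinear_op (\<lambda>F. cscale c (S F))"
  by (rule clinear_opI)
    (simp_all add: clinear_op_add[OF assms] clinear_op_scale[OF assms] cfun.scale_right_distrib mult.commute)

lemma clinear_op_setsum:
  assumes "\<And>i. i \<in> A \<Longrightarrow> clinear_op (S i)"
  shows "clinear_op (\<lambda>F. \<Sum>i\<in>A. S i F)"
  by (rule clinear_opI)
    (simp_all add: assms[THEN clinear_op_add] assms[THEN clinear_op_scale] sum.distrib cfun.scale_sum_right)

text \<open>Subspaces are given by support conditions, so that a finite \<open>I\<close> yields a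
  finite-dimensional space to which spectral arguments apply, while the operators stay defined on
  the full function type.\<close>

definition supported :: "'a set \<Rightarrow> ('a \<Rightarrow> complex) set" where
  "supported I = {F. \<forall>x. F x \<noteq> 0 \<longrightarrow> x \<in> I}"

lemma supported_add: "F \<in> supported I \<Longrightarrow> G \<in> supported I \<Longrightarrow> F + G \<in> supported I"
  and supported_diff: "F \<in> supported I \<Longrightarrow> G \<in> supported I \<Longrightarrow> F - G \<in> supported I"
  and supported_cscale: "F \<in> supported I \<Longrightarrow> cscale c F \<in> supported I"
  and supported_0: "0 \<in> supported I"
  by (simp_all add: supported_def pointwise, (metis add.right_neutral diff_0_right)+)

lemma supported_sum: "(\<And>i. i \<in> A \<Longrightarrow> H i \<in> supported I) \<Longrightarrow> (\<Sum>i\<in>A. H i) \<in> supported I"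
  by (induction A rule: infinite_finite_induct) (auto intro: supported_0 supported_add)

subsection \<open>Polynomials of an operator\<close>

definition op_poly :: "(('a \<Rightarrow> complex) \<Rightarrow> 'a \<Rightarrow> complex) \<Rightarrow> complex poly \<Rightarrow> ('a \<Rightarrow> complex) \<Rightarrow> 'a \<Rightarrow> complex" where
  "op_poly S g w = (\<Sum>i\<le>degree g. cscale (coeff g i) ((S ^^ i) w))"

lemma op_poly_bound:
  assumes "degree g \<le> m"
  shows "op_poly S g w = (\<Sum>i\<le>m. cscale (coeff g i) ((S ^^ i) w))"
  unfolding op_poly_def using assms
  by (intro sum.mono_neutral_left) (auto simp: coeff_eq_0 pointwise)

lemma op_poly_0 [simp]: "op_poly S 0 w = 0"
  by (simp add: op_poly_def pointwise)

lemma op_poly_pCons: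
  assumes "clinear_op S"
  shows "op_poly S (pCons a g) w = cscale a w + S (op_poly S g w)"
proof -
  have "op_poly S (pCons a g) w = (\<Sum>i\<le>Suc (degree g). cscale (coeff (pCons a g) i) ((S ^^ i) w))"
    by (rule op_poly_bound) (simp add: degree_pCons_le)
  also have "\<dots> = cscale a w + (\<Sum>i\<le>degree g. cscale (coeff g i) ((S ^^ Suc i) w))"
    by (subst sum.atMost_Suc_shift) simp
  also have "(\<Sum>i\<le>degree g. cscale (coeff g i) ((S ^^ Suc i) w)) = S (op_poly S g w)"
    by (simp add: op_poly_def clinear_op_sum[OF assms] clinear_op_scale[OF assms])
  finally show ?thesis .
qed

lemma op_poly_add: "op_poly S (p + q) w = op_poly S p w + op_poly S q w"
proof -
  define m where "m = max (degree p) (degree q)"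
  have "degree (p + q) \<le> m" "degree p \<le> m" "degree q \<le> m"
    by (auto simp: m_def degree_add_le_max)
  then show ?thesis
    by (simp add: op_poly_bound[of _ m] sum.distrib[symmetric] pointwise algebra_simps)
qed

lemma op_poly_smult: "op_poly S (smult c p) w = cscale c (op_poly S p w)"
  using degree_smult_le[of c p]
  by (simp add: op_poly_bound[of _ "degree p"] pointwise sum_distrib_left algebra_simps)

lemma op_poly_mult:
  assumes "clinear_op S"
  shows "op_poly S (p * q) w = op_poly S p (op_poly S q w)"
proof (induction p)
  case (pCons a p)
  then show ?case
    by (simp add: op_poly_add op_poly_smult op_poly_pCons[OF assms])
qed simp

lemma op_poly_linear_factor:
  assumes "clinear_op S"
  shows "op_poly S [:- r, 1:] w = S w - cscale r w"
  by (simp add: op_poly_pCons[OF assms] clinear_op_0[OF assms] pointwise)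

lemma funpow_supported:
  assumes "\<And>F. F \<in> V \<Longrightarrow> S F \<in> V" "w \<in> V"
  shows "(S ^^ i) w \<in> V"
  using assms by (induction i) auto

lemma op_poly_supported:
  assumes "\<And>F. F \<in> supported I \<Longrightarrow> S F \<in> supported I" "w \<in> supported I"
  shows "op_poly S p w \<in> supported I"
  unfolding op_poly_def
  by (intro supported_sum supported_cscale funpow_supported assms)

lemma clinear_op_poly: "clinear_op S \<Longrightarrow> clinear_op (op_poly S p)"
proof (induction p)
  case 0
  then show ?case
    by (intro clinear_opI) auto
next
  case (pCons a p)
  then show ?case
    by (intro clinear_opI)
      (simp_all add: op_poly_pCons clinear_op_add[OF pCons.prems] clinear_op_scale[OF pCons.prems]
        clinear_op_add[OF pCons.IH] clinear_op_scale[OF pCons.IH] cfun.scale_right_distrib mult.commute)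
qed

text \<open>Commutation is demanded on \<open>V\<close> only, since \<open>gram_lap\<close> provides
  it on one homogeneous component at a time; the intermediate vectors remain there because
  \<open>S\<close> preserves it.\<close>

lemma op_poly_commute:
  assumes S: "clinear_op S" and R: "clinear_op R"
    and comm: "\<And>F. F \<in> V \<Longrightarrow> S (R F) = R (S F)"
    and VS: "\<And>F. F \<in> supported I \<Longrightarrow> S F \<in> supported I"
    and V: "V = supported I" and w: "w \<in> V"
  shows "op_poly S p (R w) = R (op_poly S p w)"
proof (induction p)
  case 0
  then show ?case by (simp only: op_poly_0 clinear_op_0[OF R])
next
  case (pCons a p)
  then show ?case
    using op_poly_supported[of I S w p] VS w V
    by (simp add: op_poly_pCons[OF S] clinear_op_add[OF R] clinear_op_scale[OF R] comm)
qed

lemma op_poly_eigen: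
  assumes S: "clinear_op S" and e: "S u = cscale r u"
  shows "op_poly S p u = cscale (poly p r) u"
proof (induction p)
  case (pCons a p)
  then show ?case
    by (simp add: op_poly_pCons[OF S] clinear_op_scale[OF S] e cfun.scale_left_distrib mult.commute)
qed (simp add: pointwise)

text \<open>With n = card I, the n + 1 vectors w, S w, ..., S^n w lie in a space of dimension n, and
  a linear relation between them is a polynomial in S that kills w.\<close>

lemma exists_annihilating_poly:
  fixes S :: "('a \<Rightarrow> complex) \<Rightarrow> 'a \<Rightarrow> complex"
  assumes I: "finite I"
    and SV: "\<And>F. F \<in> supported I \<Longrightarrow> S F \<in> supported I" and w: "w \<in> supported I"
  shows "\<exists>P. P \<noteq> 0 \<and> op_poly S P w = 0"
proof -
  define n where "n = card I"
  define v where "v i = (S ^^ i) w" for i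
  have v: "v i \<in> supported I" for i
    unfolding v_def by (rule funpow_supported) (use SV w in auto)
  show ?thesis
  \<comment> \<open>\<open>cfun.dependent\<close> speaks of sets, so a repetition among the Krylov
    vectors is treated separately; it gives the relation t^j - t^i.\<close>
  proof (cases "inj_on v {..n}")
    case False
    then obtain i j where ij: "i < j" "v i = v j"
      by (metis inj_onI linorder_neqE_nat)
    define P :: "complex poly" where "P = monom 1 j - monom 1 i"
    have "coeff P j = 1" using ij by (simp add: P_def)
    then have "P \<noteq> 0" by auto
    have d: "degree P \<le> j"
      unfolding P_def using ij by (intro degree_diff_le) (auto intro: order.trans[OF degree_monom_le])
    have "op_poly S P w = (\<Sum>k\<le>j. cscale (coeff P k) (v k))"
      using op_poly_bound[OF d] by (simp add: v_def)
    also have "\<dots> = (\<Sum>k\<in>{i,j}. cscale (coeff P k) (v k))"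
      using ij by (intro sum.mono_neutral_right) (auto simp: P_def pointwise)
    also have "\<dots> = 0" using ij by (simp add: P_def pointwise)
    finally show ?thesis using \<open>P \<noteq> 0\<close> by blast
  next
    case True
    define \<delta> where "\<delta> x = (\<lambda>y. if y = x then 1 else 0 :: complex)" for x :: 'a
    have span: "F \<in> cfun.span (\<delta> ` I)" if "F \<in> supported I" for F
    proof -
      have "F = (\<Sum>x\<in>I. cscale (F x) (\<delta> x))"
        using that I by (auto simp: pointwise \<delta>_def supported_def if_distrib cong: if_cong)
      also have "\<dots> \<in> cfun.span (\<delta> ` I)"
        by (intro cfun.span_sum cfun.span_scale cfun.span_base) auto
      finally show ?thesis .
    qed
    have "cfun.dependent (v ` {..n})"
    proof (rule ccontr)
      assume "\<not> ?thesis"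
      then have "card (v ` {..n}) \<le> card (\<delta> ` I)"
        using cfun.independent_span_bound[of "\<delta> ` I" "v ` {..n}"] I v span by auto
      also have "\<dots> \<le> n" unfolding n_def by (rule card_image_le[OF I])
      finally show False using True by (simp add: card_image)
    qed
    then obtain u a where u: "a \<in> v ` {..n}" "u a \<noteq> 0" "(\<Sum>x\<in>v ` {..n}. cscale (u x) x) = 0"
      by (auto simp: cfun.dependent_finite)
    define P where "P = (\<Sum>i\<le>n. monom (u (v i)) i)"
    have c: "coeff P i = (if i \<le> n then u (v i) else 0)" for i
      by (simp add: P_def coeff_sum)
    have "P \<noteq> 0" using u c by (metis (mono_tags) atMost_iff coeff_0 imageE)
    moreover have "degree P \<le> n" by (rule degree_le) (simp add: c)
    then have "op_poly S P w = (\<Sum>i\<le>n. cscale (u (v i)) (v i))"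
      by (simp add: op_poly_bound v_def[symmetric] c)
    then have "op_poly S P w = 0"
      using u(3) True by (simp add: sum.reindex)
    ultimately show ?thesis by blast
  qed
qed

lemma root_factor:
  fixes P :: "complex poly"
  assumes "poly P r = 0" "P \<noteq> 0"
  obtains g where "P = [:- r, 1:] * g" "g \<noteq> 0" "degree P = Suc (degree g)"
proof -
  obtain g where g: "P = [:- r, 1:] * g"
    using assms(1) unfolding poly_eq_0_iff_dvd dvd_def ..
  then have "g \<noteq> 0" using assms(2) by auto
  moreover from this have "degree P = degree [:- r, 1:] + degree g"
    unfolding g by (intro degree_mult_eq) auto
  ultimately show thesis using that g by simp
qed

text \<open>The witness is a minimal annihilating polynomial.\<close>

lemma exists_eigenvector_poly:
  fixes S :: "('a \<Rightarrow> complex) \<Rightarrow> 'a \<Rightarrow> complex"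
  assumes S: "clinear_op S" and I: "finite I"
    and SV: "\<And>F. F \<in> supported I \<Longrightarrow> S F \<in> supported I" and w: "w \<in> supported I"
  shows "\<exists>P. P \<noteq> 0 \<and> op_poly S P w = 0 \<and>
           (\<forall>r. poly P r = 0 \<longrightarrow> (\<exists>g. op_poly S g w \<noteq> 0 \<and> S (op_poly S g w) = cscale r (op_poly S g w)))"
proof -
  obtain P0 where P0: "P0 \<noteq> 0 \<and> op_poly S P0 w = 0"
    using exists_annihilating_poly[of I S w, OF I SV w] by auto
  define P where "P = arg_min degree (\<lambda>P. P \<noteq> 0 \<and> op_poly S P w = 0)"
  have P: "P \<noteq> 0" "op_poly S P w = 0"
    unfolding P_def using arg_min_natI[of "\<lambda>P. P \<noteq> 0 \<and> op_poly S P w = 0", OF P0] by auto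
  have min: "degree P \<le> degree Q" if "Q \<noteq> 0 \<and> op_poly S Q w = 0" for Q
    unfolding P_def by (rule arg_min_nat_le[of "\<lambda>P. P \<noteq> 0 \<and> op_poly S P w = 0", OF that])
  have "\<exists>g. op_poly S g w \<noteq> 0 \<and> S (op_poly S g w) = cscale r (op_poly S g w)" if root: "poly P r = 0" for r
  proof -
    obtain g where g: "P = [:- r, 1:] * g" and "g \<noteq> 0" "degree P = Suc (degree g)"
      using root_factor[OF root P(1)] by blast
    then have "op_poly S g w \<noteq> 0" using min[of g] \<open>g \<noteq> 0\<close> by auto
    moreover have "S (op_poly S g w) - cscale r (op_poly S g w) = 0"
      using P(2) unfolding g op_poly_mult[OF S] op_poly_linear_factor[OF S] .
    ultimately show ?thesis by (intro exI[of _ g]) simp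
  qed
  then show ?thesis using P by blast
qed

lemma exists_eigenvector:
  fixes S :: "('a \<Rightarrow> complex) \<Rightarrow> 'a \<Rightarrow> complex"
  assumes S: "clinear_op S" and I: "finite I"
    and SV: "\<And>F. F \<in> supported I \<Longrightarrow> S F \<in> supported I" and w: "w \<in> supported I" "w \<noteq> 0"
  shows "\<exists>g r. op_poly S g w \<noteq> 0 \<and> S (op_poly S g w) = cscale r (op_poly S g w)"
proof -
  obtain P where P: "P \<noteq> 0" "op_poly S P w = 0"
    "\<forall>r. poly P r = 0 \<longrightarrow> (\<exists>g. op_poly S g w \<noteq> 0 \<and> S (op_poly S g w) = cscale r (op_poly S g w))"
    using exists_eigenvector_poly[of S I w, OF S I SV w(1)] by auto
  have "degree P \<noteq> 0"
  proof
    assume "degree P = 0"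
    then obtain c where "P = [:c:]" by (rule degree_eq_zeroE)
    then have "c \<noteq> 0" and "cscale c w = 0"
      using P(1,2) by (simp_all add: op_poly_pCons[OF S] clinear_op_0[OF S])
    then show False using w(2) by (simp add: pointwise)
  qed
  then obtain r where "poly P r = 0"
    using fundamental_theorem_of_algebra[of P] by (auto simp: constant_degree)
  then show ?thesis using P by blast
qed

subsection \<open>Weighted inner products\<close>

definition ip :: "'a set \<Rightarrow> ('a \<Rightarrow> real) \<Rightarrow> ('a \<Rightarrow> complex) \<Rightarrow> ('a \<Rightarrow> complex) \<Rightarrow> complex" where
  "ip I \<omega> F G = (\<Sum>x\<in>I. complex_of_real (\<omega> x) * F x * cnj (G x))"

lemma ip_add_left: "ip I \<omega> (F + F') G = ip I \<omega> F G + ip I \<omega> F' G"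
  and ip_diff_left: "ip I \<omega> (F - F') G = ip I \<omega> F G - ip I \<omega> F' G"
  and ip_scale_left: "ip I \<omega> (cscale c F) G = c * ip I \<omega> F G"
  and ip_add_right: "ip I \<omega> F (G + G') = ip I \<omega> F G + ip I \<omega> F G'"
  and ip_diff_right: "ip I \<omega> F (G - G') = ip I \<omega> F G - ip I \<omega> F G'"
  and ip_scale_right: "ip I \<omega> F (cscale c G) = cnj c * ip I \<omega> F G"
  and ip_0_left: "ip I \<omega> 0 G = 0"
  and ip_0_right: "ip I \<omega> F 0 = 0"
  by (simp_all add: ip_def pointwise sum.distrib[symmetric] sum_subtractf[symmetric] sum_distrib_left algebra_simps)

lemma ip_sum_left: "ip I \<omega> (\<Sum>i\<in>A. H i) G = (\<Sum>i\<in>A. ip I \<omega> (H i) G)"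
  by (induction A rule: infinite_finite_induct) (simp_all add: ip_add_left ip_0_left)

lemma ip_sum_right: "ip I \<omega> F (\<Sum>i\<in>A. H i) = (\<Sum>i\<in>A. ip I \<omega> F (H i))"
  by (induction A rule: infinite_finite_induct) (simp_all add: ip_add_right ip_0_right)

lemmas ip_linear = ip_add_left ip_diff_left ip_scale_left ip_add_right ip_diff_right ip_scale_right
  ip_0_left ip_0_right ip_sum_left ip_sum_right

lemma ip_cnj: "cnj (ip I \<omega> F G) = ip I \<omega> G F"
  by (simp add: ip_def mult_ac)

lemma ip_self: "ip I \<omega> F F = complex_of_real (\<Sum>x\<in>I. \<omega> x * (cmod (F x))\<^sup>2)"
  unfolding ip_def of_real_sum by (intro sum.cong refl) (simp add: complex_norm_square[symmetric] mult.assoc)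

lemma ip_self_eq_0:
  assumes "finite I" "\<And>x. x \<in> I \<Longrightarrow> \<omega> x > 0" "F \<in> supported I" "ip I \<omega> F F = 0"
  shows "F = 0"
proof -
  have "(\<Sum>x\<in>I. \<omega> x * (cmod (F x))\<^sup>2) = 0"
    using assms(4) by (simp only: ip_self of_real_eq_0_iff)
  then have "\<forall>x\<in>I. \<omega> x * (cmod (F x))\<^sup>2 = 0"
    using assms by (subst (asm) sum_nonneg_eq_0_iff) (auto simp: less_imp_le)
  then have "\<forall>x\<in>I. F x = 0" using assms(2) by fastforce
  then show ?thesis using assms(3) by (auto simp: pointwise supported_def)
qed

lemma ip_self_nonneg: "(\<And>x. x \<in> I \<Longrightarrow> \<omega> x > 0) \<Longrightarrow> Re (ip I \<omega> F F) \<ge> 0"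
  by (auto simp: ip_self less_imp_le intro!: sum_nonneg)

text \<open>Peel off one eigenvector at a time; the degree of an annihilating polynomial drops.\<close>

lemma positive_of_eigenvalues:
  fixes S :: "('a \<Rightarrow> complex) \<Rightarrow> 'a \<Rightarrow> complex"
  assumes S: "clinear_op S" and I: "finite I" and J: "J \<subseteq> I"
    and \<omega>: "\<And>x. x \<in> I \<Longrightarrow> \<omega> x > 0"
    and SV: "\<And>F. F \<in> supported J \<Longrightarrow> S F \<in> supported J"
    and sym: "\<And>F G. F \<in> supported J \<Longrightarrow> G \<in> supported J \<Longrightarrow> ip I \<omega> (S F) G = ip I \<omega> F (S G)"
    and ev: "\<And>u r. u \<in> supported J \<Longrightarrow> u \<noteq> 0 \<Longrightarrow> S u = cscale (complex_of_real r) u \<Longrightarrow> r \<ge> 0"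
    and F: "F \<in> supported J"
  shows "Re (ip I \<omega> (S F) F) \<ge> 0"
proof -
  have JI: "G \<in> supported I" if "G \<in> supported J" for G using that J by (auto simp: supported_def)
  have main: "Re (ip I \<omega> (S F) F) \<ge> 0"
    if "P \<noteq> 0" "op_poly S P F = 0" "F \<in> supported J" for P F
    using that
  proof (induction "degree P" arbitrary: P F rule: less_induct)
    case less
    note F = \<open>F \<in> supported J\<close>
    show ?case
    proof (cases "degree P = 0")
      case True
      then obtain c where "P = [:c:]" by (rule degree_eq_zeroE)
      then have "c \<noteq> 0" "cscale c F = 0"
        using less.prems by (auto simp: op_poly_pCons[OF S] clinear_op_0[OF S])
      then have "F = 0" by (auto simp: pointwise)
      then show ?thesis by (simp add: ip_0_right)
    next
      case False
      then obtain r where "poly P r = 0"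
        using fundamental_theorem_of_algebra[of P] by (auto simp: constant_degree)
      then obtain g where g: "P = [:- r, 1:] * g" and "g \<noteq> 0" and "degree P = Suc (degree g)"
        using root_factor less.prems(1) by blast
      then have deg: "degree g < degree P" by simp
      define u where "u = op_poly S g F"
      have uJ: "u \<in> supported J" unfolding u_def by (rule op_poly_supported[of J S F, OF SV F])
      have "S u - cscale r u = 0"
        using less.prems(2) unfolding g op_poly_mult[OF S] op_poly_linear_factor[OF S] u_def .
      then have Su: "S u = cscale r u" by simp
      show ?thesis
      proof (cases "u = 0")
        case True
        then show ?thesis using less.hyps[OF deg \<open>g \<noteq> 0\<close> _ F] by (simp add: u_def)
      next
        case False
        then have uu: "ip I \<omega> u u \<noteq> 0" using ip_self_eq_0[of I \<omega> u, OF I \<omega> JI[OF uJ]] by blast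
        have "r * ip I \<omega> u u = cnj r * ip I \<omega> u u"
          using sym[OF uJ uJ] by (simp add: Su ip_linear)
        then have "r = cnj r" using uu by simp
        then obtain \<rho> where \<rho>: "r = complex_of_real \<rho>"
          by (metis Reals_cnj_iff Reals_cases)
        have "\<rho> \<ge> 0" using ev[OF uJ False] Su \<rho> by simp
        have pw: "ip I \<omega> ((S ^^ i) F) u = r ^ i * ip I \<omega> F u" for i
        proof (induction i)
          case (Suc i)
          have "(S ^^ i) F \<in> supported J" by (rule funpow_supported[of "supported J" S F, OF SV F])
          then have "ip I \<omega> ((S ^^ Suc i) F) u = cnj r * ip I \<omega> ((S ^^ i) F) u"
            by (simp add: sym uJ Su ip_linear)
          then show ?case using Suc \<open>r = cnj r\<close> by simp
        qed simp
        \<comment> \<open>Here u = g(S) F. Moving each S to the other factor replaces it by the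
          number r, so g(r) cannot vanish.\<close>
        have uF: "ip I \<omega> u u = poly g r * ip I \<omega> F u"
          by (subst (1) u_def) (simp add: op_poly_def ip_linear pw poly_altdef sum_distrib_left mult_ac)
        define c where "c = ip I \<omega> F u / ip I \<omega> u u"
        have cg: "c * poly g r = 1" using uF uu by (simp add: c_def mult_ac)
        define F' where "F' = F - cscale c u"
        have F'J: "F' \<in> supported J" unfolding F'_def by (intro supported_diff supported_cscale F uJ)
        \<comment> \<open>Since c * g(r) = 1, subtracting the component along u makes g alone
          annihilate the remainder. This is where the degree drops.\<close>
        have "op_poly S g F' = u - cscale c (cscale (poly g r) u)"
          by (simp only: F'_def clinear_op_diff[OF clinear_op_poly[OF S]]
              clinear_op_scale[OF clinear_op_poly[OF S]] op_poly_eigen[OF S Su] u_def[symmetric])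
        also have "\<dots> = 0" using cg by (simp add: pointwise mult.assoc[symmetric])
        finally have "Re (ip I \<omega> (S F') F') \<ge> 0" using less.hyps[OF deg \<open>g \<noteq> 0\<close> _ F'J] by simp
        moreover have F'u: "ip I \<omega> F' u = 0" using uu by (simp add: F'_def ip_linear c_def)
        have uF': "ip I \<omega> u F' = 0" using ip_cnj[of I \<omega> F' u] F'u by simp
        have SF'u: "ip I \<omega> (S F') u = 0" using sym[OF F'J uJ] F'u by (simp add: Su ip_linear)
        have "F = F' + cscale c u" by (simp add: F'_def)
        then have "ip I \<omega> (S F) F = ip I \<omega> (S F') F' + c * cnj c * (r * ip I \<omega> u u)"
          by (simp add: clinear_op_add[OF S] clinear_op_scale[OF S] Su ip_linear SF'u uF' algebra_simps)
        moreover have "Re (c * cnj c * (r * ip I \<omega> u u)) \<ge> 0"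
        proof -
          have "c * cnj c * (r * ip I \<omega> u u) = complex_of_real ((cmod c)\<^sup>2 * (\<rho> * Re (ip I \<omega> u u)))"
            unfolding \<rho> by (simp add: ip_self complex_norm_square[symmetric] del: of_real_sum)
          then show ?thesis using \<open>\<rho> \<ge> 0\<close> ip_self_nonneg[of I \<omega> u, OF \<omega>] by simp
        qed
        ultimately show ?thesis by simp
      qed
    qed
  qed
  obtain P where "P \<noteq> 0" "op_poly S P F = 0"
    using exists_annihilating_poly[of J S F, OF finite_subset[OF J I] SV F] by auto
  then show ?thesis using main F by blast
qed

section \<open>Polynomials in power sums and the Gaussian inner product\<close>

definition partitions_upto :: "nat \<Rightarrow> nat multiset set" where
  "partitions_upto K = {\<mu>. 0 \<notin># \<mu> \<and> sum_mset \<mu> \<le> K}"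

text \<open>A multiset of positive numbers stands for the monomial in the power sums
  \<open>p\<^sub>k\<close> with these indices, and a polynomial is its coefficient function. As
  \<open>p\<^sub>k\<close> has degree k, the degree of a monomial is the sum of the
  multiset.\<close>

definition partitions_of :: "nat \<Rightarrow> nat multiset set" where
  "partitions_of d = {\<mu>. 0 \<notin># \<mu> \<and> sum_mset \<mu> = d}"

abbreviation "hom d \<equiv> supported (partitions_of d)"

lemma partitions_of_subset: "d \<le> K \<Longrightarrow> partitions_of d \<subseteq> partitions_upto K"
  by (auto simp: partitions_of_def partitions_upto_def)

lemma hom_upto: "F \<in> hom d \<Longrightarrow> d \<le> K \<Longrightarrow> F \<in> supported (partitions_upto K)"
  using partitions_of_subset[of d K] by (auto simp: supported_def)

lemma finite_partitions_upto [simp]: "finite (partitions_upto K)"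
proof (rule finite_subset)
  show "partitions_upto K \<subseteq> (\<Union>s\<le>K. multisets_of_size {..K} s)"
  proof
    fix \<mu> :: "nat multiset" assume \<mu>: "\<mu> \<in> partitions_upto K"
    have "size \<mu> \<le> sum_mset \<mu>" if "0 \<notin># \<mu>" for \<mu> :: "nat multiset"
      using that by (induction \<mu>) auto
    moreover have "x \<le> sum_mset \<mu>" if "x \<in># \<mu>" for x
      using that by (metis insert_DiffM le_add1 sum_mset.add_mset)
    ultimately show "\<mu> \<in> (\<Union>s\<le>K. multisets_of_size {..K} s)"
      using \<mu> by (fastforce simp: partitions_upto_def multisets_of_size_def)
  qed
qed auto

lemma finite_partitions_of [simp]: "finite (partitions_of d)"
  using finite_subset[OF partitions_of_subset[OF order_refl]] by simp

text \<open>The squared Gaussian norm of a monomial: the m-th power of a complex Gaussian of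
  variance \<alpha> * k contributes (\<alpha> * k)^m * m!. This is the scalar product for which Jack
  functions are orthogonal.\<close>

definition wt :: "real \<Rightarrow> nat multiset \<Rightarrow> real" where
  "wt \<alpha> \<mu> = (\<Prod>k\<in>#\<mu>. \<alpha> * real k) * (\<Prod>k\<in>set_mset \<mu>. fact (count \<mu> k))"

lemma wt_empty [simp]: "wt \<alpha> {#} = 1"
  by (simp add: wt_def)

lemma wt_add: "wt \<alpha> (add_mset k \<mu>) = \<alpha> * real k * real (Suc (count \<mu> k)) * wt \<alpha> \<mu>"
proof -
  have "(\<Prod>j\<in>set_mset (add_mset k \<mu>). fact (count (add_mset k \<mu>) j)) =
        real (Suc (count \<mu> k)) * (\<Prod>j\<in>set_mset \<mu>. fact (count \<mu> j))"
  proof (cases "k \<in># \<mu>")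
    case True
    then have "set_mset (add_mset k \<mu>) = insert k (set_mset \<mu> - {k})" "set_mset \<mu> = insert k (set_mset \<mu> - {k})"
      by auto
    moreover have "(\<Prod>j\<in>set_mset \<mu> - {k}. fact (count (add_mset k \<mu>) j)) =
        (\<Prod>j\<in>set_mset \<mu> - {k}. fact (count \<mu> j) :: real)"
      by (intro prod.cong) auto
    ultimately show ?thesis
      using True by (simp add: prod.remove[of "set_mset \<mu>" k] insert_absorb)
  next
    case False
    then have "(\<Prod>j\<in>set_mset \<mu>. fact (count (add_mset k \<mu>) j)) = (\<Prod>j\<in>set_mset \<mu>. fact (count \<mu> j))"
      by (intro prod.cong) auto
    then show ?thesis using False by (simp add: not_in_iff)
  qed
  then show ?thesis by (simp add: wt_def mult_ac)
qed

lemma wt_pos: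
  assumes "\<alpha> > 0" "0 \<notin># \<mu>"
  shows "wt \<alpha> \<mu> > 0"
  using assms(2) by (induction \<mu>) (use assms(1) in \<open>auto simp: wt_add intro!: mult_pos_pos\<close>)

text \<open>On coefficient functions, \<open>pm k\<close> is multiplication by
  \<open>p\<^sub>k\<close> and \<open>dp k\<close> is the derivative with respect to
  \<open>p\<^sub>k\<close>; the factor in \<open>dp\<close> is the exponent before
  differentiation.\<close>

definition pm :: "nat \<Rightarrow> (nat multiset \<Rightarrow> complex) \<Rightarrow> nat multiset \<Rightarrow> complex" where
  "pm k F = (\<lambda>\<mu>. if k \<in># \<mu> then F (\<mu> - {#k#}) else 0)"

definition dp :: "nat \<Rightarrow> (nat multiset \<Rightarrow> complex) \<Rightarrow> nat multiset \<Rightarrow> complex" where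
  "dp k F = (\<lambda>\<mu>. of_nat (Suc (count \<mu> k)) * F (add_mset k \<mu>))"

lemma pm_linear: "clinear_op (pm k)"
  by (rule clinear_opI) (auto simp: pm_def pointwise)

lemma dp_linear: "clinear_op (dp k)"
  by (rule clinear_opI) (auto simp: dp_def pointwise algebra_simps)

lemmas pm_simps = clinear_op_add[OF pm_linear] clinear_op_scale[OF pm_linear]
    clinear_op_sum[OF pm_linear] clinear_op_diff[OF pm_linear] clinear_op_0[OF pm_linear]
  and dp_simps = clinear_op_add[OF dp_linear] clinear_op_scale[OF dp_linear]
    clinear_op_sum[OF dp_linear] clinear_op_diff[OF dp_linear] clinear_op_0[OF dp_linear]

text \<open>The canonical commutation relation of a variable and its derivative.\<close>

lemma dp_pm: "dp k (pm l F) = pm l (dp k F) + (if k = l then F else 0)"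
proof
  fix \<mu>
  show "dp k (pm l F) \<mu> = (pm l (dp k F) + (if k = l then F else 0)) \<mu>"
  proof (cases "l \<in># \<mu>")
    case True
    from multi_member_split[OF True] obtain \<nu> where "\<mu> = add_mset l \<nu>" by blast
    then show ?thesis
      by (auto simp: dp_def pm_def pointwise algebra_simps add_mset_commute)
  next
    case False
    moreover from this have "count \<mu> l = 0" by (simp add: not_in_iff)
    ultimately show ?thesis by (auto simp: dp_def pm_def pointwise)
  qed
qed

lemma dp_commute: "dp k (dp l F) = dp l (dp k F)"
  by (auto simp: dp_def fun_eq_iff add_mset_commute)

lemma sum_mset_member_le: "k \<in># \<mu> \<Longrightarrow> k \<le> sum_mset (\<mu> :: nat multiset)"
  by (metis insert_DiffM le_add1 sum_mset.add_mset)

lemma dp_eq_0: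
  assumes "F \<in> supported (partitions_upto K)" "k > K"
  shows "dp k F = 0"
proof -
  have "F (add_mset k \<mu>) = 0" for \<mu>
    using assms sum_mset_member_le[of k "add_mset k \<mu>"]
    by (force simp: supported_def partitions_upto_def)
  then show ?thesis by (simp add: dp_def pointwise)
qed

lemma dp_supported:
  "F \<in> supported (partitions_upto K) \<Longrightarrow> dp k F \<in> supported (partitions_upto K)"
  by (fastforce simp: dp_def supported_def partitions_upto_def)

lemma dp_hom: "F \<in> hom (d + k) \<Longrightarrow> dp k F \<in> hom d"
  by (fastforce simp: dp_def supported_def partitions_of_def)

lemma pm_hom:
  assumes "F \<in> hom d" "k > 0"
  shows "pm k F \<in> hom (d + k)"
proof -
  have "\<mu> \<in> partitions_of (d + k)" if "k \<in># \<mu>" "F (\<mu> - {#k#}) \<noteq> 0" for \<mu>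
  proof -
    from multi_member_split[OF that(1)] obtain \<nu> where "\<mu> = add_mset k \<nu>" by blast
    then show ?thesis using that(2) assms by (auto simp: supported_def partitions_of_def)
  qed
  then show ?thesis by (auto simp: pm_def supported_def)
qed

lemma pm_dp_hom:
  assumes "F \<in> hom d" "k > 0"
  shows "pm k (dp k F) \<in> hom d"
proof (cases "k \<le> d")
  case True
  then show ?thesis using assms dp_hom[of F "d - k" k] pm_hom[of "dp k F" "d - k" k] by simp
next
  case False
  then have "dp k F = 0" using dp_eq_0[of F d k] hom_upto[OF assms(1)] by simp
  then show ?thesis by (simp add: pm_simps supported_0)
qed

text \<open>Adding one part k is a bijection onto the multisets containing k. Adjointness,
  multiplication under \<open>ev\<close> and the chain rule all reduce to this substitution.\<close>

lemma partitions_upto_reindex: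
  fixes F :: "nat multiset \<Rightarrow> complex"
  assumes F: "F \<in> supported (partitions_upto K)"
  shows "(\<Sum>\<nu>\<in>partitions_upto K. F (add_mset k \<nu>) * h \<nu>) =
         (\<Sum>\<mu>\<in>partitions_upto K. if k \<in># \<mu> then F \<mu> * h (\<mu> - {#k#}) else 0)"
proof -
  have "(\<Sum>\<nu>\<in>partitions_upto K. F (add_mset k \<nu>) * h \<nu>) =
      (\<Sum>\<nu>\<in>{\<nu>\<in>partitions_upto K. add_mset k \<nu> \<in> partitions_upto K}. F (add_mset k \<nu>) * h \<nu>)"
    using F by (intro sum.mono_neutral_right) (auto simp: supported_def)
  also have "\<dots> = (\<Sum>\<mu>\<in>{\<mu>\<in>partitions_upto K. k \<in># \<mu>}. F \<mu> * h (\<mu> - {#k#}))"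
    by (rule sum.reindex_bij_witness[of _ "\<lambda>\<mu>. \<mu> - {#k#}" "add_mset k"])
      (auto simp: partitions_upto_def dest!: multi_member_split)
  also have "\<dots> = (\<Sum>\<mu>\<in>partitions_upto K. if k \<in># \<mu> then F \<mu> * h (\<mu> - {#k#}) else 0)"
    by (simp add: sum.inter_filter)
  finally show ?thesis .
qed

abbreviation "ipf \<alpha> K \<equiv> ip (partitions_upto K) (wt \<alpha>)"

text \<open>Gaussian integration by parts: the ratio of neighbouring weights in
  \<open>wt_add\<close> is \<alpha> * k times the factor built into \<open>dp\<close>.\<close>

lemma ipf_pm_left:
  assumes "G \<in> supported (partitions_upto K)"
  shows "ipf \<alpha> K (pm k F) G = of_real (\<alpha> * real k) * ipf \<alpha> K F (dp k G)"
proof -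
  define H where "H \<mu> = cnj (G \<mu>) * wt \<alpha> \<mu>" for \<mu>
  have H: "H \<in> supported (partitions_upto K)" using assms by (auto simp: H_def supported_def)
  have "ipf \<alpha> K (pm k F) G = (\<Sum>\<mu>\<in>partitions_upto K. if k \<in># \<mu> then H \<mu> * F (\<mu> - {#k#}) else 0)"
    by (auto simp: ip_def pm_def H_def intro!: sum.cong)
  also have "\<dots> = (\<Sum>\<nu>\<in>partitions_upto K. H (add_mset k \<nu>) * F \<nu>)"
    by (rule partitions_upto_reindex[OF H, symmetric])
  also have "\<dots> = of_real (\<alpha> * real k) * ipf \<alpha> K F (dp k G)"
    by (simp add: H_def ip_def wt_add dp_def sum_distrib_left algebra_simps)
  finally show ?thesis .
qed

lemma ipf_pm_right:
  assumes "F \<in> supported (partitions_upto K)"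
  shows "ipf \<alpha> K F (pm k G) = of_real (\<alpha> * real k) * ipf \<alpha> K (dp k F) G"
  using ipf_pm_left[OF assms, of \<alpha> k G] ip_cnj[of "partitions_upto K" "wt \<alpha>"]
  by (metis complex_cnj_complex_of_real complex_cnj_mult)

lemma sum_mset_conv_sum:
  fixes g :: "'a \<Rightarrow> 'b :: comm_semiring_1"
  shows "finite A \<Longrightarrow> set_mset \<mu> \<subseteq> A \<Longrightarrow> (\<Sum>k\<in>#\<mu>. g k) = (\<Sum>k\<in>A. of_nat (count \<mu> k) * g k)"
proof (induction \<mu>)
  case (add x \<mu>)
  have "(\<Sum>k\<in>A. of_nat (count (add_mset x \<mu>) k) * g k) =
      (\<Sum>k\<in>A. of_nat (count \<mu> k) * g k + (if k = x then g k else 0))"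
    by (intro sum.cong) (auto simp: algebra_simps)
  then show ?case using add by (simp add: sum.distrib add.commute)
qed auto

text \<open>Euler's relation for the grading in which \<open>p\<^sub>k\<close> has degree k. The sum
  may stop at K because no larger part occurs in degree d.\<close>

lemma euler:
  assumes F: "F \<in> hom d" and d: "d \<le> K"
  shows "(\<Sum>k=1..K. cscale (of_nat k) (pm k (dp k F))) = cscale (of_nat d) F"
proof
  fix \<mu>
  have p: "pm k (dp k F) \<mu> = of_nat (count \<mu> k) * F \<mu>" for k
    by (auto simp: pm_def dp_def not_in_iff Suc_diff_le)
  have "(\<Sum>k=1..K. of_nat k * (of_nat (count \<mu> k) * F \<mu>)) = of_nat d * F \<mu>"
  proof (cases "\<mu> \<in> partitions_of d")
    case True
    then have "set_mset \<mu> \<subseteq> {1..K}"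
      using d sum_mset_member_le by (fastforce simp: partitions_of_def Suc_le_eq intro: gr0I)
    then have "sum_mset \<mu> = (\<Sum>k=1..K. count \<mu> k * k)"
      using sum_mset_conv_sum[of "{1..K}" \<mu> "\<lambda>k. k"] by simp
    then have "(of_nat d :: complex) = (\<Sum>k=1..K. of_nat (count \<mu> k) * of_nat k)"
      using True unfolding partitions_of_def by (simp flip: of_nat_mult of_nat_sum)
    then show ?thesis by (simp add: sum_distrib_left sum_distrib_right mult_ac)
  next
    case False
    then have "F \<mu> = 0" using F by (auto simp: supported_def)
    then show ?thesis by simp
  qed
  then show "(\<Sum>k=1..K. cscale (of_nat k) (pm k (dp k F))) \<mu> = cscale (of_nat d) F \<mu>"
    by (simp add: pointwise p)
qed

subsection \<open>The Laplace--Beltrami operator in power sums\<close>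

text \<open>Twice the Laplace--Beltrami (Calogero--Sutherland) operator with the terms depending on the
  number of variables removed; its eigenvectors are the Jack functions. The bound \<open>K\<close> only keeps the
  sums finite and is irrelevant on elements of degree at most \<open>K\<close>.\<close>

definition lap :: "real \<Rightarrow> nat \<Rightarrow> (nat multiset \<Rightarrow> complex) \<Rightarrow> nat multiset \<Rightarrow> complex" where
  "lap \<alpha> K F =
     (\<Sum>k=1..K. \<Sum>l=1..K. cscale (of_real \<alpha> * of_nat k * of_nat l) (pm (k + l) (dp k (dp l F)))
                         + cscale (of_nat (k + l)) (pm k (pm l (dp (k + l) F))))
     + (\<Sum>k=1..K. cscale (of_real (\<alpha> - 1) * of_nat k * (of_nat k - 1)) (pm k (dp k F)))"

definition shift_down :: "nat \<Rightarrow> (nat multiset \<Rightarrow> complex) \<Rightarrow> nat multiset \<Rightarrow> complex" where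
  "shift_down K F = (\<Sum>j=1..K. cscale (of_nat (j + 1)) (pm j (dp (j + 1) F)))"

text \<open>With X in the role of \<open>p\<^sub>0\<close>, this is the derivation sending
  \<open>p\<^sub>k\<close> to k times \<open>p\<^sub>k\<^sub>-\<^sub>1\<close>, so for X = N it is
  the sum of all partial derivatives in N variables. X stays free because the ensemble product also
  calls for N + \<alpha> - 1.\<close>

definition low :: "complex \<Rightarrow> nat \<Rightarrow> (nat multiset \<Rightarrow> complex) \<Rightarrow> nat multiset \<Rightarrow> complex" where
  "low X K F = cscale X (dp 1 F) + shift_down K F"

definition shift_up :: "nat \<Rightarrow> (nat multiset \<Rightarrow> complex) \<Rightarrow> nat multiset \<Rightarrow> complex" where
  "shift_up K F = (\<Sum>j=1..K. cscale (of_nat j) (pm (j + 1) (dp j F)))"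

text \<open>The Gaussian adjoint of \<open>low\<close> for real X. In N variables
  \<open>shift_up\<close> is the sum of the fields
  \<open>z\<^sub>i\<^sup>2 \<partial>\<^sub>i\<close>.\<close>

definition rai :: "real \<Rightarrow> complex \<Rightarrow> nat \<Rightarrow> (nat multiset \<Rightarrow> complex) \<Rightarrow> nat multiset \<Rightarrow> complex" where
  "rai \<alpha> X K F = cscale (X / of_real \<alpha>) (pm 1 F) + shift_up K F"

lemmas fock_linear_intros = clinear_op_ident clinear_op_plus clinear_op_cscale clinear_op_setsum
  clinear_op_comp[OF pm_linear] clinear_op_comp[OF dp_linear]

lemma lap_linear: "clinear_op (lap \<alpha> K)"
  unfolding lap_def
  by (intro fock_linear_intros)

lemma low_linear: "clinear_op (low X K)"
  unfolding low_def shift_down_def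
  by (intro fock_linear_intros)

text \<open>Only the terms \<open>p\<^sub>k p\<^sub>l\<close> of \<open>lap\<close> with k = 1 or l
  = 1 fail to commute with \<open>dp 1\<close>, and each of the two families contributes one
  \<open>shift_down\<close>. The diagonal term carries k * (k - 1), which vanishes at k = 1.\<close>

lemma dp1_lap: "dp 1 (lap \<alpha> K F) = lap \<alpha> K (dp 1 F) + cscale 2 (shift_down K F)"
proof -
  have a: "dp 1 (pm (k + l) (dp k (dp l F))) = pm (k + l) (dp k (dp l (dp 1 F)))"
    if "k \<ge> 1" "l \<ge> 1" for k l
    using that by (simp add: dp_pm dp_commute[of 1 k] dp_commute[of 1 l] del: One_nat_def)
  have b: "dp 1 (pm k (pm l (dp m F))) = pm k (pm l (dp m (dp 1 F)))
      + (if l = 1 then pm k (dp m F) else 0) + (if k = 1 then pm l (dp m F) else 0)" for k l m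
    by (cases "k = 1"; cases "l = 1")
      (simp_all add: dp_pm[of 1] dp_commute[of 1 m] pm_simps add_ac del: One_nat_def)
  have c: "cscale (of_real (\<alpha> - 1) * of_nat k * (of_nat k - 1)) (dp 1 (pm k (dp k F))) =
     cscale (of_real (\<alpha> - 1) * of_nat k * (of_nat k - 1)) (pm k (dp k (dp 1 F)))" for k
    by (cases "k = 1") (simp_all add: dp_pm[of 1] dp_commute[of 1 k] del: One_nat_def)
  have s1: "(\<Sum>k=1..K. \<Sum>l=1..K. cscale (of_nat (k + l)) (if l = 1 then pm k (dp (k + l) F) else 0))
      = shift_down K F"
    by (cases "K = 0")
      (auto simp: shift_down_def if_distrib[of "cscale _"] add.commute cong: if_cong)
  have s2: "(\<Sum>k=1..K. \<Sum>l=1..K. cscale (of_nat (k + l)) (if k = 1 then pm l (dp (k + l) F) else 0))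
      = shift_down K F"
    by (subst sum.swap, cases "K = 0")
      (auto simp: shift_down_def if_distrib[of "cscale _"] add.commute cong: if_cong)
  have "dp 1 (lap \<alpha> K F) =
     (\<Sum>k=1..K. \<Sum>l=1..K. cscale (of_real \<alpha> * of_nat k * of_nat l) (dp 1 (pm (k + l) (dp k (dp l F))))
                         + cscale (of_nat (k + l)) (dp 1 (pm k (pm l (dp (k + l) F)))))
     + (\<Sum>k=1..K. cscale (of_real (\<alpha> - 1) * of_nat k * (of_nat k - 1)) (dp 1 (pm k (dp k F))))"
    by (simp only: lap_def dp_simps)
  also have "\<dots> = (\<Sum>k=1..K. \<Sum>l=1..K.
       (cscale (of_real \<alpha> * of_nat k * of_nat l) (pm (k + l) (dp k (dp l (dp 1 F))))
        + cscale (of_nat (k + l)) (pm k (pm l (dp (k + l) (dp 1 F)))))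
      + cscale (of_nat (k + l)) (if l = 1 then pm k (dp (k + l) F) else 0)
      + cscale (of_nat (k + l)) (if k = 1 then pm l (dp (k + l) F) else 0))
     + (\<Sum>k=1..K. cscale (of_real (\<alpha> - 1) * of_nat k * (of_nat k - 1)) (pm k (dp k (dp 1 F))))"
    unfolding c by (rule arg_cong[where f = "\<lambda>u. u + _"], intro sum.cong refl)
      (simp_all only: a b atLeastAtMost_iff cfun.scale_right_distrib add.assoc)
  also have "\<dots> = lap \<alpha> K (dp 1 F) + (shift_down K F + shift_down K F)"
    unfolding sum.distrib s1 s2 lap_def by (simp only: add.assoc add.commute add.left_commute)
  also have "shift_down K F + shift_down K F = cscale 2 (shift_down K F)"
    by (rule ext) (simp only: plus_fun_apply cscale_apply mult_2)
  finally show ?thesis .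
qed

text \<open>On an eigenvector \<open>shift_down\<close> becomes half a commutator, so
  \<open>low X K F\<close> is a polynomial in \<open>lap\<close> applied to \<open>dp 1 F\<close>.
  On a component with eigenvalue r it multiplies by X + m - r / 2, that is, by X plus a
  content.\<close>

lemma low_eigen:
  assumes "lap \<alpha> K F = cscale (2 * m) F"
  shows "low X K F = cscale (X + m) (dp 1 F) - cscale (1/2) (lap \<alpha> K (dp 1 F))"
proof -
  have "cscale (2 * m) (dp 1 F) = lap \<alpha> K (dp 1 F) + cscale 2 (shift_down K F)"
    using dp1_lap[of \<alpha> K F] by (simp only: assms dp_simps)
  then show ?thesis
    unfolding low_def by (simp add: pointwise) (simp add: field_simps)
qed

lemma lap_hom:
  assumes "F \<in> hom d"
  shows "lap \<alpha> K F \<in> hom d"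
proof -
  have a: "pm (k + l) (dp k (dp l F)) \<in> hom d" if kl: "k \<ge> 1" "l \<ge> 1" for k l
  proof -
    have "\<mu> \<in> partitions_of d" if "k + l \<in># \<mu>" "F (add_mset l (add_mset k (\<mu> - {#k + l#}))) \<noteq> 0" for \<mu>
    proof -
      from multi_member_split[OF that(1)] obtain \<nu> where "\<mu> = add_mset (k + l) \<nu>" by blast
      then show ?thesis using that(2) assms kl by (auto simp: supported_def partitions_of_def)
    qed
    then show ?thesis by (auto simp: pm_def dp_def supported_def)
  qed
  have b: "pm k (pm l (dp (k + l) F)) \<in> hom d" if kl: "k \<ge> 1" "l \<ge> 1" for k l
  proof -
    have "\<mu> \<in> partitions_of d"
      if "k \<in># \<mu>" "l \<in># \<mu> - {#k#}" "F (add_mset (k + l) (\<mu> - {#k#} - {#l#})) \<noteq> 0" for \<mu>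
    proof -
      from multi_member_split[OF that(1)] obtain \<nu> where \<nu>: "\<mu> = add_mset k \<nu>" by blast
      then have "l \<in># \<nu>" using that(2) by simp
      from multi_member_split[OF this] obtain \<rho> where "\<nu> = add_mset l \<rho>" by blast
      then show ?thesis using that(3) assms kl \<nu> by (auto simp: supported_def partitions_of_def)
    qed
    then show ?thesis by (auto simp: pm_def dp_def supported_def)
  qed
  show ?thesis
    unfolding lap_def
    by (intro supported_add supported_sum supported_cscale a b pm_dp_hom[OF assms]) auto
qed

lemma low_hom:
  assumes "F \<in> hom (Suc d)"
  shows "low X K F \<in> hom d"
proof -
  have "pm j (dp (j + 1) F) \<in> hom d" if "j \<ge> 1" for j
  proof (cases "j \<le> d")
    case True
    then show ?thesis
      using that assms dp_hom[of F "d - j" "j + 1"] pm_hom[of "dp (j + 1) F" "d - j" j] by simp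
  next
    case False
    then have "dp (j + 1) F = 0"
      using dp_eq_0[of F "Suc d" "j + 1"] hom_upto[OF assms] by simp
    then show ?thesis by (simp add: pm_simps supported_0)
  qed
  then show ?thesis
    unfolding low_def shift_down_def using dp_hom[of F d 1] assms
    by (intro supported_add supported_sum supported_cscale) auto
qed

lemma rai_hom:
  assumes "F \<in> hom d"
  shows "rai \<alpha> X K F \<in> hom (Suc d)"
proof -
  have "pm (j + 1) (dp j F) \<in> hom (Suc d)" if "j \<ge> 1" for j
  proof (cases "j \<le> d")
    case True
    then show ?thesis
      using that assms dp_hom[of F "d - j" j] pm_hom[of "dp j F" "d - j" "j + 1"] by simp
  next
    case False
    then have "dp j F = 0"
      using dp_eq_0[of F d j] hom_upto[OF assms] by simp
    then show ?thesis by (simp add: pm_simps supported_0)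
  qed
  then show ?thesis
    unfolding rai_def shift_up_def using pm_hom[of F d 1] assms
    by (intro supported_add supported_sum supported_cscale) auto
qed

text \<open>The terms that join two parts and those that split a part are adjoint to each other; the
  diagonal term is its own adjoint.\<close>

lemma ipf_lap:
  assumes F: "F \<in> supported (partitions_upto K)" and G: "G \<in> supported (partitions_upto K)"
  shows "ipf \<alpha> K (lap \<alpha> K F) G = ipf \<alpha> K F (lap \<alpha> K G)"
proof -
  have a: "ipf \<alpha> K (cscale (of_real \<alpha> * of_nat k * of_nat l) (pm (k + l) (dp k (dp l F)))) G
      = ipf \<alpha> K F (cscale (of_nat (k + l)) (pm k (pm l (dp (k + l) G))))" for k l
    by (simp add: ip_linear ipf_pm_left[OF G] ipf_pm_right[OF F] ipf_pm_right[OF dp_supported[OF F]]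
        dp_commute[of l k] mult_ac)
  have b: "ipf \<alpha> K (cscale (of_nat (k + l)) (pm k (pm l (dp (k + l) F)))) G
      = ipf \<alpha> K F (cscale (of_real \<alpha> * of_nat k * of_nat l) (pm (k + l) (dp k (dp l G))))" for k l
    by (simp add: ip_linear ipf_pm_left[OF G] ipf_pm_left[OF dp_supported[OF G]] ipf_pm_right[OF F]
        dp_commute[of l k] mult_ac)
  have c: "ipf \<alpha> K (cscale (of_real (\<alpha> - 1) * of_nat k * (of_nat k - 1)) (pm k (dp k F))) G
      = ipf \<alpha> K F (cscale (of_real (\<alpha> - 1) * of_nat k * (of_nat k - 1)) (pm k (dp k G)))" for k
    by (simp add: ip_linear ipf_pm_left[OF G] ipf_pm_right[OF F])
  show ?thesis
    unfolding lap_def ip_add_left ip_add_right ip_sum_left ip_sum_right a b c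
    by (simp add: add.commute)
qed

lemma ipf_low:
  assumes F: "F \<in> supported (partitions_upto K)" and G: "G \<in> supported (partitions_upto K)"
    and \<alpha>: "\<alpha> \<noteq> 0" and X: "cnj X = X"
  shows "ipf \<alpha> K (low X K F) G = ipf \<alpha> K F (rai \<alpha> X K G)"
proof -
  have "ipf \<alpha> K (cscale (of_nat (j + 1)) (pm j (dp (j + 1) F))) G
      = ipf \<alpha> K F (cscale (of_nat j) (pm (j + 1) (dp j G)))" for j
    by (simp add: ip_linear ipf_pm_left[OF G] ipf_pm_right[OF F] algebra_simps)
  moreover have "ipf \<alpha> K (cscale X (dp 1 F)) G = ipf \<alpha> K F (cscale (X / of_real \<alpha>) (pm 1 G))"
    using \<alpha> X by (simp add: ip_linear ipf_pm_right[OF F])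
  ultimately show ?thesis
    unfolding low_def rai_def shift_down_def shift_up_def ip_add_left ip_add_right ip_sum_left ip_sum_right
    by simp
qed

subsection \<open>Evaluation in finitely many variables\<close>

definition psum :: "nat \<Rightarrow> nat \<Rightarrow> (nat \<Rightarrow> complex) \<Rightarrow> complex" where
  "psum N k z = (\<Sum>i<N. z i ^ k)"

definition mp :: "nat \<Rightarrow> nat multiset \<Rightarrow> (nat \<Rightarrow> complex) \<Rightarrow> complex" where
  "mp N \<mu> z = (\<Prod>k\<in>#\<mu>. psum N k z)"

definition ev :: "nat \<Rightarrow> nat \<Rightarrow> (nat multiset \<Rightarrow> complex) \<Rightarrow> (nat \<Rightarrow> complex) \<Rightarrow> complex" where
  "ev N K F z = (\<Sum>\<mu>\<in>partitions_upto K. F \<mu> * mp N \<mu> z)"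

lemma mp_simps [simp]: "mp N {#} z = 1" "mp N (add_mset k \<mu>) z = psum N k z * mp N \<mu> z"
  by (simp_all add: mp_def)

lemma ev_add: "ev N K (F + G) z = ev N K F z + ev N K G z"
  and ev_diff: "ev N K (F - G) z = ev N K F z - ev N K G z"
  and ev_scale: "ev N K (cscale c F) z = c * ev N K F z"
  and ev_0: "ev N K 0 z = 0"
  by (simp_all add: ev_def pointwise sum.distrib[symmetric] sum_subtractf[symmetric] sum_distrib_left
      algebra_simps)

lemma ev_sum: "ev N K (\<Sum>i\<in>A. H i) z = (\<Sum>i\<in>A. ev N K (H i) z)"
  by (induction A rule: infinite_finite_induct) (simp_all add: ev_add ev_0)

lemmas ev_linear = ev_add ev_diff ev_scale ev_0 ev_sum

text \<open>\<open>ev\<close> discards everything above degree K, so multiplication by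
  \<open>p\<^sub>k\<close> is respected when there are k degrees to spare. The variants below treat
  products that do not raise the degree, for which K itself suffices.\<close>

lemma ev_pm:
  assumes F: "F \<in> supported (partitions_upto m)" and mk: "m + k \<le> K" and k: "k > 0"
  shows "ev N K (pm k F) z = psum N k z * ev N K F z"
proof -
  have "pm k F \<in> supported (partitions_upto K)"
  proof -
    have "\<mu> \<in> partitions_upto K" if "k \<in># \<mu>" "F (\<mu> - {#k#}) \<noteq> 0" for \<mu>
    proof -
      from multi_member_split[OF that(1)] obtain \<nu> where "\<mu> = add_mset k \<nu>" by blast
      then show ?thesis using that(2) F mk k by (force simp: supported_def partitions_upto_def)
    qed
    then show ?thesis by (auto simp: pm_def supported_def)
  qed
  then have "(\<Sum>\<nu>\<in>partitions_upto K. pm k F (add_mset k \<nu>) * (psum N k z * mp N \<nu> z)) =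
      (\<Sum>\<mu>\<in>partitions_upto K. if k \<in># \<mu> then pm k F \<mu> * (psum N k z * mp N (\<mu> - {#k#}) z) else 0)"
    by (rule partitions_upto_reindex)
  also have "\<dots> = ev N K (pm k F) z"
    unfolding ev_def by (intro sum.cong refl) (auto simp: pm_def dest!: multi_member_split)
  finally show ?thesis
    by (simp add: pm_def ev_def sum_distrib_left mult_ac)
qed

lemma dp_upto: "F \<in> supported (partitions_upto (m + k)) \<Longrightarrow> dp k F \<in> supported (partitions_upto m)"
  by (fastforce simp: dp_def supported_def partitions_upto_def)

lemma ev_pm_dp:
  assumes F: "F \<in> supported (partitions_upto K)" and k: "k > 0"
  shows "ev N K (pm k (dp k F)) z = psum N k z * ev N K (dp k F) z"
proof (cases "k \<le> K")
  case True
  then show ?thesis using ev_pm[of "dp k F" "K - k" k K] dp_upto[of F "K - k" k] F k by simp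
next
  case False
  then show ?thesis using dp_eq_0[OF F] by (simp add: pm_simps ev_0)
qed

lemma dp_dp_eq_0:
  assumes F: "F \<in> supported (partitions_upto K)" and k: "k + l > K"
  shows "dp k (dp l F) = 0"
proof (cases "l \<le> K")
  case True
  then show ?thesis using dp_eq_0[of "dp l F" "K - l" k] dp_upto[of F "K - l" l] F k by simp
next
  case False
  then show ?thesis using dp_eq_0[OF F, of l] by (simp add: dp_simps)
qed

lemma ev_pm_dp_dp:
  assumes F: "F \<in> supported (partitions_upto K)" and k: "k > 0"
  shows "ev N K (pm (k + l) (dp k (dp l F))) z = psum N (k + l) z * ev N K (dp k (dp l F)) z"
proof (cases "k + l \<le> K")
  case True
  have "dp k (dp l F) \<in> supported (partitions_upto (K - (k + l)))"
    using True F by (intro dp_upto) (simp add: add.commute)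
  then show ?thesis using ev_pm[of "dp k (dp l F)" "K - (k + l)" "k + l" K] True k by simp
next
  case False
  then show ?thesis using dp_dp_eq_0[OF F, of k l] by (simp add: pm_simps ev_0)
qed

lemma ev_pm_pm_dp:
  assumes F: "F \<in> supported (partitions_upto K)" and k: "k > 0" and l: "l > 0"
  shows "ev N K (pm k (pm l (dp (k + l) F))) z = psum N k z * psum N l z * ev N K (dp (k + l) F) z"
proof (cases "k + l \<le> K")
  case True
  define G where "G = dp (k + l) F"
  have G: "G \<in> supported (partitions_upto (K - (k + l)))"
    using True F unfolding G_def by (intro dp_upto) simp
  have "pm l G \<in> supported (partitions_upto (K - k))"
  proof -
    have "\<mu> \<in> partitions_upto (K - k)" if "l \<in># \<mu>" "G (\<mu> - {#l#}) \<noteq> 0" for \<mu>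
    proof -
      from multi_member_split[OF that(1)] obtain \<nu> where "\<mu> = add_mset l \<nu>" by blast
      then show ?thesis using that(2) G True l by (force simp: supported_def partitions_upto_def)
    qed
    then show ?thesis by (auto simp: pm_def supported_def)
  qed
  then show ?thesis
    using ev_pm[of "pm l G" "K - k" k K] ev_pm[OF G, of l K] True k l by (simp add: G_def)
next
  case False
  then show ?thesis using dp_eq_0[OF F] by (simp add: pm_simps ev_0)
qed

lemma psum_deriv:
  assumes "i < N"
  shows "((\<lambda>t. psum N k (z(i := t))) has_field_derivative (of_nat k * t ^ (k - 1))) (at t)"
proof -
  have e: "psum N k (z(i := t)) = (\<Sum>j\<in>{..<N} - {i}. z j ^ k) + t ^ k" for t
    using assms by (simp add: psum_def sum.remove[of "{..<N}" i] add.commute)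
  show ?thesis unfolding e by (auto intro!: derivative_eq_intros)
qed

lemma mp_deriv:
  assumes "i < N"
  shows "((\<lambda>t. mp N \<mu> (z(i := t))) has_field_derivative
           (\<Sum>k\<in>#\<mu>. of_nat k * t ^ (k - 1) * mp N (\<mu> - {#k#}) (z(i := t)))) (at t)"
proof (induction \<mu>)
  case (add x \<mu>)
  have "(\<Sum>k\<in>#\<mu>. of_nat k * t ^ (k - 1) * mp N (add_mset x \<mu> - {#k#}) (z(i := t))) =
     (\<Sum>k\<in>#\<mu>. psum N x (z(i := t)) * (of_nat k * t ^ (k - 1) * mp N (\<mu> - {#k#}) (z(i := t))))"
    by (intro arg_cong[where f = sum_mset] image_mset_cong) simp
  then have 2: "(\<Sum>k\<in>#add_mset x \<mu>. of_nat k * t ^ (k - 1) * mp N (add_mset x \<mu> - {#k#}) (z(i := t))) =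
     of_nat x * t ^ (x - 1) * mp N \<mu> (z(i := t))
     + (\<Sum>k\<in>#\<mu>. of_nat k * t ^ (k - 1) * mp N (\<mu> - {#k#}) (z(i := t))) * psum N x (z(i := t))"
    by (simp add: sum_mset_distrib_left mult.commute)
  show ?case
    unfolding 2 mp_simps by (rule DERIV_mult[OF psum_deriv[OF assms] add])
qed simp

text \<open>The chain rule, since the derivative of \<open>p\<^sub>k\<close> in one variable t is k
  * t^(k - 1).\<close>

lemma ev_deriv:
  assumes i: "i < N" and F: "F \<in> supported (partitions_upto K)"
  shows "((\<lambda>t. ev N K F (z(i := t))) has_field_derivative
           (\<Sum>k=1..K. of_nat k * t ^ (k - 1) * ev N K (dp k F) (z(i := t)))) (at t)"
proof -
  have "((\<lambda>t. ev N K F (z(i := t))) has_field_derivative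
     (\<Sum>\<mu>\<in>partitions_upto K. F \<mu> * (\<Sum>k\<in>#\<mu>. of_nat k * t ^ (k - 1) * mp N (\<mu> - {#k#}) (z(i := t))))) (at t)"
    unfolding ev_def by (intro DERIV_sum DERIV_cmult mp_deriv i)
  also have "(\<Sum>\<mu>\<in>partitions_upto K. F \<mu> * (\<Sum>k\<in>#\<mu>. of_nat k * t ^ (k - 1) * mp N (\<mu> - {#k#}) (z(i := t)))) =
     (\<Sum>\<mu>\<in>partitions_upto K. \<Sum>k=1..K. F \<mu> * (of_nat (count \<mu> k) * (of_nat k * t ^ (k - 1) * mp N (\<mu> - {#k#}) (z(i := t)))))"
  proof (intro sum.cong refl)
    fix \<mu> assume "\<mu> \<in> partitions_upto K"
    then have "set_mset \<mu> \<subseteq> {1..K}"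
      using sum_mset_member_le by (fastforce simp: partitions_upto_def Suc_le_eq intro: gr0I)
    then show "F \<mu> * (\<Sum>k\<in>#\<mu>. of_nat k * t ^ (k - 1) * mp N (\<mu> - {#k#}) (z(i := t))) =
      (\<Sum>k=1..K. F \<mu> * (of_nat (count \<mu> k) * (of_nat k * t ^ (k - 1) * mp N (\<mu> - {#k#}) (z(i := t)))))"
      by (subst sum_mset_conv_sum[of "{1..K}"]) (auto simp: sum_distrib_left)
  qed
  also have "\<dots> = (\<Sum>k=1..K. \<Sum>\<mu>\<in>partitions_upto K. F \<mu> * (of_nat (count \<mu> k) * (of_nat k * t ^ (k - 1) * mp N (\<mu> - {#k#}) (z(i := t)))))"
    by (rule sum.swap)
  also have "\<dots> = (\<Sum>k=1..K. of_nat k * t ^ (k - 1) * ev N K (dp k F) (z(i := t)))"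
  proof (intro sum.cong refl)
    fix k
    have "(\<Sum>\<mu>\<in>partitions_upto K. F \<mu> * (of_nat (count \<mu> k) * (of_nat k * t ^ (k - 1) * mp N (\<mu> - {#k#}) (z(i := t))))) =
      (\<Sum>\<mu>\<in>partitions_upto K. if k \<in># \<mu> then F \<mu> * (of_nat (Suc (count (\<mu> - {#k#}) k)) * (of_nat k * t ^ (k - 1) * mp N (\<mu> - {#k#}) (z(i := t)))) else 0)"
      by (intro sum.cong refl) (auto simp: not_in_iff Suc_diff_le)
    also have "\<dots> = (\<Sum>\<nu>\<in>partitions_upto K. F (add_mset k \<nu>) * (of_nat (Suc (count \<nu> k)) * (of_nat k * t ^ (k - 1) * mp N \<nu> (z(i := t)))))"
      by (rule partitions_upto_reindex[OF F, of k "\<lambda>\<nu>. of_nat (Suc (count \<nu> k)) * (of_nat k * t ^ (k - 1) * mp N \<nu> (z(i := t)))", symmetric])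
    also have "\<dots> = of_nat k * t ^ (k - 1) * ev N K (dp k F) (z(i := t))"
      by (simp add: ev_def dp_def sum_distrib_left mult_ac)
    finally show "(\<Sum>\<mu>\<in>partitions_upto K. F \<mu> * (of_nat (count \<mu> k) * (of_nat k * t ^ (k - 1) * mp N (\<mu> - {#k#}) (z(i := t))))) =
      of_nat k * t ^ (k - 1) * ev N K (dp k F) (z(i := t))" .
  qed
  finally show ?thesis .
qed

text \<open>\<open>D1\<close> and \<open>D2\<close> are \<open>z\<^sub>i \<partial>\<^sub>i\<close> and its square applied to \<open>ev F\<close>; \<open>DQ\<close> is the divided difference
  of \<open>D1\<close> in two variables.\<close>

definition D1 :: "nat \<Rightarrow> nat \<Rightarrow> nat \<Rightarrow> (nat multiset \<Rightarrow> complex) \<Rightarrow> (nat \<Rightarrow> complex) \<Rightarrow> complex" where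
  "D1 N K i F z = (\<Sum>k=1..K. of_nat k * z i ^ k * ev N K (dp k F) z)"

definition D2 :: "nat \<Rightarrow> nat \<Rightarrow> nat \<Rightarrow> (nat multiset \<Rightarrow> complex) \<Rightarrow> (nat \<Rightarrow> complex) \<Rightarrow> complex" where
  "D2 N K i F z = (\<Sum>k=1..K. (of_nat k)\<^sup>2 * z i ^ k * ev N K (dp k F) z)
     + (\<Sum>k=1..K. \<Sum>l=1..K. of_nat k * of_nat l * z i ^ (k + l) * ev N K (dp k (dp l F)) z)"

definition DQ :: "nat \<Rightarrow> nat \<Rightarrow> nat \<Rightarrow> nat \<Rightarrow> (nat multiset \<Rightarrow> complex) \<Rightarrow> (nat \<Rightarrow> complex) \<Rightarrow> complex" where
  "DQ N K i j F z = (\<Sum>k=1..K. of_nat k * (\<Sum>a<k. z i ^ a * z j ^ (k - 1 - a)) * ev N K (dp k F) z)"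

lemma DQ_D1: "(z i - z j) * DQ N K i j F z = D1 N K i F z - D1 N K j F z"
proof -
  have "(z i - z j) * (of_nat k * (\<Sum>a<k. z i ^ a * z j ^ (k - 1 - a)) * x) =
      of_nat k * z i ^ k * x - of_nat k * z j ^ k * x" for k x
  proof -
    have "(z i - z j) * (\<Sum>a<k. z i ^ a * z j ^ (k - 1 - a)) = z i ^ k - z j ^ k"
      using power_diff_sumr2[of "z i" k "z j"] by (simp add: mult.commute)
    then have "of_nat k * ((z i - z j) * (\<Sum>a<k. z i ^ a * z j ^ (k - 1 - a))) * x = of_nat k * (z i ^ k - z j ^ k) * x"
      by simp
    then show ?thesis by (simp only: left_diff_distrib right_diff_distrib mult.assoc mult.left_commute)
  qed
  then show ?thesis
    by (simp only: DQ_def D1_def sum_subtractf[symmetric] sum_distrib_left)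
qed

lemma D1_D2_deriv:
  assumes i: "i < N" and F: "F \<in> supported (partitions_upto K)"
  shows "((\<lambda>t. D1 N K i F (z(i := t))) has_field_derivative
     (\<Sum>k=1..K. of_nat k * (of_nat k * t ^ (k - 1) * ev N K (dp k F) (z(i := t))
       + t ^ k * (\<Sum>l=1..K. of_nat l * t ^ (l - 1) * ev N K (dp l (dp k F)) (z(i := t)))))) (at t)"
proof -
  have e: "D1 N K i F (z(i := t)) = (\<Sum>k=1..K. of_nat k * (t ^ k * ev N K (dp k F) (z(i := t))))" for t
    by (simp add: D1_def mult_ac)
  have "((\<lambda>t. t ^ k * ev N K (dp k F) (z(i := t))) has_field_derivative
     (of_nat k * t ^ (k - 1) * ev N K (dp k F) (z(i := t))
       + t ^ k * (\<Sum>l=1..K. of_nat l * t ^ (l - 1) * ev N K (dp l (dp k F)) (z(i := t))))) (at t)" for k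
  proof -
    have "((\<lambda>t. t ^ k) has_field_derivative (of_nat k * t ^ (k - 1))) (at t)"
      by (auto intro!: derivative_eq_intros)
    from DERIV_mult[OF this ev_deriv[OF i dp_supported[OF F, of k]]]
    show ?thesis by (simp only: mult.commute[of _ "t ^ k"])
  qed
  then show ?thesis unfolding e by (intro DERIV_sum DERIV_cmult) auto
qed

lemma D2_alt:
  shows "D2 N K i F z = z i * (\<Sum>k=1..K. of_nat k * (of_nat k * z i ^ (k - 1) * ev N K (dp k F) z
       + z i ^ k * (\<Sum>l=1..K. of_nat l * z i ^ (l - 1) * ev N K (dp l (dp k F)) z)))"
proof -
  have "D2 N K i F z = (\<Sum>k=1..K. (of_nat k)\<^sup>2 * z i ^ k * ev N K (dp k F) z
      + (\<Sum>l=1..K. of_nat k * of_nat l * z i ^ (k + l) * ev N K (dp k (dp l F)) z))"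
    by (simp add: D2_def sum.distrib)
  also have "\<dots> = (\<Sum>k=1..K. z i * (of_nat k * (of_nat k * z i ^ (k - 1) * ev N K (dp k F) z
       + z i ^ k * (\<Sum>l=1..K. of_nat l * z i ^ (l - 1) * ev N K (dp l (dp k F)) z))))"
  proof (intro sum.cong refl)
    fix k assume k: "k \<in> {1..K}"
    then have "z i ^ k = z i * z i ^ (k - 1)" by (cases k) auto
    moreover have "(\<Sum>l=1..K. of_nat k * of_nat l * z i ^ (k + l) * ev N K (dp k (dp l F)) z) =
       z i * (of_nat k * (z i ^ k * (\<Sum>l=1..K. of_nat l * z i ^ (l - 1) * ev N K (dp l (dp k F)) z)))"
      unfolding sum_distrib_left
    proof (intro sum.cong refl)
      fix l assume "l \<in> {1..K}"
      then have "z i ^ (k + l) = z i * z i ^ k * z i ^ (l - 1)" by (cases l) (auto simp: power_add)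
      then show "of_nat k * of_nat l * z i ^ (k + l) * ev N K (dp k (dp l F)) z =
        z i * (of_nat k * (z i ^ k * (of_nat l * z i ^ (l - 1) * ev N K (dp l (dp k F)) z)))"
        by (simp add: dp_commute[of l k] mult_ac)
    qed
    ultimately show "(of_nat k)\<^sup>2 * z i ^ k * ev N K (dp k F) z
      + (\<Sum>l=1..K. of_nat k * of_nat l * z i ^ (k + l) * ev N K (dp k (dp l F)) z) =
      z i * (of_nat k * (of_nat k * z i ^ (k - 1) * ev N K (dp k F) z
       + z i ^ k * (\<Sum>l=1..K. of_nat l * z i ^ (l - 1) * ev N K (dp l (dp k F)) z)))"
      by (simp add: power2_eq_square algebra_simps)
  qed
  finally show ?thesis by (simp add: sum_distrib_left)
qed

definition pairs :: "nat \<Rightarrow> (nat \<times> nat) set" where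
  "pairs N = {(i, j). i < j \<and> j < N}"

lemma pairs_Suc: "pairs (Suc N) = pairs N \<union> (\<lambda>i. (i, N)) ` {..<N}"
  by (auto simp: pairs_def)

lemma finite_pairs [simp]: "finite (pairs N)"
  by (rule finite_subset[where B = "{..<N} \<times> {..<N}"]) (auto simp: pairs_def)

lemma sum_pairs_Suc: "(\<Sum>(i,j)\<in>pairs (Suc N). g i j) = (\<Sum>(i,j)\<in>pairs N. g i j) + (\<Sum>i<N. g i N)"
proof -
  have "pairs N \<inter> (\<lambda>i. (i, N)) ` {..<N} = {}" by (auto simp: pairs_def)
  then show ?thesis
    unfolding pairs_Suc by (simp add: sum.union_disjoint sum.reindex inj_on_def o_def)
qed

lemma sum_pairs_symmetric:
  fixes g :: "nat \<Rightarrow> nat \<Rightarrow> complex"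
  assumes "\<And>i j. g i j = g j i"
  shows "2 * (\<Sum>(i,j)\<in>pairs N. g i j) = (\<Sum>i<N. \<Sum>j<N. g i j) - (\<Sum>i<N. g i i)"
proof (induction N)
  case 0
  then show ?case by (simp add: pairs_def)
next
  case (Suc N)
  have "(\<Sum>j<N. g N j) = (\<Sum>j<N. g j N)" by (simp add: assms)
  then show ?case using Suc
    by (simp add: sum_pairs_Suc sum.distrib algebra_simps)
qed

text \<open>The inner sum is the divided difference of the m-th power. Summing over all ordered
  pairs gives products of two power sums; the term containing \<open>p\<^sub>0\<close> accounts for
  N, and removing the diagonal accounts for - m.\<close>

lemma pair_sum_identity:
  assumes m: "m \<ge> 1"
  shows "(\<Sum>(i,j)\<in>pairs N. (z i + z j) * (\<Sum>a<m. z i ^ a * z j ^ (m - 1 - a)))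
    = (of_nat N - of_nat m) * psum N m z + (\<Sum>a=1..<m. psum N a z * psum N (m - a) z)"
proof -
  define h where "h x y = (\<Sum>a<m. x ^ a * y ^ (m - 1 - a))" for x y :: complex
  define g where "g i j = (z i + z j) * h (z i) (z j)" for i j
  have h_sym: "h x y = h y x" for x y
    unfolding h_def by (rule sum.reindex_bij_witness[of _ "\<lambda>a. m - 1 - a" "\<lambda>a. m - 1 - a"])
      (use m in \<open>auto simp: mult.commute\<close>)
  have "2 * (\<Sum>(i,j)\<in>pairs N. g i j) = (\<Sum>i<N. \<Sum>j<N. g i j) - (\<Sum>i<N. g i i)"
    by (rule sum_pairs_symmetric) (simp add: g_def h_sym add.commute)
  also have "(\<Sum>i<N. g i i) = 2 * of_nat m * psum N m z"
  proof -
    have "x * h x x = of_nat m * x ^ m" for x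
    proof -
      have "x * h x x = (\<Sum>a<m. x ^ m)"
        unfolding h_def sum_distrib_left
      proof (intro sum.cong refl)
        fix a assume "a \<in> {..<m}"
        then have "m = Suc (a + (m - 1 - a))" by simp
        then show "x * (x ^ a * x ^ (m - 1 - a)) = x ^ m" by (metis power_Suc power_add)
      qed
      then show ?thesis by simp
    qed
    then have "g i i = 2 * of_nat m * z i ^ m" for i
      unfolding g_def by (metis mult.assoc mult_2 mult.left_commute)
    then show ?thesis by (simp add: psum_def sum_distrib_left)
  qed
  also have "(\<Sum>i<N. \<Sum>j<N. g i j) = 2 * (of_nat N * psum N m z + (\<Sum>a=1..<m. psum N a z * psum N (m - a) z))"
  proof -
    have s1: "(\<Sum>i<N. \<Sum>j<N. z i * h (z i) (z j)) = (\<Sum>a<m. psum N (Suc a) z * psum N (m - 1 - a) z)"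
    proof -
      have "(\<Sum>i<N. \<Sum>j<N. z i * h (z i) (z j)) = (\<Sum>i<N. \<Sum>j<N. \<Sum>a<m. z i ^ Suc a * z j ^ (m - 1 - a))"
        by (simp add: h_def sum_distrib_left mult.assoc)
      also have "\<dots> = (\<Sum>i<N. \<Sum>a<m. \<Sum>j<N. z i ^ Suc a * z j ^ (m - 1 - a))"
        by (intro sum.cong refl sum.swap)
      also have "\<dots> = (\<Sum>a<m. \<Sum>i<N. \<Sum>j<N. z i ^ Suc a * z j ^ (m - 1 - a))"
        by (rule sum.swap)
      also have "\<dots> = (\<Sum>a<m. psum N (Suc a) z * psum N (m - 1 - a) z)"
        by (simp add: psum_def sum_product)
      finally show ?thesis .
    qed
    have s2: "(\<Sum>i<N. \<Sum>j<N. z j * h (z i) (z j)) = (\<Sum>i<N. \<Sum>j<N. z i * h (z i) (z j))"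
      by (subst sum.swap) (simp add: h_sym)
    obtain m' where m': "m = Suc m'" using m by (cases m) auto
    have "(\<Sum>a<m. psum N (Suc a) z * psum N (m - 1 - a) z) =
       psum N m z * of_nat N + (\<Sum>a<m'. psum N (Suc a) z * psum N (m' - a) z)"
      by (simp add: m' psum_def)
    also have "(\<Sum>a<m'. psum N (Suc a) z * psum N (m' - a) z) = (\<Sum>a=1..<m. psum N a z * psum N (m - a) z)"
      by (rule sum.reindex_bij_witness[of _ "\<lambda>a. a - 1" Suc]) (auto simp: m')
    finally show ?thesis
      unfolding g_def distrib_right sum.distrib s2 s1 by (simp add: mult.commute)
  qed
  finally have "2 * (\<Sum>(i,j)\<in>pairs N. g i j) =
      2 * ((of_nat N - of_nat m) * psum N m z + (\<Sum>a=1..<m. psum N a z * psum N (m - a) z))"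
    by (simp add: algebra_simps)
  then have "(\<Sum>(i,j)\<in>pairs N. g i j) =
      (of_nat N - of_nat m) * psum N m z + (\<Sum>a=1..<m. psum N a z * psum N (m - a) z)"
    by (subst (asm) mult_left_cancel) simp_all
  then show ?thesis by (simp add: g_def h_def)
qed

text \<open>In N variables \<open>lap\<close> consists of the squared Euler fields weighted by
  \<alpha> and, for each pair, (z i + z j) / (z i - z j) times the difference of the two Euler
  fields. The multiple of the degree subtracted at the end removes the dependence on N.\<close>

lemma ev_lap:
  assumes F: "F \<in> hom d" and d: "d \<le> K"
  shows "ev N K (lap \<alpha> K F) z = of_real \<alpha> * (\<Sum>i<N. D2 N K i F z)
     + (\<Sum>(i,j)\<in>pairs N. (z i + z j) * DQ N K i j F z)
     - of_real (real N + \<alpha> - 1) * of_nat d * ev N K F z"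
proof -
  have Fs: "F \<in> supported (partitions_upto K)" by (rule hom_upto[OF F d])
  define e where "e k = ev N K (dp k F) z" for k
  define p where "p k = psum N k z" for k
  define S where "S = (\<Sum>k=1..K. \<Sum>l=1..K. of_nat k * of_nat l * p (k + l) * ev N K (dp k (dp l F)) z)"
  define R where "R m = (\<Sum>a=1..<m. p a * p (m - a))" for m
  have e0: "e k = 0" if "k > K" for k using dp_eq_0[OF Fs that] by (simp add: e_def ev_0)
  have d2: "(\<Sum>i<N. D2 N K i F z) = (\<Sum>k=1..K. (of_nat k)\<^sup>2 * p k * e k) + S"
  proof -
    have "(\<Sum>i<N. \<Sum>k=1..K. (of_nat k)\<^sup>2 * z i ^ k * e k) = (\<Sum>k=1..K. (of_nat k)\<^sup>2 * p k * e k)"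
      by (subst sum.swap) (simp add: p_def psum_def sum_distrib_left sum_distrib_right)
    moreover have "(\<Sum>i<N. \<Sum>k=1..K. \<Sum>l=1..K. of_nat k * of_nat l * z i ^ (k + l) * ev N K (dp k (dp l F)) z) = S"
    proof -
      have "(\<Sum>i<N. \<Sum>k=1..K. \<Sum>l=1..K. of_nat k * of_nat l * z i ^ (k + l) * ev N K (dp k (dp l F)) z)
          = (\<Sum>k=1..K. \<Sum>i<N. \<Sum>l=1..K. of_nat k * of_nat l * z i ^ (k + l) * ev N K (dp k (dp l F)) z)"
        by (rule sum.swap)
      also have "\<dots> = (\<Sum>k=1..K. \<Sum>l=1..K. \<Sum>i<N. of_nat k * of_nat l * z i ^ (k + l) * ev N K (dp k (dp l F)) z)"
        by (intro sum.cong refl sum.swap)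
      finally show ?thesis by (simp add: S_def p_def psum_def sum_distrib_left sum_distrib_right)
    qed
    ultimately show ?thesis unfolding D2_def sum.distrib e_def by simp
  qed
  have pq: "(\<Sum>(i,j)\<in>pairs N. (z i + z j) * DQ N K i j F z) =
      (\<Sum>k=1..K. of_nat k * e k * ((of_nat N - of_nat k) * p k + R k))"
  proof -
    have "(\<Sum>(i,j)\<in>pairs N. (z i + z j) * DQ N K i j F z) =
      (\<Sum>x\<in>pairs N. \<Sum>k=1..K. of_nat k * e k * (case x of (i,j) \<Rightarrow> (z i + z j) * (\<Sum>a<k. z i ^ a * z j ^ (k - 1 - a))))"
      by (intro sum.cong refl) (auto simp: DQ_def e_def sum_distrib_left mult_ac)
    also have "\<dots> = (\<Sum>k=1..K. \<Sum>x\<in>pairs N. of_nat k * e k * (case x of (i,j) \<Rightarrow> (z i + z j) * (\<Sum>a<k. z i ^ a * z j ^ (k - 1 - a))))"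
      by (rule sum.swap)
    also have "\<dots> = (\<Sum>k=1..K. of_nat k * e k * ((of_nat N - of_nat k) * p k + R k))"
    proof (intro sum.cong refl)
      fix k assume "k \<in> {1..K}"
      then have k: "k \<ge> 1" by simp
      show "(\<Sum>x\<in>pairs N. of_nat k * e k * (case x of (i,j) \<Rightarrow> (z i + z j) * (\<Sum>a<k. z i ^ a * z j ^ (k - 1 - a))))
        = of_nat k * e k * ((of_nat N - of_nat k) * p k + R k)"
        by (simp only: sum_distrib_left[symmetric] pair_sum_identity[OF k] p_def R_def)
    qed
    finally show ?thesis .
  qed
  have eu: "of_nat d * ev N K F z = (\<Sum>k=1..K. of_nat k * p k * e k)"
  proof -
    have "of_nat d * ev N K F z = ev N K (\<Sum>k=1..K. cscale (of_nat k) (pm k (dp k F))) z"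
      by (simp only: euler[OF F d] ev_scale)
    then show ?thesis by (simp add: ev_linear ev_pm_dp[OF Fs] p_def e_def mult.assoc)
  qed
  \<comment> \<open>Pairs are regrouped by m = k + l; those with m > K drop out because the
    derivative vanishes.\<close>
  have r: "(\<Sum>k=1..K. \<Sum>l=1..K. of_nat (k + l) * (p k * p l * e (k + l))) = (\<Sum>m=1..K. of_nat m * e m * R m)"
  proof -
    have "(\<Sum>k=1..K. \<Sum>l=1..K. of_nat (k + l) * (p k * p l * e (k + l))) =
      (\<Sum>(k,l)\<in>{1..K}\<times>{1..K}. of_nat (k + l) * (p k * p l * e (k + l)))"
      by (simp add: sum.cartesian_product)
    also have "\<dots> = (\<Sum>(k,l)\<in>{(k,l). 1 \<le> k \<and> 1 \<le> l \<and> k + l \<le> K}. of_nat (k + l) * (p k * p l * e (k + l)))"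
      by (intro sum.mono_neutral_right) (auto, metis e0 not_le)
    also have "\<dots> = (\<Sum>(m,a)\<in>Sigma {1..K} (\<lambda>m. {1..<m}). of_nat m * e m * (p a * p (m - a)))"
      by (rule sum.reindex_bij_witness[of _ "\<lambda>(m,a). (a, m - a)" "\<lambda>(k,l). (k + l, k)"])
        (auto simp: mult_ac)
    also have "\<dots> = (\<Sum>m=1..K. of_nat m * e m * R m)"
      by (subst sum.Sigma[symmetric]) (auto simp: R_def sum_distrib_left)
    finally show ?thesis .
  qed
  have l: "ev N K (lap \<alpha> K F) z = of_real \<alpha> * S + (\<Sum>m=1..K. of_nat m * e m * R m)
      + (\<Sum>k=1..K. of_real (\<alpha> - 1) * of_nat k * (of_nat k - 1) * (p k * e k))"
    unfolding lap_def ev_linear r[symmetric] S_def sum.distrib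
    by (simp add: ev_pm_dp[OF Fs] ev_pm_dp_dp[OF Fs] ev_pm_pm_dp[OF Fs] p_def e_def sum_distrib_left mult_ac)
  show ?thesis
    unfolding l d2 pq mult.assoc eu
    by (simp add: sum_distrib_left sum_subtractf[symmetric] sum.distrib[symmetric] distrib_left)
      (simp add: algebra_simps power2_eq_square sum.distrib sum_subtractf)
qed

lemma ev_low:
  assumes F: "F \<in> supported (partitions_upto K)"
  shows "ev N K (low (of_nat N) K F) z = (\<Sum>i<N. \<Sum>k=1..K. of_nat k * z i ^ (k - 1) * ev N K (dp k F) z)"
proof (cases "K = 0")
  case True
  then have "dp 1 F = 0" using dp_eq_0[OF F] by simp
  then show ?thesis using True by (simp add: low_def shift_down_def ev_linear)
next
  case False
  have pd: "ev N K (pm j (dp (Suc j) F)) z = psum N j z * ev N K (dp (Suc j) F) z" if "j \<ge> 1" for j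
  proof (cases "Suc j \<le> K")
    case True
    then show ?thesis
      using ev_pm[of "dp (Suc j) F" "K - Suc j" j K] dp_upto[of F "K - Suc j" "Suc j"] F that by simp
  next
    case False
    then show ?thesis using dp_eq_0[OF F, of "Suc j"] by (simp add: pm_simps ev_0)
  qed
  have "ev N K (low (of_nat N) K F) z = of_nat N * ev N K (dp 1 F) z
      + (\<Sum>j=1..K. of_nat (Suc j) * (psum N j z * ev N K (dp (Suc j) F) z))"
    by (simp add: low_def shift_down_def ev_linear pd)
  \<comment> \<open>The separate term is the case j = 0, as \<open>psum N 0 z\<close> is N.\<close>
  also have "\<dots> = (\<Sum>j=0..K. of_nat (Suc j) * (psum N j z * ev N K (dp (Suc j) F) z))"
    by (simp add: sum.atLeast_Suc_atMost psum_def)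
  also have "\<dots> = (\<Sum>j=0..K-1. of_nat (Suc j) * (psum N j z * ev N K (dp (Suc j) F) z))"
  proof (intro sum.mono_neutral_right ballI)
    fix j assume "j \<in> {0..K} - {0..K-1}"
    then have "j = K" using False by auto
    then show "of_nat (Suc j) * (psum N j z * ev N K (dp (Suc j) F) z) = 0"
      using dp_eq_0[OF F, of "Suc K"] by (simp add: ev_0)
  qed auto
  also have "\<dots> = (\<Sum>k=1..K. of_nat k * (psum N (k - 1) z * ev N K (dp k F) z))"
    by (rule sum.reindex_bij_witness[of _ "\<lambda>k. k - 1" Suc]) (use False in auto)
  also have "\<dots> = (\<Sum>k=1..K. \<Sum>i<N. of_nat k * z i ^ (k - 1) * ev N K (dp k F) z)"
    by (simp add: psum_def sum_distrib_left sum_distrib_right mult_ac)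
  also have "\<dots> = (\<Sum>i<N. \<Sum>k=1..K. of_nat k * z i ^ (k - 1) * ev N K (dp k F) z)"
    by (rule sum.swap)
  finally show ?thesis .
qed

subsection \<open>Monomial expansions\<close>

definition exps :: "nat \<Rightarrow> nat \<Rightarrow> (nat \<Rightarrow> nat) set" where
  "exps N d = {\<eta>. (\<forall>i\<ge>N. \<eta> i = 0) \<and> (\<Sum>i<N. \<eta> i) = d}"

definition mon :: "nat \<Rightarrow> (nat \<Rightarrow> nat) \<Rightarrow> (nat \<Rightarrow> complex) \<Rightarrow> complex" where
  "mon N \<eta> z = (\<Prod>i<N. z i ^ \<eta> i)"

text \<open>Homogeneous polynomials in N variables are functions that carry a coefficient family. By
  \<open>rep_unique\<close> the family is determined by the values at points with distinct
  coordinates, which are the points where dividing by z i - z j is possible.\<close>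

definition rep :: "nat \<Rightarrow> nat \<Rightarrow> ((nat \<Rightarrow> nat) \<Rightarrow> complex) \<Rightarrow> ((nat \<Rightarrow> complex) \<Rightarrow> complex) \<Rightarrow> bool" where
  "rep N d c f \<longleftrightarrow> (\<forall>\<eta>. c \<eta> \<noteq> 0 \<longrightarrow> \<eta> \<in> exps N d) \<and> (\<forall>z. f z = (\<Sum>\<eta>\<in>exps N d. c \<eta> * mon N \<eta> z))"

lemma exps_le: "\<eta> \<in> exps N d \<Longrightarrow> \<eta> i \<le> d"
  using member_le_sum[of i "{..<N}" \<eta>] by (cases "i < N") (auto simp: exps_def)

lemma finite_exps [simp]: "finite (exps N d)"
proof (rule finite_subset)
  show "exps N d \<subseteq> {\<eta>. \<forall>i. (i \<in> {..<N} \<longrightarrow> \<eta> i \<in> {..d}) \<and> (i \<notin> {..<N} \<longrightarrow> \<eta> i = 0)}"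
    using exps_le by (auto simp: exps_def)
qed (intro finite_set_of_finite_funs finite_lessThan finite_atMost)

lemma repD: "rep N d c f \<Longrightarrow> f z = (\<Sum>\<eta>\<in>exps N d. c \<eta> * mon N \<eta> z)"
  and rep_support: "rep N d c f \<Longrightarrow> c \<eta> \<noteq> 0 \<Longrightarrow> \<eta> \<in> exps N d"
  by (simp_all add: rep_def)

lemma rep_add: "rep N d c f \<Longrightarrow> rep N d c' g \<Longrightarrow> rep N d (\<lambda>\<eta>. c \<eta> + c' \<eta>) (\<lambda>z. f z + g z)"
  unfolding rep_def by (simp add: sum.distrib distrib_right) (metis add.right_neutral)

lemma rep_scale: "rep N d c f \<Longrightarrow> rep N d (\<lambda>\<eta>. a * c \<eta>) (\<lambda>z. a * f z)"
  unfolding rep_def by (auto simp: sum_distrib_left mult.assoc)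

lemma rep_diff: "rep N d c f \<Longrightarrow> rep N d c' g \<Longrightarrow> rep N d (\<lambda>\<eta>. c \<eta> - c' \<eta>) (\<lambda>z. f z - g z)"
  using rep_add[of N d c f "\<lambda>\<eta>. - 1 * c' \<eta>" "\<lambda>z. - 1 * g z"] rep_scale[of N d c' g "-1"] by simp

lemma rep_0: "rep N d (\<lambda>\<eta>. 0) (\<lambda>z. 0)"
  by (simp add: rep_def)

lemma rep_sum: "(\<And>a. a \<in> A \<Longrightarrow> rep N d (c a) (f a)) \<Longrightarrow> rep N d (\<lambda>\<eta>. \<Sum>a\<in>A. c a \<eta>) (\<lambda>z. \<Sum>a\<in>A. f a z)"
  by (induction A rule: infinite_finite_induct) (auto intro: rep_0 rep_add)

lemma mon_split:
  assumes "i < N"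
  shows "mon N \<eta> z = z i ^ \<eta> i * (\<Prod>j\<in>{..<N} - {i}. z j ^ \<eta> j)"
  using assms by (simp add: mon_def prod.remove[of "{..<N}" i])

lemma mon_upd:
  assumes "i < N"
  shows "mon N (\<eta>(i := a)) z = z i ^ a * (\<Prod>j\<in>{..<N} - {i}. z j ^ \<eta> j)"
  by (subst mon_split[OF assms]) (auto intro!: prod.cong)

lemma sum_upd:
  fixes \<eta> :: "nat \<Rightarrow> nat"
  assumes "i < N"
  shows "(\<Sum>j<N. (\<eta>(i := a)) j) + \<eta> i = (\<Sum>j<N. \<eta> j) + a"
proof -
  have "(\<Sum>j\<in>{..<N} - {i}. (\<eta>(i := a)) j) = (\<Sum>j\<in>{..<N} - {i}. \<eta> j)"
    by (intro sum.cong) auto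
  then show ?thesis using assms by (simp add: sum.remove[of "{..<N}" i])
qed

lemma exps_upd:
  assumes "i < N"
  shows "\<eta>(i := a) \<in> exps N d \<longleftrightarrow> (\<forall>j\<ge>N. \<eta> j = 0) \<and> (\<Sum>j<N. \<eta> j) + a = d + \<eta> i"
  using sum_upd[OF assms, of \<eta> a] assms by (auto simp: exps_def)

definition shift_exp :: "nat \<Rightarrow> nat \<Rightarrow> ((nat \<Rightarrow> nat) \<Rightarrow> complex) \<Rightarrow> (nat \<Rightarrow> nat) \<Rightarrow> complex" where
  "shift_exp i k c \<eta> = (if k \<le> \<eta> i then c (\<eta>(i := \<eta> i - k)) else 0)"

lemma rep_shift:
  assumes r: "rep N d c f" and i: "i < N"
  shows "rep N (d + k) (shift_exp i k c) (\<lambda>z. z i ^ k * f z)"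
proof -
  have supp: "\<eta> \<in> exps N (d + k)" if "shift_exp i k c \<eta> \<noteq> 0" for \<eta>
  proof -
    have "k \<le> \<eta> i" "\<eta>(i := \<eta> i - k) \<in> exps N d"
      using that rep_support[OF r] by (auto simp: shift_exp_def split: if_splits)
    then show ?thesis using exps_upd[OF i] i by (auto simp: exps_def)
  qed
  have "z i ^ k * f z = (\<Sum>\<eta>\<in>exps N (d + k). shift_exp i k c \<eta> * mon N \<eta> z)" for z
  proof -
    have "z i ^ k * f z = (\<Sum>\<eta>\<in>exps N d. c \<eta> * (z i ^ k * mon N \<eta> z))"
      by (simp add: repD[OF r] sum_distrib_left mult_ac)
    also have "\<dots> = (\<Sum>\<eta>\<in>{\<eta>\<in>exps N (d + k). k \<le> \<eta> i}. c (\<eta>(i := \<eta> i - k)) * mon N \<eta> z)"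
    proof (rule sum.reindex_bij_witness[of _ "\<lambda>\<eta>. \<eta>(i := \<eta> i - k)" "\<lambda>\<eta>. \<eta>(i := \<eta> i + k)"])
      fix \<eta> assume \<eta>: "\<eta> \<in> exps N d"
      show "\<eta>(i := \<eta> i + k) \<in> {\<eta> \<in> exps N (d + k). k \<le> \<eta> i}"
        using \<eta> exps_upd[OF i] by (auto simp: exps_def)
      show "c ((\<eta>(i := \<eta> i + k))(i := (\<eta>(i := \<eta> i + k)) i - k)) * mon N (\<eta>(i := \<eta> i + k)) z =
         c \<eta> * (z i ^ k * mon N \<eta> z)"
        by (simp add: mon_upd[OF i] mon_split[OF i] power_add mult_ac)
    next
      fix \<eta> assume \<eta>: "\<eta> \<in> {\<eta> \<in> exps N (d + k). k \<le> \<eta> i}"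
      then show "\<eta>(i := \<eta> i - k) \<in> exps N d"
        using exps_upd[OF i, of \<eta> "\<eta> i - k" d] by (auto simp: exps_def)
    qed auto
    also have "\<dots> = (\<Sum>\<eta>\<in>exps N (d + k). shift_exp i k c \<eta> * mon N \<eta> z)"
      by (simp add: sum.inter_filter[symmetric] shift_exp_def if_distrib[of "\<lambda>x. x * _"] cong: if_cong)
    finally show ?thesis .
  qed
  then show ?thesis using supp by (auto simp: rep_def)
qed

lemma digits_unique:
  fixes B :: nat
  assumes "\<And>i. \<eta> i < B" "\<And>i. \<zeta> i < B" "(\<Sum>i<N. \<eta> i * B ^ i) = (\<Sum>i<N. \<zeta> i * B ^ i)" "i < N"
  shows "\<eta> i = \<zeta> i"
  using assms
proof (induction N arbitrary: \<eta> \<zeta> i)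
  case (Suc N)
  have e: "(\<Sum>i<Suc N. f i * B ^ i) = f 0 + B * (\<Sum>i<N. f (Suc i) * B ^ i)" for f :: "nat \<Rightarrow> nat"
    by (subst sum.lessThan_Suc_shift) (simp add: sum_distrib_left mult_ac)
  have "B > 0" using Suc.prems(1)[of 0] by simp
  have "\<eta> 0 + B * (\<Sum>i<N. \<eta> (Suc i) * B ^ i) = \<zeta> 0 + B * (\<Sum>i<N. \<zeta> (Suc i) * B ^ i)"
    using Suc.prems(3) by (simp only: e)
  note * = this
  from arg_cong[OF *, of "\<lambda>x. x mod B"] have 0: "\<eta> 0 = \<zeta> 0"
    using Suc.prems(1,2) by simp
  then have "(\<Sum>i<N. \<eta> (Suc i) * B ^ i) = (\<Sum>i<N. \<zeta> (Suc i) * B ^ i)"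
    using * \<open>B > 0\<close> by simp
  then have "\<eta> (Suc j) = \<zeta> (Suc j)" if "j < N" for j
    using Suc.IH[of "\<lambda>i. \<eta> (Suc i)" "\<lambda>i. \<zeta> (Suc i)" j] Suc.prems(1,2) that by simp
  then show ?case using 0 Suc.prems(4) by (cases i) auto
qed simp

text \<open>Kronecker substitution \<open>z\<^sub>i = t ^ (B ^ i)\<close> reduces to one variable.\<close>

lemma rep_unique:
  assumes r: "rep N d c f" and r': "rep N d c' g"
    and eq: "\<And>z. inj_on z {..<N} \<Longrightarrow> f z = g z"
  shows "c = c'"
proof
  fix \<eta>0
  define e where "e \<eta> = c \<eta> - c' \<eta>" for \<eta>
  \<comment> \<open>All exponents are at most d, hence digits to base B. Moreover B \<ge> 2 makes
    the numbers B^i, and with them the substituted coordinates, distinct.\<close>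
  define B where "B = d + 2"
  define \<kappa> where "\<kappa> \<eta> = (\<Sum>i<N. \<eta> i * B ^ i)" for \<eta> :: "nat \<Rightarrow> nat"
  have inj: "inj_on \<kappa> (exps N d)"
  proof (rule inj_onI)
    fix \<eta> \<zeta> assume *: "\<eta> \<in> exps N d" "\<zeta> \<in> exps N d" "\<kappa> \<eta> = \<kappa> \<zeta>"
    have "\<eta> i < B" "\<zeta> i < B" for i using exps_le[OF *(1), of i] exps_le[OF *(2), of i] by (simp_all add: B_def)
    then have "\<eta> i = \<zeta> i" if "i < N" for i
      using digits_unique[of \<eta> B \<zeta> N i] *(3) that by (simp add: \<kappa>_def)
    moreover have "\<eta> i = \<zeta> i" if "\<not> i < N" for i
      using *(1,2) that by (simp add: exps_def)
    ultimately show "\<eta> = \<zeta>" by (intro ext) blast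
  qed
  define Q where "Q = (\<Sum>\<eta>\<in>exps N d. monom (e \<eta>) (\<kappa> \<eta>))"
  have root: "poly Q (of_nat m) = 0" if "m \<ge> 2" for m
  proof -
    define z where "z i = (of_nat m :: complex) ^ (B ^ i)" for i
    have "inj_on z {..<N}"
    proof (rule inj_onI)
      fix i j assume "z i = z j"
      then have "m ^ (B ^ i) = m ^ (B ^ j)" unfolding z_def by (metis of_nat_eq_iff of_nat_power)
      then have "B ^ i = B ^ j" using that by (subst (asm) power_inject_exp) auto
      then show "i = j" by (subst (asm) power_inject_exp) (auto simp: B_def)
    qed
    then have "f z = g z" by (rule eq)
    moreover have "mon N \<eta> z = of_nat m ^ \<kappa> \<eta>" for \<eta>
      by (simp add: mon_def z_def \<kappa>_def power_sum mult.commute flip: power_mult)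
    ultimately show ?thesis
      using repD[OF r, of z] repD[OF r', of z]
      by (simp add: Q_def poly_sum poly_monom e_def left_diff_distrib sum_subtractf)
  qed
  have "infinite ((of_nat :: nat \<Rightarrow> complex) ` {2..})"
    by (subst finite_image_iff) (auto simp: inj_on_def infinite_Ici)
  then have "infinite {x. poly Q x = 0}"
    by (rule infinite_super[rotated]) (use root in auto)
  then have "Q = 0" using poly_roots_finite by blast
  show "c \<eta>0 = c' \<eta>0"
  proof (cases "\<eta>0 \<in> exps N d")
    case True
    have "coeff Q (\<kappa> \<eta>0) = (\<Sum>\<eta>\<in>exps N d. if \<eta> = \<eta>0 then e \<eta> else 0)"
      unfolding Q_def coeff_sum
      by (intro sum.cong refl) (use inj True in \<open>auto simp: inj_on_def\<close>)
    then show ?thesis using True \<open>Q = 0\<close> by (simp add: e_def)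
  next
    case False
    then show ?thesis using rep_support[OF r] rep_support[OF r'] by metis
  qed
qed

lemma rep_deriv:
  assumes r: "rep N (Suc d) c f" and i: "i < N"
    and f': "\<And>z. ((\<lambda>t. f (z(i := t))) has_field_derivative f' z) (at (z i))"
  shows "rep N d (\<lambda>\<zeta>. of_nat (Suc (\<zeta> i)) * c (\<zeta>(i := Suc (\<zeta> i)))) f'"
proof -
  have supp: "\<zeta> \<in> exps N d" if "of_nat (Suc (\<zeta> i)) * c (\<zeta>(i := Suc (\<zeta> i))) \<noteq> 0" for \<zeta>
  proof -
    have "\<zeta>(i := Suc (\<zeta> i)) \<in> exps N (Suc d)" using that rep_support[OF r] by auto
    then show ?thesis using exps_upd[OF i] by (auto simp: exps_def)
  qed
  have "f' z = (\<Sum>\<zeta>\<in>exps N d. of_nat (Suc (\<zeta> i)) * c (\<zeta>(i := Suc (\<zeta> i))) * mon N \<zeta> z)" for z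
  proof -
    define R where "R \<eta> = (\<Prod>j\<in>{..<N} - {i}. z j ^ \<eta> j)" for \<eta> :: "nat \<Rightarrow> nat"
    have e: "f (z(i := t)) = (\<Sum>\<eta>\<in>exps N (Suc d). c \<eta> * R \<eta> * t ^ \<eta> i)" for t
    proof -
      have "mon N \<eta> (z(i := t)) = t ^ \<eta> i * R \<eta>" for \<eta>
        by (simp add: mon_split[OF i] R_def)
      then show ?thesis by (simp add: repD[OF r] mult_ac)
    qed
    have "((\<lambda>t. f (z(i := t))) has_field_derivative
       (\<Sum>\<eta>\<in>exps N (Suc d). c \<eta> * R \<eta> * (of_nat (\<eta> i) * z i ^ (\<eta> i - 1)))) (at (z i))"
      unfolding e by (auto intro!: derivative_eq_intros sum.cong)
    then have "f' z = (\<Sum>\<eta>\<in>exps N (Suc d). c \<eta> * R \<eta> * (of_nat (\<eta> i) * z i ^ (\<eta> i - 1)))"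
      using f' DERIV_unique by blast
    also have "\<dots> = (\<Sum>\<eta>\<in>{\<eta>\<in>exps N (Suc d). \<eta> i \<ge> 1}. c \<eta> * R \<eta> * (of_nat (\<eta> i) * z i ^ (\<eta> i - 1)))"
      by (intro sum.mono_neutral_right) (auto simp: not_less_eq_eq)
    also have "\<dots> = (\<Sum>\<zeta>\<in>exps N d. of_nat (Suc (\<zeta> i)) * c (\<zeta>(i := Suc (\<zeta> i))) * mon N \<zeta> z)"
    proof (rule sum.reindex_bij_witness[of _ "\<lambda>\<eta>. \<eta>(i := Suc (\<eta> i))" "\<lambda>\<eta>. \<eta>(i := \<eta> i - 1)"])
      fix \<eta> assume \<eta>: "\<eta> \<in> {\<eta>\<in>exps N (Suc d). \<eta> i \<ge> 1}"
      then show "\<eta>(i := \<eta> i - 1) \<in> exps N d"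
        using exps_upd[OF i, of \<eta> "\<eta> i - 1" d] by (auto simp: exps_def)
      show "of_nat (Suc ((\<eta>(i := \<eta> i - 1)) i)) * c ((\<eta>(i := \<eta> i - 1))(i := Suc ((\<eta>(i := \<eta> i - 1)) i))) *
         mon N (\<eta>(i := \<eta> i - 1)) z = c \<eta> * R \<eta> * (of_nat (\<eta> i) * z i ^ (\<eta> i - 1))"
        using \<eta> by (simp add: mon_upd[OF i] R_def mult_ac)
    next
      fix \<zeta> assume \<zeta>: "\<zeta> \<in> exps N d"
      then show "\<zeta>(i := Suc (\<zeta> i)) \<in> {\<eta>\<in>exps N (Suc d). \<eta> i \<ge> 1}"
        using exps_upd[OF i] by (auto simp: exps_def)
    qed auto
    finally show ?thesis .
  qed
  then show ?thesis using supp unfolding rep_def by blast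
qed

lemma rep_euler_deriv:
  assumes r: "rep N (Suc d) c f" and i: "i < N"
    and f': "\<And>z. ((\<lambda>t. f (z(i := t))) has_field_derivative f' z) (at (z i))"
  shows "rep N (Suc d) (\<lambda>\<eta>. of_nat (\<eta> i) * c \<eta>) (\<lambda>z. z i * f' z)"
proof -
  have "shift_exp i 1 (\<lambda>\<zeta>. of_nat (Suc (\<zeta> i)) * c (\<zeta>(i := Suc (\<zeta> i)))) = (\<lambda>\<eta>. of_nat (\<eta> i) * c \<eta>)"
    by (rule ext) (auto simp: shift_exp_def)
  then show ?thesis using rep_shift[OF rep_deriv[OF assms] i, of 1] by simp
qed

lemma exists_rep_mp: "\<exists>c. rep N (sum_mset \<mu>) c (mp N \<mu>)"
proof (induction \<mu>)
  case empty
  have "exps N 0 = {\<lambda>_. 0}"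
    by (auto simp: exps_def fun_eq_iff) (metis lessThan_iff not_le)
  then have "rep N 0 (\<lambda>\<eta>. if \<eta> = (\<lambda>_. 0) then 1 else 0) (\<lambda>z. 1)"
    by (auto simp: rep_def mon_def)
  then show ?case by (auto simp: mp_def)
next
  case (add k \<mu>)
  then obtain c where "rep N (sum_mset \<mu>) c (mp N \<mu>)" by blast
  then have "rep N (sum_mset \<mu> + k) (\<lambda>\<eta>. \<Sum>i<N. shift_exp i k c \<eta>) (\<lambda>z. \<Sum>i<N. z i ^ k * mp N \<mu> z)"
    by (intro rep_sum rep_shift) auto
  then show ?case by (auto simp: psum_def sum_distrib_right add.commute)
qed

lemma exists_rep_ev:
  assumes F: "F \<in> hom d" and d: "d \<le> K"
  shows "\<exists>c. rep N d c (ev N K F)"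
proof -
  have "\<forall>\<mu>\<in>partitions_of d. \<exists>c. rep N d c (mp N \<mu>)"
    using exists_rep_mp by (auto simp: partitions_of_def)
  then obtain c where c: "\<And>\<mu>. \<mu> \<in> partitions_of d \<Longrightarrow> rep N d (c \<mu>) (mp N \<mu>)" by metis
  have "ev N K F z = (\<Sum>\<mu>\<in>partitions_of d. F \<mu> * mp N \<mu> z)" for z
    unfolding ev_def using F partitions_of_subset[OF d]
    by (intro sum.mono_neutral_right) (auto simp: supported_def)
  then have "ev N K F = (\<lambda>z. \<Sum>\<mu>\<in>partitions_of d. F \<mu> * mp N \<mu> z)" by (rule ext)
  moreover have "rep N d (\<lambda>\<eta>. \<Sum>\<mu>\<in>partitions_of d. F \<mu> * c \<mu> \<eta>) (\<lambda>z. \<Sum>\<mu>\<in>partitions_of d. F \<mu> * mp N \<mu> z)"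
    by (intro rep_sum rep_scale c)
  ultimately show ?thesis by auto
qed

definition cf :: "nat \<Rightarrow> nat \<Rightarrow> nat \<Rightarrow> (nat multiset \<Rightarrow> complex) \<Rightarrow> (nat \<Rightarrow> nat) \<Rightarrow> complex" where
  "cf N K d F = (SOME c. rep N d c (ev N K F))"

lemma rep_cf: "F \<in> hom d \<Longrightarrow> d \<le> K \<Longrightarrow> rep N d (cf N K d F) (ev N K F)"
  unfolding cf_def by (rule someI_ex[OF exists_rep_ev])

lemma cf_eqI:
  assumes "F \<in> hom d" "d \<le> K" "rep N d c f" "\<And>z. inj_on z {..<N} \<Longrightarrow> ev N K F z = f z"
  shows "cf N K d F = c"
  using rep_unique[OF rep_cf[OF assms(1,2)] assms(3,4)] .

definition swap_at :: "nat \<Rightarrow> nat \<Rightarrow> (nat \<Rightarrow> 'a) \<Rightarrow> nat \<Rightarrow> 'a" where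
  "swap_at i j \<eta> = \<eta>(i := \<eta> j, j := \<eta> i)"

lemma swap_at_swap_at [simp]: "swap_at i j (swap_at i j \<eta>) = \<eta>"
  by (auto simp: swap_at_def fun_eq_iff)

lemma sum_swap_at:
  assumes "i < N" "j < N"
  shows "(\<Sum>k<N. g (swap_at i j u k)) = (\<Sum>k<N. g (u k))"
  by (rule sum.reindex_bij_witness[of _ "\<lambda>k. if k = i then j else if k = j then i else k"
        "\<lambda>k. if k = i then j else if k = j then i else k"])
    (use assms in \<open>auto simp: swap_at_def\<close>)

lemma swap_at_exps: "i < N \<Longrightarrow> j < N \<Longrightarrow> swap_at i j \<eta> \<in> exps N d \<longleftrightarrow> \<eta> \<in> exps N d"
  using sum_swap_at[of i N j "\<lambda>x. x" \<eta>] by (auto simp: exps_def swap_at_def split: if_splits)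

lemma mon_swap_at:
  assumes "i < N" "j < N"
  shows "mon N (swap_at i j \<eta>) z = mon N \<eta> (swap_at i j z)"
proof -
  have "(\<Prod>k<N. z k ^ swap_at i j \<eta> k) = (\<Prod>k<N. swap_at i j z k ^ \<eta> k)"
    by (rule prod.reindex_bij_witness[of _ "\<lambda>k. if k = i then j else if k = j then i else k"
          "\<lambda>k. if k = i then j else if k = j then i else k"])
      (use assms in \<open>auto simp: swap_at_def\<close>)
  then show ?thesis by (simp add: mon_def)
qed

lemma ev_swap_at:
  assumes "i < N" "j < N"
  shows "ev N K F (swap_at i j z) = ev N K F z"
proof -
  have "psum N k (swap_at i j z) = psum N k z" for k
    unfolding psum_def by (rule sum_swap_at[OF assms])
  then show ?thesis by (simp add: ev_def mp_def)
qed

lemma cf_swap_at: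
  assumes F: "F \<in> hom d" "d \<le> K" and ij: "i < N" "j < N"
  shows "cf N K d F (swap_at i j \<eta>) = cf N K d F \<eta>"
proof -
  have "rep N d (\<lambda>\<eta>. cf N K d F (swap_at i j \<eta>)) (ev N K F)"
    unfolding rep_def
  proof (intro conjI allI impI)
    fix \<eta> assume "cf N K d F (swap_at i j \<eta>) \<noteq> 0"
    then show "\<eta> \<in> exps N d" using rep_support[OF rep_cf[OF F]] swap_at_exps[OF ij] by blast
  next
    fix z
    have "ev N K F z = ev N K F (swap_at i j z)" by (simp add: ev_swap_at[OF ij])
    also have "\<dots> = (\<Sum>\<eta>\<in>exps N d. cf N K d F \<eta> * mon N (swap_at i j \<eta>) z)"
      by (simp add: repD[OF rep_cf[OF F]] mon_swap_at[OF ij])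
    also have "\<dots> = (\<Sum>\<eta>\<in>exps N d. cf N K d F (swap_at i j \<eta>) * mon N \<eta> z)"
      by (rule sum.reindex_bij_witness[of _ "swap_at i j" "swap_at i j"])
        (auto simp: swap_at_exps[OF ij])
    finally show "ev N K F z = (\<Sum>\<eta>\<in>exps N d. cf N K d F (swap_at i j \<eta>) * mon N \<eta> z)" .
  qed
  then have "cf N K d F = (\<lambda>\<eta>. cf N K d F (swap_at i j \<eta>))" by (rule cf_eqI[OF F]) simp
  then show ?thesis by metis
qed

subsection \<open>Triangularity of the Laplace--Beltrami operator\<close>

text \<open>The coefficient at z^a w^b of (z + w) / (z - w) times the difference of the Euler fields
  of z and w, when C is symmetric. Dividing z^p w^q - z^q w^p by z - w fills all exponents in
  between, so (a, b) receives a contribution from every wider pair with the same sum.\<close>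

definition qf :: "(nat \<Rightarrow> nat \<Rightarrow> complex) \<Rightarrow> nat \<Rightarrow> nat \<Rightarrow> complex" where
  "qf C a b = of_nat (max a b - min a b) * C a b
     + 2 * (\<Sum>t=1..min a b. of_nat (max a b - min a b + 2 * t) * C (max a b + t) (min a b - t))"

text \<open>Comparison of coefficients in (z - w) Q = (z + w) U, with U the difference of the Euler
  derivatives. Both tails run over the same wider pairs, starting one step apart, and
  cancel.\<close>

lemma qf_identity_less:
  fixes C :: "nat \<Rightarrow> nat \<Rightarrow> complex"
  assumes "b < a"
  shows "(of_nat a - 1 - of_nat b) * C (a - 1) b + (if b \<ge> 1 then (of_nat a - of_nat b + 1) * C a (b - 1) else 0)
    = qf C (a - 1) b - (if b \<ge> 1 then qf C a (b - 1) else 0)"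
proof -
  obtain m where m: "a = b + m + 1" using assms by (metis add.commute add.left_commute less_imp_add_positive Suc_eq_plus1 less_iff_Suc_add)
  show ?thesis
  proof (cases b)
    case 0
    then show ?thesis by (simp add: qf_def m)
  next
    case (Suc b')
    have "(\<Sum>t=1..Suc b'. of_nat (m + 2 * t) * C (b + m + t) (Suc b' - t)) =
       of_nat (m + 2) * C (b + m + 1) b' + (\<Sum>t=1..b'. of_nat (m + 2 + 2 * t) * C (b + m + 1 + t) (b' - t))"
    proof -
      have "(\<Sum>t=1..Suc b'. of_nat (m + 2 * t) * C (b + m + t) (Suc b' - t)) =
        (\<Sum>t=0..b'. of_nat (m + 2 * Suc t) * C (b + m + Suc t) (Suc b' - Suc t))"
        by (rule sum.reindex_bij_witness[of _ Suc "\<lambda>t. t - 1"]) auto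
      also have "\<dots> = of_nat (m + 2) * C (b + m + 1) b' + (\<Sum>t=1..b'. of_nat (m + 2 * Suc t) * C (b + m + Suc t) (Suc b' - Suc t))"
        by (subst sum.atLeast_Suc_atMost) auto
      finally show ?thesis by (simp add: algebra_simps)
    qed
    moreover have "qf C (b + m) b = of_nat m * C (b + m) b
        + 2 * (\<Sum>t=1..b. of_nat (m + 2 * t) * C (b + m + t) (b - t))"
      by (simp add: qf_def)
    ultimately have "qf C (a - 1) b = of_nat m * C (b + m) b + 2 * (of_nat (m + 2) * C (b + m + 1) b'
        + (\<Sum>t=1..b'. of_nat (m + 2 + 2 * t) * C (b + m + 1 + t) (b' - t)))"
      unfolding Suc[symmetric] by (simp add: m)
    moreover have "qf C (b + m + 1) b' = of_nat (m + 2) * C (b + m + 1) b'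
        + 2 * (\<Sum>t=1..b'. of_nat (m + 2 + 2 * t) * C (b + m + 1 + t) (b' - t))"
      by (simp add: qf_def Suc)
    then have "qf C a (b - 1) = of_nat (m + 2) * C (b + m + 1) b'
        + 2 * (\<Sum>t=1..b'. of_nat (m + 2 + 2 * t) * C (b + m + 1 + t) (b' - t))"
      by (simp add: m Suc)
    ultimately show ?thesis by (simp add: m Suc algebra_simps)
  qed
qed

lemma qf_sym: "(\<And>a b. C a b = C b a) \<Longrightarrow> qf C a b = qf C b a"
  by (simp add: qf_def max.commute min.commute)

lemma qf_identity:
  fixes C :: "nat \<Rightarrow> nat \<Rightarrow> complex"
  assumes sym: "\<And>a b. C a b = C b a"
  shows "(if a \<ge> 1 then (of_nat a - 1 - of_nat b) * C (a - 1) b else 0)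
       + (if b \<ge> 1 then (of_nat a - of_nat b + 1) * C a (b - 1) else 0)
    = (if a \<ge> 1 then qf C (a - 1) b else 0) - (if b \<ge> 1 then qf C a (b - 1) else 0)"
proof (cases a b rule: linorder_cases)
  case greater
  then show ?thesis using qf_identity_less[OF greater, of C] by simp
next
  case equal
  then show ?thesis using sym[of "b - 1" b] qf_sym[of C "b - 1" b, OF sym] by simp
next
  case less
  then show ?thesis
    using qf_identity_less[OF less, of C] sym[of "a - 1" b] sym[of a "b - 1"]
      qf_sym[of C "a - 1" b, OF sym] qf_sym[of C a "b - 1", OF sym]
    by (auto simp: algebra_simps)
qed

definition pairco :: "nat \<Rightarrow> nat \<Rightarrow> nat \<Rightarrow> nat \<Rightarrow> ((nat \<Rightarrow> nat) \<Rightarrow> complex) \<Rightarrow> (nat \<Rightarrow> nat) \<Rightarrow> complex" where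
  "pairco N d i j c \<eta> = (if \<eta> \<in> exps N d then qf (\<lambda>a b. c (\<eta>(i := a, j := b))) (\<eta> i) (\<eta> j) else 0)"

text \<open>\<open>DQ\<close> is not expanded directly: the polynomial with coefficients from
  \<open>qf\<close> is compared with it after multiplication by z i - z j, and this factor is
  cancelled at points with distinct coordinates.\<close>

lemma rep_pair:
  assumes F: "F \<in> hom d" "d \<le> K" and ij: "i < N" "j < N" "i \<noteq> j"
    and Di: "rep N d (\<lambda>\<eta>. of_nat (\<eta> i) * cf N K d F \<eta>) (D1 N K i F)"
    and Dj: "rep N d (\<lambda>\<eta>. of_nat (\<eta> j) * cf N K d F \<eta>) (D1 N K j F)"
  shows "\<exists>g. rep N d (pairco N d i j (cf N K d F)) g \<and>
           (\<forall>z. inj_on z {..<N} \<longrightarrow> g z = (z i + z j) * DQ N K i j F z)"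
proof -
  define c where "c = cf N K d F"
  define Q where "Q = pairco N d i j c"
  define g where "g z = (\<Sum>\<eta>\<in>exps N d. Q \<eta> * mon N \<eta> z)" for z
  have g: "rep N d Q g" by (auto simp: rep_def g_def Q_def pairco_def)
  define u where "u \<eta> = of_nat (\<eta> i) * c \<eta> - of_nat (\<eta> j) * c \<eta>" for \<eta>
  define U where "U z = D1 N K i F z - D1 N K j F z" for z
  have u: "rep N d u U"
    using rep_diff[OF Di Dj] by (simp add: u_def[abs_def] U_def[abs_def] c_def)
  have "rep N (d + 1) (\<lambda>\<eta>. shift_exp i 1 u \<eta> + shift_exp j 1 u \<eta>) (\<lambda>z. z i ^ 1 * U z + z j ^ 1 * U z)"
    by (intro rep_add rep_shift u ij)
  moreover have "rep N (d + 1) (\<lambda>\<eta>. shift_exp i 1 Q \<eta> - shift_exp j 1 Q \<eta>) (\<lambda>z. z i ^ 1 * g z - z j ^ 1 * g z)"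
    by (intro rep_diff rep_shift g ij)
  moreover have "shift_exp i 1 u \<zeta> + shift_exp j 1 u \<zeta> = shift_exp i 1 Q \<zeta> - shift_exp j 1 Q \<zeta>" for \<zeta>
  proof (cases "\<zeta> \<in> exps N (d + 1)")
    case True
    define C where "C a b = c (\<zeta>(i := a, j := b))" for a b
    have sym: "C a b = C b a" for a b
    proof -
      have "swap_at i j (\<zeta>(i := a, j := b)) = \<zeta>(i := b, j := a)"
        using ij by (auto simp: swap_at_def fun_eq_iff)
      then show ?thesis using cf_swap_at[OF F ij(1,2), of "\<zeta>(i := a, j := b)"] by (simp add: C_def c_def)
    qed
    have ex: "\<zeta>(k := \<zeta> k - 1) \<in> exps N d" if "k < N" "\<zeta> k \<ge> 1" for k
      using True exps_upd[OF that(1), of \<zeta> "\<zeta> k - 1" d] that by (auto simp: exps_def)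
    have i1: "\<zeta>(i := \<zeta> i - Suc 0, j := \<zeta> j) = \<zeta>(i := \<zeta> i - Suc 0)"
      and j1: "\<zeta>(i := \<zeta> i, j := \<zeta> j - Suc 0) = \<zeta>(j := \<zeta> j - Suc 0)"
      and i2: "\<zeta>(i := \<zeta> i - Suc 0, i := a, j := b) = \<zeta>(i := a, j := b)"
      and j2: "\<zeta>(j := \<zeta> j - Suc 0, i := a, j := b) = \<zeta>(i := a, j := b)" for a b
      using ij by (auto simp: fun_eq_iff)
    have "shift_exp i 1 u \<zeta> = (if \<zeta> i \<ge> 1 then (of_nat (\<zeta> i) - 1 - of_nat (\<zeta> j)) * C (\<zeta> i - 1) (\<zeta> j) else 0)"
      using ij by (auto simp: shift_exp_def u_def C_def i1 of_nat_diff algebra_simps)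
    moreover have "shift_exp j 1 u \<zeta> = (if \<zeta> j \<ge> 1 then (of_nat (\<zeta> i) - of_nat (\<zeta> j) + 1) * C (\<zeta> i) (\<zeta> j - 1) else 0)"
      using ij by (auto simp: shift_exp_def u_def C_def j1 of_nat_diff algebra_simps)
    moreover have "shift_exp i 1 Q \<zeta> = (if \<zeta> i \<ge> 1 then qf C (\<zeta> i - 1) (\<zeta> j) else 0)"
      using ij ex[OF ij(1)] by (auto simp: shift_exp_def Q_def pairco_def C_def[abs_def] i2)
    moreover have "shift_exp j 1 Q \<zeta> = (if \<zeta> j \<ge> 1 then qf C (\<zeta> i) (\<zeta> j - 1) else 0)"
      using ij ex[OF ij(2)] by (auto simp: shift_exp_def Q_def pairco_def C_def[abs_def] j2)
    ultimately show ?thesis using qf_identity[of C "\<zeta> i" "\<zeta> j", OF sym] by simp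
  next
    case False
    then have z: "shift_exp k 1 v \<zeta> = 0" if "rep N d v V" "k < N" for k v V
      using rep_support[OF rep_shift[OF that, of 1]] by blast
    show ?thesis using z[OF u ij(1)] z[OF u ij(2)] z[OF g ij(1)] z[OF g ij(2)] by simp
  qed
  ultimately have eq: "z i ^ 1 * U z + z j ^ 1 * U z = z i ^ 1 * g z - z j ^ 1 * g z" for z
    by (metis (no_types, lifting) repD ext)
  have "g z = (z i + z j) * DQ N K i j F z" if "inj_on z {..<N}" for z
  proof -
    have "z i - z j \<noteq> 0" using that ij by (auto dest: inj_onD)
    have "(z i - z j) * g z = (z i + z j) * U z" using eq[of z] by (simp add: algebra_simps)
    also have "\<dots> = (z i - z j) * ((z i + z j) * DQ N K i j F z)"
      by (simp add: U_def DQ_D1[symmetric])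
    finally show ?thesis using \<open>z i - z j \<noteq> 0\<close> by simp
  qed
  then show ?thesis using g unfolding Q_def c_def by blast
qed

text \<open>The diagonal entry of \<open>lap\<close> at the exponent vector \<eta>. For a partition
  of size d it is twice the sum of \<alpha> * column - row over its boxes, both counted from 0, so
  that N drops out.\<close>

definition h2 :: "nat \<Rightarrow> real \<Rightarrow> nat \<Rightarrow> (nat \<Rightarrow> nat) \<Rightarrow> real" where
  "h2 N \<alpha> d \<eta> = \<alpha> * (\<Sum>i<N. (real (\<eta> i))\<^sup>2)
     + (\<Sum>(i,j)\<in>pairs N. real (max (\<eta> i) (\<eta> j) - min (\<eta> i) (\<eta> j))) - (real N + \<alpha> - 1) * real d"

text \<open>The off-diagonal part. It reads coefficients at vectors in which t units have moved from
  the smaller of two entries to the larger, the larger being placed first; for i < j all of these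
  lie lexicographically beyond \<eta>.\<close>

definition tails :: "nat \<Rightarrow> ((nat \<Rightarrow> nat) \<Rightarrow> complex) \<Rightarrow> (nat \<Rightarrow> nat) \<Rightarrow> nat \<times> nat \<Rightarrow> complex" where
  "tails N c \<eta> = (\<lambda>(i,j). \<Sum>t=1..min (\<eta> i) (\<eta> j). of_nat (max (\<eta> i) (\<eta> j) - min (\<eta> i) (\<eta> j) + 2 * t)
     * c (\<eta>(i := max (\<eta> i) (\<eta> j) + t, j := min (\<eta> i) (\<eta> j) - t)))"

lemma rep_D1:
  assumes F: "F \<in> hom (Suc d)" "Suc d \<le> K" and i: "i < N"
  shows "rep N (Suc d) (\<lambda>\<eta>. of_nat (\<eta> i) * cf N K (Suc d) F \<eta>) (D1 N K i F)"
proof -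
  have Fs: "F \<in> supported (partitions_upto K)" by (rule hom_upto[OF F])
  have "D1 N K i F = (\<lambda>z. z i * (\<Sum>k=1..K. of_nat k * z i ^ (k - 1) * ev N K (dp k F) z))"
    unfolding D1_def fun_eq_iff sum_distrib_left
  proof (intro allI sum.cong refl)
    fix z :: "nat \<Rightarrow> complex" and k assume "k \<in> {1..K}"
    then have "z i ^ k = z i * z i ^ (k - 1)" by (cases k) auto
    then show "of_nat k * z i ^ k * ev N K (dp k F) z = z i * (of_nat k * z i ^ (k - 1) * ev N K (dp k F) z)"
      by (simp add: mult_ac)
  qed
  moreover have "((\<lambda>t. ev N K F (z(i := t))) has_field_derivative
      (\<Sum>k=1..K. of_nat k * z i ^ (k - 1) * ev N K (dp k F) z)) (at (z i))" for z
    using ev_deriv[OF i Fs, of z "z i"] by simp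
  ultimately show ?thesis using rep_euler_deriv[OF rep_cf[OF F] i] by simp
qed

lemma rep_D2:
  assumes F: "F \<in> hom (Suc d)" "Suc d \<le> K" and i: "i < N"
  shows "rep N (Suc d) (\<lambda>\<eta>. of_nat (\<eta> i) * (of_nat (\<eta> i) * cf N K (Suc d) F \<eta>)) (D2 N K i F)"
proof -
  have Fs: "F \<in> supported (partitions_upto K)" by (rule hom_upto[OF F])
  have d: "((\<lambda>t. D1 N K i F (z(i := t))) has_field_derivative (\<Sum>k=1..K. of_nat k * (of_nat k * z i ^ (k - 1) * ev N K (dp k F) z
       + z i ^ k * (\<Sum>l=1..K. of_nat l * z i ^ (l - 1) * ev N K (dp l (dp k F)) z)))) (at (z i))" for z
    using D1_D2_deriv[OF i Fs, of z "z i"] by simp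
  show ?thesis
    unfolding D2_alt[abs_def] by (rule rep_euler_deriv[OF rep_D1[OF F i] i d])
qed

lemma cf_lap:
  assumes F: "F \<in> hom (Suc d)" "Suc d \<le> K" and \<eta>: "\<eta> \<in> exps N (Suc d)"
  shows "cf N K (Suc d) (lap \<alpha> K F) \<eta> = of_real (h2 N \<alpha> (Suc d) \<eta>) * cf N K (Suc d) F \<eta>
           + 2 * (\<Sum>p\<in>pairs N. tails N (cf N K (Suc d) F) \<eta> p)"
proof -
  define c where "c = cf N K (Suc d) F"
  define G where "G i j = (SOME g. rep N (Suc d) (pairco N (Suc d) i j c) g \<and>
       (\<forall>z. inj_on z {..<N} \<longrightarrow> g z = (z i + z j) * DQ N K i j F z))" for i j
  have G: "rep N (Suc d) (pairco N (Suc d) i j c) (G i j)"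
    "\<And>z. inj_on z {..<N} \<Longrightarrow> G i j z = (z i + z j) * DQ N K i j F z" if "(i, j) \<in> pairs N" for i j
    using someI_ex[OF rep_pair[OF F, of i N j]] rep_D1[OF F] that
    by (auto simp: G_def pairs_def c_def)
  define f where "f z = of_real \<alpha> * (\<Sum>i<N. D2 N K i F z) + (\<Sum>p\<in>pairs N. G (fst p) (snd p) z)
      - of_real (real N + \<alpha> - 1) * of_nat (Suc d) * ev N K F z" for z
  define c' where "c' \<eta> = of_real \<alpha> * (\<Sum>i<N. of_nat (\<eta> i) * (of_nat (\<eta> i) * c \<eta>))
      + (\<Sum>p\<in>pairs N. pairco N (Suc d) (fst p) (snd p) c \<eta>)
      - of_real (real N + \<alpha> - 1) * of_nat (Suc d) * c \<eta>" for \<eta>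
  have "rep N (Suc d) c' f"
    unfolding c'_def f_def c_def
    by (intro rep_diff rep_add rep_scale rep_sum rep_D2 F rep_cf G[unfolded c_def]) auto
  moreover have "ev N K (lap \<alpha> K F) z = f z" if "inj_on z {..<N}" for z
    unfolding ev_lap[OF F] f_def using G(2)[OF _ that]
    by (auto intro!: sum.cong simp: case_prod_beta)
  ultimately have "cf N K (Suc d) (lap \<alpha> K F) = c'"
    by (intro cf_eqI lap_hom F)
  then have "cf N K (Suc d) (lap \<alpha> K F) \<eta> = c' \<eta>" by simp
  also have "(\<Sum>p\<in>pairs N. pairco N (Suc d) (fst p) (snd p) c \<eta>) =
     of_real (\<Sum>(i,j)\<in>pairs N. real (max (\<eta> i) (\<eta> j) - min (\<eta> i) (\<eta> j))) * c \<eta>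
     + 2 * (\<Sum>p\<in>pairs N. tails N c \<eta> p)"
    unfolding of_real_sum sum_distrib_left sum_distrib_right sum.distrib[symmetric]
    by (intro sum.cong refl) (use \<eta> in \<open>auto simp: pairco_def qf_def tails_def\<close>)
  then have "c' \<eta> = of_real (h2 N \<alpha> (Suc d) \<eta>) * c \<eta> + 2 * (\<Sum>p\<in>pairs N. tails N c \<eta> p)"
    by (simp add: c'_def h2_def algebra_simps sum_distrib_left power2_eq_square)
  finally show ?thesis by (simp add: c_def)
qed

lemma cf_add:
  assumes "F \<in> hom d" "G \<in> hom d" "d \<le> K"
  shows "cf N K d (F + G) = (\<lambda>\<eta>. cf N K d F \<eta> + cf N K d G \<eta>)"
  by (rule cf_eqI[OF supported_add[OF assms(1,2)] assms(3) rep_add[OF rep_cf rep_cf]])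
    (simp_all add: assms ev_add)

lemma cf_scale:
  assumes "F \<in> hom d" "d \<le> K"
  shows "cf N K d (cscale a F) = (\<lambda>\<eta>. a * cf N K d F \<eta>)"
  by (rule cf_eqI[OF supported_cscale[OF assms(1)] assms(2) rep_scale[OF rep_cf]])
    (simp_all add: assms ev_scale)

lemma cf_0: "d \<le> K \<Longrightarrow> cf N K d 0 = (\<lambda>\<eta>. 0)"
  by (rule cf_eqI[OF supported_0 _ rep_0]) (simp_all add: ev_0)

lemma cf_lap':
  assumes F: "F \<in> hom d" "d \<le> K" and \<eta>: "\<eta> \<in> exps N d"
  shows "cf N K d (lap \<alpha> K F) \<eta> = of_real (h2 N \<alpha> d \<eta>) * cf N K d F \<eta>
           + 2 * (\<Sum>p\<in>pairs N. tails N (cf N K d F) \<eta> p)"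
proof (cases d)
  case 0
  have "dp k F = 0" if "k > 0" for k
    using that F dp_eq_0[of F 0 k] hom_upto[of F 0 0] 0 by simp
  then have "(\<Sum>k=1..K. \<Sum>l=1..K. cscale (of_real \<alpha> * of_nat k * of_nat l) (pm (k + l) (dp k (dp l F)))
                         + cscale (of_nat (k + l)) (pm k (pm l (dp (k + l) F)))) = 0"
    and "(\<Sum>k=1..K. cscale (of_real (\<alpha> - 1) * of_nat k * (of_nat k - 1)) (pm k (dp k F))) = 0"
    by (auto intro!: sum.neutral simp: pm_simps dp_simps)
  then have "lap \<alpha> K F = 0" unfolding lap_def by simp
  moreover have "\<eta> i = 0" for i using exps_le[OF \<eta>, of i] 0 by simp
  ultimately show ?thesis
    by (simp add: cf_0 F h2_def tails_def case_prod_beta 0)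
next
  case (Suc d')
  then show ?thesis using cf_lap[of F d' K \<eta> N \<alpha>] F \<eta> by simp
qed

lemma less_fun_upd: "i < j \<Longrightarrow> \<eta> i < a \<Longrightarrow> less_fun \<eta> (\<eta>(i := a, j := b))"
  by (rule less_funI) (auto intro!: exI[of _ i])

text \<open>Triangularity: \<open>tails\<close> reads lexicographically larger exponents only, where
  the coefficients vanish by assumption.\<close>

lemma lap_leading:
  assumes F: "F \<in> hom d" "d \<le> K" and van: "\<And>\<eta>. less_fun \<nu> \<eta> \<Longrightarrow> cf N K d F \<eta> = 0"
  shows "cf N K d (lap \<alpha> K F) \<nu> = of_real (h2 N \<alpha> d \<nu>) * cf N K d F \<nu>"
    and "less_fun \<nu> \<eta> \<Longrightarrow> cf N K d (lap \<alpha> K F) \<eta> = 0"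
proof -
  have t: "tails N (cf N K d F) \<zeta> p = 0" if "p \<in> pairs N" "\<zeta> = \<nu> \<or> less_fun \<nu> \<zeta>" for p \<zeta>
  proof -
    obtain i j where p: "p = (i, j)" "i < j" using \<open>p \<in> pairs N\<close> by (auto simp: pairs_def)
    have "cf N K d F (\<zeta>(i := max (\<zeta> i) (\<zeta> j) + t, j := min (\<zeta> i) (\<zeta> j) - t)) = 0" if "t \<ge> 1" for t
    proof -
      have "less_fun \<zeta> (\<zeta>(i := max (\<zeta> i) (\<zeta> j) + t, j := min (\<zeta> i) (\<zeta> j) - t))"
        using that by (intro less_fun_upd p(2)) auto
      then show ?thesis using \<open>\<zeta> = \<nu> \<or> less_fun \<nu> \<zeta>\<close> less_fun_trans van by blast
    qed
    then show ?thesis by (simp add: tails_def p)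
  qed
  have out: "cf N K d G \<zeta> = 0" if "\<zeta> \<notin> exps N d" "G \<in> hom d" for G \<zeta>
    using rep_support[OF rep_cf[OF that(2) F(2)]] that(1) by blast
  show "cf N K d (lap \<alpha> K F) \<nu> = of_real (h2 N \<alpha> d \<nu>) * cf N K d F \<nu>"
    using cf_lap'[OF F, of \<nu> N \<alpha>] t out[of \<nu>] lap_hom[OF F(1)] F(1) by (cases "\<nu> \<in> exps N d") auto
  show "cf N K d (lap \<alpha> K F) \<eta> = 0" if "less_fun \<nu> \<eta>"
    using cf_lap'[OF F, of \<eta> N \<alpha>] t out[of \<eta>] lap_hom[OF F(1)] van that by (cases "\<eta> \<in> exps N d") auto
qed

text \<open>On the leading coefficient a polynomial in \<open>lap\<close> becomes its value at the
  diagonal entry. \<open>removable_content\<close> uses this to find a root of every annihilating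
  polynomial.\<close>

lemma lap_poly_leading:
  assumes F: "F \<in> hom d" "d \<le> K" and van: "\<And>\<eta>. less_fun \<nu> \<eta> \<Longrightarrow> cf N K d F \<eta> = 0"
  shows "cf N K d (op_poly (lap \<alpha> K) P F) \<nu> = poly P (of_real (h2 N \<alpha> d \<nu>)) * cf N K d F \<nu> \<and>
         (\<forall>\<eta>. less_fun \<nu> \<eta> \<longrightarrow> cf N K d (op_poly (lap \<alpha> K) P F) \<eta> = 0)"
proof (induction P)
  case 0
  then show ?case by (simp add: cf_0 F)
next
  case (pCons a P)
  define G where "G = op_poly (lap \<alpha> K) P F"
  have G: "G \<in> hom d" unfolding G_def by (rule op_poly_supported) (use F lap_hom in auto)
  have van': "cf N K d G \<eta> = 0" if "less_fun \<nu> \<eta>" for \<eta> using pCons that by (simp add: G_def)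
  have "cf N K d (op_poly (lap \<alpha> K) (pCons a P) F) = (\<lambda>\<eta>. a * cf N K d F \<eta> + cf N K d (lap \<alpha> K G) \<eta>)"
    by (simp add: op_poly_pCons[OF lap_linear] G_def[symmetric] cf_add cf_scale F G lap_hom supported_cscale)
  then show ?case
    using lap_leading[OF G F(2) van'] pCons van by (simp add: G_def[symmetric] algebra_simps)
qed

lemma exists_lex_max:
  fixes A :: "(nat \<Rightarrow> nat) set"
  assumes "finite A" "A \<noteq> {}"
  shows "\<exists>m\<in>A. \<forall>\<eta>\<in>A. \<not> less_fun m \<eta>"
  using assms
proof (induction A rule: finite_ne_induct)
  case (singleton x)
  then show ?case by (simp add: less_fun_irrefl)
next
  case (insert x A)
  then obtain m where m: "m \<in> A" "\<forall>\<eta>\<in>A. \<not> less_fun m \<eta>" by blast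
  show ?case
  proof (cases "less_fun m x")
    case True
    then have "\<not> less_fun x \<eta>" if "\<eta> \<in> insert x A" for \<eta>
      using m that less_fun_trans less_fun_irrefl by blast
    then show ?thesis by blast
  next
    case False
    then show ?thesis using m by blast
  qed
qed

lemma sum_pairs_sorted:
  fixes x :: "nat \<Rightarrow> real"
  shows "(\<Sum>(i,j)\<in>pairs N. x i - x j) = (\<Sum>i<N. (real N - 1 - 2 * real i) * x i)"
proof (induction N)
  case 0
  then show ?case by (simp add: pairs_def)
next
  case (Suc N)
  have "(\<Sum>i<N. (real N - 1 - 2 * real i) * x i) + (\<Sum>i<N. x i) = (\<Sum>i<N. (real N - 2 * real i) * x i)"
    by (simp add: sum.distrib[symmetric] algebra_simps)
  then show ?case using Suc by (simp add: sum_pairs_Suc sum_subtractf algebra_simps)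
qed

lemma h2_sorted:
  assumes "\<And>i j. i < j \<Longrightarrow> j < N \<Longrightarrow> \<eta> j \<le> \<eta> i"
  shows "h2 N \<alpha> d \<eta> = (\<Sum>i<N. \<alpha> * (real (\<eta> i))\<^sup>2 + (real N - 1 - 2 * real i) * real (\<eta> i))
           - (real N + \<alpha> - 1) * real d"
proof -
  have "(\<Sum>(i,j)\<in>pairs N. real (max (\<eta> i) (\<eta> j) - min (\<eta> i) (\<eta> j))) =
      (\<Sum>(i,j)\<in>pairs N. real (\<eta> i) - real (\<eta> j))"
    using assms by (intro sum.cong refl) (auto simp: pairs_def assms of_nat_diff max_absorb1 min_absorb2)
  then show ?thesis by (simp add: h2_def sum_pairs_sorted sum.distrib sum_distrib_left)
qed

lemma cf_low:
  assumes F: "F \<in> hom (Suc d)" "Suc d \<le> K"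
  shows "cf N K d (low (of_nat N) K F) =
     (\<lambda>\<zeta>. \<Sum>i<N. of_nat (Suc (\<zeta> i)) * cf N K (Suc d) F (\<zeta>(i := Suc (\<zeta> i))))"
proof (rule cf_eqI)
  have Fs: "F \<in> supported (partitions_upto K)" by (rule hom_upto[OF F])
  show "low (of_nat N) K F \<in> hom d" by (rule low_hom[OF F(1)])
  show "d \<le> K" using F by simp
  show "rep N d (\<lambda>\<zeta>. \<Sum>i<N. of_nat (Suc (\<zeta> i)) * cf N K (Suc d) F (\<zeta>(i := Suc (\<zeta> i))))
     (\<lambda>z. \<Sum>i<N. \<Sum>k=1..K. of_nat k * z i ^ (k - 1) * ev N K (dp k F) z)"
  proof (intro rep_sum rep_deriv[OF rep_cf[OF F]])
    fix i z assume "i \<in> {..<N}"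
    then show "((\<lambda>t. ev N K F (z(i := t))) has_field_derivative
      (\<Sum>k=1..K. of_nat k * z i ^ (k - 1) * ev N K (dp k F) z)) (at (z i))"
      using ev_deriv[OF _ Fs, of i N z "z i"] by simp
  qed auto
qed (rule ev_low[OF hom_upto[OF F]])

text \<open>The content \<open>\<alpha> m - q\<close> of the last box of the leading partition of \<open>F\<close> is a difference of
  eigenvalues which survives in \<open>dp 1 F\<close>. Removing that box yields the leading partition of \<open>low F\<close>:
  besides \<open>F\<close>'s leading coefficient only the neighbouring coefficient \<open>x\<close> contributes, and
  the eigenvalue equation determines \<open>x\<close> and its sign.\<close>

lemma removable_content:
  assumes \<alpha>: "\<alpha> > 0" and F: "F \<in> hom (Suc d)" "Suc d \<le> K"
    and eig: "lap \<alpha> K F = cscale (2 * \<epsilon>) F" and nz: "ev N K F z0 \<noteq> 0"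
  shows "\<exists>m q. q < N \<and> q \<le> d \<and> (\<forall>P. op_poly (lap \<alpha> K) P (dp 1 F) = 0 \<longrightarrow>
           poly P (2 * \<epsilon> - 2 * of_real (\<alpha> * real m - real q)) = 0)"
proof -
  define c where "c = cf N K (Suc d) F"
  have rc: "rep N (Suc d) c (ev N K F)" unfolding c_def by (rule rep_cf[OF F])
  have "\<exists>\<eta>\<in>exps N (Suc d). c \<eta> \<noteq> 0"
  proof (rule ccontr)
    assume "\<not> ?thesis"
    then have "ev N K F z0 = 0" using repD[OF rc, of z0] by simp
    then show False using nz by simp
  qed
  then obtain l where l: "l \<in> exps N (Suc d)" "c l \<noteq> 0"
    and max: "\<And>\<eta>. \<eta> \<in> exps N (Suc d) \<Longrightarrow> c \<eta> \<noteq> 0 \<Longrightarrow> \<not> less_fun l \<eta>"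
    using exists_lex_max[of "{\<eta> \<in> exps N (Suc d). c \<eta> \<noteq> 0}"] by auto
  have van: "c \<eta> = 0" if "less_fun l \<eta>" for \<eta>
    using max that rep_support[OF rc] by blast
  have sym: "c (swap_at i j \<eta>) = c \<eta>" if "i < N" "j < N" for i j \<eta>
    unfolding c_def by (rule cf_swap_at[OF F that])
  \<comment> \<open>The coefficients are symmetric, so swapping two entries in the wrong order would
    give a nonzero coefficient beyond the maximum. Hence the leading exponent is a
    partition.\<close>
  have sorted: "l j \<le> l i" if "i < j" "j < N" for i j
  proof (rule ccontr)
    assume "\<not> l j \<le> l i"
    then have "less_fun l (swap_at i j l)"
      unfolding swap_at_def using that by (intro less_fun_upd) auto
    then show False using van sym[of i j l] that l by simp
  qed
  have l0: "l i = 0" if "i \<ge> N" for i using l that by (simp add: exps_def)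
  have "\<exists>i<N. l i > 0"
  proof (rule ccontr)
    assume "\<not> ?thesis"
    then have "(\<Sum>i<N. l i) = 0" by simp
    then show False using l by (simp add: exps_def)
  qed
  define q where "q = Max {i. i < N \<and> l i > 0}"
  have q: "q < N" "l q > 0" and qmax: "\<And>i. i > q \<Longrightarrow> l i = 0"
  proof -
    have "q \<in> {i. i < N \<and> l i > 0}"
      unfolding q_def by (rule Max_in) (use \<open>\<exists>i<N. l i > 0\<close> in auto)
    then show "q < N" "l q > 0" by auto
    show "l i = 0" if "i > q" for i
    proof (rule ccontr)
      assume "l i \<noteq> 0"
      moreover from this have "i < N" using l0[of i] by (cases "i < N") auto
      ultimately have "i \<le> q" unfolding q_def by (intro Max_ge) auto
      then show False using that by simp
    qed
  qed
  have suml: "(\<Sum>i<N. l i) = Suc d" using l by (simp add: exps_def)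
  \<comment> \<open>Each of the rows 0 to q contains a box: q + 1 boxes out of d + 1.\<close>
  have "q \<le> d"
  proof -
    have "l i \<ge> 1" if "i \<le> q" for i using sorted[of i q] q that by (cases "i = q") auto
    then have "(\<Sum>i\<in>{..q}. 1) \<le> (\<Sum>i\<in>{..q}. l i)" by (intro sum_mono) auto
    also have "\<dots> \<le> (\<Sum>i<N. l i)" using q by (intro sum_mono2) auto
    finally show ?thesis using suml by simp
  qed
  define \<nu> where "\<nu> = l(q := l q - 1)"
  have \<nu>q: "\<nu> q = l q - 1" "\<And>i. i \<noteq> q \<Longrightarrow> \<nu> i = l i" by (auto simp: \<nu>_def)
  have hl: "of_real (h2 N \<alpha> (Suc d) l) * c l = 2 * \<epsilon> * c l"
  proof -
    have "cf N K (Suc d) (lap \<alpha> K F) l = of_real (h2 N \<alpha> (Suc d) l) * c l"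
      unfolding c_def by (rule lap_leading(1)[OF F]) (use van in \<open>simp add: c_def\<close>)
    moreover have "cf N K (Suc d) (lap \<alpha> K F) l = 2 * \<epsilon> * c l"
      unfolding eig by (simp add: cf_scale[OF F] c_def)
    ultimately show ?thesis by metis
  qed
  then have eps: "2 * \<epsilon> = of_real (h2 N \<alpha> (Suc d) l)" using l by simp
  have \<nu>sorted: "\<nu> j \<le> \<nu> i" if "i < j" "j < N" for i j
    using sorted[OF that] qmax[of j] that by (auto simp: \<nu>_def)
  have hs_l: "h2 N \<alpha> e l = (\<Sum>i<N. \<alpha> * (real (l i))\<^sup>2 + (real N - 1 - 2 * real i) * real (l i))
           - (real N + \<alpha> - 1) * real e" for e
    by (rule h2_sorted) (rule sorted)
  have hs_\<nu>: "h2 N \<alpha> e \<nu> = (\<Sum>i<N. \<alpha> * (real (\<nu> i))\<^sup>2 + (real N - 1 - 2 * real i) * real (\<nu> i))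
           - (real N + \<alpha> - 1) * real e" for e
    by (rule h2_sorted) (rule \<nu>sorted)
  have Ssplit: "(\<Sum>i<N. g i (\<eta> i)) = g q (\<eta> q) + (\<Sum>i\<in>{..<N}-{q}. g i (\<eta> i))"
    for g :: "nat \<Rightarrow> nat \<Rightarrow> real" and \<eta>
    using q by (simp add: sum.remove[of "{..<N}" q])
  \<comment> \<open>The drop of the diagonal entry is twice the content of the removed box, which
    sits in row q and column l q - 1.\<close>
  have h\<nu>: "h2 N \<alpha> (Suc d) l - h2 N \<alpha> d \<nu> = 2 * (\<alpha> * real (l q - 1) - real q)"
  proof -
    define g where "g i a = \<alpha> * (real a)\<^sup>2 + (real N - 1 - 2 * real i) * real a" for i a :: nat
    have "(\<Sum>i\<in>{..<N}-{q}. g i (\<nu> i)) = (\<Sum>i\<in>{..<N}-{q}. g i (l i))"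
      by (intro sum.cong) (auto simp: \<nu>_def)
    then have "(\<Sum>i<N. g i (l i)) - (\<Sum>i<N. g i (\<nu> i)) = g q (l q) - g q (l q - 1)"
      using Ssplit[of g l] Ssplit[of g \<nu>] by (simp add: \<nu>q)
    moreover have "g q (l q) - g q (l q - 1) = \<alpha> * (2 * real (l q) - 1) + (real N - 1 - 2 * real q)"
      using q by (simp add: g_def of_nat_diff power2_eq_square algebra_simps)
    ultimately show ?thesis
      unfolding hs_l hs_\<nu> g_def[symmetric]
      using q(2) by (simp add: of_nat_diff algebra_simps)
  qed
  \<comment> \<open>The value forced by the eigenvalue equation at \<mu> below on the coefficient
    with the last box moved to a new row; the denominator is half the difference of the two diagonal
    entries. For l q = 1 it reduces to \<open>c l\<close>.\<close>
  define x where "x = of_nat (l q) * c l / of_real (\<alpha> * real (l q - 1) + 1)"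
  have pos: "\<alpha> * real (l q - 1) + 1 > 0" using \<alpha> by (simp add: add_nonneg_pos)
  have cx: "c (\<nu>(r := Suc (\<nu> r))) = x" if r: "q < r" "r < N" for r
  proof (cases "l q = 1")
    case True
    have "\<nu>(r := Suc (\<nu> r)) = swap_at q r l"
      using True r qmax[of r] by (auto simp: \<nu>_def swap_at_def fun_eq_iff)
    then show ?thesis using sym[of q r l] q r True by (simp add: x_def)
  next
    case False
    then have l2: "l q \<ge> 2" using q by simp
    define s where "s = Suc q"
    have s: "s < N" using r by (simp add: s_def)
    \<comment> \<open>By symmetry every empty row r can be exchanged with the first empty one, s = q
      + 1.\<close>
    define \<mu> where "\<mu> = \<nu>(s := 1)"
    have \<mu>: "\<mu> q = l q - 1" "\<mu> s = 1" "\<And>i. i < q \<Longrightarrow> \<mu> i = l i" "\<And>i. i > s \<Longrightarrow> \<mu> i = 0"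
      using qmax by (auto simp: \<mu>_def \<nu>_def s_def)
    have "\<nu>(r := Suc (\<nu> r)) = swap_at s r \<mu>"
      using r qmax[of r] qmax[of s] by (auto simp: \<mu>_def \<nu>_def swap_at_def fun_eq_iff s_def)
    then have cr: "c (\<nu>(r := Suc (\<nu> r))) = c \<mu>" using sym[of s r \<mu>] s r by simp
    have \<mu>sorted: "\<mu> j \<le> \<mu> i" if ij: "i < j" "j < N" for i j
    proof -
      consider "j > s" | "j = s" "i = q" | "j = s" "i < q" | "j \<le> q"
        using ij s_def by linarith
      then show ?thesis
      proof cases
        case 3
        then have "l q \<le> l i" using sorted[of i q] q by simp
        then show ?thesis using 3 \<mu> l2 by simp
      next
        case 4
        then show ?thesis using sorted[of i j] \<mu> ij by (cases "j = q") auto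
      qed (use \<mu> l2 in auto)
    qed
    have sum\<mu>: "(\<Sum>i<N. \<mu> i) = Suc d"
    proof -
      have "(\<Sum>i<N. \<nu> i) + l q = (\<Sum>i<N. l i) + (l q - 1)"
        unfolding \<nu>_def by (rule sum_upd[OF q(1)])
      moreover have "(\<Sum>i<N. \<mu> i) + \<nu> s = (\<Sum>i<N. \<nu> i) + 1"
        unfolding \<mu>_def by (rule sum_upd[OF s])
      moreover have "\<nu> s = 0" using qmax[of s] by (simp add: \<nu>_def s_def)
      ultimately show ?thesis using suml l2 by simp
    qed
    have \<mu>e: "\<mu> \<in> exps N (Suc d)"
      using sum\<mu> \<mu>(4) s by (auto simp: exps_def)
    \<comment> \<open>Only moving the box back from row s to row q returns to \<open>l\<close>.
      Pairs starting above row q lead beyond \<open>l\<close>, and pairs reaching below row s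
      contain an entry 0 and give an empty sum.\<close>
    have tails: "(\<Sum>p\<in>pairs N. tails N c \<mu> p) = of_nat (l q) * c l"
    proof -
      have "tails N c \<mu> p = (if p = (q, s) then of_nat (l q) * c l else 0)" if p: "p \<in> pairs N" for p
      proof -
        obtain i j where ij: "p = (i, j)" "i < j" "j < N" using p by (auto simp: pairs_def)
        have lq: "\<mu>(q := l q, s := 0) = l"
          using qmax[of s] by (auto simp: \<mu>_def \<nu>_def s_def fun_eq_iff)
        consider "i < q" | "i = q" "j = s" | "i \<ge> q" "j > s"
          using ij s_def by linarith
        then show ?thesis
        proof cases
          case 1
          have "c (\<mu>(i := max (\<mu> i) (\<mu> j) + t, j := min (\<mu> i) (\<mu> j) - t)) = 0" if "t \<ge> 1" for t
          proof (rule van, rule less_funI, intro exI[of _ i] conjI allI impI)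
            show "l i < (\<mu>(i := max (\<mu> i) (\<mu> j) + t, j := min (\<mu> i) (\<mu> j) - t)) i"
              using 1 that ij \<mu>(3)[of i] by auto
            show "l k = (\<mu>(i := max (\<mu> i) (\<mu> j) + t, j := min (\<mu> i) (\<mu> j) - t)) k" if "k < i" for k
              using that 1 ij \<mu>(3)[of k] by auto
          qed
          then show ?thesis using 1 by (simp add: tails_def ij)
        next
          case 2
          have "max (l q - 1) 1 = l q - 1" "min (l q - 1) 1 = 1" using l2 by auto
          then show ?thesis
            using 2 l2 lq by (simp add: tails_def ij \<mu> numeral_2_eq_2[symmetric])
        next
          case 3
          then show ?thesis using \<mu>(4)[of j] by (auto simp: tails_def ij)
        qed
      qed
      then have "(\<Sum>p\<in>pairs N. tails N c \<mu> p) = (\<Sum>p\<in>pairs N. if p = (q, s) then of_nat (l q) * c l else 0)"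
        by (rule sum.cong[OF refl])
      also have "\<dots> = of_nat (l q) * c l"
      proof -
        have "(q, s) \<in> pairs N" using s by (simp add: pairs_def s_def)
        then show ?thesis by simp
      qed
      finally show ?thesis .
    qed
    have hs_\<mu>: "h2 N \<alpha> e \<mu> = (\<Sum>i<N. \<alpha> * (real (\<mu> i))\<^sup>2 + (real N - 1 - 2 * real i) * real (\<mu> i))
           - (real N + \<alpha> - 1) * real e" for e
    by (rule h2_sorted) (rule \<mu>sorted)
    \<comment> \<open>The contents \<alpha> * (l q - 1) - q and - (q + 1) of the old and the new
      position of the box differ by \<alpha> * (l q - 1) + 1.\<close>
    have h\<mu>: "h2 N \<alpha> (Suc d) l - h2 N \<alpha> (Suc d) \<mu> = 2 * (\<alpha> * real (l q - 1) + 1)"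
    proof -
      define g where "g i a = \<alpha> * (real a)\<^sup>2 + (real N - 1 - 2 * real i) * real a" for i a :: nat
      have S2: "(\<Sum>i<N. g i (\<eta> i)) = g q (\<eta> q) + g s (\<eta> s) + (\<Sum>i\<in>{..<N}-{q}-{s}. g i (\<eta> i))" for \<eta>
        using Ssplit[of g \<eta>] s by (simp add: sum.remove[of "{..<N}-{q}" s] s_def)
      have "(\<Sum>i\<in>{..<N}-{q}-{s}. g i (\<mu> i)) = (\<Sum>i\<in>{..<N}-{q}-{s}. g i (l i))"
        by (intro sum.cong) (auto simp: \<mu>_def \<nu>_def)
      moreover have "l s = 0" using qmax[of s] by (simp add: s_def)
      ultimately have "(\<Sum>i<N. g i (l i)) - (\<Sum>i<N. g i (\<mu> i)) = g q (l q) - g q (l q - 1) - g s 1"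
      proof -
        assume "(\<Sum>i\<in>{..<N}-{q}-{s}. g i (\<mu> i)) = (\<Sum>i\<in>{..<N}-{q}-{s}. g i (l i))" "l s = 0"
        then show ?thesis using S2[of l] S2[of \<mu>] by (simp add: \<mu> g_def)
      qed
      moreover have "g q (l q) - g q (l q - 1) - g s 1 = 2 * (\<alpha> * real (l q - 1) + 1)"
        using q by (simp add: g_def of_nat_diff power2_eq_square algebra_simps s_def)
      ultimately show ?thesis
        unfolding hs_l hs_\<mu> g_def[symmetric]
        by simp
    qed
    have "2 * \<epsilon> * c \<mu> = of_real (h2 N \<alpha> (Suc d) \<mu>) * c \<mu> + 2 * (of_nat (l q) * c l)"
      using cf_lap[OF F \<mu>e, of \<alpha>] tails unfolding eig by (simp add: cf_scale[OF F] c_def[symmetric])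
    then have "of_real (h2 N \<alpha> (Suc d) l - h2 N \<alpha> (Suc d) \<mu>) * c \<mu> = 2 * (of_nat (l q) * c l)"
      unfolding eps by (simp add: algebra_simps)
    then have "complex_of_real (\<alpha> * real (l q - 1) + 1) * c \<mu> = of_nat (l q) * c l"
      unfolding h\<mu> of_real_mult[of 2] of_real_numeral mult.assoc by (subst (asm) mult_left_cancel) simp_all
    moreover have "complex_of_real (\<alpha> * real (l q - 1) + 1) \<noteq> 0" using pos by (simp only: of_real_eq_0_iff)
    ultimately have "c \<mu> = x" unfolding x_def by (subst nonzero_eq_divide_eq) (simp_all only: mult.commute not_False_eq_True)
    then show ?thesis using cr by simp
  qed
  define w where "w = low (of_nat N) K F"
  have w: "w \<in> hom d" unfolding w_def by (rule low_hom[OF F(1)])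
  define cw where "cw = cf N K d w"
  have cw: "cw \<zeta> = (\<Sum>i<N. of_nat (Suc (\<zeta> i)) * c (\<zeta>(i := Suc (\<zeta> i))))" for \<zeta>
    by (simp add: cw_def w_def cf_low[OF F] c_def)
  have low_zero: "c (\<nu>(i := Suc (\<nu> i))) = 0" if "i < q" for i
    by (rule van, rule less_funI, rule exI[of _ i]) (use that in \<open>auto simp: \<nu>_def\<close>)
  have "cw \<nu> = of_nat (l q) * c l + of_nat (N - Suc q) * x"
  proof -
    have "{..<N} = {..<q} \<union> {q} \<union> {q<..<N}" using q by auto
    then have "cw \<nu> = (\<Sum>i\<in>{..<q} \<union> {q} \<union> {q<..<N}. of_nat (Suc (\<nu> i)) * c (\<nu>(i := Suc (\<nu> i))))"
      by (simp add: cw)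
    also have "\<dots> = of_nat (Suc (\<nu> q)) * c (\<nu>(q := Suc (\<nu> q)))
       + (\<Sum>i\<in>{q<..<N}. of_nat (Suc (\<nu> i)) * c (\<nu>(i := Suc (\<nu> i))))"
      by (subst sum.union_disjoint; (subst sum.union_disjoint)?) (auto simp: low_zero)
    also have "(\<Sum>i\<in>{q<..<N}. of_nat (Suc (\<nu> i)) * c (\<nu>(i := Suc (\<nu> i)))) = (\<Sum>i\<in>{q<..<N}. x)"
    proof (intro sum.cong refl)
      fix i assume i: "i \<in> {q<..<N}"
      then have "\<nu> i = 0" using qmax[of i] \<nu>q(2)[of i] by simp
      moreover have "c (\<nu>(i := Suc (\<nu> i))) = x" using i by (intro cx) auto
      ultimately show "of_nat (Suc (\<nu> i)) * c (\<nu>(i := Suc (\<nu> i))) = x" by simp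
    qed
    also have "\<nu>(q := Suc (\<nu> q)) = l" using q by (auto simp: \<nu>_def)
    also have "of_nat (Suc (\<nu> q)) = of_nat (l q)" using q by (simp add: \<nu>q)
    finally show ?thesis by simp
  qed
  also have "\<dots> = c l * of_real (real (l q) * (1 + real (N - Suc q) / (\<alpha> * real (l q - 1) + 1)))"
  proof -
    define r where "r = \<alpha> * real (l q - 1) + 1"
    show ?thesis unfolding x_def r_def[symmetric] by (simp add: distrib_left mult_ac)
  qed
  finally have cwE: "cw \<nu> = c l * of_real (real (l q) * (1 + real (N - Suc q) / (\<alpha> * real (l q - 1) + 1)))" .
  have "real (l q) * (1 + real (N - Suc q) / (\<alpha> * real (l q - 1) + 1)) > 0"
    by (intro mult_pos_pos add_pos_nonneg divide_nonneg_pos pos) (use q in auto)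
  then have cw_nz: "cw \<nu> \<noteq> 0"
    using l unfolding cwE by (metis less_irrefl mult_eq_0_iff of_real_eq_0_iff)
  have cw_van: "cw \<eta> = 0" if less: "less_fun \<nu> \<eta>" for \<eta>
  proof (rule ccontr)
    assume nz: "cw \<eta> \<noteq> 0"
    then have "\<eta> \<in> exps N d" using rep_support[OF rep_cf[OF w]] F(2) unfolding cw_def by (metis Suc_leD)
    then have sum\<eta>: "(\<Sum>i<N. \<eta> i) = d" and \<eta>0: "\<And>i. i \<ge> N \<Longrightarrow> \<eta> i = 0" by (auto simp: exps_def)
    from nz obtain i where i: "i < N" "c (\<eta>(i := Suc (\<eta> i))) \<noteq> 0"
      unfolding cw by (metis (no_types, lifting) lessThan_iff mult_zero_right sum.neutral)
    obtain r where r: "\<nu> r < \<eta> r" "\<And>k. k < r \<Longrightarrow> \<nu> k = \<eta> k" using less by (auto elim: less_funE)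
    have "r < N" using r \<eta>0[of r] by (cases "r < N") auto
    have sum\<nu>: "(\<Sum>k<N. \<nu> k) = d"
      using sum_upd[OF q(1), of l "l q - 1"] suml q by (simp add: \<nu>_def)
    show False
    \<comment> \<open>At r the vector \<eta> first exceeds \<nu>. Above row q, adding any box to
      \<eta> still gives an exponent beyond \<open>l\<close>; from row q on, \<eta> dominates \<nu>
      entrywise, which contradicts the equal sums.\<close>
    proof (cases "r < q")
      case True
      have "less_fun l (\<eta>(i := Suc (\<eta> i)))"
      proof (rule less_funI)
        show "\<exists>k. l k < (\<eta>(i := Suc (\<eta> i))) k \<and> (\<forall>k'<k. l k' = (\<eta>(i := Suc (\<eta> i))) k')"
        proof (cases "i < r")
          case True
          then show ?thesis using r \<open>r < q\<close> by (intro exI[of _ i]) (auto simp: \<nu>q less_imp_neq)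
        next
          case False
          then show ?thesis using r \<open>r < q\<close> by (intro exI[of _ r]) (auto simp: \<nu>q less_imp_neq)
        qed
      qed
      then show False using van i by blast
    next
      case False
      have "(\<Sum>k\<in>{..<N}. \<nu> k) < (\<Sum>k\<in>{..<N}. \<eta> k)"
      proof (rule sum_strict_mono_ex1)
        show "\<forall>k\<in>{..<N}. \<nu> k \<le> \<eta> k"
        proof
          fix k
          show "\<nu> k \<le> \<eta> k"
            using r False qmax[of k] \<nu>q(2)[of k] by (cases k r rule: linorder_cases) auto
        qed
        show "\<exists>k\<in>{..<N}. \<nu> k < \<eta> k" using r \<open>r < N\<close> by blast
      qed simp
      then show False using sum\<nu> sum\<eta> by simp
    qed
  qed
  \<comment> \<open>By \<open>low_eigen\<close>, \<open>w\<close> is a polynomial in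
    \<open>lap\<close> applied to \<open>dp 1 F\<close>, so P annihilates it as well; its leading
    coefficient then shows that P vanishes at the diagonal entry of \<nu>.\<close>
  have "poly P (2 * \<epsilon> - 2 * of_real (\<alpha> * real (l q - 1) - real q)) = 0"
    if P: "op_poly (lap \<alpha> K) P (dp 1 F) = 0" for P
  proof -
    have d1: "dp 1 F \<in> hom d" using dp_hom[of F d 1] F by simp
    have "op_poly (lap \<alpha> K) P (lap \<alpha> K (dp 1 F)) = lap \<alpha> K (op_poly (lap \<alpha> K) P (dp 1 F))"
      by (rule op_poly_commute[where V = "hom d" and I = "partitions_of d", OF lap_linear lap_linear]) (use d1 lap_hom in auto)
    then have "op_poly (lap \<alpha> K) P w = 0"
      unfolding w_def low_eigen[OF eig] clinear_op_diff[OF clinear_op_poly[OF lap_linear]]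
        clinear_op_scale[OF clinear_op_poly[OF lap_linear]] P
      by (simp add: clinear_op_0[OF lap_linear] pointwise)
    then have "poly P (of_real (h2 N \<alpha> d \<nu>)) * cw \<nu> = 0"
      using lap_poly_leading[OF w _, of K \<nu> N \<alpha> P] cw_van F(2) by (simp add: cw_def cf_0)
    then have "poly P (of_real (h2 N \<alpha> d \<nu>)) = 0" using cw_nz by simp
    moreover have "of_real (h2 N \<alpha> d \<nu>) = 2 * \<epsilon> - 2 * of_real (\<alpha> * real (l q - 1) - real q)"
      unfolding eps using h\<nu> by (metis diff_diff_eq2 add_diff_cancel_left' diff_add_cancel of_real_diff of_real_mult of_real_numeral)
    ultimately show ?thesis by simp
  qed
  then show ?thesis using q(1) \<open>q \<le> d\<close> by blast
qed

subsection \<open>Algebraic independence of the power sums\<close>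

text \<open>The derivative in z i is a polynomial in z i of degree at most d - 1 whose coefficients
  are k times the evaluations of \<open>dp k F\<close>. It vanishes at N \<ge> d distinct points, so
  every \<open>dp k F\<close> vanishes in N variables and, by induction, identically.\<close>

lemma ev_injective:
  assumes F: "F \<in> hom d" and d: "d \<le> N" "d \<le> K" and z: "\<And>z. inj_on z {..<N} \<Longrightarrow> ev N K F z = 0"
  shows "F = 0"
  using assms
proof (induction d arbitrary: F rule: less_induct)
  case (less d)
  have r: "rep N d (cf N K d F) (ev N K F)" by (rule rep_cf) (use less.prems in auto)
  have "cf N K d F = (\<lambda>\<eta>. 0)" by (rule cf_eqI[OF _ _ rep_0]) (use less.prems in auto)
  then have zero: "ev N K F z = 0" for z using repD[OF r, of z] by simp
  have Fs: "F \<in> supported (partitions_upto K)" by (rule hom_upto) (use less.prems in auto)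
  show ?case
  proof (cases "d = 0")
    case True
    then have "partitions_of d = {{#}}"
      by (auto simp: partitions_of_def) (metis multiset_nonemptyE)
    moreover have "ev N K F (\<lambda>_. 0) = (\<Sum>\<mu>\<in>partitions_of d. F \<mu> * mp N \<mu> (\<lambda>_. 0))"
      unfolding ev_def using less.prems(1) partitions_of_subset[OF less.prems(3)]
      by (intro sum.mono_neutral_right) (auto simp: supported_def)
    ultimately have "F {#} = 0" using zero by simp
    then show ?thesis using less.prems(1) \<open>partitions_of d = {{#}}\<close>
      by (auto simp: supported_def pointwise)
  next
    case False
    have dk: "dp k F = 0" if k: "k > 0" for k
    proof (cases "k \<le> d")
      case True
      show ?thesis
      proof (rule less.IH[of "d - k"])
        show "d - k < d" "d - k \<le> N" "d - k \<le> K" using k True less.prems by auto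
        show "dp k F \<in> hom (d - k)" using dp_hom[of F "d - k" k] True less.prems by simp
        fix z :: "nat \<Rightarrow> complex" assume inj: "inj_on z {..<N}"
        define Q where "Q = (\<Sum>k=1..d. monom (of_nat k * ev N K (dp k F) z) (k - 1))"
        have deg: "degree Q \<le> d - 1"
          unfolding Q_def by (intro degree_sum_le) (auto intro!: order.trans[OF degree_monom_le])
        have root: "poly Q (z i) = 0" if i: "i < N" for i
        proof -
          have "(\<Sum>k=1..K. of_nat k * z i ^ (k - 1) * ev N K (dp k F) z) = 0"
            using ev_deriv[OF i Fs, of z "z i"] zero DERIV_unique[OF _ DERIV_const[of 0 "at (z i)"]] by simp
          also have "(\<Sum>k=1..K. of_nat k * z i ^ (k - 1) * ev N K (dp k F) z) =
            (\<Sum>k=1..d. of_nat k * z i ^ (k - 1) * ev N K (dp k F) z)"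
          proof (intro sum.mono_neutral_right ballI)
            fix k assume "k \<in> {1..K} - {1..d}"
            then have "dp k F = 0"
              using dp_eq_0[of F d k] hom_upto[OF less.prems(1), of d] by auto
            then show "of_nat k * z i ^ (k - 1) * ev N K (dp k F) z = 0"
              by (simp add: ev_0)
          qed (use less.prems in auto)
          finally show ?thesis by (simp add: Q_def poly_sum poly_monom mult_ac)
        qed
        have "Q = 0"
        proof (rule ccontr)
          assume "Q \<noteq> 0"
          then have "card {x. poly Q x = 0} \<le> d - 1" "finite {x. poly Q x = 0}"
            using card_poly_roots_bound[of Q] deg poly_roots_finite by auto
          moreover have "card (z ` {..<N}) \<le> card {x. poly Q x = 0}"
            by (rule card_mono) (use root calculation in auto)
          moreover have "card (z ` {..<N}) = N" using inj by (simp add: card_image)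
          ultimately show False using less.prems(2) False by linarith
        qed
        have "coeff Q (k - 1) = (\<Sum>j=1..d. if j = k then of_nat j * ev N K (dp j F) z else 0)"
          unfolding Q_def coeff_sum by (intro sum.cong refl) (use k in auto)
        then show "ev N K (dp k F) z = 0" using \<open>Q = 0\<close> k True by simp
      qed
    next
      case False
      then show ?thesis using dp_eq_0[of F d k] hom_upto[OF less.prems(1), of d] by simp
    qed
    have "F \<mu> = 0" for \<mu>
    proof (cases "\<mu> \<in> partitions_of d")
      case True
      then have "\<mu> \<noteq> {#}" using False by (auto simp: partitions_of_def)
      then obtain k \<nu> where \<mu>: "\<mu> = add_mset k \<nu>" by (meson multiset_cases)
      then have "k > 0" using True by (auto simp: partitions_of_def)
      then have "dp k F \<nu> = 0" using dk by (simp add: pointwise)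
      then show ?thesis
        unfolding \<mu> dp_def mult_eq_0_iff of_nat_eq_0_iff by simp
    next
      case False
      then show ?thesis using less.prems(1) by (auto simp: supported_def)
    qed
    then show ?thesis by (simp add: pointwise)
  qed
qed

subsection \<open>Integration over the torus\<close>

abbreviation torus :: "nat \<Rightarrow> (nat \<Rightarrow> real) measure" where
  "torus N \<equiv> (\<Pi>\<^sub>M j\<in>{..<N}. arc_measure)"

lemma space_arc [simp]: "space arc_measure = {-pi<..<pi}"
  by (simp add: arc_measure_def space_restrict_space)

lemma finite_arc: "finite_measure arc_measure"
  by (rule finite_measureI) (simp add: arc_measure_def emeasure_restrict_space space_restrict_space)

interpretation arc: product_sigma_finite "\<lambda>j::nat. arc_measure"
  by (simp add: product_sigma_finite_def finite_measure.axioms(1)[OF finite_arc])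

lemma finite_torus: "finite_measure (torus N)"
proof (rule finite_measureI)
  have "emeasure arc_measure (space arc_measure) \<noteq> \<infinity>"
    using finite_measure.emeasure_finite[OF finite_arc] by auto
  then show "emeasure (torus N) (space (torus N)) \<noteq> \<infinity>"
    unfolding space_PiM
    by (subst arc.emeasure_PiM) (auto simp: power_eq_top_ennreal simp del: space_arc)
qed

lemma measurable_coord [measurable]: "j < N \<Longrightarrow> (\<lambda>\<theta>. \<theta> j) \<in> borel_measurable (torus N)"
proof -
  assume j: "j < N"
  have "(\<lambda>x. x) \<in> borel_measurable arc_measure"
    unfolding arc_measure_def by (intro measurable_restrict_space1) simp
  moreover have "(\<lambda>\<theta>. \<theta> j) \<in> torus N \<rightarrow>\<^sub>M arc_measure"
    using j by (intro measurable_component_singleton) simp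
  ultimately show ?thesis by (rule measurable_compose[rotated])
qed

text \<open>A class closed under all operations applied to evaluations, so that measurability,
  boundedness, continuity and periodicity in each angle follow by one induction each.\<close>

inductive_set trigp :: "nat \<Rightarrow> ((nat \<Rightarrow> real) \<Rightarrow> complex) set" for N where
  const: "(\<lambda>\<theta>. c) \<in> trigp N"
| ei: "j < N \<Longrightarrow> (\<lambda>\<theta>. exp (\<i> * \<theta> j)) \<in> trigp N"
| ei_neg: "j < N \<Longrightarrow> (\<lambda>\<theta>. exp (- (\<i> * \<theta> j))) \<in> trigp N"
| add: "f \<in> trigp N \<Longrightarrow> g \<in> trigp N \<Longrightarrow> (\<lambda>\<theta>. f \<theta> + g \<theta>) \<in> trigp N"
| mult: "f \<in> trigp N \<Longrightarrow> g \<in> trigp N \<Longrightarrow> (\<lambda>\<theta>. f \<theta> * g \<theta>) \<in> trigp N"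

lemma trigp_sum: "(\<And>a. a \<in> A \<Longrightarrow> f a \<in> trigp N) \<Longrightarrow> (\<lambda>\<theta>. \<Sum>a\<in>A. f a \<theta>) \<in> trigp N"
  by (induction A rule: infinite_finite_induct) (auto intro: trigp.intros)

lemma trigp_power: "f \<in> trigp N \<Longrightarrow> (\<lambda>\<theta>. f \<theta> ^ k) \<in> trigp N"
  by (induction k) (auto intro: trigp.intros)

lemma trigp_uminus: "f \<in> trigp N \<Longrightarrow> (\<lambda>\<theta>. - f \<theta>) \<in> trigp N"
  using trigp.mult[OF trigp.const[of "-1"]] by fastforce

lemma trigp_diff: "f \<in> trigp N \<Longrightarrow> g \<in> trigp N \<Longrightarrow> (\<lambda>\<theta>. f \<theta> - g \<theta>) \<in> trigp N"
  using trigp.add[OF _ trigp_uminus] by fastforce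

lemma trigp_cnj: "f \<in> trigp N \<Longrightarrow> (\<lambda>\<theta>. cnj (f \<theta>)) \<in> trigp N"
proof (induction rule: trigp.induct)
  case (ei j)
  then show ?case using trigp.ei_neg[of j N] by (simp add: exp_cnj)
next
  case (ei_neg j)
  then show ?case using trigp.ei[of j N] by (simp add: exp_cnj)
qed (auto intro: trigp.intros)

lemmas trigp_intros = trigp.intros trigp_sum trigp_power trigp_uminus trigp_diff trigp_cnj

lemma trigp_measurable: "f \<in> trigp N \<Longrightarrow> f \<in> borel_measurable (torus N)"
  by (induction rule: trigp.induct) (measurable, auto)

lemma trigp_bounded: "f \<in> trigp N \<Longrightarrow> \<exists>B. \<forall>\<theta>. cmod (f \<theta>) \<le> B"
proof (induction rule: trigp.induct)
  case (add f g)
  then obtain B C where "\<And>\<theta>. cmod (f \<theta>) \<le> B" "\<And>\<theta>. cmod (g \<theta>) \<le> C" by blast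
  then have "cmod (f \<theta> + g \<theta>) \<le> B + C" for \<theta> by (meson add_mono norm_triangle_le)
  then show ?case by blast
next
  case (mult f g)
  then obtain B C where *: "\<And>\<theta>. cmod (f \<theta>) \<le> B" "\<And>\<theta>. cmod (g \<theta>) \<le> C" by blast
  have "cmod (f \<theta> * g \<theta>) \<le> B * C" for \<theta>
    using mult_mono[OF *(1)[of \<theta>] *(2)[of \<theta>]] order.trans[OF norm_ge_zero *(1)[of \<theta>]] by (simp add: norm_mult)
  then show ?case by blast
next
  case (ei_neg j)
  have "cmod (exp (- (\<i> * complex_of_real (\<theta> j)))) = 1" for \<theta>
    using norm_exp_i_times[of "- \<theta> j"] by simp
  then show ?case by (metis order_refl)
qed auto

lemma trigp_continuous: "f \<in> trigp N \<Longrightarrow> continuous_on UNIV (\<lambda>t. f (\<theta>(i := t)))"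
proof (induction rule: trigp.induct)
  case (ei j)
  then show ?case by (cases "i = j") (auto intro!: continuous_intros)
next
  case (ei_neg j)
  then show ?case by (cases "i = j") (auto intro!: continuous_intros)
qed (auto intro!: continuous_intros)

lemma trigp_periodic: "f \<in> trigp N \<Longrightarrow> f (\<theta>(i := pi)) = f (\<theta>(i := - pi))"
proof (induction rule: trigp.induct)
  case (ei j)
  then show ?case by (cases "i = j") (auto simp: exp_pi_i exp_minus_inverse exp_minus)
next
  case (ei_neg j)
  then show ?case by (cases "i = j") (auto simp: exp_pi_i exp_minus)
qed auto

lemma integrable_torus_bounded:
  fixes f :: "(nat \<Rightarrow> real) \<Rightarrow> 'b :: {banach, second_countable_topology}"
  assumes "f \<in> borel_measurable (torus N)" "\<And>\<theta>. norm (f \<theta>) \<le> B"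
  shows "integrable (torus N) f"
  using finite_measure.integrable_const_bound[OF finite_torus, of f B N] assms by auto

lemma integral_arc_derivative:
  fixes F f :: "real \<Rightarrow> complex"
  assumes "\<And>t. (F has_vector_derivative f t) (at t)" "continuous_on UNIV f" "F pi = F (- pi)"
  shows "(\<integral>t. f t \<partial>arc_measure) = 0"
proof -
  have "(\<integral>t. f t \<partial>arc_measure) = (\<integral>t. indicator {-pi<..<pi} t *\<^sub>R f t \<partial>lborel)"
    unfolding arc_measure_def by (rule integral_restrict_space) simp
  also have "\<dots> = (\<integral>t. indicator {-pi..pi} t *\<^sub>R f t \<partial>lborel)"
  proof (rule integral_cong_AE)
    have "f \<in> borel_measurable borel" using assms(2) by (rule borel_measurable_continuous_onI)
    then show "(\<lambda>t. indicator {-pi<..<pi} t *\<^sub>R f t) \<in> borel_measurable lborel"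
      "(\<lambda>t. indicator {-pi..pi} t *\<^sub>R f t) \<in> borel_measurable lborel"
      by (auto intro!: borel_measurable_scaleR borel_measurable_indicator)
    have "AE t in lborel. t \<noteq> - pi" "AE t in lborel. t \<noteq> pi" by (rule AE_lborel_singleton)+
    then show "AE t in lborel. indicator {-pi<..<pi} t *\<^sub>R f t = indicator {-pi..pi} t *\<^sub>R f t"
      by eventually_elim (auto simp: indicator_def)
  qed
  also have "\<dots> = F pi - F (- pi)"
    by (rule integral_FTC_Icc)
      (use assms in \<open>auto intro: has_vector_derivative_at_within continuous_on_subset\<close>)
  finally show ?thesis using assms(3) by simp
qed

lemma integral_torus_derivative:
  fixes \<Psi> \<Psi>' :: "(nat \<Rightarrow> real) \<Rightarrow> complex"
  assumes i: "i < N" and m: "\<Psi>' \<in> borel_measurable (torus N)" and b: "\<And>\<theta>. cmod (\<Psi>' \<theta>) \<le> B"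
    and d: "\<And>\<theta> t. ((\<lambda>t. \<Psi> (\<theta>(i := t))) has_vector_derivative \<Psi>' (\<theta>(i := t))) (at t)"
    and c: "\<And>\<theta>. continuous_on UNIV (\<lambda>t. \<Psi>' (\<theta>(i := t)))"
    and p: "\<And>\<theta>. \<Psi> (\<theta>(i := pi)) = \<Psi> (\<theta>(i := - pi))"
  shows "(\<integral>\<theta>. \<Psi>' \<theta> \<partial>torus N) = 0"
proof -
  have I: "{..<N} = insert i ({..<N} - {i})" using i by auto
  have "(\<integral>\<theta>. \<Psi>' \<theta> \<partial>torus N) = (\<integral>\<theta>. \<Psi>' \<theta> \<partial>(\<Pi>\<^sub>M j\<in>insert i ({..<N} - {i}). arc_measure))"
    using I by simp
  also have "\<dots> = (\<integral>\<theta>. (\<integral>t. \<Psi>' (\<theta>(i := t)) \<partial>arc_measure) \<partial>(\<Pi>\<^sub>M j\<in>{..<N} - {i}. arc_measure))"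
    by (rule arc.product_integral_insert)
      (use integrable_torus_bounded[OF m b] I in auto)
  also have "\<dots> = 0"
    by (simp add: integral_arc_derivative[OF d c p])
  finally show ?thesis .
qed

section \<open>Integration by parts against the ensemble weight\<close>

lemma cmod_diff_exp: "(cmod (exp (\<i> * complex_of_real a) - exp (\<i> * complex_of_real b)))\<^sup>2 = 2 - 2 * cos (a - b)"
proof -
  have "(cmod (exp (\<i> * complex_of_real a) - exp (\<i> * complex_of_real b)))\<^sup>2
      = (cos a - cos b)\<^sup>2 + (sin a - sin b)\<^sup>2"
    by (simp add: cmod_power2 flip: cis_conv_exp)
  also have "\<dots> = ((cos a)\<^sup>2 + (sin a)\<^sup>2) + ((cos b)\<^sup>2 + (sin b)\<^sup>2) - 2 * (cos a * cos b + sin a * sin b)"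
    by (simp add: power2_eq_square algebra_simps)
  also have "\<dots> = 2 - 2 * cos (a - b)"
    by (simp add: cos_diff)
  finally show ?thesis .
qed

text \<open>The identity cot ((a - b) / 2) = i (x + y) / (x - y) for x = e^(ia) and y = e^(ib), with
  denominators cleared because the regularised weight adds \<epsilon> to one of them.\<close>

lemma exp_diff_sin:
  "(exp (\<i> * complex_of_real a) - exp (\<i> * complex_of_real b)) * complex_of_real (2 * sin (a - b)) =
   \<i> * (exp (\<i> * complex_of_real a) + exp (\<i> * complex_of_real b)) * complex_of_real (2 - 2 * cos (a - b))"
proof -
  define x y where "x = exp (\<i> * complex_of_real a)" and "y = exp (\<i> * complex_of_real b)"
  have xy: "x \<noteq> 0" "y \<noteq> 0" by (simp_all add: x_def y_def)
  have "x / y = cis (a - b)" "y / x = cis (b - a)"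
    by (simp_all add: x_def y_def cis_divide flip: cis_conv_exp)
  moreover define u v where "u = cos (a - b)" and "v = sin (a - b)"
  ultimately have e: "x / y = complex_of_real u + \<i> * complex_of_real v"
    "y / x = complex_of_real u - \<i> * complex_of_real v"
    by (simp_all add: complex_eq_iff cos_diff sin_diff)
  have s: "complex_of_real (2 * v) = - \<i> * (x / y - y / x)"
    and c: "complex_of_real (2 * u) = x / y + y / x"
    unfolding e by simp_all
  have d1: "x / y - y / x = (x\<^sup>2 - y\<^sup>2) / (x * y)"
    by (simp only: diff_frac_eq[OF xy(2,1)] power2_eq_square mult.commute[of y x])
  have "x / y + y / x = (x\<^sup>2 + y\<^sup>2) / (x * y)"
    by (simp only: add_frac_eq[OF xy(2,1)] power2_eq_square mult.commute[of y x])
  moreover have "2 = 2 * (x * y) / (x * y)" using xy by simp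
  ultimately have "2 - (x / y + y / x) = (2 * (x * y) - (x\<^sup>2 + y\<^sup>2)) / (x * y)"
    by (metis diff_divide_distrib)
  also have "2 * (x * y) - (x\<^sup>2 + y\<^sup>2) = - ((x - y)\<^sup>2)"
    by (simp add: power2_eq_square algebra_simps)
  finally have d2: "2 - (x / y + y / x) = - ((x - y)\<^sup>2) / (x * y)" .
  have n: "(x - y) * (- \<i> * (x\<^sup>2 - y\<^sup>2)) = \<i> * (x + y) * (- ((x - y)\<^sup>2))"
    by (simp add: power2_eq_square algebra_simps)
  have "(x - y) * (- \<i> * ((x\<^sup>2 - y\<^sup>2) / (x * y))) = ((x - y) * (- \<i> * (x\<^sup>2 - y\<^sup>2))) / (x * y)"
    by simp
  also have "\<dots> = \<i> * (x + y) * (- ((x - y)\<^sup>2) / (x * y))" unfolding n by simp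
  finally show ?thesis
    unfolding x_def[symmetric] y_def[symmetric] u_def[symmetric] v_def[symmetric]
      s of_real_diff c d1 of_real_numeral d2 .
qed

text \<open>The weight is regularised so that it is smooth; \<open>\<epsilon> \<rightarrow> 0\<close> at the end.\<close>

definition reg_weight :: "real \<Rightarrow> real \<Rightarrow> nat \<Rightarrow> (nat \<Rightarrow> real) \<Rightarrow> real" where
  "reg_weight \<epsilon> \<beta> N \<theta> = (\<Prod>(l,m)\<in>pairs N. (\<epsilon> + (2 - 2 * cos (\<theta> l - \<theta> m))) powr (\<beta> / 2))"

lemma circular_weight_eq: "circular_weight \<beta> N \<theta> = reg_weight 0 \<beta> N \<theta>"
  unfolding circular_weight_def reg_weight_def pairs_def
  by (intro prod.cong refl) (auto simp: cmod_diff_exp[symmetric] powr_half_sqrt_powr powr_powr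
      simp flip: powr_numeral)

lemma reg_weight_measurable [measurable]: "reg_weight \<epsilon> \<beta> N \<in> borel_measurable (torus N)"
  unfolding reg_weight_def case_prod_beta
proof (intro borel_measurable_prod)
  fix p assume "p \<in> pairs N"
  then have [measurable]: "fst p < N" "snd p < N" by (auto simp: pairs_def)
  show "(\<lambda>\<theta>. (\<epsilon> + (2 - 2 * cos (\<theta> (fst p) - \<theta> (snd p)))) powr (\<beta> / 2)) \<in> borel_measurable (torus N)"
    by measurable
qed

text \<open>5 = 1 + 4, from \<epsilon> \<le> 1 and a squared chord of at most 4.\<close>

lemma reg_weight_bounds:
  assumes "0 \<le> \<epsilon>" "\<epsilon> \<le> 1" "\<beta> \<ge> 0"
  shows "0 \<le> reg_weight \<epsilon> \<beta> N \<theta>" "reg_weight \<epsilon> \<beta> N \<theta> \<le> (5 powr (\<beta> / 2)) ^ card (pairs N)"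
proof -
  show "0 \<le> reg_weight \<epsilon> \<beta> N \<theta>" unfolding reg_weight_def by (intro prod_nonneg) auto
  have "reg_weight \<epsilon> \<beta> N \<theta> \<le> (\<Prod>p\<in>pairs N. 5 powr (\<beta> / 2))"
    unfolding reg_weight_def
  proof (intro prod_mono)
    fix p assume "p \<in> pairs N"
    obtain l m where p: "p = (l, m)" by force
    have "0 \<le> \<epsilon> + (2 - 2 * cos (\<theta> l - \<theta> m))" "\<epsilon> + (2 - 2 * cos (\<theta> l - \<theta> m)) \<le> 5"
      using cos_ge_minus_one[of "\<theta> l - \<theta> m"] cos_le_one[of "\<theta> l - \<theta> m"] assms by linarith+
    then show "0 \<le> (case p of (l,m) \<Rightarrow> (\<epsilon> + (2 - 2 * cos (\<theta> l - \<theta> m))) powr (\<beta> / 2)) \<and>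
       (case p of (l,m) \<Rightarrow> (\<epsilon> + (2 - 2 * cos (\<theta> l - \<theta> m))) powr (\<beta> / 2)) \<le> 5 powr (\<beta> / 2)"
      using assms by (auto simp: p intro!: powr_mono2)
  qed
  then show "reg_weight \<epsilon> \<beta> N \<theta> \<le> (5 powr (\<beta> / 2)) ^ card (pairs N)" by simp
qed

text \<open>For \<epsilon> > 0 every factor is positive and logarithmic differentiation applies; at
  \<epsilon> = 0 the weight need not be differentiable where two points collide.\<close>

lemma reg_weight_deriv:
  assumes \<epsilon>: "\<epsilon> > 0"
  shows "((\<lambda>t. reg_weight \<epsilon> \<beta> N (\<theta>(i := t))) has_real_derivative
     reg_weight \<epsilon> \<beta> N (\<theta>(i := t)) * (\<beta> / 2 * (\<Sum>(l,m)\<in>pairs N.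
       ((if l = i then 1 else 0) - (if m = i then 1 else 0)) *
       (2 * sin ((\<theta>(i := t)) l - (\<theta>(i := t)) m) / (\<epsilon> + (2 - 2 * cos ((\<theta>(i := t)) l - (\<theta>(i := t)) m)))))))
     (at t)"
proof -
  have pos: "\<epsilon> + (2 - 2 * cos x) > 0" for x using \<epsilon> by (smt (verit) cos_le_one)
  have e: "reg_weight \<epsilon> \<beta> N \<phi> = exp (\<beta> / 2 * (\<Sum>(l,m)\<in>pairs N. ln (\<epsilon> + (2 - 2 * cos (\<phi> l - \<phi> m)))))" for \<phi>
    using pos by (simp add: reg_weight_def powr_def exp_sum sum_distrib_left case_prod_beta less_imp_neq[THEN not_sym])
  have d: "((\<lambda>t. ln (\<epsilon> + (2 - 2 * cos ((\<theta>(i := t)) l - (\<theta>(i := t)) m)))) has_real_derivative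
     ((if l = i then 1 else 0) - (if m = i then 1 else 0)) *
       (2 * sin ((\<theta>(i := t)) l - (\<theta>(i := t)) m) / (\<epsilon> + (2 - 2 * cos ((\<theta>(i := t)) l - (\<theta>(i := t)) m))))) (at t)"
    for l m
  proof -
    have "((\<lambda>t. (\<theta>(i := t)) l) has_real_derivative (if l = i then 1 else 0)) (at t)" for l
      by (cases "l = i") auto
    note [derivative_intros] = this
    have "((\<lambda>t. \<epsilon> + (2 - 2 * cos ((\<theta>(i := t)) l - (\<theta>(i := t)) m))) has_real_derivative
        ((if l = i then 1 else 0) - (if m = i then 1 else 0)) * (2 * sin ((\<theta>(i := t)) l - (\<theta>(i := t)) m))) (at t)"
      by (auto intro!: derivative_eq_intros simp del: fun_upd_apply)
    from DERIV_chain2[OF DERIV_ln[OF pos] this]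
    show ?thesis by (simp only: divide_inverse mult_ac)
  qed
  have "((\<lambda>t. \<Sum>p\<in>pairs N. ln (\<epsilon> + (2 - 2 * cos ((\<theta>(i := t)) (fst p) - (\<theta>(i := t)) (snd p))))) has_real_derivative
     (\<Sum>p\<in>pairs N. ((if fst p = i then 1 else 0) - (if snd p = i then 1 else 0)) *
       (2 * sin ((\<theta>(i := t)) (fst p) - (\<theta>(i := t)) (snd p)) / (\<epsilon> + (2 - 2 * cos ((\<theta>(i := t)) (fst p) - (\<theta>(i := t)) (snd p))))))) (at t)"
    by (intro DERIV_sum d)
  from DERIV_fun_exp[OF DERIV_cmult[OF this, of "\<beta> / 2"]]
  show ?thesis unfolding e case_prod_beta .
qed

lemma reg_weight_tendsto:
  assumes "\<beta> > 0" "\<epsilon> \<longlonglongrightarrow> 0" "\<And>n. \<epsilon> n > 0"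
  shows "(\<lambda>n. reg_weight (\<epsilon> n) \<beta> N \<theta>) \<longlonglongrightarrow> reg_weight 0 \<beta> N \<theta>"
  unfolding reg_weight_def case_prod_beta
proof (intro tendsto_prod tendsto_powr')
  fix p
  show "(\<lambda>n. \<epsilon> n + (2 - 2 * cos (\<theta> (fst p) - \<theta> (snd p)))) \<longlonglongrightarrow> 0 + (2 - 2 * cos (\<theta> (fst p) - \<theta> (snd p)))"
    by (intro tendsto_intros assms)
  have "\<epsilon> n + (2 - 2 * cos x) \<ge> 0" for n x using assms(3)[of n] by (smt (verit) cos_le_one)
  then show "0 + (2 - 2 * cos (\<theta> (fst p) - \<theta> (snd p))) \<noteq> 0 \<or>
      0 < \<beta> / 2 \<and> (\<forall>\<^sub>F n in sequentially. 0 \<le> \<epsilon> n + (2 - 2 * cos (\<theta> (fst p) - \<theta> (snd p))))"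
    using assms(1) by simp
qed simp

abbreviation ez :: "(nat \<Rightarrow> real) \<Rightarrow> nat \<Rightarrow> complex" where
  "ez \<theta> \<equiv> \<lambda>j. exp (\<i> * complex_of_real (\<theta> j))"

text \<open>The logarithmic derivative of the weight is \<beta> / 2 times a sum of cotangents,
  singular where points collide. Collecting the two contributions of a pair leaves h l - h m against
  each cotangent, and the assumed divisibility by the difference of the points cancels the
  singularity.\<close>

lemma circular_integration_by_parts:
  fixes h h' :: "nat \<Rightarrow> (nat \<Rightarrow> real) \<Rightarrow> complex"
  assumes \<beta>: "\<beta> > 0"
    and h: "\<And>i. i < N \<Longrightarrow> h i \<in> trigp N" and h': "\<And>i. i < N \<Longrightarrow> h' i \<in> trigp N"
    and d: "\<And>i \<theta> t. i < N \<Longrightarrow> ((\<lambda>t. h i (\<theta>(i := t))) has_vector_derivative h' i (\<theta>(i := t))) (at t)"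
    and q: "\<And>l m. (l, m) \<in> pairs N \<Longrightarrow> q l m \<in> trigp N"
    and hq: "\<And>l m \<theta>. (l, m) \<in> pairs N \<Longrightarrow> h l \<theta> - h m \<theta> = (ez \<theta> l - ez \<theta> m) * q l m \<theta>"
  shows "(\<integral>\<theta>. of_real (circular_weight \<beta> N \<theta>) * ((\<Sum>i<N. h' i \<theta>)
           + \<i> * of_real (\<beta> / 2) * (\<Sum>(l,m)\<in>pairs N. (ez \<theta> l + ez \<theta> m) * q l m \<theta>)) \<partial>torus N) = 0"
proof -
  define s where "s \<epsilon> l m \<theta> = 2 * sin (\<theta> l - \<theta> m) / (\<epsilon> + (2 - 2 * cos (\<theta> l - \<theta> m)))"
    for \<epsilon> l m and \<theta> :: "nat \<Rightarrow> real"
  define r where "r \<epsilon> l m \<theta> = (2 - 2 * cos (\<theta> l - \<theta> m)) / (\<epsilon> + (2 - 2 * cos (\<theta> l - \<theta> m)))"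
    for \<epsilon> l m and \<theta> :: "nat \<Rightarrow> real"
  define W where "W \<epsilon> \<theta> = reg_weight \<epsilon> \<beta> N \<theta>" for \<epsilon> \<theta>
  define H where "H \<theta> = (\<Sum>i<N. h' i \<theta>)" for \<theta>
  define I where "I \<epsilon> \<theta> = of_real (W \<epsilon> \<theta>) * (H \<theta>
           + \<i> * of_real (\<beta> / 2) * (\<Sum>(l,m)\<in>pairs N. (ez \<theta> l + ez \<theta> m) * q l m \<theta> * of_real (r \<epsilon> l m \<theta>)))" for \<epsilon> \<theta>
  define C where "C = (5 powr (\<beta> / 2)) ^ card (pairs N)"
  have WC: "0 \<le> W \<epsilon> \<theta>" "W \<epsilon> \<theta> \<le> C" if "0 \<le> \<epsilon>" "\<epsilon> \<le> 1" for \<epsilon> \<theta>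
    using reg_weight_bounds[OF that] \<beta> by (auto simp: W_def C_def)
  have C0: "C \<ge> 0" by (simp add: C_def)
  have pos: "2 - 2 * cos x \<ge> 0" for x :: real using cos_le_one[of x] by simp
  have [measurable]: "s \<epsilon> l m \<in> borel_measurable (torus N)" "r \<epsilon> l m \<in> borel_measurable (torus N)"
    if "(l, m) \<in> pairs N" for \<epsilon> l m
  proof -
    have [measurable]: "l < N" "m < N" using that by (auto simp: pairs_def)
    show "s \<epsilon> l m \<in> borel_measurable (torus N)" "r \<epsilon> l m \<in> borel_measurable (torus N)"
      unfolding s_def r_def by measurable
  qed
  have [measurable]: "W \<epsilon> \<in> borel_measurable (torus N)" for \<epsilon> unfolding W_def by measurable
  have reg: "(\<integral>\<theta>. I \<epsilon> \<theta> \<partial>torus N) = 0" if \<epsilon>: "0 < \<epsilon>" "\<epsilon> \<le> 1" for \<epsilon>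
  proof -
    \<comment> \<open>With the factor \<beta> / 2 this is the logarithmic derivative of the
      regularised weight in the i-th angle.\<close>
    define S where "S i \<theta> = (\<Sum>(l,m)\<in>pairs N. ((if l = i then 1 else 0) - (if m = i then 1 else 0)) * s \<epsilon> l m \<theta>)"
      for i \<theta>
    define \<Psi>' where "\<Psi>' i \<theta> = of_real (W \<epsilon> \<theta>) * h' i \<theta> + of_real (W \<epsilon> \<theta> * (\<beta> / 2 * S i \<theta>)) * h i \<theta>" for i \<theta>
    have eps_pos: "\<epsilon> + (2 - 2 * cos x) \<ge> \<epsilon>" "\<epsilon> + (2 - 2 * cos x) > 0" for x using pos[of x] \<epsilon> by linarith+
    have Sm: "S i \<in> borel_measurable (torus N)" for i
      unfolding S_def case_prod_beta by (intro borel_measurable_sum borel_measurable_times) auto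
    have m: "\<Psi>' i \<in> borel_measurable (torus N)" if "i < N" for i
      using Sm trigp_measurable[OF h[OF that]] trigp_measurable[OF h'[OF that]]
      unfolding \<Psi>'_def by measurable
    have Sb: "\<bar>S i \<theta>\<bar> \<le> (\<Sum>p\<in>pairs N. 2 / \<epsilon>)" for i \<theta>
      unfolding S_def
    proof (rule order.trans[OF sum_abs], rule sum_mono)
      fix p assume "p \<in> pairs N"
      obtain l m where p: "p = (l, m)" by force
      have "\<bar>s \<epsilon> l m \<theta>\<bar> = 2 * \<bar>sin (\<theta> l - \<theta> m)\<bar> / (\<epsilon> + (2 - 2 * cos (\<theta> l - \<theta> m)))"
        using eps_pos(2)[of "\<theta> l - \<theta> m"] by (simp add: s_def abs_mult)
      also have "\<dots> \<le> 2 * 1 / \<epsilon>"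
        using eps_pos[of "\<theta> l - \<theta> m"] \<epsilon> by (intro frac_le) auto
      finally show "\<bar>case p of (l, m) \<Rightarrow> ((if l = i then 1 else 0) - (if m = i then 1 else 0)) * s \<epsilon> l m \<theta>\<bar> \<le> 2 / \<epsilon>"
        using \<epsilon> by (auto simp: p)
    qed
    have b: "\<exists>B. \<forall>\<theta>. cmod (\<Psi>' i \<theta>) \<le> B" if i: "i < N" for i
    proof -
      obtain B1 B2 where B: "\<And>\<theta>. cmod (h i \<theta>) \<le> B1" "\<And>\<theta>. cmod (h' i \<theta>) \<le> B2"
        using trigp_bounded[OF h[OF i]] trigp_bounded[OF h'[OF i]] by blast
      have "cmod (\<Psi>' i \<theta>) \<le> C * B2 + C * (\<beta> / 2 * (\<Sum>p\<in>pairs N. 2 / \<epsilon>)) * B1" for \<theta>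
        unfolding \<Psi>'_def
      proof (rule order.trans[OF norm_triangle_ineq add_mono])
        show "cmod (complex_of_real (W \<epsilon> \<theta>) * h' i \<theta>) \<le> C * B2"
          using WC[of \<epsilon> \<theta>] B \<epsilon> C0 by (simp add: norm_mult mult_mono)
        show "cmod (complex_of_real (W \<epsilon> \<theta> * (\<beta> / 2 * S i \<theta>)) * h i \<theta>) \<le> C * (\<beta> / 2 * (\<Sum>p\<in>pairs N. 2 / \<epsilon>)) * B1"
          unfolding norm_mult norm_of_real abs_mult
          using WC[of \<epsilon> \<theta>] B \<epsilon> C0 \<beta> Sb[of i \<theta>] by (intro mult_mono) (auto intro!: mult_nonneg_nonneg sum_nonneg)
      qed
      then show ?thesis by blast
    qed
    have zero: "(\<integral>\<theta>. \<Psi>' i \<theta> \<partial>torus N) = 0" if i: "i < N" for i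
    proof -
      obtain B where B: "\<And>\<theta>. cmod (\<Psi>' i \<theta>) \<le> B" using b[OF i] by blast
      show ?thesis
      proof (rule integral_torus_derivative[OF i m[OF i] B, where \<Psi> = "\<lambda>\<theta>. of_real (W \<epsilon> \<theta>) * h i \<theta>"])
        fix \<theta> :: "nat \<Rightarrow> real" and t :: real
        have dW: "((\<lambda>t. W \<epsilon> (\<theta>(i := t))) has_real_derivative W \<epsilon> (\<theta>(i := t)) * (\<beta> / 2 * S i (\<theta>(i := t)))) (at t)"
          using reg_weight_deriv[OF \<epsilon>(1), of \<beta> N \<theta> i t]
          unfolding W_def S_def s_def .
        show "((\<lambda>t. of_real (W \<epsilon> (\<theta>(i := t))) * h i (\<theta>(i := t))) has_vector_derivative \<Psi>' i (\<theta>(i := t))) (at t)"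
          unfolding \<Psi>'_def
          by (rule has_vector_derivative_mult[OF has_vector_derivative_of_real[OF dW] d[OF i]])
        have "continuous_on UNIV (\<lambda>t. W \<epsilon> (\<theta>(i := t)))" for \<theta>
        proof -
          have "isCont (\<lambda>t. W \<epsilon> (\<theta>(i := t))) t" for t
            using DERIV_isCont[OF reg_weight_deriv[OF \<epsilon>(1), of \<beta> N \<theta> i t]] by (simp add: W_def)
          then show ?thesis by (simp add: continuous_at_imp_continuous_on)
        qed
        moreover have "continuous_on UNIV (\<lambda>t. S i (\<theta>(i := t)))"
        proof -
          have "continuous_on UNIV (\<lambda>t. (\<theta>(i := t)) l)" for l by (cases "l = i") auto
          then show ?thesis
            unfolding S_def s_def case_prod_beta using eps_pos(2)
            by (intro continuous_intros ballI) (auto simp: less_imp_neq[THEN not_sym])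
        qed
        ultimately show "continuous_on UNIV (\<lambda>t. \<Psi>' i (\<theta>(i := t)))"
          unfolding \<Psi>'_def by (intro continuous_intros trigp_continuous[OF h'[OF i]] trigp_continuous[OF h[OF i]])
        have "reg_weight \<epsilon> \<beta> N (\<theta>(i := pi)) = reg_weight \<epsilon> \<beta> N (\<theta>(i := - pi))"
          unfolding reg_weight_def
        proof (intro prod.cong refl)
          fix p :: "nat \<times> nat"
          obtain l m where p: "p = (l, m)" by force
          have "cos (pi - x) = cos (- pi - x)" "cos (x - pi) = cos (x + pi)" for x :: real
            by (simp_all add: cos_diff cos_add)
          then show "(case p of (l, m) \<Rightarrow> (\<epsilon> + (2 - 2 * cos ((\<theta>(i := pi)) l - (\<theta>(i := pi)) m))) powr (\<beta> / 2)) =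
             (case p of (l, m) \<Rightarrow> (\<epsilon> + (2 - 2 * cos ((\<theta>(i := - pi)) l - (\<theta>(i := - pi)) m))) powr (\<beta> / 2))"
            by (auto simp: p)
        qed
        then show "of_real (W \<epsilon> (\<theta>(i := pi))) * h i (\<theta>(i := pi)) = of_real (W \<epsilon> (\<theta>(i := - pi))) * h i (\<theta>(i := - pi))"
          using trigp_periodic[OF h[OF i]] by (simp add: W_def)
      qed
    qed
    have "I \<epsilon> \<theta> = (\<Sum>i<N. \<Psi>' i \<theta>)" for \<theta>
    proof -
      have "(\<Sum>i<N. of_real (S i \<theta>) * h i \<theta>) =
         (\<Sum>p\<in>pairs N. \<Sum>i<N. of_real (((if fst p = i then 1 else 0) - (if snd p = i then 1 else 0)) * s \<epsilon> (fst p) (snd p) \<theta>) * h i \<theta>)"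
        unfolding S_def case_prod_beta of_real_sum sum_distrib_right by (rule sum.swap)
      also have "\<dots> = (\<Sum>p\<in>pairs N. \<i> * ((ez \<theta> (fst p) + ez \<theta> (snd p)) * q (fst p) (snd p) \<theta> * of_real (r \<epsilon> (fst p) (snd p) \<theta>)))"
      proof (intro sum.cong refl)
        fix p assume p: "p \<in> pairs N"
        obtain l m where lm: "p = (l, m)" by force
        have lmN: "l < N" "m < N" using p lm by (auto simp: pairs_def)
        have "(\<Sum>i<N. of_real (((if l = i then 1 else 0) - (if m = i then 1 else 0)) * s \<epsilon> l m \<theta>) * h i \<theta>)
          = (\<Sum>i<N. (if i = l then of_real (s \<epsilon> l m \<theta>) * h i \<theta> else 0)) - (\<Sum>i<N. (if i = m then of_real (s \<epsilon> l m \<theta>) * h i \<theta> else 0))"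
          unfolding sum_subtractf[symmetric] by (intro sum.cong refl) (auto simp: algebra_simps)
        also have "\<dots> = of_real (s \<epsilon> l m \<theta>) * (h l \<theta> - h m \<theta>)"
          using lmN by (simp add: algebra_simps)
        also have "\<dots> = (ez \<theta> l - ez \<theta> m) * complex_of_real (2 * sin (\<theta> l - \<theta> m)) * q l m \<theta>
            / complex_of_real (\<epsilon> + (2 - 2 * cos (\<theta> l - \<theta> m)))"
          using hq[of l m \<theta>] p lm by (simp add: s_def mult_ac)
        also have "\<dots> = \<i> * ((ez \<theta> l + ez \<theta> m) * q l m \<theta> * of_real (r \<epsilon> l m \<theta>))"
          unfolding exp_diff_sin r_def by (simp add: mult_ac)
        finally show "(\<Sum>i<N. of_real (((if fst p = i then 1 else 0) - (if snd p = i then 1 else 0)) * s \<epsilon> (fst p) (snd p) \<theta>) * h i \<theta>) =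
          \<i> * ((ez \<theta> (fst p) + ez \<theta> (snd p)) * q (fst p) (snd p) \<theta> * of_real (r \<epsilon> (fst p) (snd p) \<theta>))"
          by (simp add: lm)
      qed
      finally have fin: "\<i> * (\<Sum>(l,m)\<in>pairs N. (ez \<theta> l + ez \<theta> m) * q l m \<theta> * of_real (r \<epsilon> l m \<theta>)) = (\<Sum>i<N. of_real (S i \<theta>) * h i \<theta>)"
        by (simp add: case_prod_beta sum_distrib_left)
      have psi: "(\<Sum>i<N. \<Psi>' i \<theta>) = of_real (W \<epsilon> \<theta>) * (H \<theta> + of_real (\<beta> / 2) * (\<Sum>i<N. of_real (S i \<theta>) * h i \<theta>))"
        by (simp add: \<Psi>'_def H_def sum.distrib sum_distrib_left distrib_left mult_ac)
      show ?thesis unfolding I_def psi fin[symmetric] by (simp only: mult.assoc mult.left_commute)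
    qed
    then have "(\<integral>\<theta>. I \<epsilon> \<theta> \<partial>torus N) = (\<integral>\<theta>. (\<Sum>i<N. \<Psi>' i \<theta>) \<partial>torus N)" by simp
    also have "\<dots> = (\<Sum>i<N. (\<integral>\<theta>. \<Psi>' i \<theta> \<partial>torus N))"
    proof (rule Bochner_Integration.integral_sum)
      fix i assume "i \<in> {..<N}"
      then show "integrable (torus N) (\<Psi>' i)"
        using b[of i] m[of i] integrable_torus_bounded by blast
    qed
    also have "\<dots> = 0" using zero by simp
    finally show ?thesis .
  qed
  define J where "J \<theta> = of_real (W 0 \<theta>) * (H \<theta>
           + \<i> * of_real (\<beta> / 2) * (\<Sum>(l,m)\<in>pairs N. (ez \<theta> l + ez \<theta> m) * q l m \<theta>))" for \<theta>
  define \<epsilon> where "\<epsilon> n = 1 / real (Suc n)" for n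
  have eps: "0 < \<epsilon> n" "\<epsilon> n \<le> 1" for n by (auto simp: \<epsilon>_def)
  have eps0: "\<epsilon> \<longlonglongrightarrow> 0"
    unfolding \<epsilon>_def using LIMSEQ_inverse_real_of_nat by (simp add: inverse_eq_divide)
  have ezm[measurable]: "(\<lambda>\<theta>. ez \<theta> l) \<in> borel_measurable (torus N)" if "l < N" for l
    using trigp_measurable[OF trigp.ei[OF that]] .
  have Hm[measurable]: "H \<in> borel_measurable (torus N)"
    unfolding H_def by (intro borel_measurable_sum trigp_measurable h') auto
  obtain BH where BH: "\<And>\<theta>. cmod (H \<theta>) \<le> BH"
    using trigp_bounded[OF trigp_sum[of "{..<N}" h' N]] h' unfolding H_def by auto
  \<comment> \<open>As \<open>r\<close> lies in [0, 1] for every \<epsilon>, one dominating function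
    serves the whole limit.\<close>
  have r01: "0 \<le> r \<epsilon> l m \<theta>" "r \<epsilon> l m \<theta> \<le> 1" if "0 < \<epsilon>" for \<epsilon> l m \<theta>
  proof -
    have "0 \<le> x / (\<epsilon> + x)" "x / (\<epsilon> + x) \<le> 1" if "0 \<le> x" for x
      using that \<open>0 < \<epsilon>\<close> by auto
    from this[OF pos] show "0 \<le> r \<epsilon> l m \<theta>" "r \<epsilon> l m \<theta> \<le> 1" by (simp_all only: r_def)
  qed
  have "\<forall>p\<in>pairs N. \<exists>B. \<forall>\<theta>. cmod ((ez \<theta> (fst p) + ez \<theta> (snd p)) * q (fst p) (snd p) \<theta>) \<le> B"
  proof
    fix p assume p: "p \<in> pairs N"
    have "(\<lambda>\<theta>. (ez \<theta> (fst p) + ez \<theta> (snd p)) * q (fst p) (snd p) \<theta>) \<in> trigp N"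
      using p q[of "fst p" "snd p"] by (intro trigp_intros) (auto simp: pairs_def)
    from trigp_bounded[OF this]
    show "\<exists>B. \<forall>\<theta>. cmod ((ez \<theta> (fst p) + ez \<theta> (snd p)) * q (fst p) (snd p) \<theta>) \<le> B" .
  qed
  then obtain Bq where Bq: "\<And>p \<theta>. p \<in> pairs N \<Longrightarrow> cmod ((ez \<theta> (fst p) + ez \<theta> (snd p)) * q (fst p) (snd p) \<theta>) \<le> Bq p"
    by metis
  define B where "B = BH + \<beta> / 2 * (\<Sum>p\<in>pairs N. Bq p)"
  have HB: "cmod (H \<theta> + \<i> * of_real (\<beta> / 2) * (\<Sum>(l,m)\<in>pairs N. (ez \<theta> l + ez \<theta> m) * q l m \<theta> * of_real (r e l m \<theta>))) \<le> B"
    if e: "0 < e" for e \<theta>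
    unfolding B_def
  proof (rule order.trans[OF norm_triangle_ineq add_mono[OF BH]])
    have "cmod (\<Sum>p\<in>pairs N. (ez \<theta> (fst p) + ez \<theta> (snd p)) * q (fst p) (snd p) \<theta> * of_real (r e (fst p) (snd p) \<theta>)) \<le> (\<Sum>p\<in>pairs N. Bq p)"
    proof (rule order.trans[OF norm_sum sum_mono])
      fix p assume p: "p \<in> pairs N"
      have "cmod ((ez \<theta> (fst p) + ez \<theta> (snd p)) * q (fst p) (snd p) \<theta>) * cmod (of_real (r e (fst p) (snd p) \<theta>)) \<le> Bq p * 1"
        using Bq[OF p, of \<theta>] r01[OF e, of "fst p" "snd p" \<theta>] order.trans[OF norm_ge_zero Bq[OF p, of \<theta>]]
        by (intro mult_mono) auto
      then show "cmod ((ez \<theta> (fst p) + ez \<theta> (snd p)) * q (fst p) (snd p) \<theta> * of_real (r e (fst p) (snd p) \<theta>)) \<le> Bq p"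
        by (simp add: norm_mult)
    qed
    then show "cmod (\<i> * of_real (\<beta> / 2) * (\<Sum>(l,m)\<in>pairs N. (ez \<theta> l + ez \<theta> m) * q l m \<theta> * of_real (r e l m \<theta>))) \<le> \<beta> / 2 * (\<Sum>p\<in>pairs N. Bq p)"
      using \<beta> by (simp add: norm_mult case_prod_beta mult_left_mono)
  qed
  have B0: "B \<ge> 0" using HB[of 1] order.trans[OF norm_ge_zero] by force
  have qm: "(\<lambda>\<theta>. (ez \<theta> (fst p) + ez \<theta> (snd p)) * q (fst p) (snd p) \<theta>) \<in> borel_measurable (torus N)" if "p \<in> pairs N" for p
    using that q[of "fst p" "snd p"] by (intro trigp_measurable trigp_intros) (auto simp: pairs_def)
  have Im: "I e \<in> borel_measurable (torus N)" for e
  proof -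
    have "(\<lambda>\<theta>. \<Sum>p\<in>pairs N. (ez \<theta> (fst p) + ez \<theta> (snd p)) * q (fst p) (snd p) \<theta> * of_real (r e (fst p) (snd p) \<theta>)) \<in> borel_measurable (torus N)"
    proof (rule borel_measurable_sum, rule borel_measurable_times)
      fix p assume "p \<in> pairs N"
      then show "(\<lambda>\<theta>. (ez \<theta> (fst p) + ez \<theta> (snd p)) * q (fst p) (snd p) \<theta>) \<in> borel_measurable (torus N)"
        by (rule qm)
    next
      fix p assume "p \<in> pairs N"
      then have "r e (fst p) (snd p) \<in> borel_measurable (torus N)" by simp
      then show "(\<lambda>\<theta>. complex_of_real (r e (fst p) (snd p) \<theta>)) \<in> borel_measurable (torus N)" by measurable
    qed
    then show ?thesis unfolding I_def case_prod_beta
      by (intro borel_measurable_times borel_measurable_add Hm borel_measurable_const) auto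
  qed
  have Jm: "J \<in> borel_measurable (torus N)"
  proof -
    have "(\<lambda>\<theta>. \<Sum>p\<in>pairs N. (ez \<theta> (fst p) + ez \<theta> (snd p)) * q (fst p) (snd p) \<theta>) \<in> borel_measurable (torus N)"
      by (intro borel_measurable_sum qm)
    then show ?thesis unfolding J_def case_prod_beta
      by (intro borel_measurable_times borel_measurable_add Hm borel_measurable_const) auto
  qed
  have Ib: "cmod (I (\<epsilon> n) \<theta>) \<le> W (\<epsilon> n) \<theta> * B" for n \<theta>
    unfolding I_def using HB[OF eps(1), of \<theta> n] WC(1)[of "\<epsilon> n" \<theta>] eps[of n]
    by (simp add: norm_mult mult_left_mono)
  have W_lim: "(\<lambda>n. W (\<epsilon> n) \<theta>) \<longlonglongrightarrow> W 0 \<theta>" for \<theta>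
    unfolding W_def by (rule reg_weight_tendsto[OF \<beta> eps0 eps(1)])
  have lim: "(\<lambda>n. I (\<epsilon> n) \<theta>) \<longlonglongrightarrow> J \<theta>" for \<theta>
  \<comment> \<open>Away from collisions every \<open>r\<close> tends to 1. At a collision
    \<open>r\<close> stays 0, but there the limiting weight vanishes and the other factor is
    bounded.\<close>
  proof (cases "\<forall>(l,m)\<in>pairs N. 2 - 2 * cos (\<theta> l - \<theta> m) \<noteq> 0")
    case True
    have "(\<lambda>n. I (\<epsilon> n) \<theta>) \<longlonglongrightarrow> of_real (W 0 \<theta>) * (H \<theta>
           + \<i> * of_real (\<beta> / 2) * (\<Sum>p\<in>pairs N. (ez \<theta> (fst p) + ez \<theta> (snd p)) * q (fst p) (snd p) \<theta> * of_real 1))"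
      unfolding I_def case_prod_beta
    proof (intro tendsto_mult tendsto_add tendsto_const tendsto_sum tendsto_of_real W_lim)
      fix p assume "p \<in> pairs N"
      then have nz: "2 - 2 * cos (\<theta> (fst p) - \<theta> (snd p)) \<noteq> 0" using True by (auto simp: case_prod_beta)
      have "(\<lambda>n. r (\<epsilon> n) (fst p) (snd p) \<theta>) \<longlonglongrightarrow> (2 - 2 * cos (\<theta> (fst p) - \<theta> (snd p))) / (0 + (2 - 2 * cos (\<theta> (fst p) - \<theta> (snd p))))"
        unfolding r_def by (intro tendsto_intros eps0) (use nz in simp)
      then show "(\<lambda>n. r (\<epsilon> n) (fst p) (snd p) \<theta>) \<longlonglongrightarrow> 1" using nz by simp
    qed
    then show ?thesis by (simp add: J_def case_prod_beta)
  next
    case False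
    then obtain l m where lm: "(l, m) \<in> pairs N" "2 - 2 * cos (\<theta> l - \<theta> m) = 0" by auto
    have "W 0 \<theta> = 0"
      unfolding W_def reg_weight_def by (rule prod_zero[OF finite_pairs], rule bexI[OF _ lm(1)]) (use lm in simp)
    then have "(\<lambda>n. W (\<epsilon> n) \<theta> * B) \<longlonglongrightarrow> 0" using tendsto_mult_left_zero[of "\<lambda>n. W (\<epsilon> n) \<theta>"] W_lim[of \<theta>] by simp
    then have "(\<lambda>n. I (\<epsilon> n) \<theta>) \<longlonglongrightarrow> 0"
      by (rule Lim_null_comparison[rotated]) (simp add: Ib)
    then show ?thesis using \<open>W 0 \<theta> = 0\<close> by (simp add: J_def)
  qed
  have "(\<lambda>n. \<integral>\<theta>. I (\<epsilon> n) \<theta> \<partial>torus N) \<longlonglongrightarrow> (\<integral>\<theta>. J \<theta> \<partial>torus N)"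
  proof (rule integral_dominated_convergence[where w = "\<lambda>_. C * B"])
    show "integrable (torus N) (\<lambda>_. C * B)" by (rule integrable_torus_bounded) auto
    show "AE \<theta> in torus N. (\<lambda>n. I (\<epsilon> n) \<theta>) \<longlonglongrightarrow> J \<theta>" using lim by simp
    fix n
    have "cmod (I (\<epsilon> n) \<theta>) \<le> C * B" for \<theta>
      using Ib[of n \<theta>] mult_right_mono[OF WC(2)[of "\<epsilon> n" \<theta>] B0] eps[of n] by (auto intro: order.trans)
    then show "AE \<theta> in torus N. cmod (I (\<epsilon> n) \<theta>) \<le> C * B" by simp
  qed (use Im Jm in auto)
  then have "(\<integral>\<theta>. J \<theta> \<partial>torus N) = 0"
    using reg eps by (simp add: LIMSEQ_const_iff)
  then show ?thesis unfolding J_def W_def H_def circular_weight_eq .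
qed

subsection \<open>The inner product of the circular ensemble\<close>

definition Jint :: "real \<Rightarrow> nat \<Rightarrow> ((nat \<Rightarrow> real) \<Rightarrow> complex) \<Rightarrow> complex" where
  "Jint \<beta> N f = (\<integral>\<theta>. of_real (circular_weight \<beta> N \<theta>) * f \<theta> \<partial>torus N)"

definition ipN :: "real \<Rightarrow> nat \<Rightarrow> nat \<Rightarrow> (nat multiset \<Rightarrow> complex) \<Rightarrow> (nat multiset \<Rightarrow> complex) \<Rightarrow> complex" where
  "ipN \<beta> N K F G = Jint \<beta> N (\<lambda>\<theta>. ev N K F (ez \<theta>) * cnj (ev N K G (ez \<theta>))) / of_real (circular_partition \<beta> N)"

lemma circular_weight_measurable [measurable]: "circular_weight \<beta> N \<in> borel_measurable (torus N)"
  by (subst measurable_cong[OF circular_weight_eq]) measurable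

lemma circular_weight_bounds:
  assumes "\<beta> \<ge> 0"
  shows "0 \<le> circular_weight \<beta> N \<theta>" "circular_weight \<beta> N \<theta> \<le> (5 powr (\<beta> / 2)) ^ card (pairs N)"
  using reg_weight_bounds[of 0 \<beta>] assms by (auto simp: circular_weight_eq)

lemma integrable_weight_bounded:
  fixes f :: "(nat \<Rightarrow> real) \<Rightarrow> complex"
  assumes "\<beta> \<ge> 0" "f \<in> borel_measurable (torus N)" "\<And>\<theta>. cmod (f \<theta>) \<le> B"
  shows "integrable (torus N) (\<lambda>\<theta>. of_real (circular_weight \<beta> N \<theta>) * f \<theta>)"
proof (rule integrable_torus_bounded)
  show "(\<lambda>\<theta>. of_real (circular_weight \<beta> N \<theta>) * f \<theta>) \<in> borel_measurable (torus N)"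
    using assms(2) by measurable
  show "cmod (of_real (circular_weight \<beta> N \<theta>) * f \<theta>) \<le> (5 powr (\<beta> / 2)) ^ card (pairs N) * B" for \<theta>
    using circular_weight_bounds[OF assms(1), of N \<theta>] assms(3)[of \<theta>]
    by (auto simp: norm_mult intro!: mult_mono)
qed

lemma integrable_weight:
  assumes "\<beta> \<ge> 0" "f \<in> trigp N"
  shows "integrable (torus N) (\<lambda>\<theta>. of_real (circular_weight \<beta> N \<theta>) * f \<theta>)"
  using trigp_bounded[OF assms(2)] integrable_weight_bounded[OF assms(1) trigp_measurable[OF assms(2)]] by blast

lemma Jint_add: "\<beta> \<ge> 0 \<Longrightarrow> f \<in> trigp N \<Longrightarrow> g \<in> trigp N \<Longrightarrow> Jint \<beta> N (\<lambda>\<theta>. f \<theta> + g \<theta>) = Jint \<beta> N f + Jint \<beta> N g"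
  unfolding Jint_def distrib_left by (intro Bochner_Integration.integral_add integrable_weight)

lemma Jint_diff: "\<beta> \<ge> 0 \<Longrightarrow> f \<in> trigp N \<Longrightarrow> g \<in> trigp N \<Longrightarrow> Jint \<beta> N (\<lambda>\<theta>. f \<theta> - g \<theta>) = Jint \<beta> N f - Jint \<beta> N g"
  unfolding Jint_def right_diff_distrib by (intro Bochner_Integration.integral_diff integrable_weight)

lemma Jint_cmult: "Jint \<beta> N (\<lambda>\<theta>. c * f \<theta>) = c * Jint \<beta> N f"
  unfolding Jint_def by (simp add: mult.left_commute)

lemma Jint_cnj: "Jint \<beta> N (\<lambda>\<theta>. cnj (f \<theta>)) = cnj (Jint \<beta> N f)"
  proof -
  have "(\<lambda>\<theta>. of_real (circular_weight \<beta> N \<theta>) * cnj (f \<theta>)) = (\<lambda>\<theta>. cnj (of_real (circular_weight \<beta> N \<theta>) * f \<theta>))"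
    by simp
  then show ?thesis unfolding Jint_def by (simp only: Bochner_Integration.integral_cnj)
qed

lemma Jint_sum:
  assumes "\<beta> \<ge> 0" "\<And>a. a \<in> A \<Longrightarrow> f a \<in> trigp N"
  shows "Jint \<beta> N (\<lambda>\<theta>. \<Sum>a\<in>A. f a \<theta>) = (\<Sum>a\<in>A. Jint \<beta> N (f a))"
  unfolding Jint_def sum_distrib_left
  by (intro Bochner_Integration.integral_sum integrable_weight assms)

text \<open>Placing the j-th angle in the j-th of N disjoint intervals inside (0, pi) gives a box of
  positive measure on which the weight does not vanish.\<close>

lemma circular_partition_pos:
  assumes \<beta>: "\<beta> \<ge> 0"
  shows "circular_partition \<beta> N > 0"
proof -
  have nn: "circular_partition \<beta> N \<ge> 0"
    unfolding circular_partition_def by (intro integral_nonneg_AE) (simp add: circular_weight_bounds[OF \<beta>])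
  have int: "integrable (torus N) (circular_weight \<beta> N)"
    by (rule integrable_torus_bounded) (use circular_weight_bounds[OF \<beta>] in auto)
  have "circular_partition \<beta> N \<noteq> 0"
  proof
    assume "circular_partition \<beta> N = 0"
    then have ae: "AE \<theta> in torus N. circular_weight \<beta> N \<theta> = 0"
      unfolding circular_partition_def
      by (subst (asm) integral_nonneg_eq_0_iff_AE) (use int circular_weight_bounds[OF \<beta>] in auto)
    define h where "h = pi / real (Suc N)"
    have h: "h > 0" by (simp add: h_def)
    define A where "A j = {real j * h <..< real (Suc j) * h}" for j
    have hN: "real (Suc j) * h \<le> pi" if "j < N" for j
    proof -
      have "real (Suc j) * h \<le> real (Suc N) * h" using that h by (intro mult_right_mono) auto
      then show ?thesis by (simp add: h_def)
    qed
    have Asub: "A j \<subseteq> {-pi<..<pi}" if "j < N" for j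
    proof
      fix x assume "x \<in> A j"
      then have "real j * h < x" "x < real (Suc j) * h" by (auto simp: A_def)
      moreover have "0 \<le> real j * h" using h by simp
      ultimately have "0 < x" "x < pi" using hN[OF that] by linarith+
      moreover have "- pi < 0" by simp
      ultimately have "- pi < x" "x < pi" by linarith+
      then show "x \<in> {-pi<..<pi}" by simp
    qed
    have Asets: "A j \<in> sets arc_measure" if "j < N" for j
      using Asub[OF that] by (auto simp: arc_measure_def sets_restrict_space_iff A_def)
    have Aem: "emeasure arc_measure (A j) = ennreal h" if "j < N" for j
    proof -
      have "emeasure arc_measure (A j) = emeasure lborel (A j)"
        unfolding arc_measure_def by (rule emeasure_restrict_space) (use Asub[OF that] in auto)
      also have "\<dots> = ennreal h" using h by (simp add: A_def distrib_right)
      finally show ?thesis .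
    qed
    have pos: "circular_weight \<beta> N \<theta> \<noteq> 0" if \<theta>: "\<theta> \<in> Pi\<^sub>E {..<N} A" for \<theta>
    proof -
      have "2 - 2 * cos (\<theta> l - \<theta> m) \<noteq> 0" if p: "(l, m) \<in> pairs N" for l m
      proof -
        have lm: "l < m" "m < N" using p by (auto simp: pairs_def)
        have "\<theta> l \<in> A l" "\<theta> m \<in> A m" using PiE_mem[OF \<theta>] lm by simp_all
        then have "real l * h < \<theta> l" "\<theta> l < real (Suc l) * h" "real m * h < \<theta> m" "\<theta> m < real (Suc m) * h"
          by (simp_all only: A_def greaterThanLessThan_iff)
        moreover have "real (Suc l) * h \<le> real m * h" using lm h by (intro mult_right_mono) simp_all
        moreover have "real (Suc m) * h \<le> pi" by (rule hN[OF lm(2)])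
        moreover have "0 \<le> real l * h" using h by simp
        ultimately have "0 < \<theta> m - \<theta> l" "\<theta> m - \<theta> l < pi" by linarith+
        then have "cos (\<theta> m - \<theta> l) < cos 0" by (intro cos_monotone_0_pi) simp_all
        moreover have "cos (\<theta> l - \<theta> m) = cos (\<theta> m - \<theta> l)" by (metis cos_minus minus_diff_eq)
        ultimately show ?thesis by simp
      qed
      then show ?thesis by (auto simp: circular_weight_eq reg_weight_def)
    qed
    have "AE \<theta> in torus N. \<theta> \<notin> Pi\<^sub>E {..<N} A" using ae by eventually_elim (use pos in auto)
    moreover have "Pi\<^sub>E {..<N} A \<in> sets (torus N)" by (intro sets_PiM_I_finite) (auto simp: Asets)
    ultimately have "emeasure (torus N) (Pi\<^sub>E {..<N} A) = 0"
      using AE_iff_null_sets by blast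
    moreover have "emeasure (torus N) (Pi\<^sub>E {..<N} A) = (\<Prod>j<N. ennreal h)"
      by (subst arc.emeasure_PiM) (auto simp: Asets Aem)
    ultimately show False using h by simp
  qed
  then show ?thesis using nn by simp
qed

lemma trigp_ev: "(\<lambda>\<theta>. ev N K F (ez \<theta>)) \<in> trigp N"
proof -
  have ps: "(\<lambda>\<theta>. psum N k (ez \<theta>)) \<in> trigp N" for k
    unfolding psum_def by (intro trigp_sum trigp_power trigp.ei) auto
  have "(\<lambda>\<theta>. mp N \<mu> (ez \<theta>)) \<in> trigp N" for \<mu>
    by (induction \<mu>) (auto intro!: trigp.intros ps)
  then show ?thesis unfolding ev_def by (intro trigp_sum trigp.mult trigp.const)
qed

lemma trigp_D1: "i < N \<Longrightarrow> (\<lambda>\<theta>. D1 N K i F (ez \<theta>)) \<in> trigp N"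
  unfolding D1_def by (intro trigp_sum trigp.mult trigp_power trigp_ev trigp.ei trigp.const)

lemma trigp_D2: "i < N \<Longrightarrow> (\<lambda>\<theta>. D2 N K i F (ez \<theta>)) \<in> trigp N"
  unfolding D2_def by (intro trigp.add trigp_sum trigp.mult trigp_power trigp_ev trigp.ei trigp.const)

lemma trigp_DQ: "i < N \<Longrightarrow> j < N \<Longrightarrow> (\<lambda>\<theta>. DQ N K i j F (ez \<theta>)) \<in> trigp N"
  unfolding DQ_def by (intro trigp_sum trigp.mult trigp_power trigp_ev trigp.ei trigp.const)

lemma ez_upd: "ez (\<theta>(i := t)) = (ez \<theta>)(i := exp (\<i> * complex_of_real t))"
  by auto

lemma exp_i_deriv: "((\<lambda>t. exp (\<i> * complex_of_real t)) has_vector_derivative \<i> * exp (\<i> * complex_of_real t)) (at t)"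
  by (rule has_vector_derivative_real_field) (auto intro!: derivative_eq_intros)

lemma ez_chain:
  assumes "\<And>z t. ((\<lambda>t. f (z(i := t))) has_field_derivative f' (z(i := t))) (at t)"
  shows "((\<lambda>t. f (ez (\<theta>(i := t)))) has_vector_derivative
     \<i> * (ez (\<theta>(i := t)) i * f' (ez (\<theta>(i := t))))) (at t)"
proof -
  have "(((\<lambda>t. f ((ez \<theta>)(i := t))) \<circ> (\<lambda>t. exp (\<i> * complex_of_real t))) has_vector_derivative
     (\<i> * exp (\<i> * complex_of_real t)) * f' ((ez \<theta>)(i := exp (\<i> * complex_of_real t)))) (at t)"
    by (rule field_vector_diff_chain_at[OF exp_i_deriv assms])
  then show ?thesis unfolding ez_upd by (simp add: o_def mult.assoc)
qed

lemma ev_ez_deriv: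
  assumes i: "i < N" and F: "F \<in> supported (partitions_upto K)"
  shows "((\<lambda>t. ev N K F (ez (\<theta>(i := t)))) has_vector_derivative \<i> * D1 N K i F (ez (\<theta>(i := t)))) (at t)"
proof -
  have "D1 N K i F z = z i * (\<Sum>k=1..K. of_nat k * z i ^ (k - 1) * ev N K (dp k F) z)" for z
    unfolding D1_def sum_distrib_left
  proof (intro sum.cong refl)
    fix k assume "k \<in> {1..K}"
    then have "z i ^ k = z i * z i ^ (k - 1)" by (cases k) auto
    then show "of_nat k * z i ^ k * ev N K (dp k F) z = z i * (of_nat k * z i ^ (k - 1) * ev N K (dp k F) z)"
      by (simp add: mult_ac)
  qed
  moreover have "((\<lambda>t. ev N K F (z(i := t))) has_field_derivative
      (\<Sum>k=1..K. of_nat k * (z(i := t)) i ^ (k - 1) * ev N K (dp k F) (z(i := t)))) (at t)" for z t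
    using ev_deriv[OF i F, of z t] by simp
  from ez_chain[OF this, of \<theta> t] show ?thesis by (simp only: calculation)
qed

lemma D1_ez_deriv:
  assumes i: "i < N" and F: "F \<in> supported (partitions_upto K)"
  shows "((\<lambda>t. D1 N K i F (ez (\<theta>(i := t)))) has_vector_derivative \<i> * D2 N K i F (ez (\<theta>(i := t)))) (at t)"
proof -
  have "((\<lambda>t. D1 N K i F (z(i := t))) has_field_derivative
     (\<Sum>k=1..K. of_nat k * (of_nat k * (z(i := t)) i ^ (k - 1) * ev N K (dp k F) (z(i := t))
       + (z(i := t)) i ^ k * (\<Sum>l=1..K. of_nat l * (z(i := t)) i ^ (l - 1) * ev N K (dp l (dp k F)) (z(i := t)))))) (at t)" for z t
    using D1_D2_deriv[OF i F, of z t] by simp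
  from ez_chain[OF this, of \<theta> t] show ?thesis by (simp only: D2_alt)
qed

lemma has_vector_derivative_cnj':
  "(f has_vector_derivative f') F \<Longrightarrow> ((\<lambda>t. cnj (f t)) has_vector_derivative cnj f') F"
  by (rule bounded_linear.has_vector_derivative[OF bounded_linear_cnj])

context
  fixes \<beta> :: real and N K :: nat
  assumes \<beta>: "\<beta> > 0"
begin

private lemma b0: "\<beta> \<ge> 0" using \<beta> by simp

lemma ipN_add_left: "ipN \<beta> N K (F + F') G = ipN \<beta> N K F G + ipN \<beta> N K F' G"
  by (simp add: ipN_def ev_add distrib_right Jint_add[OF b0] trigp_intros trigp_ev add_divide_distrib)

lemma ipN_scale_left: "ipN \<beta> N K (cscale c F) G = c * ipN \<beta> N K F G"
  by (simp add: ipN_def ev_scale mult.assoc Jint_cmult)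

lemma ipN_cnj: "cnj (ipN \<beta> N K F G) = ipN \<beta> N K G F"
  by (simp add: ipN_def mult.commute flip: Jint_cnj)

lemma ipN_add_right: "ipN \<beta> N K F (G + G') = ipN \<beta> N K F G + ipN \<beta> N K F G'"
  using ipN_add_left[of G G' F] ipN_cnj by (metis complex_cnj_add)

lemma ipN_scale_right: "ipN \<beta> N K F (cscale c G) = cnj c * ipN \<beta> N K F G"
  using ipN_scale_left[of c G F] ipN_cnj by (metis complex_cnj_mult)

lemma ipN_0_right: "ipN \<beta> N K F 0 = 0"
  by (simp add: ipN_def ev_0 Jint_def)

lemma ipN_sum_right: "ipN \<beta> N K F (\<Sum>a\<in>A. G a) = (\<Sum>a\<in>A. ipN \<beta> N K F (G a))"
  by (induction A rule: infinite_finite_induct) (simp_all add: ipN_add_right ipN_0_right)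

lemma ipN_self: "\<exists>x\<ge>0. ipN \<beta> N K F F = complex_of_real x"
proof -
  have "Jint \<beta> N (\<lambda>\<theta>. ev N K F (ez \<theta>) * cnj (ev N K F (ez \<theta>))) =
     complex_of_real (\<integral>\<theta>. circular_weight \<beta> N \<theta> * (cmod (ev N K F (ez \<theta>)))\<^sup>2 \<partial>torus N)"
    unfolding Jint_def integral_complex_of_real[symmetric]
    by (intro Bochner_Integration.integral_cong refl) (simp only: of_real_mult complex_norm_square)
  moreover have "(\<integral>\<theta>. circular_weight \<beta> N \<theta> * (cmod (ev N K F (ez \<theta>)))\<^sup>2 \<partial>torus N) \<ge> 0"
    by (intro integral_nonneg_AE) (simp add: circular_weight_bounds[OF b0])
  ultimately show ?thesis
    using circular_partition_pos[OF b0, of N] unfolding ipN_def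
    by (intro exI[of _ "(\<integral>\<theta>. circular_weight \<beta> N \<theta> * (cmod (ev N K F (ez \<theta>)))\<^sup>2 \<partial>torus N) / circular_partition \<beta> N"]) auto
qed

lemma sum_D1:
  assumes F: "F \<in> hom d" "d \<le> K"
  shows "(\<Sum>i<N. D1 N K i F z) = of_nat d * ev N K F z"
proof -
  have Fs: "F \<in> supported (partitions_upto K)" by (rule hom_upto[OF F])
  have "of_nat d * ev N K F z = ev N K (\<Sum>k=1..K. cscale (of_nat k) (pm k (dp k F))) z"
    by (simp only: euler[OF F] ev_scale)
  also have "\<dots> = (\<Sum>k=1..K. \<Sum>i<N. of_nat k * z i ^ k * ev N K (dp k F) z)"
    by (simp add: ev_linear ev_pm_dp[OF Fs] psum_def sum_distrib_left sum_distrib_right mult_ac)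
  also have "\<dots> = (\<Sum>i<N. D1 N K i F z)"
    unfolding D1_def by (rule sum.swap)
  finally show ?thesis by simp
qed

text \<open>Integration by parts against the generator of simultaneous rotations.\<close>

lemma ipN_orthogonal:
  assumes F: "F \<in> hom d" "d \<le> K" and G: "G \<in> hom e" "e \<le> K" and ne: "d \<noteq> e"
  shows "ipN \<beta> N K F G = 0"
proof -
  define f g where "f \<theta> = ev N K F (ez \<theta>)" and "g \<theta> = ev N K G (ez \<theta>)" for \<theta>
  have Fs: "F \<in> supported (partitions_upto K)" and Gs: "G \<in> supported (partitions_upto K)"
    by (auto intro: hom_upto F G)
  have tp: "f \<in> trigp N" "g \<in> trigp N" by (simp_all add: f_def[abs_def] g_def[abs_def] trigp_ev)
  define h' where "h' i \<theta> = f \<theta> * cnj (\<i> * D1 N K i G (ez \<theta>)) + \<i> * D1 N K i F (ez \<theta>) * cnj (g \<theta>)" for i \<theta>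
  have "Jint \<beta> N (\<lambda>\<theta>. (\<Sum>i<N. h' i \<theta>)
     + \<i> * of_real (\<beta> / 2) * (\<Sum>(l,m)\<in>pairs N. (ez \<theta> l + ez \<theta> m) * 0)) = 0"
    unfolding Jint_def
  proof (rule circular_integration_by_parts[OF \<beta>, where h = "\<lambda>i \<theta>. f \<theta> * cnj (g \<theta>)"])
    fix i \<theta> t assume i: "i < N"
    show "((\<lambda>t. f (\<theta>(i := t)) * cnj (g (\<theta>(i := t)))) has_vector_derivative h' i (\<theta>(i := t))) (at t)"
      unfolding f_def g_def h'_def
      by (rule has_vector_derivative_mult[OF ev_ez_deriv[OF i Fs] has_vector_derivative_cnj'[OF ev_ez_deriv[OF i Gs]]])
    show "(\<lambda>\<theta>. f \<theta> * cnj (g \<theta>)) \<in> trigp N" "h' i \<in> trigp N"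
      using i by (auto simp: h'_def[abs_def] simp del: complex_cnj_mult intro!: trigp_intros tp trigp_D1)
  qed (auto intro: trigp.intros)
  moreover have "(\<Sum>i<N. h' i \<theta>) = \<i> * (of_nat d - of_nat e) * (f \<theta> * cnj (g \<theta>))" for \<theta>
  proof -
    have "(\<Sum>i<N. h' i \<theta>) = \<i> * ((\<Sum>i<N. D1 N K i F (ez \<theta>)) * cnj (g \<theta>)) - \<i> * (f \<theta> * cnj (\<Sum>i<N. D1 N K i G (ez \<theta>)))"
      by (simp add: h'_def sum.distrib sum_distrib_left sum_distrib_right sum_negf mult_ac sum_subtractf[symmetric])
    then show ?thesis unfolding sum_D1[OF F] sum_D1[OF G] by (simp add: f_def g_def algebra_simps)
  qed
  ultimately have "\<i> * (of_nat d - of_nat e) * Jint \<beta> N (\<lambda>\<theta>. f \<theta> * cnj (g \<theta>)) = 0"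
    by (simp add: Jint_cmult[symmetric])
  then have "Jint \<beta> N (\<lambda>\<theta>. f \<theta> * cnj (g \<theta>)) = 0" using ne by simp
  then show ?thesis by (simp add: ipN_def f_def g_def)
qed

lemma ev_shift_up:
  assumes G: "G \<in> hom e" "Suc e \<le> K"
  shows "ev N K (shift_up K G) z = (\<Sum>i<N. z i * D1 N K i G z)"
proof -
  have Gs: "G \<in> supported (partitions_upto K)" by (rule hom_upto[OF G(1)]) (use G in simp)
  have pd: "ev N K (pm (j + 1) (dp j G)) z = psum N (j + 1) z * ev N K (dp j G) z" if "j \<ge> 1" for j
  proof (cases "j \<le> e")
    case True
    have "dp j G \<in> supported (partitions_upto (e - j))"
      using True dp_hom[of G "e - j" j] G hom_upto[of _ "e - j" "e - j"] by simp
    then show ?thesis using ev_pm[of "dp j G" "e - j" "j + 1" K] True G by simp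
  next
    case False
    then have "dp j G = 0" using dp_eq_0[of G e j] hom_upto[OF G(1), of e] by simp
    then show ?thesis by (simp add: pm_simps ev_0)
  qed
  have "ev N K (shift_up K G) z = (\<Sum>j=1..K. \<Sum>i<N. z i * (of_nat j * z i ^ j * ev N K (dp j G) z))"
    unfolding shift_up_def ev_linear
    by (intro sum.cong refl, subst pd)
      (auto simp: psum_def sum_distrib_left sum_distrib_right mult_ac)
  also have "\<dots> = (\<Sum>i<N. z i * D1 N K i G z)"
    unfolding D1_def sum_distrib_left by (rule sum.swap)
  finally show ?thesis .
qed

lemma sum_pairs_add: "(\<Sum>(l,m)\<in>pairs M. a l + a m) = (of_nat M - 1) * (\<Sum>i<M. a i :: complex)"
proof (induction M)
  case 0
  then show ?case by (simp add: pairs_def)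
next
  case (Suc M)
  then show ?case by (simp add: sum_pairs_Suc sum.distrib algebra_simps)
qed

text \<open>Integration by parts against the vector field \<open>\<Sum>\<^sub>i \<partial>\<^sub>i\<close>: the number of variables \<open>N\<close> on one side becomes
  \<open>N + \<alpha> - 1\<close> on the other.\<close>

lemma ipN_low:
  assumes F: "F \<in> supported (partitions_upto K)" and G: "G \<in> hom e" "Suc e \<le> K" and \<alpha>: "\<alpha> = 2 / \<beta>"
  shows "ipN \<beta> N K (low (of_nat N) K F) G = ipN \<beta> N K F (rai \<alpha> (of_real (real N + \<alpha> - 1)) K G)"
proof -
  define f g where "f \<theta> = ev N K F (ez \<theta>)" and "g \<theta> = ev N K G (ez \<theta>)" for \<theta>
  have Gs: "G \<in> supported (partitions_upto K)" by (rule hom_upto[OF G(1)]) (use G in simp)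
  have tp: "f \<in> trigp N" "g \<in> trigp N" by (simp_all add: f_def[abs_def] g_def[abs_def] trigp_ev)
  \<comment> \<open>Dividing the Euler field by its coordinate leaves the plain partial derivative.
    On the circle the inverse is the conjugate, so on the side of G the same factor becomes
    multiplication by z i.\<close>
  define e' where "e' i \<theta> = exp (- (\<i> * complex_of_real (\<theta> i)))" for i and \<theta> :: "nat \<Rightarrow> real"
  have e'_ez: "e' i \<theta> * ez \<theta> i = 1" "cnj (e' i \<theta>) = ez \<theta> i" "cnj (ez \<theta> i) = e' i \<theta>" for i \<theta>
    by (simp_all add: e'_def exp_cnj flip: exp_add)
  have te': "e' i \<in> trigp N" if "i < N" for i unfolding e'_def[abs_def] by (rule trigp.ei_neg[OF that])
  define h' where "h' i \<theta> = e' i \<theta> * (f \<theta> * cnj (\<i> * D1 N K i G (ez \<theta>)) + \<i> * D1 N K i F (ez \<theta>) * cnj (g \<theta>))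
      + - \<i> * e' i \<theta> * (f \<theta> * cnj (g \<theta>))" for i \<theta>
  \<comment> \<open>From 1 / x - 1 / y = - (x - y) / (x * y).\<close>
  define q where "q l m \<theta> = - (e' l \<theta> * e' m \<theta>) * (f \<theta> * cnj (g \<theta>))" for l m :: nat and \<theta>
  have "Jint \<beta> N (\<lambda>\<theta>. (\<Sum>i<N. h' i \<theta>)
     + \<i> * of_real (\<beta> / 2) * (\<Sum>(l,m)\<in>pairs N. (ez \<theta> l + ez \<theta> m) * q l m \<theta>)) = 0"
    unfolding Jint_def
  proof (rule circular_integration_by_parts[OF \<beta>, where h = "\<lambda>i \<theta>. e' i \<theta> * (f \<theta> * cnj (g \<theta>))"])
    fix i \<theta> t assume i: "i < N"
    have "((\<lambda>t. e' i (\<theta>(i := t))) has_vector_derivative - \<i> * e' i (\<theta>(i := t))) (at t)"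
      unfolding e'_def fun_upd_same
      by (rule has_vector_derivative_real_field[of "\<lambda>x. exp (- (\<i> * x))"]) (auto intro!: derivative_eq_intros)
    from has_vector_derivative_mult[OF this has_vector_derivative_mult[OF ev_ez_deriv[OF i F, of \<theta> t] has_vector_derivative_cnj'[OF ev_ez_deriv[OF i Gs, of \<theta> t]]]]
    show "((\<lambda>t. e' i (\<theta>(i := t)) * (f (\<theta>(i := t)) * cnj (g (\<theta>(i := t))))) has_vector_derivative h' i (\<theta>(i := t))) (at t)"
      unfolding f_def g_def h'_def .
    show "(\<lambda>\<theta>. e' i \<theta> * (f \<theta> * cnj (g \<theta>))) \<in> trigp N" "h' i \<in> trigp N"
      using i te'[OF i] tp
      by (auto simp: h'_def[abs_def] simp del: complex_cnj_mult mult_minus_left intro!: trigp_intros trigp_D1)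
  next
    fix l m assume "(l, m) \<in> pairs N"
    then have "l < N" "m < N" by (auto simp: pairs_def)
    then show "q l m \<in> trigp N" using te' tp unfolding q_def[abs_def] by (intro trigp_intros) auto
    fix \<theta> :: "nat \<Rightarrow> real"
    have "(ez \<theta> l - ez \<theta> m) * q l m \<theta> = ((e' m \<theta> * ez \<theta> m) * e' l \<theta> - (e' l \<theta> * ez \<theta> l) * e' m \<theta>) * (f \<theta> * cnj (g \<theta>))"
      by (simp add: q_def algebra_simps)
    then show "e' l \<theta> * (f \<theta> * cnj (g \<theta>)) - e' m \<theta> * (f \<theta> * cnj (g \<theta>)) = (ez \<theta> l - ez \<theta> m) * q l m \<theta>"
      by (simp only: e'_ez) (simp add: algebra_simps)
  qed
  moreover have "(\<Sum>i<N. h' i \<theta>) + \<i> * of_real (\<beta> / 2) * (\<Sum>(l,m)\<in>pairs N. (ez \<theta> l + ez \<theta> m) * q l m \<theta>)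
     = \<i> * (ev N K (low (of_nat N) K F) (ez \<theta>) * cnj (g \<theta>)
        - f \<theta> * cnj (ev N K (rai \<alpha> (of_real (real N + \<alpha> - 1)) K G) (ez \<theta>)))" for \<theta>
  proof -
    have pq: "(\<Sum>(l,m)\<in>pairs N. (ez \<theta> l + ez \<theta> m) * q l m \<theta>) = - ((of_nat N - 1) * (\<Sum>i<N. e' i \<theta>)) * (f \<theta> * cnj (g \<theta>))"
    proof -
      have "(ez \<theta> l + ez \<theta> m) * q l m \<theta> = - ((e' l \<theta> + e' m \<theta>) * (f \<theta> * cnj (g \<theta>)))" for l m
      proof -
        have "(ez \<theta> l + ez \<theta> m) * q l m \<theta> = - (((e' l \<theta> * ez \<theta> l) * e' m \<theta> + (e' m \<theta> * ez \<theta> m) * e' l \<theta>) * (f \<theta> * cnj (g \<theta>)))"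
          by (simp add: q_def algebra_simps)
        then show ?thesis by (simp only: e'_ez) (simp add: algebra_simps)
      qed
      then have "(\<Sum>(l,m)\<in>pairs N. (ez \<theta> l + ez \<theta> m) * q l m \<theta>) = - ((\<Sum>(l,m)\<in>pairs N. e' l \<theta> + e' m \<theta>) * (f \<theta> * cnj (g \<theta>)))"
        by (simp add: case_prod_beta sum_negf sum_distrib_right)
      then show ?thesis by (simp add: sum_pairs_add)
    qed
    have lo: "ev N K (low (of_nat N) K F) (ez \<theta>) = (\<Sum>i<N. e' i \<theta> * D1 N K i F (ez \<theta>))"
      unfolding ev_low[OF F] D1_def sum_distrib_left
    proof (intro sum.cong refl)
      fix i k assume "k \<in> {1..K}"
      then have "ez \<theta> i ^ k = ez \<theta> i * ez \<theta> i ^ (k - 1)" by (cases k) auto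
      then have "e' i \<theta> * (of_nat k * ez \<theta> i ^ k * ev N K (dp k F) (ez \<theta>)) =
        (e' i \<theta> * ez \<theta> i) * (of_nat k * ez \<theta> i ^ (k - 1) * ev N K (dp k F) (ez \<theta>))"
        by (simp only: mult_ac)
      then show "of_nat k * ez \<theta> i ^ (k - 1) * ev N K (dp k F) (ez \<theta>) =
        e' i \<theta> * (of_nat k * ez \<theta> i ^ k * ev N K (dp k F) (ez \<theta>))"
        by (simp only: e'_ez mult_1)
    qed
    have "cnj (ev N K (shift_up K G) (ez \<theta>)) = (\<Sum>i<N. e' i \<theta> * cnj (D1 N K i G (ez \<theta>)))"
      unfolding ev_shift_up[OF G] by (simp only: cnj_sum complex_cnj_mult e'_ez)
    moreover have "cnj (ev N K (pm 1 G) (ez \<theta>)) = (\<Sum>i<N. e' i \<theta>) * cnj (g \<theta>)"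
    proof -
      have "ev N K (pm 1 G) (ez \<theta>) = psum N 1 (ez \<theta>) * g \<theta>"
        unfolding g_def by (rule ev_pm[of G e]) (use G hom_upto[OF G(1), of e] in auto)
      then show ?thesis by (simp only: psum_def power_one_right complex_cnj_mult cnj_sum e'_ez)
    qed
    ultimately have ra: "cnj (ev N K (rai \<alpha> (of_real (real N + \<alpha> - 1)) K G) (ez \<theta>)) =
       of_real ((real N + \<alpha> - 1) / \<alpha>) * ((\<Sum>i<N. e' i \<theta>) * cnj (g \<theta>)) + (\<Sum>i<N. e' i \<theta> * cnj (D1 N K i G (ez \<theta>)))"
      unfolding rai_def ev_add ev_scale by (simp only: complex_cnj_add complex_cnj_mult complex_cnj_divide complex_cnj_complex_of_real of_real_divide)
    define c where "c = complex_of_real (\<beta> / 2)"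
    \<comment> \<open>The 1 comes from differentiating e' itself; the rest arises because each e' i
      occurs in N - 1 pairs with weight \<beta> / 2. This is the origin of N + \<alpha> - 1.\<close>
    have "(real N + \<alpha> - 1) / \<alpha> = 1 + \<beta> / 2 * (real N - 1)"
      using \<beta> by (simp add: \<alpha> field_simps)
    then have al: "complex_of_real ((real N + \<alpha> - 1) / \<alpha>) = 1 + c * (of_nat N - 1)"
      by (simp add: c_def)
    have "(\<Sum>i<N. h' i \<theta>) = \<i> * ((\<Sum>i<N. e' i \<theta> * D1 N K i F (ez \<theta>)) * cnj (g \<theta>)
       - f \<theta> * (\<Sum>i<N. e' i \<theta> * cnj (D1 N K i G (ez \<theta>))) - (\<Sum>i<N. e' i \<theta>) * (f \<theta> * cnj (g \<theta>)))"
      unfolding sum_distrib_left sum_distrib_right sum_subtractf[symmetric]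
      by (intro sum.cong refl) (simp add: h'_def algebra_simps)
    then show ?thesis
      unfolding lo ra pq al c_def[symmetric] by (simp add: algebra_simps)
  qed
  ultimately have "\<i> * Jint \<beta> N (\<lambda>\<theta>. ev N K (low (of_nat N) K F) (ez \<theta>) * cnj (g \<theta>)
        - f \<theta> * cnj (ev N K (rai \<alpha> (of_real (real N + \<alpha> - 1)) K G) (ez \<theta>))) = 0"
    by (simp add: Jint_cmult[symmetric])
  then have "Jint \<beta> N (\<lambda>\<theta>. ev N K (low (of_nat N) K F) (ez \<theta>) * cnj (g \<theta>))
     = Jint \<beta> N (\<lambda>\<theta>. f \<theta> * cnj (ev N K (rai \<alpha> (of_real (real N + \<alpha> - 1)) K G) (ez \<theta>)))"
    by (subst (asm) Jint_diff[OF b0]) (auto intro!: trigp_intros trigp_ev tp)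
  then show ?thesis by (simp add: ipN_def f_def g_def)
qed

text \<open>One integration by parts leaves a Dirichlet form in the Euler derivatives of F and G and
  a real multiple of the product of F and G, both of which are Hermitian.\<close>

lemma ipN_lap:
  assumes F: "F \<in> hom d" "d \<le> K" and G: "G \<in> hom d" and \<alpha>: "\<alpha> = 2 / \<beta>"
  shows "ipN \<beta> N K (lap \<alpha> K F) G = ipN \<beta> N K F (lap \<alpha> K G)"
proof -
  have dir: "Jint \<beta> N (\<lambda>\<theta>. ev N K (lap \<alpha> K F) (ez \<theta>) * cnj (ev N K G (ez \<theta>))) =
      of_real \<alpha> * (\<Sum>i<N. Jint \<beta> N (\<lambda>\<theta>. D1 N K i F (ez \<theta>) * cnj (D1 N K i G (ez \<theta>))))
      - of_real (real N + \<alpha> - 1) * of_nat d * Jint \<beta> N (\<lambda>\<theta>. ev N K F (ez \<theta>) * cnj (ev N K G (ez \<theta>)))"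
    if F: "F \<in> hom d" and G: "G \<in> hom d" for F G
  proof -
    define f g where "f \<theta> = ev N K F (ez \<theta>)" and "g \<theta> = ev N K G (ez \<theta>)" for \<theta>
    have Fs: "F \<in> supported (partitions_upto K)" and Gs: "G \<in> supported (partitions_upto K)"
      using assms(2) by (auto intro: hom_upto[OF F] hom_upto[OF G])
    have tp: "f \<in> trigp N" "g \<in> trigp N" by (simp_all add: f_def[abs_def] g_def[abs_def] trigp_ev)
    define h' where "h' i \<theta> = D1 N K i F (ez \<theta>) * cnj (\<i> * D1 N K i G (ez \<theta>)) + \<i> * D2 N K i F (ez \<theta>) * cnj (g \<theta>)" for i \<theta>
    define q where "q l m \<theta> = DQ N K l m F (ez \<theta>) * cnj (g \<theta>)" for l m \<theta>
    have "Jint \<beta> N (\<lambda>\<theta>. (\<Sum>i<N. h' i \<theta>)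
       + \<i> * of_real (\<beta> / 2) * (\<Sum>(l,m)\<in>pairs N. (ez \<theta> l + ez \<theta> m) * q l m \<theta>)) = 0"
      unfolding Jint_def
    proof (rule circular_integration_by_parts[OF \<beta>, where h = "\<lambda>i \<theta>. D1 N K i F (ez \<theta>) * cnj (g \<theta>)"])
      fix i \<theta> t assume i: "i < N"
      show "((\<lambda>t. D1 N K i F (ez (\<theta>(i := t))) * cnj (g (\<theta>(i := t)))) has_vector_derivative h' i (\<theta>(i := t))) (at t)"
        unfolding g_def h'_def
        by (rule has_vector_derivative_mult[OF D1_ez_deriv[OF i Fs] has_vector_derivative_cnj'[OF ev_ez_deriv[OF i Gs]]])
      show "(\<lambda>\<theta>. D1 N K i F (ez \<theta>) * cnj (g \<theta>)) \<in> trigp N" "h' i \<in> trigp N"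
        using i tp by (auto simp: h'_def[abs_def] simp del: complex_cnj_mult intro!: trigp_intros trigp_D1 trigp_D2)
    next
      fix l m assume "(l, m) \<in> pairs N"
      then have "l < N" "m < N" by (auto simp: pairs_def)
      then show "q l m \<in> trigp N" using tp unfolding q_def[abs_def] by (intro trigp.mult trigp_cnj trigp_DQ)
      fix \<theta> :: "nat \<Rightarrow> real"
      show "D1 N K l F (ez \<theta>) * cnj (g \<theta>) - D1 N K m F (ez \<theta>) * cnj (g \<theta>) = (ez \<theta> l - ez \<theta> m) * q l m \<theta>"
        using DQ_D1[of "ez \<theta>" l m N K F] by (simp add: q_def left_diff_distrib mult.assoc[symmetric])
    qed
    moreover have "of_real \<alpha> * ((\<Sum>i<N. h' i \<theta>)
       + \<i> * of_real (\<beta> / 2) * (\<Sum>(l,m)\<in>pairs N. (ez \<theta> l + ez \<theta> m) * q l m \<theta>)) =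
       \<i> * ((ev N K (lap \<alpha> K F) (ez \<theta>) * cnj (g \<theta>) + of_real (real N + \<alpha> - 1) * of_nat d * (f \<theta> * cnj (g \<theta>)))
         - of_real \<alpha> * (\<Sum>i<N. D1 N K i F (ez \<theta>) * cnj (D1 N K i G (ez \<theta>))))" for \<theta>
    proof -
      define U V P where "U = (\<Sum>i<N. D2 N K i F (ez \<theta>))"
        and "V = (\<Sum>i<N. D1 N K i F (ez \<theta>) * cnj (D1 N K i G (ez \<theta>)))"
        and "P = (\<Sum>(l,m)\<in>pairs N. (ez \<theta> l + ez \<theta> m) * DQ N K l m F (ez \<theta>))"
      define c where "c = complex_of_real (\<beta> / 2)"
      have 1: "(\<Sum>i<N. h' i \<theta>) = \<i> * (U * cnj (g \<theta>) - V)"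
        unfolding U_def V_def sum_distrib_left sum_distrib_right sum_subtractf[symmetric]
        by (intro sum.cong refl) (simp add: h'_def algebra_simps)
      have 2: "(\<Sum>(l,m)\<in>pairs N. (ez \<theta> l + ez \<theta> m) * q l m \<theta>) = P * cnj (g \<theta>)"
        by (simp add: q_def P_def case_prod_beta sum_distrib_right mult.assoc)
      \<comment> \<open>With \<alpha> = 2 / \<beta> the cotangents of the weight match the pair
        interaction in \<open>lap\<close> exactly.\<close>
      have 3: "complex_of_real \<alpha> * c = 1"
        using \<beta> by (simp add: \<alpha> c_def)
      have "of_real \<alpha> * (\<i> * (U * cnj (g \<theta>) - V) + \<i> * c * (P * cnj (g \<theta>))) =
        of_real \<alpha> * \<i> * (U * cnj (g \<theta>) - V) + \<i> * ((of_real \<alpha> * c) * (P * cnj (g \<theta>)))"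
        by (simp add: algebra_simps)
      also have "\<dots> = of_real \<alpha> * \<i> * (U * cnj (g \<theta>) - V) + \<i> * (P * cnj (g \<theta>))"
        by (simp add: 3)
      finally show ?thesis
        unfolding 1 2 c_def[symmetric] ev_lap[OF F assms(2)] U_def[symmetric] V_def[symmetric] P_def[symmetric] f_def
        by (simp add: algebra_simps)
    qed
    ultimately have J0: "\<i> * Jint \<beta> N (\<lambda>\<theta>. (ev N K (lap \<alpha> K F) (ez \<theta>) * cnj (g \<theta>) + of_real (real N + \<alpha> - 1) * of_nat d * (f \<theta> * cnj (g \<theta>)))
         - of_real \<alpha> * (\<Sum>i<N. D1 N K i F (ez \<theta>) * cnj (D1 N K i G (ez \<theta>)))) = 0"
      unfolding Jint_cmult[symmetric] by (metis (no_types, lifting) Jint_cmult mult_zero_right ext)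
    have tA: "(\<lambda>\<theta>. ev N K (lap \<alpha> K F) (ez \<theta>) * cnj (g \<theta>)) \<in> trigp N"
      and tB: "(\<lambda>\<theta>. of_real (real N + \<alpha> - 1) * of_nat d * (f \<theta> * cnj (g \<theta>))) \<in> trigp N"
      by (intro trigp.mult trigp.const trigp_cnj trigp_ev tp)+
    have tD: "(\<lambda>\<theta>. D1 N K i F (ez \<theta>) * cnj (D1 N K i G (ez \<theta>))) \<in> trigp N" if "i \<in> {..<N}" for i
      using that by (intro trigp.mult trigp_cnj trigp_D1) auto
    have "Jint \<beta> N (\<lambda>\<theta>. ev N K (lap \<alpha> K F) (ez \<theta>) * cnj (g \<theta>))
       + of_real (real N + \<alpha> - 1) * of_nat d * Jint \<beta> N (\<lambda>\<theta>. f \<theta> * cnj (g \<theta>))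
       - of_real \<alpha> * (\<Sum>i<N. Jint \<beta> N (\<lambda>\<theta>. D1 N K i F (ez \<theta>) * cnj (D1 N K i G (ez \<theta>)))) = 0"
    proof -
      have tS: "(\<lambda>\<theta>. \<Sum>i<N. D1 N K i F (ez \<theta>) * cnj (D1 N K i G (ez \<theta>))) \<in> trigp N"
        and jS: "Jint \<beta> N (\<lambda>\<theta>. \<Sum>i<N. D1 N K i F (ez \<theta>) * cnj (D1 N K i G (ez \<theta>))) =
          (\<Sum>i<N. Jint \<beta> N (\<lambda>\<theta>. D1 N K i F (ez \<theta>) * cnj (D1 N K i G (ez \<theta>))))"
        by (rule trigp_sum[OF tD] Jint_sum[OF b0 tD]; assumption)+
      show ?thesis
        using J0 unfolding mult_eq_0_iff Jint_diff[OF b0 trigp.add[OF tA tB] trigp.mult[OF trigp.const tS]]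
          Jint_add[OF b0 tA tB] Jint_cmult jS by simp
    qed
    then show ?thesis by (simp add: f_def g_def algebra_simps)
  qed
  define Z where "Z = circular_partition \<beta> N"
  have sw: "Jint \<beta> N (\<lambda>\<theta>. u \<theta> * cnj (v \<theta>)) = cnj (Jint \<beta> N (\<lambda>\<theta>. v \<theta> * cnj (u \<theta>)))" for u v
    by (simp add: mult.commute flip: Jint_cnj)
  have "Jint \<beta> N (\<lambda>\<theta>. ev N K (lap \<alpha> K F) (ez \<theta>) * cnj (ev N K G (ez \<theta>))) =
     cnj (Jint \<beta> N (\<lambda>\<theta>. ev N K (lap \<alpha> K G) (ez \<theta>) * cnj (ev N K F (ez \<theta>))))"
    unfolding dir[OF F(1) G] dir[OF G F(1)]
    by (simp add: sw[of "\<lambda>\<theta>. ev N K F (ez \<theta>)"] sw[of "\<lambda>\<theta>. D1 N K i F (ez \<theta>)" for i])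
  also have "\<dots> = Jint \<beta> N (\<lambda>\<theta>. ev N K F (ez \<theta>) * cnj (ev N K (lap \<alpha> K G) (ez \<theta>)))"
    by (rule sw[symmetric])
  finally show ?thesis by (simp add: ipN_def)
qed

end

subsection \<open>Comparison of the two inner products\<close>

definition delta :: "'a \<Rightarrow> 'a \<Rightarrow> complex" where
  "delta x = (\<lambda>y. if y = x then 1 else 0)"

text \<open>\<open>gram\<close> represents \<open>ipN\<close> with respect to \<open>ipf\<close>.\<close>

definition gram :: "real \<Rightarrow> nat \<Rightarrow> nat \<Rightarrow> (nat multiset \<Rightarrow> complex) \<Rightarrow> nat multiset \<Rightarrow> complex" where
  "gram \<beta> N K F = (\<lambda>\<mu>. if \<mu> \<in> partitions_upto K then ipN \<beta> N K F (delta \<mu>) / of_real (wt (2 / \<beta>) \<mu>) else 0)"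

context
  fixes \<beta> \<alpha> :: real and N K :: nat
  assumes \<beta>: "\<beta> > 0" and \<alpha>: "\<alpha> = 2 / \<beta>"
begin

private lemma apos: "\<alpha> > 0" using \<beta> \<alpha> by simp

private lemma wt_upto: "\<mu> \<in> partitions_upto K \<Longrightarrow> wt \<alpha> \<mu> > 0"
  using wt_pos[OF apos] by (auto simp: partitions_upto_def)

lemma gram_linear: "clinear_op (gram \<beta> N K)"
  by (rule clinear_opI)
    (auto simp: gram_def pointwise ipN_add_left[OF \<beta>] ipN_scale_left[OF \<beta>] add_divide_distrib)

lemma ipf_gram:
  assumes G: "G \<in> supported (partitions_upto K)"
  shows "ipf \<alpha> K (gram \<beta> N K F) G = ipN \<beta> N K F G"
proof -
  have "G = (\<Sum>\<mu>\<in>partitions_upto K. cscale (G \<mu>) (delta \<mu>))"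
    using G by (auto simp: pointwise delta_def supported_def if_distrib cong: if_cong)
  then have "ipN \<beta> N K F G = ipN \<beta> N K F (\<Sum>\<mu>\<in>partitions_upto K. cscale (G \<mu>) (delta \<mu>))" by simp
  also have "\<dots> = (\<Sum>\<mu>\<in>partitions_upto K. cnj (G \<mu>) * ipN \<beta> N K F (delta \<mu>))"
    by (simp add: ipN_sum_right[OF \<beta>] ipN_scale_right[OF \<beta>])
  also have "\<dots> = ipf \<alpha> K (gram \<beta> N K F) G"
    unfolding ip_def
  proof (intro sum.cong refl)
    fix \<mu> assume \<mu>: "\<mu> \<in> partitions_upto K"
    then show "cnj (G \<mu>) * ipN \<beta> N K F (delta \<mu>) = complex_of_real (wt \<alpha> \<mu>) * gram \<beta> N K F \<mu> * cnj (G \<mu>)"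
      using wt_upto[OF \<mu>] by (simp add: gram_def \<alpha>[symmetric])
  qed
  finally show ?thesis by simp
qed

lemma gram_hom:
  assumes F: "F \<in> hom d" "d \<le> K"
  shows "gram \<beta> N K F \<in> hom d"
proof -
  have "\<mu> \<in> partitions_of d" if "gram \<beta> N K F \<mu> \<noteq> 0" for \<mu>
  proof (rule ccontr)
    assume n: "\<mu> \<notin> partitions_of d"
    have \<mu>: "\<mu> \<in> partitions_upto K" using that by (auto simp: gram_def split: if_splits)
    then have "delta \<mu> \<in> hom (sum_mset \<mu>)" "sum_mset \<mu> \<le> K" "d \<noteq> sum_mset \<mu>"
      using n by (auto simp: supported_def delta_def partitions_of_def partitions_upto_def)
    then have "ipN \<beta> N K F (delta \<mu>) = 0" using ipN_orthogonal[OF \<beta> F] by blast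
    then show False using that \<mu> by (simp add: gram_def)
  qed
  then show ?thesis by (auto simp: supported_def)
qed

lemma hom_eqI:
  assumes d: "d \<le> K" and F: "F \<in> hom d" "F' \<in> hom d"
    and eq: "\<And>G. G \<in> hom d \<Longrightarrow> ipf \<alpha> K F G = ipf \<alpha> K F' G"
  shows "F = F'"
proof -
  have D: "F - F' \<in> hom d" by (intro supported_diff F)
  then have "ipf \<alpha> K (F - F') (F - F') = 0" using eq[OF D] by (simp only: ip_diff_left) simp
  then have "F - F' = 0"
    using ip_self_eq_0[OF finite_partitions_upto wt_upto hom_upto[OF D d]] by simp
  then show ?thesis by simp
qed

lemma gram_lap:
  assumes F: "F \<in> hom d" "d \<le> K"
  shows "gram \<beta> N K (lap \<alpha> K F) = lap \<alpha> K (gram \<beta> N K F)"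
proof (rule hom_eqI[OF F(2)])
  show "gram \<beta> N K (lap \<alpha> K F) \<in> hom d" "lap \<alpha> K (gram \<beta> N K F) \<in> hom d"
    using F by (auto intro: gram_hom lap_hom)
  fix G assume G: "G \<in> hom d"
  have "ipf \<alpha> K (gram \<beta> N K (lap \<alpha> K F)) G = ipN \<beta> N K F (lap \<alpha> K G)"
    by (simp only: ipf_gram[OF hom_upto[OF G F(2)]] ipN_lap[OF \<beta> F G \<alpha>])
  also have "\<dots> = ipf \<alpha> K (gram \<beta> N K F) (lap \<alpha> K G)"
    by (simp only: ipf_gram[OF hom_upto[OF lap_hom[OF G] F(2)]])
  also have "\<dots> = ipf \<alpha> K (lap \<alpha> K (gram \<beta> N K F)) G"
    by (rule ipf_lap[OF hom_upto[OF gram_hom[OF F] F(2)] hom_upto[OF G F(2)], symmetric])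
  finally show "ipf \<alpha> K (gram \<beta> N K (lap \<alpha> K F)) G = ipf \<alpha> K (lap \<alpha> K (gram \<beta> N K F)) G" .
qed

lemma gram_low:
  assumes F: "F \<in> hom (Suc d)" "Suc d \<le> K"
  shows "gram \<beta> N K (low (of_nat N) K F) = low (of_real (real N + \<alpha> - 1)) K (gram \<beta> N K F)"
proof (rule hom_eqI)
  show "d \<le> K" using F by simp
  show "gram \<beta> N K (low (of_nat N) K F) \<in> hom d" "low (of_real (real N + \<alpha> - 1)) K (gram \<beta> N K F) \<in> hom d"
    using F by (auto intro!: gram_hom low_hom)
  fix G assume G: "G \<in> hom d"
  have Gs: "G \<in> supported (partitions_upto K)" using hom_upto[OF G] F by simp
  have "ipf \<alpha> K (gram \<beta> N K (low (of_nat N) K F)) G = ipN \<beta> N K F (rai \<alpha> (of_real (real N + \<alpha> - 1)) K G)"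
    by (simp only: ipf_gram[OF Gs] ipN_low[OF \<beta> hom_upto[OF F] G F(2) \<alpha>])
  also have "\<dots> = ipf \<alpha> K (gram \<beta> N K F) (rai \<alpha> (of_real (real N + \<alpha> - 1)) K G)"
    using F by (intro ipf_gram[symmetric] hom_upto[OF rai_hom[OF G]])
  also have "\<dots> = ipf \<alpha> K (low (of_real (real N + \<alpha> - 1)) K (gram \<beta> N K F)) G"
    using apos by (intro ipf_low[symmetric] hom_upto[OF gram_hom[OF F]] F Gs) auto
  finally show "ipf \<alpha> K (gram \<beta> N K (low (of_nat N) K F)) G =
    ipf \<alpha> K (low (of_real (real N + \<alpha> - 1)) K (gram \<beta> N K F)) G" .
qed

text \<open>\<open>ipN\<close> is in general only semidefinite: a nonzero F may vanish identically
  in N variables, and then its eigenvalue is 0.\<close>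

lemma gram_eigenvalue:
  assumes F: "F \<in> hom d" "d \<le> K" "F \<noteq> 0" and e: "gram \<beta> N K F = cscale (of_real \<tau>) F"
  shows "\<tau> \<ge> 0" "\<tau> \<noteq> 0 \<Longrightarrow> \<exists>z. ev N K F z \<noteq> 0"
proof -
  have Fs: "F \<in> supported (partitions_upto K)" by (rule hom_upto[OF F(1,2)])
  define y where "y = (\<Sum>\<mu>\<in>partitions_upto K. wt \<alpha> \<mu> * (cmod (F \<mu>))\<^sup>2)"
  have y: "ipf \<alpha> K F F = of_real y" unfolding y_def by (rule ip_self)
  have "y \<ge> 0" unfolding y_def using wt_upto by (intro sum_nonneg) (simp add: less_imp_le)
  moreover have "y \<noteq> 0" using ip_self_eq_0[OF finite_partitions_upto wt_upto Fs] y F(3) by auto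
  ultimately have "y > 0" by simp
  obtain x where x: "x \<ge> 0" "ipN \<beta> N K F F = complex_of_real x" using ipN_self[OF \<beta>] by blast
  have "complex_of_real x = of_real (\<tau> * y)"
    using ipf_gram[OF Fs, of F] x y by (simp add: e ip_scale_left)
  then have xt: "x = \<tau> * y" by (simp only: of_real_eq_iff)
  then show "\<tau> \<ge> 0" using x(1) \<open>y > 0\<close> by (simp add: zero_le_mult_iff)
  assume "\<tau> \<noteq> 0"
  show "\<exists>z. ev N K F z \<noteq> 0"
  proof (rule ccontr)
    assume "\<not> ?thesis"
    then have "ipN \<beta> N K F F = 0" by (simp add: ipN_def Jint_def)
    then show False using x xt \<open>\<tau> \<noteq> 0\<close> \<open>y > 0\<close> by simp
  qed
qed

lemma gram_degree_0:
  assumes F: "F \<in> hom 0" "F \<noteq> 0" and e: "gram \<beta> N K F = cscale (of_real \<tau>) F"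
  shows "\<tau> = 1"
proof -
  have p0: "partitions_of 0 = {{#}}"
    by (auto simp: partitions_of_def) (metis multiset_nonemptyE)
  define a where "a = F {#}"
  have Fa: "F \<mu> = (if \<mu> = {#} then a else 0)" for \<mu>
    using F(1) by (auto simp: a_def supported_def p0)
  have "a \<noteq> 0" using F(2) Fa by (auto simp: pointwise)
  have ee: "{#} \<in> partitions_upto K" by (simp add: partitions_upto_def)
  have evF: "ev N K F z = a" for z
    using ee by (simp add: ev_def Fa if_distrib[of "\<lambda>x. x * _"] cong: if_cong)
  have evd: "ev N K (delta {#}) z = 1" for z
    using ee by (simp add: ev_def delta_def if_distrib[of "\<lambda>x. x * _"] cong: if_cong)
  have "Jint \<beta> N (\<lambda>\<theta>. a) = a * of_real (circular_partition \<beta> N)"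
    by (simp add: Jint_def circular_partition_def)
  then have "ipN \<beta> N K F (delta {#}) = a"
    using circular_partition_pos[of \<beta> N] \<beta> by (simp add: ipN_def evF evd)
  then have "gram \<beta> N K F {#} = a" using ee by (simp add: gram_def)
  moreover have "gram \<beta> N K F {#} = of_real \<tau> * a" unfolding e by (simp add: pointwise Fa)
  ultimately have "complex_of_real \<tau> = 1" using \<open>a \<noteq> 0\<close> by simp
  then show ?thesis by simp
qed

text \<open>The induction goes from \<open>F\<close> to an eigenvector of \<open>lap\<close> in the Krylov space of \<open>dp 1 F\<close>.\<close>

lemma joint_eigenvalue_bounds:
  assumes \<alpha>1: "\<alpha> \<ge> 1" and N: "N = 2 * n" "n \<ge> 1"
    and F: "F \<in> hom d" "d \<le> K" "F \<noteq> 0"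
    and e: "gram \<beta> N K F = cscale (of_real \<tau>) F" and l: "lap \<alpha> K F = cscale (2 * \<epsilon>) F"
  shows "\<tau> \<le> 1 \<and> (d \<le> n \<longrightarrow> (1 - (\<alpha> - 1) / (real n + \<alpha>)) ^ d \<le> \<tau>)"
  using F e l
proof (induction d arbitrary: F \<tau> \<epsilon>)
  case 0
  then show ?case using gram_degree_0[of F \<tau>] by simp
next
  case (Suc d)
  note F = Suc.prems(1-3) and e = Suc.prems(4) and l = Suc.prems(5)
  show ?case
  \<comment> \<open>The leading monomial requires that F does not vanish in N variables. If \<tau> =
    0 this is known for degrees up to N, and above degree n there is then nothing to prove.\<close>
  proof (cases "\<tau> = 0 \<and> \<not> Suc d \<le> n")
    case True
    then show ?thesis by simp
  next
    case False
    have "\<exists>z. ev N K F z \<noteq> 0"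
    proof (cases "\<tau> = 0")
      case True
      then have "Suc d \<le> n" using False by simp
      then have "Suc d \<le> N" using N by simp
      then show ?thesis using ev_injective[OF F(1) _ F(2), of N] F(3) by blast
    next
      case False
      then show ?thesis using gram_eigenvalue(2)[OF F e] by blast
    qed
    then obtain z where z: "ev N K F z \<noteq> 0" by blast
    obtain m q where q: "q < N" "q \<le> d" and P: "\<And>P. op_poly (lap \<alpha> K) P (dp 1 F) = 0 \<Longrightarrow>
           poly P (2 * \<epsilon> - 2 * of_real (\<alpha> * real m - real q)) = 0"
      using removable_content[OF apos F(1,2) l z] by blast
    define c where "c = \<alpha> * real m - real q"
    define r where "r = 2 * \<epsilon> - 2 * complex_of_real c"
    define w where "w = dp 1 F"
    have w: "w \<in> hom d" using dp_hom[of F d 1] F by (simp add: w_def)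
    obtain P0 where "P0 \<noteq> 0" "op_poly (lap \<alpha> K) P0 w = 0"
      and P0: "\<forall>r. poly P0 r = 0 \<longrightarrow> (\<exists>g. op_poly (lap \<alpha> K) g w \<noteq> 0 \<and>
         lap \<alpha> K (op_poly (lap \<alpha> K) g w) = cscale r (op_poly (lap \<alpha> K) g w))"
      using exists_eigenvector_poly[of "lap \<alpha> K" "partitions_of d" w, OF lap_linear finite_partitions_of lap_hom w]
      by auto
    then have "poly P0 r = 0" using P[of P0] by (simp add: r_def c_def w_def)
    then obtain g where g: "op_poly (lap \<alpha> K) g w \<noteq> 0"
      "lap \<alpha> K (op_poly (lap \<alpha> K) g w) = cscale r (op_poly (lap \<alpha> K) g w)" using P0 by blast
    define s where "s = op_poly (lap \<alpha> K) g w"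
    have s: "s \<in> hom d" "s \<noteq> 0" "lap \<alpha> K s = cscale r s"
      using g op_poly_supported[of "partitions_of d" "lap \<alpha> K" w g] lap_hom w by (auto simp: s_def)
    have dK: "d \<le> K" using F by simp
    \<comment> \<open>The same polynomial g in \<open>lap\<close> takes \<open>low X K F\<close> to
      a multiple of s for every X, so both sides of the intertwining relation can be compared on s
      alone.\<close>
    have gl: "op_poly (lap \<alpha> K) g (low X K F) = cscale (X + of_real c) s" for X
    proof -
      have "op_poly (lap \<alpha> K) g (lap \<alpha> K w) = lap \<alpha> K s"
        unfolding s_def
        by (rule op_poly_commute[where V = "hom d" and I = "partitions_of d", OF lap_linear lap_linear])
          (use w lap_hom in auto)
      then have "op_poly (lap \<alpha> K) g (low X K F) = cscale (X + \<epsilon>) s - cscale (1/2) (cscale r s)"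
        unfolding low_eigen[OF l] w_def[symmetric]
        by (simp only: clinear_op_diff[OF clinear_op_poly[OF lap_linear]]
            clinear_op_scale[OF clinear_op_poly[OF lap_linear]] s(3) s_def[symmetric])
      also have "\<dots> = cscale (X + of_real c) s"
        by (rule ext) (simp add: pointwise r_def field_simps)
      finally show ?thesis .
    qed
    have lowh: "low X K F \<in> hom d" for X by (rule low_hom[OF F(1)])
    define X' where "X' = real N + \<alpha> - 1"
    have "gram \<beta> N K (low (of_nat N) K F) = cscale (of_real \<tau>) (low (of_real X') K F)"
      by (simp only: gram_low[OF F(1,2)] e clinear_op_scale[OF low_linear] X'_def)
    then have "op_poly (lap \<alpha> K) g (gram \<beta> N K (low (of_nat N) K F)) =
       cscale (of_real \<tau>) (cscale (of_real X' + of_real c) s)"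
      by (simp only: clinear_op_scale[OF clinear_op_poly[OF lap_linear]] gl)
    moreover have "op_poly (lap \<alpha> K) g (gram \<beta> N K (low (of_nat N) K F)) =
       gram \<beta> N K (op_poly (lap \<alpha> K) g (low (of_nat N) K F))"
      by (rule op_poly_commute[where V = "hom d" and I = "partitions_of d", OF lap_linear gram_linear])
        (use lowh lap_hom gram_lap dK in auto)
    ultimately have "gram \<beta> N K (cscale (of_nat N + of_real c) s) = cscale (of_real \<tau>) (cscale (of_real X' + of_real c) s)"
      by (simp only: gl)
    then have Ts: "cscale (of_real (real N + c)) (gram \<beta> N K s) = cscale (of_real (\<tau> * (X' + c))) s"
      by (simp add: clinear_op_scale[OF gram_linear])
    have cq: "c \<ge> - real q" using apos by (simp add: c_def)
    have Nc: "real N + c > 0" using cq q(1) by linarith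
    have X'c: "X' + c > 0" using Nc \<alpha>1 by (simp add: X'_def)
    define \<sigma> where "\<sigma> = \<tau> * (X' + c) / (real N + c)"
    have es: "gram \<beta> N K s = cscale (of_real \<sigma>) s"
    proof (rule ext)
      fix \<mu>
      have "of_real (real N + c) * gram \<beta> N K s \<mu> = of_real (\<tau> * (X' + c)) * s \<mu>"
        using Ts by (metis cscale_apply)
      moreover have "complex_of_real (real N + c) \<noteq> 0" using Nc by (simp only: of_real_eq_0_iff)
      moreover have "\<tau> * (X' + c) = (real N + c) * \<sigma>" using Nc by (simp add: \<sigma>_def)
      ultimately show "gram \<beta> N K s \<mu> = cscale (of_real \<sigma>) s \<mu>"
        by (simp only: of_real_mult[of "real N + c"] mult.assoc mult_left_cancel cscale_apply) simp
    qed
    have IH: "\<sigma> \<le> 1 \<and> (d \<le> n \<longrightarrow> (1 - (\<alpha> - 1) / (real n + \<alpha>)) ^ d \<le> \<sigma>)"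
      by (rule Suc.IH[OF s(1) dK s(2) es, of "r / 2"]) (use s in simp)
    have s0: "\<sigma> \<ge> 0" using gram_eigenvalue(1)[OF s(1) dK s(2) es] .
    have te: "\<tau> = \<sigma> * ((real N + c) / (X' + c))" using Nc X'c by (simp add: \<sigma>_def)
    have fr: "(real N + c) / (X' + c) = 1 - (\<alpha> - 1) / (X' + c)"
      using X'c by (simp add: field_simps) (simp add: X'_def)
    have le1: "(real N + c) / (X' + c) \<le> 1" unfolding fr using \<alpha>1 X'c by simp
    have ge0: "0 \<le> (real N + c) / (X' + c)" using Nc X'c by simp
    have "\<tau> \<le> 1" unfolding te using IH le1 ge0 s0 by (intro mult_le_one) auto
    moreover have "(1 - (\<alpha> - 1) / (real n + \<alpha>)) ^ Suc d \<le> \<tau>" if dn: "Suc d \<le> n"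
    proof -
      \<comment> \<open>Here c \<ge> - q \<ge> - d \<ge> 1 - n and X' = 2 * n + \<alpha> - 1; this
        is the point of taking N = 2 * n.\<close>
      have "real n + \<alpha> \<le> X' + c" using cq q(2) dn N by (simp add: X'_def)
      then have f: "1 - (\<alpha> - 1) / (real n + \<alpha>) \<le> (real N + c) / (X' + c)"
        unfolding fr using \<alpha>1 X'c by (intro diff_left_mono divide_left_mono) auto
      have "0 \<le> 1 - (\<alpha> - 1) / (real n + \<alpha>)" using \<alpha>1 by (simp add: divide_le_eq)
      then have "(1 - (\<alpha> - 1) / (real n + \<alpha>)) ^ d * (1 - (\<alpha> - 1) / (real n + \<alpha>)) \<le> \<sigma> * ((real N + c) / (X' + c))"
        using IH dn f s0 by (intro mult_mono) auto
      then show ?thesis unfolding te by (simp add: mult.commute)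
    qed
    ultimately show ?thesis by blast
  qed
qed

text \<open>Polynomials in \<open>lap\<close> commute with \<open>gram\<close> and so preserve its
  eigenspace, which therefore contains an eigenvector of both operators.\<close>

lemma gram_real_eigenvalue_bounds:
  assumes \<alpha>1: "\<alpha> \<ge> 1" and N: "N = 2 * n" "n \<ge> 1"
    and F: "F \<in> hom d" "d \<le> K" "F \<noteq> 0" and e: "gram \<beta> N K F = cscale (of_real \<tau>) F"
  shows "\<tau> \<le> 1" "1 - \<alpha> * real d / real n \<le> \<tau>"
proof -
  obtain g r where g: "op_poly (lap \<alpha> K) g F \<noteq> 0"
    "lap \<alpha> K (op_poly (lap \<alpha> K) g F) = cscale r (op_poly (lap \<alpha> K) g F)"
    using exists_eigenvector[of "lap \<alpha> K" "partitions_of d" F, OF lap_linear finite_partitions_of lap_hom F(1,3)]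
    by auto
  define s where "s = op_poly (lap \<alpha> K) g F"
  have s: "s \<in> hom d" "s \<noteq> 0" "lap \<alpha> K s = cscale (2 * (r / 2)) s"
    using g op_poly_supported[of "partitions_of d" "lap \<alpha> K" F g] lap_hom F by (auto simp: s_def)
  have "gram \<beta> N K s = op_poly (lap \<alpha> K) g (gram \<beta> N K F)"
    unfolding s_def
    by (rule op_poly_commute[where V = "hom d" and I = "partitions_of d", OF lap_linear gram_linear, symmetric])
      (use F lap_hom gram_lap in auto)
  also have "\<dots> = cscale (of_real \<tau>) s"
    by (simp only: e clinear_op_scale[OF clinear_op_poly[OF lap_linear]] s_def)
  finally have es: "gram \<beta> N K s = cscale (of_real \<tau>) s" .
  have b: "\<tau> \<le> 1 \<and> (d \<le> n \<longrightarrow> (1 - (\<alpha> - 1) / (real n + \<alpha>)) ^ d \<le> \<tau>)"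
    by (rule joint_eigenvalue_bounds[OF \<alpha>1 N s(1) F(2) s(2) es s(3)])
  then show "\<tau> \<le> 1" by simp
  have t0: "\<tau> \<ge> 0" by (rule gram_eigenvalue(1)[OF F e])
  show "1 - \<alpha> * real d / real n \<le> \<tau>"
  proof (cases "d \<le> n")
    case True
    define x where "x = (\<alpha> - 1) / (real n + \<alpha>)"
    have x: "x \<le> 1" using \<alpha>1 by (simp add: x_def divide_le_eq)
    have "x \<le> \<alpha> / real n" unfolding x_def using \<alpha>1 N by (intro frac_le) auto
    then have "1 - \<alpha> * real d / real n \<le> 1 + real d * (- x)"
      using mult_left_mono[of x "\<alpha> / real n" "real d"] by (simp add: mult.commute)
    also have "\<dots> \<le> (1 + - x) ^ d" using x by (intro Bernoulli_inequality) simp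
    also have "\<dots> \<le> \<tau>" using b True by (simp add: x_def)
    finally show ?thesis .
  next
    \<comment> \<open>For d > n the claimed lower bound is not positive.\<close>
    case False
    then have "real n \<le> \<alpha> * real d" using \<alpha>1 mult_mono[of 1 \<alpha> "real n" "real d"] by simp
    then have "1 \<le> \<alpha> * real d / real n" using N by simp
    then show ?thesis using t0 by simp
  qed
qed

text \<open>\<open>positive_of_eigenvalues\<close>, applied to 1 - \<open>gram\<close> and to
  \<open>gram\<close> - (1 - \<delta>), turns the eigenvalue bounds into inequalities between
  forms.\<close>

lemma ipN_bounds:
  assumes \<alpha>1: "\<alpha> \<ge> 1" and N: "N = 2 * n" "n \<ge> 1" and F: "F \<in> hom d" "d \<le> K"
  shows "0 \<le> Re (ipf \<alpha> K F F - ipN \<beta> N K F F)"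
    and "Re (ipf \<alpha> K F F - ipN \<beta> N K F F) \<le> \<alpha> * real d / real n * Re (ipf \<alpha> K F F)"
proof -
  define D where "D F = F - gram \<beta> N K F" for F
  define \<delta> where "\<delta> = \<alpha> * real d / real n"
  define E where "E F = gram \<beta> N K F - cscale (of_real (1 - \<delta>)) F" for F
  have Dl: "clinear_op D" unfolding D_def by (intro clinear_op_minus clinear_op_ident gram_linear)
  have El: "clinear_op E" unfolding E_def by (intro clinear_op_minus clinear_op_cscale clinear_op_ident gram_linear)
  have sub: "partitions_of d \<subseteq> partitions_upto K" by (rule partitions_of_subset[OF F(2)])
  have gsym: "ipf \<alpha> K (gram \<beta> N K F) G = ipf \<alpha> K F (gram \<beta> N K G)" if "F \<in> hom d" "G \<in> hom d" for F G
  proof -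
    have "ipf \<alpha> K (gram \<beta> N K F) G = cnj (ipf \<alpha> K (gram \<beta> N K G) F)"
      using that F(2) by (simp add: ipf_gram hom_upto ipN_cnj[OF \<beta>])
    then show ?thesis by (simp add: ip_cnj)
  qed
  have evu: "\<exists>\<tau>. gram \<beta> N K u = cscale (of_real \<tau>) u \<and> r = 1 - \<tau>" if "D u = cscale (of_real r) u" for u r
  proof (intro exI[of _ "1 - r"] conjI)
    have "gram \<beta> N K u = u - D u" by (simp add: D_def)
    then show "gram \<beta> N K u = cscale (of_real (1 - r)) u" unfolding that by (simp add: pointwise algebra_simps)
  qed simp
  have "Re (ipf \<alpha> K (D F) F) \<ge> 0"
  proof (rule positive_of_eigenvalues[OF Dl finite_partitions_upto sub wt_upto])
    show "D G \<in> hom d" if "G \<in> hom d" for G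
      unfolding D_def by (intro supported_diff that gram_hom F(2))
    show "ipf \<alpha> K (D G) H = ipf \<alpha> K G (D H)" if "G \<in> hom d" "H \<in> hom d" for G H
      unfolding D_def ip_diff_left ip_diff_right by (simp add: gsym that)
    fix u r assume u: "u \<in> hom d" "u \<noteq> 0" "D u = cscale (of_real r) u"
    then obtain \<tau> where "gram \<beta> N K u = cscale (of_real \<tau>) u" "r = 1 - \<tau>" using evu by blast
    then show "r \<ge> 0" using gram_real_eigenvalue_bounds(1)[OF \<alpha>1 N u(1) F(2) u(2)] by simp
  qed (use F in auto)
  then show "0 \<le> Re (ipf \<alpha> K F F - ipN \<beta> N K F F)"
    unfolding D_def ip_diff_left by (simp add: ipf_gram hom_upto[OF F])
  have evE: "gram \<beta> N K u = cscale (of_real (r + (1 - \<delta>))) u" if "E u = cscale (of_real r) u" for u r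
  proof -
    have "gram \<beta> N K u = E u + cscale (of_real (1 - \<delta>)) u" by (simp add: E_def)
    then show ?thesis unfolding that by (simp add: pointwise algebra_simps)
  qed
  have "Re (ipf \<alpha> K (E F) F) \<ge> 0"
  proof (rule positive_of_eigenvalues[OF El finite_partitions_upto sub wt_upto])
    show "E G \<in> hom d" if "G \<in> hom d" for G
      unfolding E_def by (intro supported_diff supported_cscale that gram_hom F(2))
    show "ipf \<alpha> K (E G) H = ipf \<alpha> K G (E H)" if "G \<in> hom d" "H \<in> hom d" for G H
      unfolding E_def ip_diff_left ip_diff_right ip_scale_left ip_scale_right by (simp add: gsym that)
    fix u r assume u: "u \<in> hom d" "u \<noteq> 0" "E u = cscale (of_real r) u"
    then show "r \<ge> 0"
      using gram_real_eigenvalue_bounds(2)[OF \<alpha>1 N u(1) F(2) u(2) evE[OF u(3)]] by (simp add: \<delta>_def)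
  qed (use F in auto)
  then show "Re (ipf \<alpha> K F F - ipN \<beta> N K F F) \<le> \<alpha> * real d / real n * Re (ipf \<alpha> K F F)"
    unfolding E_def ip_diff_left ip_scale_left \<delta>_def[symmetric]
    by (simp add: ipf_gram hom_upto[OF F] algebra_simps)
qed

text \<open>Cauchy-Schwarz for the positive form \<open>ipf\<close> - \<open>ipN\<close>, stated
  with a free t instead of a product of square roots: a common t for all degrees keeps the bound
  additive over d.\<close>

lemma ip_difference_bound:
  assumes \<alpha>1: "\<alpha> \<ge> 1" and N: "N = 2 * n" "n \<ge> 1" and F: "F \<in> hom d" "d \<le> K" and G: "G \<in> hom d"
    and t: "t > 0"
  shows "cmod (ipf \<alpha> K F G - ipN \<beta> N K F G) \<le>
     \<alpha> * real d / (2 * real n) * (t * Re (ipf \<alpha> K F F) + Re (ipf \<alpha> K G G) / t)"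
proof -
  define D where "D F G = ipf \<alpha> K F G - ipN \<beta> N K F G" for F G
  have add: "D (F + F') G = D F G + D F' G" "D F (G + G') = D F G + D F G'" for F F' G G'
    by (simp_all add: D_def ip_linear ipN_add_left[OF \<beta>] ipN_add_right[OF \<beta>])
  have scale: "D (cscale c F) G = c * D F G" "D F (cscale c G) = cnj c * D F G" for F G c
    by (simp_all add: D_def ip_linear ipN_scale_left[OF \<beta>] ipN_scale_right[OF \<beta>] algebra_simps)
  have cnjD: "D G F = cnj (D F G)" by (simp add: D_def ip_cnj ipN_cnj[OF \<beta>])
  obtain u where u: "cmod u = 1" "u * D F G = of_real (cmod (D F G))"
  proof (cases "D F G = 0")
    case True
    then show thesis using that[of 1] by simp
  next
    case False
    have "D F G * cnj (D F G) = complex_of_real (cmod (D F G)) * complex_of_real (cmod (D F G))"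
      by (metis complex_norm_square of_real_mult power2_eq_square)
    then show thesis
      using False by (intro that[of "cnj (D F G) / of_real (cmod (D F G))"]) (auto simp: norm_divide mult.commute)
  qed
  define a where "a = sqrt t"
  have a: "a > 0" "a * a = t" using t by (simp_all add: a_def)
  \<comment> \<open>The phase u and the scaling by sqrt t make the cross terms of D H H add up to -
    2 * |D F G|.\<close>
  define p q where "p = of_real a * u" and "q = - complex_of_real (1 / a)"
  define H where "H = cscale p F + cscale q G"
  have H: "H \<in> hom d" unfolding H_def by (intro supported_add supported_cscale F G)
  have uu: "u * cnj u = 1" using u(1) by (metis complex_norm_square of_real_1 one_power2)
  have "D H H = p * cnj p * D F F + p * cnj q * D F G + q * cnj p * D G F + q * cnj q * D G G"
    by (simp add: H_def add scale algebra_simps)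
  moreover have "p * cnj p = of_real t"
    using uu by (simp add: p_def mult_ac flip: a(2))
  moreover have "p * cnj q = - u" "q * cnj p = - cnj u" using a(1) by (simp_all add: p_def q_def)
  moreover have "q * cnj q = 1 / of_real t" using a(1) by (simp add: q_def flip: a(2))
  ultimately have "D H H = of_real t * D F F - (u * D F G + cnj (u * D F G)) + D G G / of_real t"
    by (simp add: cnjD)
  then have "Re (D H H) = t * Re (D F F) - 2 * cmod (D F G) + Re (D G G) / t"
    unfolding u(2) using t by (simp add: Re_divide_of_real)
  moreover have "0 \<le> Re (D H H)" unfolding D_def by (rule ipN_bounds(1)[OF \<alpha>1 N H F(2)])
  ultimately have "2 * cmod (D F G) \<le> t * Re (D F F) + Re (D G G) / t" by simp
  also have "\<dots> \<le> t * (\<alpha> * real d / real n * Re (ipf \<alpha> K F F)) + (\<alpha> * real d / real n * Re (ipf \<alpha> K G G)) / t"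
    unfolding D_def using t
    by (intro add_mono mult_left_mono divide_right_mono ipN_bounds(2)[OF \<alpha>1 N] F G) auto
  also have "\<dots> = \<alpha> * real d / real n * (t * Re (ipf \<alpha> K F F) + Re (ipf \<alpha> K G G) / t)"
    by (simp add: algebra_simps)
  also have "\<dots> = 2 * (\<alpha> * real d / (2 * real n) * (t * Re (ipf \<alpha> K F F) + Re (ipf \<alpha> K G G) / t))"
    by simp
  finally show ?thesis unfolding D_def by linarith
qed

end

subsection \<open>Exponential generating functions\<close>

text \<open>The series of exp (y * t^k), where t marks the degree.\<close>

definition exp_mono :: "'a :: {real_normed_field, banach} \<Rightarrow> nat \<Rightarrow> 'a fps" where
  "exp_mono y k = Abs_fps (\<lambda>i. if k dvd i then y ^ (i div k) / fact (i div k) else 0)"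

definition exp_poly :: "(nat \<Rightarrow> 'a :: {real_normed_field, banach}) \<Rightarrow> nat \<Rightarrow> 'a fps" where
  "exp_poly y M = (\<Prod>k=1..M. exp_mono (y k) k)"

text \<open>Evaluation of a series at t = 1; absolute convergence makes Cauchy products sum to the
  product.\<close>

definition abs_conv :: "'a :: {real_normed_field, banach} fps \<Rightarrow> 'a \<Rightarrow> bool" where
  "abs_conv F s \<longleftrightarrow> summable (\<lambda>n. norm (fps_nth F n)) \<and> fps_nth F sums s"

lemma abs_conv_mult:
  assumes "abs_conv F s" "abs_conv G t"
  shows "abs_conv (F * G) (s * t)"
proof -
  have F: "summable (\<lambda>n. norm (fps_nth F n))" "fps_nth F sums s"
    and G: "summable (\<lambda>n. norm (fps_nth G n))" "fps_nth G sums t"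
    using assms by (auto simp: abs_conv_def)
  have n: "fps_nth (F * G) k = (\<Sum>i\<le>k. fps_nth F i * fps_nth G (k - i))" for k
    by (simp add: fps_mult_nth atLeast0AtMost)
  have "summable (\<lambda>k. \<Sum>i\<le>k. norm (fps_nth F i) * norm (fps_nth G (k - i)))"
    by (rule summable_Cauchy_product) (use F G in auto)
  then have "summable (\<lambda>k. norm (fps_nth (F * G) k))"
  proof (rule summable_comparison_test')
    fix k :: nat
    show "norm (norm (fps_nth (F * G) k)) \<le> (\<Sum>i\<le>k. norm (fps_nth F i) * norm (fps_nth G (k - i)))"
      unfolding n by (simp add: norm_mult[symmetric] norm_sum)
  qed
  moreover have "fps_nth (F * G) sums (s * t)"
    using Cauchy_product_sums[OF F(1) G(1)] sums_unique[OF F(2)] sums_unique[OF G(2)]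
    unfolding n[symmetric] by simp
  ultimately show ?thesis by (simp add: abs_conv_def)
qed

lemma abs_conv_exp_mono:
  fixes y :: "'a :: {real_normed_field, banach}"
  assumes k: "k \<ge> 1"
  shows "abs_conv (exp_mono y k) (exp y)"
proof -
  have sm: "strict_mono (\<lambda>j. k * j)" using k by (auto simp: strict_mono_def)
  have "(\<lambda>j. fps_nth (exp_mono y k) (k * j)) = (\<lambda>j. y ^ j /\<^sub>R fact j)"
    using k by (simp add: exp_mono_def scaleR_conv_of_real divide_inverse mult.commute)
  then have "(\<lambda>j. fps_nth (exp_mono y k) (k * j)) sums exp y"
    using exp_converges[of y] by simp
  then have s: "fps_nth (exp_mono y k) sums exp y"
    by (subst (asm) sums_mono_reindex[OF sm]) (auto simp: exp_mono_def)
  have "(\<lambda>j. norm (fps_nth (exp_mono y k) (k * j))) = (\<lambda>j. norm y ^ j /\<^sub>R fact j)"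
    using k by (simp add: exp_mono_def norm_divide norm_power norm_mult divide_inverse mult.commute norm_inverse)
  then have "summable (\<lambda>j. norm (fps_nth (exp_mono y k) (k * j)))"
    using exp_converges[of "norm y"] by (simp add: sums_iff)
  then have "summable (\<lambda>i. norm (fps_nth (exp_mono y k) i))"
    by (subst (asm) summable_mono_reindex[OF sm]) (auto simp: exp_mono_def)
  then show ?thesis using s by (simp add: abs_conv_def)
qed

lemma abs_conv_exp_poly: "abs_conv (exp_poly y M) (exp (\<Sum>k=1..M. y k))"
proof (induction M)
  case 0
  have "(\<lambda>n. norm (fps_nth (1 :: 'a fps) n)) = (\<lambda>n. if n = 0 then 1 else 0)" by auto
  moreover have "fps_nth (1 :: 'a fps) = (\<lambda>n. if n = 0 then 1 else 0)" by auto
  ultimately show ?case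
    using sums_single[of 0 "\<lambda>_. 1 :: 'a"] sums_single[of 0 "\<lambda>_. 1 :: real"]
    by (simp add: exp_poly_def abs_conv_def sums_iff)
next
  case (Suc M)
  then show ?case
    using abs_conv_mult[OF Suc abs_conv_exp_mono[of "Suc M" "y (Suc M)"]]
    by (simp add: exp_poly_def exp_add)
qed

lemma exp_mono_bound:
  assumes "norm (y :: 'a :: {real_normed_field, banach}) \<le> (w :: real)"
  shows "norm (fps_nth (exp_mono y k) i) \<le> fps_nth (exp_mono w k) i"
proof -
  have "norm y ^ j / fact j \<le> w ^ j / fact j" for j
    using assms by (intro divide_right_mono power_mono) auto
  then show ?thesis by (simp add: exp_mono_def norm_divide norm_power)
qed

text \<open>Coefficientwise majorants, through which partial sums are bounded uniformly in the
  angles.\<close>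

lemma exp_poly_bound:
  fixes y :: "nat \<Rightarrow> 'a :: {real_normed_field, banach}"
  assumes "\<And>k. norm (y k) \<le> w k"
  shows "norm (fps_nth (exp_poly y M) i) \<le> fps_nth (exp_poly w M) i"
proof (induction M arbitrary: i)
  case 0
  then show ?case by (simp add: exp_poly_def)
next
  case (Suc M)
  have e: "exp_poly v (Suc M) = exp_poly v M * exp_mono (v (Suc M)) (Suc M)" for v :: "nat \<Rightarrow> 'b :: {real_normed_field, banach}"
    by (simp add: exp_poly_def)
  have "norm (fps_nth (exp_poly y (Suc M)) i) \<le>
     (\<Sum>j=0..i. norm (fps_nth (exp_poly y M) j) * norm (fps_nth (exp_mono (y (Suc M)) (Suc M)) (i - j)))"
    unfolding e fps_mult_nth by (simp add: norm_mult[symmetric] norm_sum)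
  also have "\<dots> \<le> (\<Sum>j=0..i. fps_nth (exp_poly w M) j * fps_nth (exp_mono (w (Suc M)) (Suc M)) (i - j))"
    by (intro sum_mono mult_mono Suc exp_mono_bound assms order.trans[OF norm_ge_zero Suc]) auto
  finally show ?case unfolding e fps_mult_nth .
qed

lemma exp_mono_deriv:
  assumes k: "k \<ge> 1"
  shows "fps_deriv (exp_mono y k) = fps_const (of_nat k * y) * fps_X ^ (k - 1) * exp_mono y k"
proof (rule fps_ext)
  fix i
  have "fps_nth (fps_const (of_nat k * y) * fps_X ^ (k - 1) * exp_mono y k) i =
     (if i < k - 1 then 0 else of_nat k * y * fps_nth (exp_mono y k) (i - (k - 1)))"
    by (simp add: mult.assoc fps_X_power_mult_nth)
  also have "\<dots> = of_nat (Suc i) * fps_nth (exp_mono y k) (Suc i)"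
  proof (cases "k dvd Suc i")
    case True
    then obtain j where j: "Suc i = k * j" by (auto elim: dvdE)
    then obtain j' where j': "j = Suc j'" by (cases j) auto
    then have "i - (k - 1) = k * j'" "\<not> i < k - 1" using j k by (auto simp: algebra_simps)
    moreover have "y * (y ^ j' / fact j') * of_nat k = of_nat (k * Suc j') * (y ^ Suc j' / fact (Suc j'))"
    proof -
      have "(of_nat (Suc j') :: 'a) \<noteq> 0" by (simp del: of_nat_Suc)
      then show ?thesis by (simp add: field_simps del: of_nat_Suc mult_Suc_right)
    qed
    ultimately show ?thesis using k by (simp add: exp_mono_def j j' mult_ac del: of_nat_Suc of_nat_mult)
  next
    case False
    have "\<not> k dvd i - (k - 1)" if "\<not> i < k - 1"
    proof
      assume "k dvd i - (k - 1)"
      then have "k dvd i - (k - 1) + k" by simp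
      moreover have "i - (k - 1) + k = Suc i" using that k by simp
      ultimately show False using False by simp
    qed
    then show ?thesis using False by (simp add: exp_mono_def)
  qed
  finally show "fps_nth (fps_deriv (exp_mono y k)) i = fps_nth (fps_const (of_nat k * y) * fps_X ^ (k - 1) * exp_mono y k) i"
    by (simp add: fps_deriv_nth)
qed

lemma exp_poly_deriv:
  "fps_deriv (exp_poly y M) = (\<Sum>k=1..M. fps_const (of_nat k * y k) * fps_X ^ (k - 1)) * exp_poly y M"
proof (induction M)
  case 0
  then show ?case by (simp add: exp_poly_def)
next
  case (Suc M)
  then show ?case
    using exp_mono_deriv[of "Suc M" "y (Suc M)"]
    by (simp add: exp_poly_def algebra_simps)
qed

lemma exp_poly_0: "fps_nth (exp_poly y M) 0 = 1"
  by (induction M) (simp_all add: exp_poly_def exp_mono_def)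

text \<open>The recursion is the differential equation of \<open>exp_poly_deriv\<close> read
  coefficient by coefficient. Evaluations and Gaussian products of exponentials are both recognised
  through it.\<close>

lemma exp_poly_unique:
  assumes e0: "e 0 = 1" and y: "\<And>k. k > M \<Longrightarrow> y k = 0"
    and rec: "\<And>d. d > 0 \<Longrightarrow> of_nat d * e d = (\<Sum>k=1..d. of_nat k * y k * e (d - k))"
  shows "e d = fps_nth (exp_poly y M) d"
proof (induction d rule: less_induct)
  case (less d)
  show ?case
  proof (cases d)
    case 0
    then show ?thesis by (simp add: e0 exp_poly_0)
  next
    case (Suc i)
    have "of_nat (Suc i) * fps_nth (exp_poly y M) (Suc i) =
      (\<Sum>k=1..M. fps_nth (fps_const (of_nat k * y k) * fps_X ^ (k - 1) * exp_poly y M) i)"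
      using arg_cong[OF exp_poly_deriv[of y M], of "\<lambda>F. fps_nth F i"]
      by (simp add: fps_deriv_nth sum_distrib_right fps_sum_nth)
    also have "\<dots> = (\<Sum>k=1..M. if i < k - 1 then 0 else of_nat k * y k * fps_nth (exp_poly y M) (i - (k - 1)))"
      by (intro sum.cong refl) (simp add: mult.assoc fps_X_power_mult_nth)
    also have "\<dots> = (\<Sum>k\<in>{1..M} \<inter> {1..d}. of_nat k * y k * e (d - k))"
    proof (intro sum.mono_neutral_cong_right ballI)
      fix k assume "k \<in> {1..M} \<inter> {1..d}"
      then show "(if i < k - 1 then 0 else of_nat k * y k * fps_nth (exp_poly y M) (i - (k - 1))) =
        of_nat k * y k * e (d - k)"
        using less.IH[of "d - k"] Suc by (auto simp: Suc_diff_le)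
    qed (auto simp: Suc)
    also have "\<dots> = (\<Sum>k=1..d. of_nat k * y k * e (d - k))"
      using y by (intro sum.mono_neutral_left) auto
    also have "\<dots> = of_nat (Suc i) * e d" using rec[of d] Suc by simp
    finally show ?thesis unfolding Suc by (simp del: of_nat_Suc)
  qed
qed

text \<open>The degree d part of the exponential of the sum of all
  \<open>x\<^sub>k p\<^sub>k\<close>; splitting by degree keeps every element finitely
  supported.\<close>

definition expF :: "(nat \<Rightarrow> complex) \<Rightarrow> nat \<Rightarrow> nat multiset \<Rightarrow> complex" where
  "expF x d = (\<lambda>\<mu>. if \<mu> \<in> partitions_of d then \<Prod>k\<in>set_mset \<mu>. x k ^ count \<mu> k / fact (count \<mu> k) else 0)"

lemma expF_hom: "expF x d \<in> hom d"
  by (simp add: expF_def supported_def)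

text \<open>An exponential is an eigenvector of every derivative, like a coherent state; in the
  graded version only the degree shifts.\<close>

lemma dp_expF:
  assumes k: "k > 0"
  shows "dp k (expF x (d + k)) = cscale (x k) (expF x d)"
proof
  fix \<mu>
  have p: "add_mset k \<mu> \<in> partitions_of (d + k) \<longleftrightarrow> \<mu> \<in> partitions_of d"
    using k by (auto simp: partitions_of_def)
  define g where "g c j = x j ^ c / fact c" for c j
  have s: "(\<Prod>j\<in>set_mset \<nu>. g (count \<nu> j) j) = (\<Prod>j\<in>A. g (count \<nu> j) j)"
    if "set_mset \<nu> \<subseteq> A" "finite A" for \<nu> A
    by (rule prod.mono_neutral_left) (use that in \<open>auto simp: g_def not_in_iff\<close>)
  define A where "A = insert k (set_mset \<mu>)"
  have A: "finite A" "k \<in> A" "set_mset (add_mset k \<mu>) \<subseteq> A" "set_mset \<mu> \<subseteq> A" by (auto simp: A_def)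
  have "of_nat (Suc (count \<mu> k)) * (\<Prod>j\<in>set_mset (add_mset k \<mu>). g (count (add_mset k \<mu>) j) j) =
     of_nat (Suc (count \<mu> k)) * g (Suc (count \<mu> k)) k * (\<Prod>j\<in>A - {k}. g (count (add_mset k \<mu>) j) j)"
    unfolding s[OF A(3,1)] using A by (simp add: prod.remove)
  also have "(\<Prod>j\<in>A - {k}. g (count (add_mset k \<mu>) j) j) = (\<Prod>j\<in>A - {k}. g (count \<mu> j) j)"
    by (intro prod.cong) auto
  also have "of_nat (Suc (count \<mu> k)) * g (Suc (count \<mu> k)) k = x k * g (count \<mu> k) k"
    by (simp add: g_def field_simps del: of_nat_Suc)
  also have "x k * g (count \<mu> k) k * (\<Prod>j\<in>A - {k}. g (count \<mu> j) j) = x k * (\<Prod>j\<in>set_mset \<mu>. g (count \<mu> j) j)"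
    unfolding s[OF A(4,1)] using A by (simp add: prod.remove)
  finally show "dp k (expF x (d + k)) \<mu> = cscale (x k) (expF x d) \<mu>"
    using p by (simp add: dp_def expF_def cscale_apply g_def del: of_nat_Suc)
qed

lemma dp_expF':
  assumes "k > 0"
  shows "dp k (expF x d) = (if k \<le> d then cscale (x k) (expF x (d - k)) else 0)"
  using dp_expF[OF assms, of x "d - k"] dp_eq_0[of "expF x d" d k] hom_upto[OF expF_hom, of d d x] by auto

lemma expF_0: "expF x 0 {#} = 1"
  by (simp add: expF_def partitions_of_def)

lemma euler_expF:
  assumes "d \<le> K"
  shows "cscale (of_nat d) (expF x d) = (\<Sum>k=1..d. cscale (of_nat k * x k) (pm k (expF x (d - k))))"
proof -
  have "cscale (of_nat d) (expF x d) = (\<Sum>k=1..d. cscale (of_nat k) (pm k (dp k (expF x d))))"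
    by (rule euler[OF expF_hom order_refl, symmetric])
  also have "\<dots> = (\<Sum>k=1..d. cscale (of_nat k * x k) (pm k (expF x (d - k))))"
    by (intro sum.cong refl) (simp add: dp_expF' pm_simps)
  finally show ?thesis .
qed

lemma ev_expF:
  assumes x: "\<And>k. k > M \<Longrightarrow> x k = 0" and d: "d \<le> K"
  shows "ev N K (expF x d) z = fps_nth (exp_poly (\<lambda>k. x k * psum N k z) M) d"
proof -
  have p0: "partitions_of 0 = {{#}}"
    by (auto simp: partitions_of_def) (metis multiset_nonemptyE)
  have indep: "ev N K (expF x d) z = (\<Sum>\<mu>\<in>partitions_of d. expF x d \<mu> * mp N \<mu> z)" if "d \<le> K" for K d
    unfolding ev_def using partitions_of_subset[OF that]
    by (intro sum.mono_neutral_right) (auto simp: expF_def)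
  define e where "e d = (\<Sum>\<mu>\<in>partitions_of d. expF x d \<mu> * mp N \<mu> z)" for d
  have "e d = fps_nth (exp_poly (\<lambda>k. x k * psum N k z) M) d"
  proof (rule exp_poly_unique)
    show "e 0 = 1" by (simp add: e_def p0 expF_0)
    show "x k * psum N k z = 0" if "k > M" for k using x[OF that] by simp
    fix d :: nat
    have "of_nat d * e d = ev N d (cscale (of_nat d) (expF x d)) z" by (simp add: ev_scale e_def indep)
    also have "\<dots> = (\<Sum>k=1..d. of_nat k * (x k * psum N k z) * e (d - k))"
      unfolding euler_expF[OF order_refl] ev_linear
    proof (intro sum.cong refl)
      fix k assume k: "k \<in> {1..d}"
      have "ev N d (pm k (expF x (d - k))) z = psum N k z * ev N d (expF x (d - k)) z"
        by (rule ev_pm[of _ "d - k"]) (use k hom_upto[OF expF_hom, of "d - k" "d - k" x] in auto)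
      then show "of_nat k * x k * ev N d (pm k (expF x (d - k))) z = of_nat k * (x k * psum N k z) * e (d - k)"
        using k by (simp add: e_def indep)
    qed
    finally show "of_nat d * e d = (\<Sum>k=1..d. of_nat k * (x k * psum N k z) * e (d - k))" .
  qed
  then show ?thesis using indep[OF d] by (simp add: e_def)
qed

lemma ipf_K_indep:
  assumes "F \<in> hom d" "d \<le> K"
  shows "ipf \<alpha> K F G = ip (partitions_of d) (wt \<alpha>) F G"
  unfolding ip_def using partitions_of_subset[OF assms(2)] assms(1)
  by (intro sum.mono_neutral_right) (auto simp: supported_def)

lemma ipf_expF_rec:
  assumes d: "d \<le> K"
  shows "of_nat d * ipf \<alpha> K (expF x d) (expF y d) =
     (\<Sum>k=1..d. of_real \<alpha> * (of_nat k)\<^sup>2 * (x k * cnj (y k)) * ipf \<alpha> K (expF x (d - k)) (expF y (d - k)))"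
proof -
  have s: "expF y d \<in> supported (partitions_upto K)" by (rule hom_upto[OF expF_hom d])
  have "of_nat d * ipf \<alpha> K (expF x d) (expF y d) = ipf \<alpha> K (cscale (of_nat d) (expF x d)) (expF y d)"
    by (simp add: ip_scale_left)
  also have "\<dots> = (\<Sum>k=1..d. of_nat k * x k * (of_real (\<alpha> * real k) * ipf \<alpha> K (expF x (d - k)) (dp k (expF y d))))"
    unfolding euler_expF[OF order_refl] ip_linear by (simp add: ipf_pm_left[OF s])
  also have "\<dots> = (\<Sum>k=1..d. of_real \<alpha> * (of_nat k)\<^sup>2 * (x k * cnj (y k)) * ipf \<alpha> K (expF x (d - k)) (expF y (d - k)))"
    by (intro sum.cong refl) (simp add: dp_expF' ip_scale_right power2_eq_square mult_ac)
  finally show ?thesis .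
qed

definition cexp :: "real \<Rightarrow> (nat \<Rightarrow> complex) \<Rightarrow> (nat \<Rightarrow> complex) \<Rightarrow> nat \<Rightarrow> complex" where
  "cexp \<alpha> x y d = ip (partitions_of d) (wt \<alpha>) (expF x d) (expF y d)"

lemma cexp_eq: "d \<le> K \<Longrightarrow> ipf \<alpha> K (expF x d) (expF y d) = cexp \<alpha> x y d"
  by (simp add: cexp_def ipf_K_indep[OF expF_hom])

lemma cexp_rec: "of_nat d * cexp \<alpha> x y d =
     (\<Sum>k=1..d. of_real \<alpha> * (of_nat k)\<^sup>2 * (x k * cnj (y k)) * cexp \<alpha> x y (d - k))"
  using ipf_expF_rec[OF order_refl, of d \<alpha> x y] by (simp add: cexp_eq)

text \<open>The Gaussian reproducing kernel: \<open>cexp_rec\<close> is the recursion of an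
  exponential with exponents \<alpha> * k * x k * cnj (y k).\<close>

lemma cexp_sums:
  assumes x: "\<And>k. k > M \<Longrightarrow> x k = 0"
  shows "cexp \<alpha> x y sums exp (of_real \<alpha> * (\<Sum>k=1..M. of_nat k * (x k * cnj (y k))))"
    and "summable (\<lambda>d. cmod (cexp \<alpha> x y d))"
proof -
  define v where "v k = of_real \<alpha> * (of_nat k * (x k * cnj (y k)))" for k
  have "cexp \<alpha> x y d = fps_nth (exp_poly v M) d" for d
  proof (rule exp_poly_unique)
    have p0: "partitions_of 0 = {{#}}"
      by (auto simp: partitions_of_def) (metis multiset_nonemptyE)
    show "cexp \<alpha> x y 0 = 1" by (simp add: cexp_def ip_def p0 expF_0)
    show "v k = 0" if "k > M" for k using x[OF that] by (simp add: v_def)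
    show "of_nat d * cexp \<alpha> x y d = (\<Sum>k=1..d. of_nat k * v k * cexp \<alpha> x y (d - k))" for d
      unfolding cexp_rec by (simp add: v_def power2_eq_square mult_ac)
  qed
  then have "cexp \<alpha> x y = fps_nth (exp_poly v M)" by (rule ext)
  moreover have "abs_conv (exp_poly v M) (exp (\<Sum>k=1..M. v k))" by (rule abs_conv_exp_poly)
  ultimately show "cexp \<alpha> x y sums exp (of_real \<alpha> * (\<Sum>k=1..M. of_nat k * (x k * cnj (y k))))"
    "summable (\<lambda>d. cmod (cexp \<alpha> x y d))"
    by (simp_all add: abs_conv_def v_def sum_distrib_left)
qed

text \<open>Through the recursion the weight d brings down a second factor k, hence the H^1 sum.
  What remains are partial sums of the Gaussian norm, bounded by its total.\<close>

lemma cexp_diag_sum: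
  assumes \<alpha>: "\<alpha> > 0" and x: "\<And>k. k > M \<Longrightarrow> x k = 0"
  shows "0 \<le> Re (cexp \<alpha> x x d)"
    and "(\<Sum>d\<le>D. real d * Re (cexp \<alpha> x x d)) \<le>
      \<alpha> * (\<Sum>k=1..M. (real k)\<^sup>2 * (cmod (x k))\<^sup>2) * exp (\<alpha> * (\<Sum>k=1..M. real k * (cmod (x k))\<^sup>2))"
proof -
  have nn: "0 \<le> Re (cexp \<alpha> x x d)" for d
    unfolding cexp_def using wt_pos[OF \<alpha>] by (intro ip_self_nonneg) (auto simp: partitions_of_def)
  then show "0 \<le> Re (cexp \<alpha> x x d)" .
  have "complex_of_real (exp (\<alpha> * (\<Sum>k=1..M. real k * (cmod (x k))\<^sup>2))) =
      exp (of_real \<alpha> * (\<Sum>k=1..M. of_nat k * (x k * cnj (x k))))"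
    by (simp add: complex_norm_square[symmetric] exp_of_real[symmetric])
  then have "(\<lambda>d. Re (cexp \<alpha> x x d)) sums exp (\<alpha> * (\<Sum>k=1..M. real k * (cmod (x k))\<^sup>2))"
    using sums_Re[OF cexp_sums(1)[of M x \<alpha> x, OF x]] unfolding \<open>complex_of_real _ = _\<close>[symmetric] by simp
  then have S: "(\<Sum>d\<le>D. Re (cexp \<alpha> x x d)) \<le> exp (\<alpha> * (\<Sum>k=1..M. real k * (cmod (x k))\<^sup>2))" for D
    using sum_le_suminf[of "\<lambda>d. Re (cexp \<alpha> x x d)" "{..D}"] nn unfolding sums_iff by auto
  have rec: "real d * Re (cexp \<alpha> x x d) = (\<Sum>k=1..d. \<alpha> * (real k)\<^sup>2 * (cmod (x k))\<^sup>2 * Re (cexp \<alpha> x x (d - k)))" for d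
  proof -
    have "of_real (\<alpha> * (real k)\<^sup>2 * (cmod (x k))\<^sup>2) = of_real \<alpha> * (of_nat k)\<^sup>2 * (x k * cnj (x k))" for k
      unfolding complex_norm_square[symmetric] by simp
    then have "of_nat d * cexp \<alpha> x x d = (\<Sum>k=1..d. of_real (\<alpha> * (real k)\<^sup>2 * (cmod (x k))\<^sup>2) * cexp \<alpha> x x (d - k))"
      by (simp only: cexp_rec)
    then have "Re (of_nat d * cexp \<alpha> x x d) = (\<Sum>k=1..d. Re (of_real (\<alpha> * (real k)\<^sup>2 * (cmod (x k))\<^sup>2) * cexp \<alpha> x x (d - k)))"
      by (simp only: Re_sum)
    then show ?thesis by (simp only: Re_complex_of_real times_complex.sel
          complex_Re_of_nat complex_Im_of_nat Im_complex_of_real mult_zero_left diff_zero)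
  qed
  have "(\<Sum>d\<le>D. real d * Re (cexp \<alpha> x x d)) =
      (\<Sum>d\<le>D. \<Sum>k=1..d. \<alpha> * (real k)\<^sup>2 * (cmod (x k))\<^sup>2 * Re (cexp \<alpha> x x (d - k)))"
    by (simp only: rec)
  also have "\<dots> = (\<Sum>(d,k)\<in>Sigma {..D} (\<lambda>d. {1..d}). \<alpha> * (real k)\<^sup>2 * (cmod (x k))\<^sup>2 * Re (cexp \<alpha> x x (d - k)))"
    by (simp add: sum.Sigma)
  also have "\<dots> = (\<Sum>(k,j)\<in>Sigma {1..D} (\<lambda>k. {..D - k}). \<alpha> * (real k)\<^sup>2 * (cmod (x k))\<^sup>2 * Re (cexp \<alpha> x x j))"
    by (rule sum.reindex_bij_witness[of _ "\<lambda>(k,j). (j + k, k)" "\<lambda>(d,k). (k, d - k)"]) auto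
  also have "\<dots> = (\<Sum>k=1..D. \<alpha> * (real k)\<^sup>2 * (cmod (x k))\<^sup>2 * (\<Sum>j\<le>D - k. Re (cexp \<alpha> x x j)))"
    by (simp add: sum.Sigma[symmetric] sum_distrib_left)
  also have "\<dots> \<le> (\<Sum>k=1..D. \<alpha> * (real k)\<^sup>2 * (cmod (x k))\<^sup>2 * exp (\<alpha> * (\<Sum>k=1..M. real k * (cmod (x k))\<^sup>2)))"
    using \<alpha> by (intro sum_mono mult_left_mono S) auto
  also have "\<dots> = (\<Sum>k\<in>{1..D} \<inter> {1..M}. \<alpha> * (real k)\<^sup>2 * (cmod (x k))\<^sup>2 * exp (\<alpha> * (\<Sum>k=1..M. real k * (cmod (x k))\<^sup>2)))"
    using x by (intro sum.mono_neutral_right) auto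
  also have "\<dots> \<le> (\<Sum>k=1..M. \<alpha> * (real k)\<^sup>2 * (cmod (x k))\<^sup>2 * exp (\<alpha> * (\<Sum>k=1..M. real k * (cmod (x k))\<^sup>2)))"
    using \<alpha> by (intro sum_mono2) auto
  also have "\<dots> = \<alpha> * (\<Sum>k=1..M. (real k)\<^sup>2 * (cmod (x k))\<^sup>2) * exp (\<alpha> * (\<Sum>k=1..M. real k * (cmod (x k))\<^sup>2))"
    by (simp add: sum_distrib_left sum_distrib_right mult_ac)
  finally show "(\<Sum>d\<le>D. real d * Re (cexp \<alpha> x x d)) \<le>
      \<alpha> * (\<Sum>k=1..M. (real k)\<^sup>2 * (cmod (x k))\<^sup>2) * exp (\<alpha> * (\<Sum>k=1..M. real k * (cmod (x k))\<^sup>2))" .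
qed

subsection \<open>Trigonometric polynomials\<close>

lemma psum_ez_bound: "cmod (psum N k (ez \<theta>)) \<le> real N"
proof -
  have "cmod (psum N k (ez \<theta>)) \<le> (\<Sum>i<N. cmod (ez \<theta> i ^ k))" unfolding psum_def by (rule norm_sum)
  then show ?thesis by (simp add: norm_power)
qed

lemma exponential_expansion:
  fixes x :: "nat \<Rightarrow> complex" and N :: nat
  assumes x: "\<And>k. k > M \<Longrightarrow> x k = 0"
  defines "\<Phi> \<equiv> \<lambda>D \<theta>. \<Sum>d\<le>D. ev N D (expF x d) (ez \<theta>)"
  shows "(\<lambda>D. \<Phi> D \<theta>) \<longlonglongrightarrow> exp (\<Sum>k=1..M. x k * psum N k (ez \<theta>))"
    and "\<exists>C. \<forall>D \<theta>. cmod (\<Phi> D \<theta>) \<le> C"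
proof -
  define y where "y \<theta> k = x k * psum N k (ez \<theta>)" for \<theta> k
  have P: "\<Phi> D \<theta> = (\<Sum>d\<le>D. fps_nth (exp_poly (y \<theta>) M) d)" for D \<theta>
    unfolding \<Phi>_def y_def by (intro sum.cong refl ev_expF[OF x]) auto
  have "fps_nth (exp_poly (y \<theta>) M) sums exp (\<Sum>k=1..M. y \<theta> k)"
    using abs_conv_exp_poly by (auto simp: abs_conv_def)
  then show "(\<lambda>D. \<Phi> D \<theta>) \<longlonglongrightarrow> exp (\<Sum>k=1..M. x k * psum N k (ez \<theta>))"
    unfolding P sums_def_le by (simp add: y_def)
  define w where "w k = cmod (x k) * real N" for k
  have w: "cmod (y \<theta> k) \<le> w k" for \<theta> k
    unfolding y_def w_def norm_mult by (intro mult_left_mono psum_ez_bound) simp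
  have "abs_conv (exp_poly w M) (exp (\<Sum>k=1..M. w k))" by (rule abs_conv_exp_poly)
  then have ws: "fps_nth (exp_poly w M) sums exp (\<Sum>k=1..M. w k)" by (simp add: abs_conv_def)
  have "cmod (\<Phi> D \<theta>) \<le> exp (\<Sum>k=1..M. w k)" for D \<theta>
  proof -
    have "cmod (\<Phi> D \<theta>) \<le> (\<Sum>d\<le>D. fps_nth (exp_poly w M) d)"
      unfolding P by (rule order.trans[OF norm_sum sum_mono]) (rule exp_poly_bound[OF w])
    also have "\<dots> \<le> (\<Sum>d. fps_nth (exp_poly w M) d)"
      by (rule sum_le_suminf)
        (use ws order.trans[OF norm_ge_zero exp_poly_bound[OF w]] in \<open>auto simp: sums_iff\<close>)
    also have "\<dots> = exp (\<Sum>k=1..M. w k)" using ws by (simp add: sums_iff)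
    finally show ?thesis .
  qed
  then show "\<exists>C. \<forall>D \<theta>. cmod (\<Phi> D \<theta>) \<le> C" by blast
qed

text \<open>\<open>ip_difference_bound\<close> is summed over the degrees up to D; the resulting
  bound does not depend on D, so it survives the limit.\<close>

lemma trigonometric_bound:
  fixes x y :: "nat \<Rightarrow> complex"
  assumes \<beta>: "0 < \<beta>" "\<beta> \<le> 2" and N: "N = 2 * n" "n \<ge> 1" and \<alpha>: "\<alpha> = 2 / \<beta>"
    and x: "\<And>k. k > M \<Longrightarrow> x k = 0" and y: "\<And>k. k > M \<Longrightarrow> y k = 0"
  shows "cmod (Jint \<beta> N (\<lambda>\<theta>. exp (\<Sum>k=1..M. x k * psum N k (ez \<theta>)) * cnj (exp (\<Sum>k=1..M. y k * psum N k (ez \<theta>))))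
           / of_real (circular_partition \<beta> N)
         - exp (of_real \<alpha> * (\<Sum>k=1..M. of_nat k * (x k * cnj (y k)))))
     \<le> \<alpha>\<^sup>2 / (2 * real n) * ((\<Sum>k=1..M. (real k)\<^sup>2 * (cmod (x k))\<^sup>2) + (\<Sum>k=1..M. (real k)\<^sup>2 * (cmod (y k))\<^sup>2))
       * exp (\<alpha> / 2 * ((\<Sum>k=1..M. real k * (cmod (x k))\<^sup>2) + (\<Sum>k=1..M. real k * (cmod (y k))\<^sup>2)))"
proof -
  have \<alpha>1: "\<alpha> \<ge> 1" "\<alpha> > 0" using \<beta> by (simp_all add: \<alpha>)
  define Z where "Z = complex_of_real (circular_partition \<beta> N)"
  define ex ey where "ex \<theta> = exp (\<Sum>k=1..M. x k * psum N k (ez \<theta>))"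
    and "ey \<theta> = exp (\<Sum>k=1..M. y k * psum N k (ez \<theta>))" for \<theta>
  define X Y where "X D \<theta> = (\<Sum>d\<le>D. ev N D (expF x d) (ez \<theta>))"
    and "Y D \<theta> = (\<Sum>d\<le>D. ev N D (expF y d) (ez \<theta>))" for D \<theta>
  define Ax Ay Sx Sy where "Ax = (\<Sum>k=1..M. (real k)\<^sup>2 * (cmod (x k))\<^sup>2)"
    and "Ay = (\<Sum>k=1..M. (real k)\<^sup>2 * (cmod (y k))\<^sup>2)"
    and "Sx = (\<Sum>k=1..M. real k * (cmod (x k))\<^sup>2)" and "Sy = (\<Sum>k=1..M. real k * (cmod (y k))\<^sup>2)"
  have tX: "X D \<in> trigp N" "Y D \<in> trigp N" for D
    unfolding X_def[abs_def] Y_def[abs_def] by (intro trigp_sum trigp_ev)+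
  have J: "Jint \<beta> N (\<lambda>\<theta>. X D \<theta> * cnj (Y D \<theta>)) / Z = (\<Sum>d\<le>D. ipN \<beta> N D (expF x d) (expF y d))" for D
  proof -
    define Fx Fy where "Fx = (\<Sum>d\<le>D. expF x d)" and "Fy = (\<Sum>d\<le>D. expF y d)"
    have "X D \<theta> = ev N D Fx (ez \<theta>)" "Y D \<theta> = ev N D Fy (ez \<theta>)" for \<theta>
      by (simp_all add: X_def Y_def Fx_def Fy_def ev_sum)
    then have "Jint \<beta> N (\<lambda>\<theta>. X D \<theta> * cnj (Y D \<theta>)) / Z = ipN \<beta> N D Fx Fy"
      by (simp add: ipN_def Z_def)
    also have "\<dots> = (\<Sum>e\<le>D. ipN \<beta> N D Fx (expF y e))"
      unfolding Fy_def by (rule ipN_sum_right[OF \<beta>(1)])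
    also have "\<dots> = (\<Sum>e\<le>D. \<Sum>d\<le>D. ipN \<beta> N D (expF x d) (expF y e))"
    proof (intro sum.cong refl)
      fix e
      have "ipN \<beta> N D Fx (expF y e) = cnj (ipN \<beta> N D (expF y e) Fx)" by (simp add: ipN_cnj[OF \<beta>(1)])
      then show "ipN \<beta> N D Fx (expF y e) = (\<Sum>d\<le>D. ipN \<beta> N D (expF x d) (expF y e))"
        unfolding Fx_def ipN_sum_right[OF \<beta>(1)] by (simp add: ipN_cnj[OF \<beta>(1)])
    qed
    also have "\<dots> = (\<Sum>e\<le>D. ipN \<beta> N D (expF x e) (expF y e))"
    proof (intro sum.cong refl)
      fix e assume e: "e \<in> {..D}"
      have "(\<Sum>d\<le>D. ipN \<beta> N D (expF x d) (expF y e)) = (\<Sum>d\<in>{e}. ipN \<beta> N D (expF x d) (expF y e))"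
        using e by (intro sum.mono_neutral_right ballI ipN_orthogonal[OF \<beta>(1) expF_hom _ expF_hom]) auto
      then show "(\<Sum>d\<le>D. ipN \<beta> N D (expF x d) (expF y e)) = ipN \<beta> N D (expF x e) (expF y e)" by simp
    qed
    finally show ?thesis .
  qed
  \<comment> \<open>Chosen so that t * exp (\<alpha> * Sx) and exp (\<alpha> * Sy) / t both equal
    the geometric mean of the two exponentials.\<close>
  define t where "t = exp (\<alpha> / 2 * (Sy - Sx))"
  have t: "t > 0" by (simp add: t_def)
  define R where "R = \<alpha>\<^sup>2 / (2 * real n) * (Ax + Ay) * exp (\<alpha> / 2 * (Sx + Sy))"
  have bound: "cmod ((\<Sum>d\<le>D. cexp \<alpha> x y d) - Jint \<beta> N (\<lambda>\<theta>. X D \<theta> * cnj (Y D \<theta>)) / Z) \<le> R" for D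
  proof -
    have "cmod ((\<Sum>d\<le>D. cexp \<alpha> x y d) - Jint \<beta> N (\<lambda>\<theta>. X D \<theta> * cnj (Y D \<theta>)) / Z)
       \<le> (\<Sum>d\<le>D. cmod (ipf \<alpha> D (expF x d) (expF y d) - ipN \<beta> N D (expF x d) (expF y d)))"
      unfolding J sum_subtractf[symmetric] by (rule order.trans[OF norm_sum]) (simp add: cexp_eq)
    also have "\<dots> \<le> (\<Sum>d\<le>D. \<alpha> * real d / (2 * real n) * (t * Re (cexp \<alpha> x x d) + Re (cexp \<alpha> y y d) / t))"
    proof (intro sum_mono)
      fix d assume "d \<in> {..D}"
      then show "cmod (ipf \<alpha> D (expF x d) (expF y d) - ipN \<beta> N D (expF x d) (expF y d))
        \<le> \<alpha> * real d / (2 * real n) * (t * Re (cexp \<alpha> x x d) + Re (cexp \<alpha> y y d) / t)"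
        using ip_difference_bound[OF \<beta>(1) \<alpha> \<alpha>1(1) N expF_hom _ expF_hom t, of d D x y] by (simp add: cexp_eq)
    qed
    also have "\<dots> = \<alpha> / (2 * real n) * (t * (\<Sum>d\<le>D. real d * Re (cexp \<alpha> x x d)) + (\<Sum>d\<le>D. real d * Re (cexp \<alpha> y y d)) / t)"
      by (simp add: sum_distrib_left sum_divide_distrib sum.distrib[symmetric] algebra_simps)
    also have "\<dots> \<le> \<alpha> / (2 * real n) * (t * (\<alpha> * Ax * exp (\<alpha> * Sx)) + (\<alpha> * Ay * exp (\<alpha> * Sy)) / t)"
      using t \<alpha>1 cexp_diag_sum(2)[OF \<alpha>1(2) x] cexp_diag_sum(2)[OF \<alpha>1(2) y] unfolding Ax_def Ay_def Sx_def Sy_def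
      by (intro mult_left_mono add_mono divide_right_mono) auto
    also have "t * (\<alpha> * Ax * exp (\<alpha> * Sx)) = \<alpha> * Ax * exp (\<alpha> / 2 * (Sx + Sy))"
    proof -
      have "t * exp (\<alpha> * Sx) = exp (\<alpha> / 2 * (Sx + Sy))"
        unfolding t_def exp_add[symmetric] by (simp add: field_simps)
      then show ?thesis by (metis mult.left_commute)
    qed
    also have "(\<alpha> * Ay * exp (\<alpha> * Sy)) / t = \<alpha> * Ay * exp (\<alpha> / 2 * (Sx + Sy))"
    proof -
      have "exp (\<alpha> * Sy) / t = exp (\<alpha> / 2 * (Sx + Sy))"
        unfolding t_def exp_diff[symmetric] by (simp add: field_simps)
      then show ?thesis by (metis times_divide_eq_right)
    qed
    finally show ?thesis by (simp add: R_def power2_eq_square algebra_simps add_divide_distrib)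
  qed
  obtain Cx Cy where C: "\<And>D \<theta>. cmod (X D \<theta>) \<le> Cx" "\<And>D \<theta>. cmod (Y D \<theta>) \<le> Cy"
    using exponential_expansion(2)[of M x N, OF x] exponential_expansion(2)[of M y N, OF y]
    unfolding X_def Y_def by blast
  have Xlim: "(\<lambda>D. X D \<theta>) \<longlonglongrightarrow> ex \<theta>" "(\<lambda>D. Y D \<theta>) \<longlonglongrightarrow> ey \<theta>" for \<theta>
    using exponential_expansion(1)[of M x N, OF x] exponential_expansion(1)[of M y N, OF y]
    unfolding X_def Y_def ex_def ey_def by blast+
  have psm: "(\<lambda>\<theta>. psum N k (ez \<theta>)) \<in> borel_measurable (torus N)" for k
    unfolding psum_def by (intro trigp_measurable trigp_sum trigp_power trigp.ei) auto
  have m: "ex \<in> borel_measurable (torus N)" "ey \<in> borel_measurable (torus N)"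
    unfolding ex_def[abs_def] ey_def[abs_def] using psm by measurable
  define W where "W = (5 powr (\<beta> / 2)) ^ card (pairs N)"
  have prodm: "(\<lambda>\<theta>. of_real (circular_weight \<beta> N \<theta>) * (u \<theta> * cnj (v \<theta>))) \<in> borel_measurable (torus N)"
    if "u \<in> borel_measurable (torus N)" "v \<in> borel_measurable (torus N)" for u v :: "(nat \<Rightarrow> real) \<Rightarrow> complex"
  proof -
    have "cnj \<in> borel_measurable borel"
      by (intro borel_measurable_continuous_onI continuous_intros)
    then show ?thesis using that by measurable
  qed
  have Jlim: "(\<lambda>D. Jint \<beta> N (\<lambda>\<theta>. X D \<theta> * cnj (Y D \<theta>))) \<longlonglongrightarrow> Jint \<beta> N (\<lambda>\<theta>. ex \<theta> * cnj (ey \<theta>))"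
    unfolding Jint_def
  proof (rule integral_dominated_convergence[where w = "\<lambda>_. W * (Cx * Cy)"])
    show "integrable (torus N) (\<lambda>_. W * (Cx * Cy))" by (rule integrable_torus_bounded) auto
    show "(\<lambda>\<theta>. of_real (circular_weight \<beta> N \<theta>) * (ex \<theta> * cnj (ey \<theta>))) \<in> borel_measurable (torus N)"
      by (intro prodm m)
    show "(\<lambda>\<theta>. of_real (circular_weight \<beta> N \<theta>) * (X D \<theta> * cnj (Y D \<theta>))) \<in> borel_measurable (torus N)" for D
      by (intro prodm trigp_measurable tX)
    show "AE \<theta> in torus N. (\<lambda>D. of_real (circular_weight \<beta> N \<theta>) * (X D \<theta> * cnj (Y D \<theta>)))
        \<longlonglongrightarrow> of_real (circular_weight \<beta> N \<theta>) * (ex \<theta> * cnj (ey \<theta>))"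
      by (intro AE_I2 tendsto_intros Xlim)
    fix D
    have "cmod (of_real (circular_weight \<beta> N \<theta>) * (X D \<theta> * cnj (Y D \<theta>))) \<le> W * (Cx * Cy)" for \<theta>
      using circular_weight_bounds[of \<beta> N \<theta>] \<beta> C[where D = D and \<theta> = \<theta>] order.trans[OF norm_ge_zero C(1)]
      unfolding norm_mult complex_mod_cnj norm_of_real W_def by (intro mult_mono mult_nonneg_nonneg) auto
    then show "AE \<theta> in torus N. cmod (of_real (circular_weight \<beta> N \<theta>) * (X D \<theta> * cnj (Y D \<theta>))) \<le> W * (Cx * Cy)"
      by simp
  qed
  have "Z \<noteq> 0" using circular_partition_pos[of \<beta> N] \<beta> by (simp add: Z_def)
  have "(\<lambda>D. \<Sum>d\<le>D. cexp \<alpha> x y d) \<longlonglongrightarrow> exp (of_real \<alpha> * (\<Sum>k=1..M. of_nat k * (x k * cnj (y k))))"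
    using cexp_sums(1)[of M x \<alpha> y, OF x] by (simp add: sums_def_le)
  then have "(\<lambda>D. cmod ((\<Sum>d\<le>D. cexp \<alpha> x y d) - Jint \<beta> N (\<lambda>\<theta>. X D \<theta> * cnj (Y D \<theta>)) / Z)) \<longlonglongrightarrow>
     cmod (exp (of_real \<alpha> * (\<Sum>k=1..M. of_nat k * (x k * cnj (y k)))) - Jint \<beta> N (\<lambda>\<theta>. ex \<theta> * cnj (ey \<theta>)) / Z)"
    by (intro tendsto_intros Jlim \<open>Z \<noteq> 0\<close>)
  then have "cmod (exp (of_real \<alpha> * (\<Sum>k=1..M. of_nat k * (x k * cnj (y k)))) - Jint \<beta> N (\<lambda>\<theta>. ex \<theta> * cnj (ey \<theta>)) / Z) \<le> R"
    by (rule LIMSEQ_le_const2) (use bound in blast)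
  then show ?thesis
    unfolding R_def Ax_def Ay_def Sx_def Sy_def ex_def ey_def Z_def by (simp only: norm_minus_commute)
qed

subsection \<open>Uniqueness of Fourier coefficients\<close>

lemma borel_measurable_arcI: "f \<in> borel_measurable borel \<Longrightarrow> f \<in> borel_measurable arc_measure"
  unfolding arc_measure_def by (intro measurable_restrict_space1) simp

lemma circle_measurable:
  assumes "continuous_on UNIV \<phi>"
  shows "(\<lambda>\<theta>. \<phi> (exp (\<i> * complex_of_real \<theta>)) :: 'b :: real_normed_vector) \<in> borel_measurable arc_measure"
proof -
  have "continuous_on UNIV (\<lambda>\<theta>. \<phi> (exp (\<i> * complex_of_real \<theta>)))"
    by (rule continuous_on_compose2[OF assms]) (auto intro!: continuous_intros)
  then show ?thesis by (intro borel_measurable_arcI borel_measurable_continuous_onI)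
qed

lemma integrable_times_bounded:
  fixes h w :: "'a \<Rightarrow> complex"
  assumes h: "integrable A h" and w: "w \<in> borel_measurable A" "\<And>t. cmod (w t) \<le> B"
  shows "integrable A (\<lambda>t. h t * w t)"
proof (rule Bochner_Integration.integrable_bound)
  show "integrable A (\<lambda>t. of_real B * h t)" using h by simp
  show "(\<lambda>t. h t * w t) \<in> borel_measurable A" using h w by measurable
  show "AE t in A. cmod (h t * w t) \<le> cmod (of_real B * h t)"
  proof (intro AE_I2)
    fix t
    have "cmod (w t) \<le> \<bar>B\<bar>" using w(2)[of t] by linarith
    then show "cmod (h t * w t) \<le> cmod (of_real B * h t)"
      by (simp add: norm_mult mult.commute[of "\<bar>B\<bar>"] mult_left_mono)
  qed
qed

lemma circle_bounded:
  assumes "continuous_on UNIV (\<phi> :: complex \<Rightarrow> real)"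
  obtains B where "\<And>\<theta>. \<bar>\<phi> (exp (\<i> * complex_of_real \<theta>))\<bar> \<le> B"
proof -
  have "compact (\<phi> ` sphere 0 1)"
    by (intro compact_continuous_image continuous_on_subset[OF assms]) auto
  then obtain B where "\<And>z. z \<in> sphere 0 1 \<Longrightarrow> \<bar>\<phi> z\<bar> \<le> B"
    using compact_imp_bounded bounded_iff by (metis image_eqI real_norm_def)
  then show thesis by (intro that[of B]) auto
qed

lemma circle_polynomial_times:
  assumes p: "real_polynomial_function p" and w: "w \<in> borel_measurable arc_measure" "\<And>\<theta>. cmod (w \<theta>) \<le> B"
  obtains C where "\<And>\<theta>. cmod (complex_of_real (p (exp (\<i> * complex_of_real \<theta>))) * w \<theta>) \<le> C"
    "(\<lambda>\<theta>. complex_of_real (p (exp (\<i> * complex_of_real \<theta>))) * w \<theta>) \<in> borel_measurable arc_measure"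
proof -
  have pc: "continuous_on UNIV p" using p by (simp add: continuous_on_polymonial_function real_polynomial_function_eq)
  obtain D where D: "\<And>\<theta>. \<bar>p (exp (\<i> * complex_of_real \<theta>))\<bar> \<le> D" using circle_bounded[OF pc] by blast
  have "cmod (complex_of_real (p (exp (\<i> * complex_of_real \<theta>))) * w \<theta>) \<le> D * B" for \<theta>
    unfolding norm_mult norm_of_real
    by (intro mult_mono D w order.trans[OF abs_ge_zero D[of \<theta>]]) auto
  moreover have "(\<lambda>\<theta>. complex_of_real (p (exp (\<i> * complex_of_real \<theta>))) * w \<theta>) \<in> borel_measurable arc_measure"
    using circle_measurable[OF pc] w by measurable
  ultimately show thesis by (rule that)
qed

text \<open>The bounded factor w stands for polynomial factors already treated, so that a product
  takes two uses of the induction hypothesis; the frequency k varies because a linear factor shifts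
  it.\<close>

lemma integral_real_polynomial:
  fixes h :: "real \<Rightarrow> complex"
  assumes h: "integrable arc_measure h" and p: "real_polynomial_function p"
    and "w \<in> borel_measurable arc_measure" "\<And>\<theta>. cmod (w \<theta>) \<le> B"
    and "\<And>k :: int. (\<integral>\<theta>. h \<theta> * (exp (\<i> * of_int k * complex_of_real \<theta>) * w \<theta>) \<partial>arc_measure) = 0"
  shows "(\<integral>\<theta>. h \<theta> * (exp (\<i> * of_int k * complex_of_real \<theta>) * (complex_of_real (p (exp (\<i> * complex_of_real \<theta>))) * w \<theta>)) \<partial>arc_measure) = 0"
  using p assms(3-)
proof (induction p arbitrary: w B k rule: real_polynomial_function.induct)
  case (linear f)
  \<comment> \<open>A real linear f satisfies f (e^(i \<theta>)) = cos \<theta> * f 1 + sin \<theta>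
    * f i; a and b are its coefficients in terms of e^(i \<theta>) and e^(- i \<theta>).\<close>
  define a b where "a = complex_of_real (f 1) / 2 + of_real (f \<i>) / (2 * \<i>)"
    and "b = complex_of_real (f 1) / 2 - of_real (f \<i>) / (2 * \<i>)"
  define e where "e k \<theta> = exp (\<i> * of_int k * complex_of_real \<theta>)" for k :: int and \<theta>
  have e1: "cmod (e k \<theta>) = 1" for k \<theta>
    by (simp add: e_def)
  have em: "e k \<in> borel_measurable arc_measure" for k
    unfolding e_def[abs_def] by (intro borel_measurable_arcI borel_measurable_continuous_onI continuous_intros)
  have f: "of_real (f (exp (\<i> * complex_of_real \<theta>))) = a * e 1 \<theta> + b * e (-1) \<theta>" for \<theta>
  proof -
    have "f (exp (\<i> * complex_of_real \<theta>)) = f (cos \<theta> *\<^sub>R 1 + sin \<theta> *\<^sub>R \<i>)"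
      by (rule arg_cong[of _ _ f]) (simp add: complex_eq_iff Re_exp Im_exp)
    also have "\<dots> = cos \<theta> * f 1 + sin \<theta> * f \<i>"
      using linear(1) by (simp add: linear_simps)
    finally have r: "complex_of_real (f (exp (\<i> * complex_of_real \<theta>))) = cos (complex_of_real \<theta>) * f 1 + sin (complex_of_real \<theta>) * f \<i>"
      by (simp add: cos_of_real sin_of_real)
    show ?thesis unfolding r a_def b_def e_def cos_exp_eq sin_exp_eq by (simp add: field_simps)
  qed
  have m: "e k \<theta> * e l \<theta> = e (k + l) \<theta>" for k l \<theta>
    by (simp add: e_def exp_add[symmetric] algebra_simps)
  have "h \<theta> * (e k \<theta> * (complex_of_real (f (exp (\<i> * complex_of_real \<theta>))) * w \<theta>)) =
    a * (h \<theta> * (e (k + 1) \<theta> * w \<theta>)) + b * (h \<theta> * (e (k + -1) \<theta> * w \<theta>))" for \<theta>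
    unfolding f m[symmetric] by (simp only: algebra_simps)
  moreover have "integrable arc_measure (\<lambda>\<theta>. h \<theta> * (e k \<theta> * w \<theta>))" for k
    by (rule integrable_times_bounded[OF h, where B = B]) (use linear em e1 in \<open>auto simp: norm_mult\<close>)
  moreover have "(\<integral>\<theta>. h \<theta> * (e k \<theta> * w \<theta>) \<partial>arc_measure) = 0" for k
    using linear by (simp add: e_def)
  ultimately show ?case unfolding e_def[symmetric] by simp
next
  case (const c)
  have "h \<theta> * (exp (\<i> * of_int k * complex_of_real \<theta>) * (complex_of_real c * w \<theta>)) =
    c * (h \<theta> * (exp (\<i> * of_int k * complex_of_real \<theta>) * w \<theta>))" for \<theta> by simp
  then show ?case using const(3) by (simp only: integral_mult_right_zero mult_zero_right)
next
  case (add f g)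
  have i: "integrable arc_measure (\<lambda>\<theta>. h \<theta> * (exp (\<i> * of_int k * complex_of_real \<theta>) * (complex_of_real (p (exp (\<i> * complex_of_real \<theta>))) * w \<theta>)))"
    if p: "real_polynomial_function p" for p
  proof -
    obtain C where C: "\<And>\<theta>. cmod (complex_of_real (p (exp (\<i> * complex_of_real \<theta>))) * w \<theta>) \<le> C"
      "(\<lambda>\<theta>. complex_of_real (p (exp (\<i> * complex_of_real \<theta>))) * w \<theta>) \<in> borel_measurable arc_measure"
      using circle_polynomial_times[OF p add(5,6)] by blast
    have "(\<lambda>\<theta>. exp (\<i> * of_int k * complex_of_real \<theta>)) \<in> borel_measurable arc_measure"
      by (intro borel_measurable_arcI borel_measurable_continuous_onI continuous_intros)
    then show ?thesis using C
      by (intro integrable_times_bounded[OF h, where B = C]) (auto simp: norm_mult)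
  qed
  have "(\<integral>\<theta>. h \<theta> * (exp (\<i> * of_int k * complex_of_real \<theta>) * (complex_of_real (f (exp (\<i> * complex_of_real \<theta>))) * w \<theta>)) \<partial>arc_measure) = 0"
    by (rule add.IH(1)[OF add(5,6,7)])
  moreover have "(\<integral>\<theta>. h \<theta> * (exp (\<i> * of_int k * complex_of_real \<theta>) * (complex_of_real (g (exp (\<i> * complex_of_real \<theta>))) * w \<theta>)) \<partial>arc_measure) = 0"
    by (rule add.IH(2)[OF add(5,6,7)])
  ultimately show ?case
    using Bochner_Integration.integral_add[OF i[OF add(1)] i[OF add(2)]]
    by (simp add: distrib_left distrib_right)
next
  case (mult f g)
  obtain C where C: "\<And>\<theta>. cmod (complex_of_real (g (exp (\<i> * complex_of_real \<theta>))) * w \<theta>) \<le> C"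
      "(\<lambda>\<theta>. complex_of_real (g (exp (\<i> * complex_of_real \<theta>))) * w \<theta>) \<in> borel_measurable arc_measure"
    using circle_polynomial_times[OF mult(2,5,6)] by blast
  have "(\<integral>\<theta>. h \<theta> * (exp (\<i> * of_int k * complex_of_real \<theta>) * (complex_of_real (f (exp (\<i> * complex_of_real \<theta>))) *
     (complex_of_real (g (exp (\<i> * complex_of_real \<theta>))) * w \<theta>))) \<partial>arc_measure) = 0"
    by (rule mult.IH(1)[OF C(2,1)]) (rule mult.IH(2)[OF mult(5,6,7)])
  then show ?case by (simp add: mult.assoc)
qed

text \<open>Stone-Weierstrass on the unit circle; the error is at most \<delta> times the L^1 norm
  of h.\<close>

lemma integral_circle_continuous:
  fixes h :: "real \<Rightarrow> complex"
  assumes h: "integrable arc_measure h"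
    and z: "\<And>k :: int. (\<integral>\<theta>. h \<theta> * exp (\<i> * of_int k * complex_of_real \<theta>) \<partial>arc_measure) = 0"
    and \<phi>: "continuous_on UNIV (\<phi> :: complex \<Rightarrow> real)"
  shows "(\<integral>\<theta>. h \<theta> * complex_of_real (\<phi> (exp (\<i> * complex_of_real \<theta>))) \<partial>arc_measure) = 0"
proof -
  define H where "H = (\<integral>\<theta>. cmod (h \<theta>) \<partial>arc_measure)"
  have i: "integrable arc_measure (\<lambda>\<theta>. h \<theta> * complex_of_real (\<psi> (exp (\<i> * complex_of_real \<theta>))))"
    if cont: "continuous_on UNIV (\<psi> :: complex \<Rightarrow> real)" for \<psi>
  proof -
    obtain B where "\<And>\<theta>. \<bar>\<psi> (exp (\<i> * complex_of_real \<theta>))\<bar> \<le> B" using circle_bounded[OF cont] by blast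
    then show ?thesis
      using circle_measurable[OF cont] by (intro integrable_times_bounded[OF h, where B = B]) auto
  qed
  have "cmod (\<integral>\<theta>. h \<theta> * complex_of_real (\<phi> (exp (\<i> * complex_of_real \<theta>))) \<partial>arc_measure) \<le> 0 + \<epsilon>"
    if \<epsilon>: "\<epsilon> > 0" for \<epsilon>
  proof -
    define \<delta> where "\<delta> = \<epsilon> / (H + 1)"
    have H0: "H \<ge> 0" by (simp add: H_def)
    have \<delta>: "\<delta> > 0" using \<epsilon> H0 by (simp add: \<delta>_def)
    obtain p where p: "real_polynomial_function p" "\<And>z. z \<in> sphere 0 1 \<Longrightarrow> \<bar>\<phi> z - p z\<bar> < \<delta>"
      using Stone_Weierstrass_real_polynomial_function[of "sphere (0 :: complex) 1" \<phi> \<delta>] \<delta>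
        continuous_on_subset[OF \<phi>] by (metis compact_sphere subset_UNIV)
    have pc: "continuous_on UNIV p" using p by (simp add: continuous_on_polymonial_function real_polynomial_function_eq)
    have pp: "(\<integral>\<theta>. h \<theta> * complex_of_real (p (exp (\<i> * complex_of_real \<theta>))) \<partial>arc_measure) = 0"
      using integral_real_polynomial[OF h p(1), of "\<lambda>_. 1" 1 0] z by simp
    have "(\<integral>\<theta>. h \<theta> * complex_of_real (\<phi> (exp (\<i> * complex_of_real \<theta>))) \<partial>arc_measure) =
       (\<integral>\<theta>. h \<theta> * complex_of_real (\<phi> (exp (\<i> * complex_of_real \<theta>)) - p (exp (\<i> * complex_of_real \<theta>))) \<partial>arc_measure)"
      using Bochner_Integration.integral_diff[OF i[OF \<phi>] i[OF pc]] pp by (simp add: algebra_simps)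
    also have "cmod \<dots> \<le> (\<integral>\<theta>. \<delta> * cmod (h \<theta>) \<partial>arc_measure)"
    proof (rule order.trans[OF integral_norm_bound integral_mono])
      show "integrable arc_measure (\<lambda>\<theta>. cmod (h \<theta> * complex_of_real (\<phi> (exp (\<i> * complex_of_real \<theta>)) - p (exp (\<i> * complex_of_real \<theta>)))))"
        by (intro integrable_norm i continuous_intros \<phi> pc)
      show "integrable arc_measure (\<lambda>\<theta>. \<delta> * cmod (h \<theta>))" using h by simp
      fix \<theta>
      have "\<bar>\<phi> (exp (\<i> * complex_of_real \<theta>)) - p (exp (\<i> * complex_of_real \<theta>))\<bar> \<le> \<delta>"
        using p(2)[of "exp (\<i> * complex_of_real \<theta>)"] by (simp add: less_imp_le)
      then show "cmod (h \<theta> * complex_of_real (\<phi> (exp (\<i> * complex_of_real \<theta>)) - p (exp (\<i> * complex_of_real \<theta>)))) \<le> \<delta> * cmod (h \<theta>)"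
        unfolding norm_mult norm_of_real by (subst mult.commute) (rule mult_right_mono, auto)
    qed
    also have "\<dots> = \<delta> * H" by (simp add: H_def)
    also have "\<dots> \<le> \<epsilon>" using H0 \<epsilon> by (simp add: \<delta>_def field_simps)
    finally show ?thesis by simp
  qed
  then have "cmod (\<integral>\<theta>. h \<theta> * complex_of_real (\<phi> (exp (\<i> * complex_of_real \<theta>))) \<partial>arc_measure) \<le> 0"
    by (rule field_le_epsilon)
  then show ?thesis by simp
qed

text \<open>One interval is open and one closed: the compact sets used below lie over [-pi, pi],
  whose ends coincide on the circle, while the points of integration avoid the ends.\<close>

lemma exp_arc_inj:
  assumes "exp (\<i> * complex_of_real s) = exp (\<i> * complex_of_real t)" "s \<in> {-pi<..<pi}" "t \<in> {-pi..pi}"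
  shows "s = t"
proof -
  obtain n :: int where "\<i> * complex_of_real s = \<i> * complex_of_real t + (of_int (2 * n) * pi) * \<i>"
    using assms(1) unfolding exp_eq by blast
  then have "\<i> * complex_of_real s = \<i> * complex_of_real (t + of_int (2 * n) * pi)"
    by (simp add: algebra_simps)
  then have s: "s = t + of_int (2 * n) * pi"
    by (metis complex_i_not_zero mult_cancel_left of_real_eq_iff)
  have "n = 0"
  proof (rule ccontr)
    assume "n \<noteq> 0"
    then have "\<bar>of_int (2 * n) * pi\<bar> \<ge> 2 * pi" by (simp add: abs_mult)
    moreover have "\<bar>s - t\<bar> < 2 * pi" using assms(2,3) by auto
    ultimately show False using s by simp
  qed
  then show ?thesis using s by simp
qed

text \<open>h integrates to 0 over closed sets, since their indicators are limits of continuous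
  functions on the circle; Dynkin's argument extends this to all Borel sets.\<close>

lemma fourier_unique_zero:
  fixes h :: "real \<Rightarrow> complex"
  assumes h: "integrable arc_measure h"
    and z: "\<And>k :: int. (\<integral>\<theta>. h \<theta> * exp (\<i> * of_int k * complex_of_real \<theta>) \<partial>arc_measure) = 0"
  shows "AE \<theta> in arc_measure. h \<theta> = 0"
proof -
  have sf: "sigma_finite_measure arc_measure"
    using finite_arc by (rule finite_measure.axioms(1))
  show ?thesis
  proof (rule sigma_finite_measure.density_zero[OF sf h])
  have closed: "(\<integral>\<theta>. indicator E \<theta> *\<^sub>R h \<theta> \<partial>arc_measure) = 0" if "closed E" for E :: "real set"
  proof -
    \<comment> \<open>The image on the circle is compact, hence closed, and over the open arc it
      determines E.\<close>
    define C where "C = (\<lambda>\<theta>. exp (\<i> * complex_of_real \<theta>)) ` (E \<inter> {-pi..pi})"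
    have "compact C" unfolding C_def
      by (intro compact_continuous_image continuous_intros closed_Int_compact that) auto
    then have Cc: "closed C" by (rule compact_imp_closed)
    have CE: "exp (\<i> * complex_of_real \<theta>) \<in> C \<longleftrightarrow> \<theta> \<in> E" if "\<theta> \<in> {-pi<..<pi}" for \<theta>
      using that exp_arc_inj by (force simp: C_def)
    show ?thesis
    proof (cases "C = {}")
      case True
      then have "indicator E \<theta> *\<^sub>R h \<theta> = 0" if "\<theta> \<in> space arc_measure" for \<theta>
        using CE that by (auto simp: indicator_def)
      then have "(\<integral>\<theta>. indicator E \<theta> *\<^sub>R h \<theta> \<partial>arc_measure) = (\<integral>\<theta>. 0 \<partial>arc_measure)"
        by (intro Bochner_Integration.integral_cong) auto
      then show ?thesis by simp
    next
      case False
      \<comment> \<open>Continuous functions that equal 1 on C and decrease to its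
        indicator.\<close>
      define \<phi> where "\<phi> m z = max 0 (1 - real m * infdist z C)" for m z
      have \<phi>: "continuous_on UNIV (\<phi> m)" for m
        unfolding \<phi>_def[abs_def] by (intro continuous_intros)
      have \<phi>01: "0 \<le> \<phi> m z" "\<phi> m z \<le> 1" for m z
        by (auto simp: \<phi>_def infdist_nonneg)
      have lim: "(\<lambda>m. \<phi> m z) \<longlonglongrightarrow> indicator C z" for z
      proof (cases "z \<in> C")
        case True
        then show ?thesis by (simp add: \<phi>_def)
      next
        case z: False
        then have d: "infdist z C > 0" using in_closed_iff_infdist_zero[OF Cc \<open>C \<noteq> {}\<close>] infdist_nonneg[of z C] by force
        obtain m0 :: nat where m0: "1 < real m0 * infdist z C" using ex_less_of_nat_mult[OF d] by blast
        have "\<phi> m z = 0" if "m \<ge> m0" for m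
        proof -
          have "real m0 * infdist z C \<le> real m * infdist z C" using that d by simp
          then show ?thesis using m0 by (simp add: \<phi>_def)
        qed
        then have "eventually (\<lambda>m. \<phi> m z = 0) sequentially" by (auto simp: eventually_sequentially)
        then show ?thesis using z by (simp add: tendsto_eventually)
      qed
      have "(\<lambda>m. \<integral>\<theta>. h \<theta> * complex_of_real (\<phi> m (exp (\<i> * complex_of_real \<theta>))) \<partial>arc_measure)
         \<longlonglongrightarrow> (\<integral>\<theta>. indicator E \<theta> *\<^sub>R h \<theta> \<partial>arc_measure)"
      proof (rule integral_dominated_convergence[where w = "\<lambda>\<theta>. cmod (h \<theta>)"])
        show "(\<lambda>\<theta>. indicator E \<theta> *\<^sub>R h \<theta>) \<in> borel_measurable arc_measure"
          using h that by (intro borel_measurable_scaleR borel_measurable_arcI[of "indicator _"] borel_measurable_indicator) auto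
        show "(\<lambda>\<theta>. h \<theta> * complex_of_real (\<phi> m (exp (\<i> * complex_of_real \<theta>)))) \<in> borel_measurable arc_measure" for m
          using h using circle_measurable[OF \<phi>] by measurable
        show "integrable arc_measure (\<lambda>\<theta>. cmod (h \<theta>))" using h by simp
        show "AE \<theta> in arc_measure. (\<lambda>m. h \<theta> * complex_of_real (\<phi> m (exp (\<i> * complex_of_real \<theta>)))) \<longlonglongrightarrow> indicator E \<theta> *\<^sub>R h \<theta>"
        proof (intro AE_I2)
          fix \<theta> assume "\<theta> \<in> space arc_measure"
          then have "indicator C (exp (\<i> * complex_of_real \<theta>)) = (indicator E \<theta> :: real)"
            using CE[of \<theta>] by (auto simp: indicator_def)
          then have "(\<lambda>m. h \<theta> * complex_of_real (\<phi> m (exp (\<i> * complex_of_real \<theta>)))) \<longlonglongrightarrow> h \<theta> * complex_of_real (indicator E \<theta>)"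
            using lim[of "exp (\<i> * complex_of_real \<theta>)"] by (intro tendsto_intros) simp
          then show "(\<lambda>m. h \<theta> * complex_of_real (\<phi> m (exp (\<i> * complex_of_real \<theta>)))) \<longlonglongrightarrow> indicator E \<theta> *\<^sub>R h \<theta>"
            by (simp add: scaleR_conv_of_real mult.commute)
        qed
        fix m
        show "AE \<theta> in arc_measure. cmod (h \<theta> * complex_of_real (\<phi> m (exp (\<i> * complex_of_real \<theta>)))) \<le> cmod (h \<theta>)"
          using \<phi>01 by (intro AE_I2) (simp add: norm_mult mult_left_le)
      qed
      then show ?thesis
        unfolding integral_circle_continuous[OF h z \<phi>] by (simp add: LIMSEQ_const_iff)
    qed
  qed
  have ind: "integrable arc_measure (\<lambda>\<theta>. indicator B \<theta> *\<^sub>R h \<theta>)" if "B \<in> sets borel" for B :: "real set"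
  proof (rule Bochner_Integration.integrable_bound[OF h])
    show "(\<lambda>\<theta>. indicator B \<theta> *\<^sub>R h \<theta>) \<in> borel_measurable arc_measure"
      using h that by (intro borel_measurable_scaleR borel_measurable_arcI[of "indicator _"] borel_measurable_indicator) auto
  qed (simp add: indicator_def)
  have borel: "(\<integral>\<theta>. indicator B \<theta> *\<^sub>R h \<theta> \<partial>arc_measure) = 0" if "B \<in> sets borel" for B :: "real set"
  proof -
    have sb: "sets borel = sigma_sets UNIV (Collect closed :: real set set)"
      by (simp add: borel_eq_closed)
    have "Int_stable (Collect closed :: real set set)" by (auto simp: Int_stable_def)
    moreover have "(Collect closed :: real set set) \<subseteq> Pow UNIV" by simp
    moreover have "B \<in> sigma_sets UNIV (Collect closed)" using that by (simp add: sb)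
    ultimately show ?thesis
    proof (induction rule: sigma_sets_induct_disjoint)
      case (basic A)
      then show ?case using closed by simp
    next
      case empty
      then show ?case by simp
    next
      case (compl A)
      have "indicator (UNIV - A) \<theta> *\<^sub>R h \<theta> = h \<theta> - indicator A \<theta> *\<^sub>R h \<theta>" for \<theta>
        by (simp add: indicator_def)
      \<comment> \<open>The frequency k = 0 says that h has total integral 0, which settles
        complements.\<close>
      then show ?case using compl ind[of A] h z[of 0] by (simp add: sb)
    next
      case (union A)
      have A: "A i \<in> sets borel" for i using union(2) by (auto simp: sb)
      have "(\<lambda>n. \<integral>\<theta>. (\<Sum>i<n. indicator (A i) \<theta> *\<^sub>R h \<theta>) \<partial>arc_measure) \<longlonglongrightarrow> (\<integral>\<theta>. indicator (\<Union>i. A i) \<theta> *\<^sub>R h \<theta> \<partial>arc_measure)"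
      proof (rule integral_dominated_convergence[where w = "\<lambda>\<theta>. cmod (h \<theta>)"])
        have U: "(\<Sum>i<n. indicator (A i) \<theta> *\<^sub>R h \<theta>) = indicator (\<Union>i<n. A i) \<theta> *\<^sub>R h \<theta>" for n \<theta>
        proof -
          have "disjoint_family_on A {..<n}" using union(1) by (auto simp: disjoint_family_on_def)
          then show ?thesis by (simp add: indicator_UN_disjoint scaleR_sum_left)
        qed
        show "(\<lambda>\<theta>. indicator (\<Union>i. A i) \<theta> *\<^sub>R h \<theta>) \<in> borel_measurable arc_measure"
          using ind[of "\<Union>i. A i"] A by auto
        show "(\<lambda>\<theta>. \<Sum>i<n. indicator (A i) \<theta> *\<^sub>R h \<theta>) \<in> borel_measurable arc_measure" for n
          using ind[OF A] by (intro borel_measurable_sum) auto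
        show "integrable arc_measure (\<lambda>\<theta>. cmod (h \<theta>))" using h by simp
        show "AE \<theta> in arc_measure. (\<lambda>n. \<Sum>i<n. indicator (A i) \<theta> *\<^sub>R h \<theta>) \<longlonglongrightarrow> indicator (\<Union>i. A i) \<theta> *\<^sub>R h \<theta>"
          unfolding U by (intro AE_I2 tendsto_scaleR LIMSEQ_indicator_UN tendsto_const)
        show "AE \<theta> in arc_measure. cmod (\<Sum>i<n. indicator (A i) \<theta> *\<^sub>R h \<theta>) \<le> cmod (h \<theta>)" for n
          unfolding U by (intro AE_I2) (simp add: indicator_def)
      qed
      moreover have "(\<integral>\<theta>. (\<Sum>i<n. indicator (A i) \<theta> *\<^sub>R h \<theta>) \<partial>arc_measure) = 0" for n
        using union(3) by (subst Bochner_Integration.integral_sum) (auto intro: ind[OF A])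
      ultimately show ?case by (simp only: LIMSEQ_const_iff)
    qed
  qed
  fix A assume "A \<in> sets arc_measure"
  then have "A \<in> sets borel" by (auto simp: arc_measure_def sets_restrict_space)
  then show "set_lebesgue_integral arc_measure A h = 0"
    using borel by (simp add: set_lebesgue_integral_def)
qed
qed

subsection \<open>Fourier series of Sobolev functions\<close>

lemma sum_symmetric_int:
  "(\<Sum>k\<in>{- int M..int M}. F k) = F 0 + (\<Sum>k=1..M. F (int k) + F (- int k) :: 'a :: comm_monoid_add)"
proof (induction M)
  case (Suc M)
  have "{- int (Suc M)..int (Suc M)} = insert (int (Suc M)) (insert (- int (Suc M)) {- int M..int M})" by auto
  then show ?case using Suc by (simp add: add_ac)
qed simp

lemma sum_symmetric_le_infsum:
  fixes F :: "int \<Rightarrow> real"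
  assumes "F summable_on UNIV" "\<And>k. F k \<ge> 0"
  shows "(\<Sum>k=1..M. F (int k) + F (- int k)) \<le> infsum F UNIV"
proof -
  have "(\<Sum>k\<in>{- int M..int M}. F k) \<le> infsum F UNIV"
    by (rule finite_sum_le_infsum) (use assms in auto)
  then show ?thesis using assms(2)[of 0] by (simp add: sum_symmetric_int)
qed

lemma summable_nat_of_int:
  fixes F :: "int \<Rightarrow> real"
  assumes "F summable_on UNIV" "\<And>k. F k \<ge> 0" "inj g"
  shows "summable (\<lambda>k::nat. F (g k))"
proof -
  have "F summable_on range g" by (rule summable_on_subset_banach[OF assms(1)]) simp
  then have "(F \<circ> g) summable_on UNIV" using summable_on_reindex[OF assms(3)] by blast
  then show ?thesis using assms(2) by (subst (asm) summable_on_UNIV_nonneg_real_iff) (auto simp: o_def)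
qed

text \<open>Write a k = (k * a k) * (1 / k) and use the inequality of arithmetic and geometric
  means. This gives absolutely summable Fourier coefficients on H^1.\<close>

lemma summable_of_weighted_squares:
  fixes a :: "nat \<Rightarrow> real"
  assumes a: "summable (\<lambda>k. (real k)\<^sup>2 * (a k)\<^sup>2)" "\<And>k. a k \<ge> 0"
  shows "summable a"
proof (rule summable_comparison_test')
  show "summable (\<lambda>k. (real k)\<^sup>2 * (a k)\<^sup>2 + inverse (real k ^ 2))"
    by (intro summable_add a inverse_power_summable) simp
  fix k :: nat assume k: "k \<ge> 1"
  have "0 \<le> (real k * a k - inverse (real k))\<^sup>2" by simp
  then have "2 * (a k * (real k * inverse (real k))) \<le> (real k)\<^sup>2 * (a k)\<^sup>2 + inverse (real k ^ 2)"
    by (simp add: power2_eq_square algebra_simps)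
  then show "norm (a k) \<le> (real k)\<^sup>2 * (a k)\<^sup>2 + inverse (real k ^ 2)"
    using k a(2)[of k] by simp
qed

lemma integral_arc_character:
  "(\<integral>\<theta>. exp (\<i> * of_int k * complex_of_real \<theta>) \<partial>arc_measure) = (if k = 0 then of_real (2 * pi) else 0)"
proof (cases "k = 0")
  case True
  have "measure arc_measure {-pi<..<pi} = 2 * pi"
    by (simp add: arc_measure_def measure_restrict_space)
  then show ?thesis using True by (simp add: scaleR_conv_of_real)
next
  case False
  define F where "F \<theta> = exp (\<i> * of_int k * complex_of_real \<theta>) / (\<i> * of_int k)" for \<theta>
  have "(F has_vector_derivative exp (\<i> * of_int k * complex_of_real \<theta>)) (at \<theta>)" for \<theta>
    unfolding F_def[abs_def] using False
    by (intro has_vector_derivative_real_field) (auto intro!: derivative_eq_intros)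
  moreover have "F pi = F (- pi)"
  proof -
    have "exp (\<i> * of_int k * complex_of_real pi) = exp (\<i> * of_int k * complex_of_real (- pi))"
      unfolding exp_eq by (rule exI[of _ k]) (simp add: algebra_simps)
    then show ?thesis by (simp only: F_def)
  qed
  ultimately have "(\<integral>\<theta>. exp (\<i> * of_int k * complex_of_real \<theta>) \<partial>arc_measure) = 0"
    by (intro integral_arc_derivative[of F]) (auto intro!: continuous_intros)
  then show ?thesis using False by simp
qed

lemma L2_circle_integrable:
  assumes "f \<in> L2_circle"
  shows "integrable arc_measure f"
proof (rule Bochner_Integration.integrable_bound)
  show "integrable arc_measure (\<lambda>\<theta>. 1 + (cmod (f \<theta>))\<^sup>2)"
    using assms finite_measure.integrable_const[OF finite_arc, of "1 :: real"]
    by (intro Bochner_Integration.integrable_add) (auto simp: L2_circle_def)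
  show "f \<in> borel_measurable arc_measure" using assms by (simp add: L2_circle_def)
  have "x \<le> 1 + x\<^sup>2" for x :: real
  proof -
    have "2 * x \<le> x\<^sup>2 + 1" using zero_le_power2[of "x - 1"] by (simp add: power2_diff)
    then show ?thesis using zero_le_power2[of x] by linarith
  qed
  then show "AE \<theta> in arc_measure. cmod (f \<theta>) \<le> norm (1 + (cmod (f \<theta>))\<^sup>2)"
    by (intro AE_I2) (simp add: add_nonneg_nonneg)
qed

definition fsum :: "(int \<Rightarrow> complex) \<Rightarrow> nat \<Rightarrow> real \<Rightarrow> complex" where
  "fsum c M \<theta> = (\<Sum>k\<in>{- int M..int M}. c k * exp (\<i> * of_int k * complex_of_real \<theta>))"

lemma fsum_nat:
  "fsum c M \<theta> = c 0 + (\<Sum>k=1..M. c (int k) * exp (\<i> * complex_of_real \<theta>) ^ k + c (- int k) * cnj (exp (\<i> * complex_of_real \<theta>)) ^ k)"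
proof -
  have e: "exp (\<i> * of_int (int k) * complex_of_real \<theta>) = exp (\<i> * complex_of_real \<theta>) ^ k"
    "exp (\<i> * of_int (- int k) * complex_of_real \<theta>) = cnj (exp (\<i> * complex_of_real \<theta>)) ^ k" for k
    by (simp_all add: exp_cnj exp_of_nat_mult[symmetric] algebra_simps)
  show ?thesis unfolding fsum_def sum_symmetric_int e by simp
qed

lemma fsum_measurable: "fsum c M \<in> borel_measurable arc_measure"
  unfolding fsum_def[abs_def]
  by (intro borel_measurable_arcI borel_measurable_continuous_onI continuous_intros)

lemma fsum_converges:
  assumes a: "summable (\<lambda>k. cmod (c (int k)))" and b: "summable (\<lambda>k. cmod (c (- int k)))"
  obtains g B where "\<And>\<theta>. (\<lambda>M. fsum c M \<theta>) \<longlonglongrightarrow> g \<theta>" "\<And>M \<theta>. cmod (fsum c M \<theta>) \<le> B"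
proof -
  define t where "t \<theta> k = c (int k) * exp (\<i> * complex_of_real \<theta>) ^ k + c (- int k) * cnj (exp (\<i> * complex_of_real \<theta>)) ^ k" for \<theta> k
  define w where "w k = cmod (c (int k)) + cmod (c (- int k))" for k
  have w: "summable w" unfolding w_def by (intro summable_add a b)
  have tw: "cmod (t \<theta> k) \<le> w k" for \<theta> k
    unfolding t_def w_def by (rule order.trans[OF norm_triangle_ineq]) (simp add: norm_mult norm_power)
  have P: "fsum c M \<theta> = c 0 + (\<Sum>k<M. t \<theta> (Suc k))" for M \<theta>
    unfolding fsum_nat t_def by (simp add: sum.atLeast1_atMost_eq del: of_nat_Suc)
  have ws: "summable (\<lambda>k. w (Suc k))" using w by (simp add: summable_Suc_iff)
  have ts: "summable (\<lambda>k. t \<theta> (Suc k))" for \<theta>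
    by (rule summable_comparison_test'[OF ws]) (rule tw)
  show thesis
  proof (rule that)
    show "(\<lambda>M. fsum c M \<theta>) \<longlonglongrightarrow> c 0 + (\<Sum>k. t \<theta> (Suc k))" for \<theta>
      unfolding P by (intro tendsto_intros summable_LIMSEQ ts)
    show "cmod (fsum c M \<theta>) \<le> cmod (c 0) + (\<Sum>k. w (Suc k))" for M \<theta>
    proof -
      have "cmod (\<Sum>k<M. t \<theta> (Suc k)) \<le> (\<Sum>k<M. w (Suc k))"
        by (rule order.trans[OF norm_sum sum_mono]) (rule tw)
      also have "\<dots> \<le> (\<Sum>k. w (Suc k))"
        by (rule sum_le_suminf[OF ws]) (auto simp: w_def)
      finally show ?thesis unfolding P by (intro order.trans[OF norm_triangle_ineq]) simp
    qed
  qed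
qed

text \<open>By dominated convergence the limit g has the Fourier coefficients of f, and
  \<open>fourier_unique_zero\<close> applies to f - g.\<close>

lemma fourier_series_AE:
  assumes f: "f \<in> L2_circle"
    and lim: "\<And>\<theta>. (\<lambda>M. fsum (fourier_coeff f) M \<theta>) \<longlonglongrightarrow> g \<theta>"
    and bd: "\<And>M \<theta>. cmod (fsum (fourier_coeff f) M \<theta>) \<le> B"
  shows "AE \<theta> in arc_measure. f \<theta> = g \<theta>"
proof -
  define c where "c = fourier_coeff f"
  define e where "e k \<theta> = exp (\<i> * of_int k * complex_of_real \<theta>)" for k :: int and \<theta>
  have e1: "cmod (e k \<theta>) = 1" for k \<theta> by (simp add: e_def)
  have em: "e k \<in> borel_measurable arc_measure" for k
    unfolding e_def[abs_def] by (intro borel_measurable_arcI borel_measurable_continuous_onI continuous_intros)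
  have fi: "integrable arc_measure f" by (rule L2_circle_integrable[OF f])
  have bi: "integrable arc_measure u" if "u \<in> borel_measurable arc_measure" "\<And>\<theta>. cmod (u \<theta>) \<le> C"
    for u :: "real \<Rightarrow> complex" and C
    by (rule finite_measure.integrable_const_bound[OF finite_arc, of _ C]) (use that in auto)
  have gm: "g \<in> borel_measurable arc_measure"
    by (rule borel_measurable_LIMSEQ_metric[OF fsum_measurable lim])
  have gB: "cmod (g \<theta>) \<le> B" for \<theta>
    by (rule LIMSEQ_le_const2[OF tendsto_norm[OF lim]]) (use bd in blast)
  have coeff: "(\<integral>\<theta>. fsum c M \<theta> * e (- j) \<theta> \<partial>arc_measure) = of_real (2 * pi) * c j" if "\<bar>j\<bar> \<le> int M" for M j
  proof -
    have "fsum c M \<theta> * e (- j) \<theta> = (\<Sum>k\<in>{- int M..int M}. c k * e (k - j) \<theta>)" for \<theta>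
      unfolding fsum_def sum_distrib_right
      by (intro sum.cong refl) (simp add: e_def algebra_simps exp_add[symmetric] flip: exp_add)
    then have "(\<integral>\<theta>. fsum c M \<theta> * e (- j) \<theta> \<partial>arc_measure) = (\<Sum>k\<in>{- int M..int M}. c k * (\<integral>\<theta>. e (k - j) \<theta> \<partial>arc_measure))"
      using bi[OF em, of _ 1] e1 by (simp add: Bochner_Integration.integral_sum)
    also have "\<dots> = (\<Sum>k\<in>{- int M..int M}. if k = j then c k * of_real (2 * pi) else 0)"
      unfolding e_def integral_arc_character by (intro sum.cong) auto
    also have "\<dots> = of_real (2 * pi) * c j" using that by (auto simp: mult.commute)
    finally show ?thesis .
  qed
  have g: "(\<integral>\<theta>. g \<theta> * e (- j) \<theta> \<partial>arc_measure) = of_real (2 * pi) * c j" for j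
  proof (rule LIMSEQ_unique)
    show "(\<lambda>M. \<integral>\<theta>. fsum c M \<theta> * e (- j) \<theta> \<partial>arc_measure) \<longlonglongrightarrow> (\<integral>\<theta>. g \<theta> * e (- j) \<theta> \<partial>arc_measure)"
    proof (rule integral_dominated_convergence[where w = "\<lambda>_. B"])
      show "(\<lambda>\<theta>. g \<theta> * e (- j) \<theta>) \<in> borel_measurable arc_measure" using gm em by measurable
      show "(\<lambda>\<theta>. fsum c M \<theta> * e (- j) \<theta>) \<in> borel_measurable arc_measure" for M
        using fsum_measurable em by measurable
      show "integrable arc_measure (\<lambda>_. B)" by (rule finite_measure.integrable_const[OF finite_arc])
      show "AE \<theta> in arc_measure. (\<lambda>M. fsum c M \<theta> * e (- j) \<theta>) \<longlonglongrightarrow> g \<theta> * e (- j) \<theta>"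
        unfolding c_def by (intro AE_I2 tendsto_intros lim)
      show "AE \<theta> in arc_measure. cmod (fsum c M \<theta> * e (- j) \<theta>) \<le> B" for M
        unfolding c_def using bd by (simp add: norm_mult e1)
    qed
    have "eventually (\<lambda>M. (\<integral>\<theta>. fsum c M \<theta> * e (- j) \<theta> \<partial>arc_measure) = of_real (2 * pi) * c j) sequentially"
      by (rule eventually_sequentiallyI[of "nat \<bar>j\<bar>"]) (rule coeff, simp)
    then show "(\<lambda>M. \<integral>\<theta>. fsum c M \<theta> * e (- j) \<theta> \<partial>arc_measure) \<longlonglongrightarrow> of_real (2 * pi) * c j"
      by (rule tendsto_eventually)
  qed
  have fj: "(\<integral>\<theta>. f \<theta> * e (- j) \<theta> \<partial>arc_measure) = of_real (2 * pi) * c j" for j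
    by (simp add: c_def fourier_coeff_def e_def)
  have "AE \<theta> in arc_measure. f \<theta> - g \<theta> = 0"
  proof (rule fourier_unique_zero)
    show "integrable arc_measure (\<lambda>\<theta>. f \<theta> - g \<theta>)" using fi bi[OF gm gB] by simp
    fix k :: int
    have "integrable arc_measure (\<lambda>\<theta>. f \<theta> * e k \<theta>)" "integrable arc_measure (\<lambda>\<theta>. g \<theta> * e k \<theta>)"
      by (rule integrable_times_bounded[OF _ em, of _ _ 1]; use fi bi[OF gm gB] e1 in simp)+
    then show "(\<integral>\<theta>. (f \<theta> - g \<theta>) * exp (\<i> * of_int k * complex_of_real \<theta>) \<partial>arc_measure) = 0"
      using g[of "- k"] fj[of "- k"] by (simp add: left_diff_distrib flip: e_def)
  qed
  then show ?thesis by simp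
qed

lemma AE_torus:
  assumes "AE \<theta> in arc_measure. P \<theta>"
  shows "AE \<theta> in torus N. \<forall>j\<in>{..<N}. P (\<theta> j)"
proof (rule AE_finite_allI)
  fix j assume j: "j \<in> {..<N}"
  obtain A where A: "{\<theta> \<in> space arc_measure. \<not> P \<theta>} \<subseteq> A" "emeasure arc_measure A = 0" "A \<in> sets arc_measure"
    using AE_E[OF assms] by blast
  define B where "B = (\<Pi>\<^sub>E i\<in>{..<N}. if i = j then A else space arc_measure)"
  have s: "(if i = j then A else space arc_measure) \<in> sets arc_measure" for i using A(3) sets.top[of arc_measure] by (simp del: space_arc)
  have "emeasure (torus N) B = (\<Prod>i\<in>{..<N}. emeasure arc_measure (if i = j then A else space arc_measure))"
    unfolding B_def by (rule arc.emeasure_PiM) (use s in auto)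
  also have "\<dots> = 0" by (rule prod_zero) (use A j in auto)
  finally have "B \<in> null_sets (torus N)"
    unfolding B_def using s by (intro null_setsI sets_PiM_I_finite) auto
  moreover have "{\<theta> \<in> space (torus N). \<not> P (\<theta> j)} \<subseteq> B"
    using A(1) j unfolding B_def space_PiM by (auto simp: PiE_iff extensional_def)
  ultimately show "AE \<theta> in torus N. P (\<theta> j)" by (rule AE_I')
qed simp

section \<open>From trigonometric polynomials to the ensemble expectation\<close>

lemma circular_expectation_eq:
  assumes \<beta>: "\<beta> \<ge> 0" and F: "F \<in> borel_measurable (torus N)"
  shows "circular_expectation \<beta> N F = Jint \<beta> N F / of_real (circular_partition \<beta> N)"
proof -
  have m: "(\<lambda>\<theta>. circular_weight \<beta> N \<theta> / circular_partition \<beta> N) \<in> borel_measurable (torus N)"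
    using circular_weight_measurable by measurable
  have "circular_expectation \<beta> N F = (\<integral>\<theta>. (circular_weight \<beta> N \<theta> / circular_partition \<beta> N) *\<^sub>R F \<theta> \<partial>torus N)"
    unfolding circular_expectation_def circular_ensemble_def
    using circular_weight_bounds(1)[OF \<beta>, of N] circular_partition_pos[OF \<beta>, of N]
    by (intro integral_density F m) auto
  also have "\<dots> = (\<integral>\<theta>. (of_real (circular_weight \<beta> N \<theta>) * F \<theta>) / of_real (circular_partition \<beta> N) \<partial>torus N)"
    by (simp add: scaleR_conv_of_real)
  finally show ?thesis by (simp add: Jint_def)
qed

text \<open>Positive frequencies give x and conjugated negative ones give y. The product over j is
  then a constant times an exponential of power sums times the conjugate of another, which is the
  shape of an inner product.\<close>

lemma truncated_bound:
  fixes c :: "int \<Rightarrow> complex"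
  assumes \<beta>: "0 < \<beta>" "\<beta> \<le> 2" and N: "N = 2 * n" "n \<ge> 1"
    and A: "(\<lambda>k. (real_of_int k)\<^sup>2 * (cmod (c k))\<^sup>2) summable_on UNIV"
    and S: "(\<lambda>k. \<bar>real_of_int k\<bar> * (cmod (c k))\<^sup>2) summable_on UNIV"
  shows "cmod (Jint \<beta> N (\<lambda>\<theta>. \<Prod>j<N. exp (fsum c M (\<theta> j))) / of_real (circular_partition \<beta> N) * exp (- (of_nat N * c 0))
         - exp (of_real (2 / \<beta>) * (\<Sum>k=1..M. of_nat k * (c (int k) * c (- int k)))))
     \<le> 4 / (\<beta>\<^sup>2 * real n) * (\<Sum>\<^sub>\<infinity>k\<in>UNIV. (real_of_int k)\<^sup>2 * (cmod (c k))\<^sup>2)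
       * exp (1 / \<beta> * (\<Sum>\<^sub>\<infinity>k\<in>UNIV. \<bar>real_of_int k\<bar> * (cmod (c k))\<^sup>2))"
proof -
  define \<alpha> where "\<alpha> = 2 / \<beta>"
  define x y where "x k = (if k \<le> M then c (int k) else 0)" and "y k = (if k \<le> M then cnj (c (- int k)) else 0)" for k
  define SA where "SA = (\<Sum>k=1..M. (real k)\<^sup>2 * (cmod (x k))\<^sup>2) + (\<Sum>k=1..M. (real k)\<^sup>2 * (cmod (y k))\<^sup>2)"
  define SS where "SS = (\<Sum>k=1..M. real k * (cmod (x k))\<^sup>2) + (\<Sum>k=1..M. real k * (cmod (y k))\<^sup>2)"
  define A' where "A' = (\<Sum>\<^sub>\<infinity>k\<in>UNIV. (real_of_int k)\<^sup>2 * (cmod (c k))\<^sup>2)"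
  define S' where "S' = (\<Sum>\<^sub>\<infinity>k\<in>UNIV. \<bar>real_of_int k\<bar> * (cmod (c k))\<^sup>2)"
  define Q where "Q \<theta> = exp (\<Sum>k=1..M. x k * psum N k (ez \<theta>)) * cnj (exp (\<Sum>k=1..M. y k * psum N k (ez \<theta>)))" for \<theta>
  have "SA = (\<Sum>k=1..M. (real_of_int (int k))\<^sup>2 * (cmod (c (int k)))\<^sup>2 + (real_of_int (- int k))\<^sup>2 * (cmod (c (- int k)))\<^sup>2)"
    unfolding SA_def sum.distrib[symmetric] by (intro sum.cong) (auto simp: x_def y_def)
  then have SA: "SA \<le> A'"
    unfolding A'_def using sum_symmetric_le_infsum[OF A, of M] by simp
  have "SS = (\<Sum>k=1..M. \<bar>real_of_int (int k)\<bar> * (cmod (c (int k)))\<^sup>2 + \<bar>real_of_int (- int k)\<bar> * (cmod (c (- int k)))\<^sup>2)"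
    unfolding SS_def sum.distrib[symmetric] by (intro sum.cong) (auto simp: x_def y_def)
  then have SS: "SS \<le> S'"
    unfolding S'_def using sum_symmetric_le_infsum[OF S, of M] by simp
  have xy: "(\<Sum>k=1..M. of_nat k * (x k * cnj (y k))) = (\<Sum>k=1..M. of_nat k * (c (int k) * c (- int k)))"
    by (intro sum.cong) (auto simp: x_def y_def)
  have pr: "(\<Prod>j<N. exp (fsum c M (\<theta> j))) = exp (of_nat N * c 0) * Q \<theta>" for \<theta>
  proof -
    have "(\<Sum>j<N. fsum c M (\<theta> j)) = of_nat N * c 0 + ((\<Sum>j<N. \<Sum>k=1..M. c (int k) * ez \<theta> j ^ k) + (\<Sum>j<N. \<Sum>k=1..M. c (- int k) * cnj (ez \<theta> j) ^ k))"
      unfolding fsum_nat by (simp add: sum.distrib)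
    also have "(\<Sum>j<N. \<Sum>k=1..M. c (int k) * ez \<theta> j ^ k) = (\<Sum>k=1..M. x k * psum N k (ez \<theta>))"
      unfolding psum_def sum_distrib_left by (subst sum.swap) (auto intro!: sum.cong simp: x_def)
    also have "(\<Sum>j<N. \<Sum>k=1..M. c (- int k) * cnj (ez \<theta> j) ^ k) = cnj (\<Sum>k=1..M. y k * psum N k (ez \<theta>))"
      unfolding psum_def sum_distrib_left cnj_sum by (subst sum.swap) (auto intro!: sum.cong simp: y_def)
    finally show ?thesis
      by (simp only: exp_sum[OF finite_lessThan, symmetric] Q_def exp_cnj exp_add)
  qed
  have "Jint \<beta> N (\<lambda>\<theta>. \<Prod>j<N. exp (fsum c M (\<theta> j))) * exp (- (of_nat N * c 0)) = Jint \<beta> N Q"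
    unfolding pr Jint_cmult by (simp add: exp_minus)
  then have eq: "Jint \<beta> N (\<lambda>\<theta>. \<Prod>j<N. exp (fsum c M (\<theta> j))) / of_real (circular_partition \<beta> N) * exp (- (of_nat N * c 0))
     = Jint \<beta> N Q / of_real (circular_partition \<beta> N)"
    by (metis times_divide_eq_left)
  have bound: "cmod (Jint \<beta> N Q / of_real (circular_partition \<beta> N)
       - exp (of_real \<alpha> * (\<Sum>k=1..M. of_nat k * (c (int k) * c (- int k)))))
     \<le> \<alpha>\<^sup>2 / (2 * real n) * SA * exp (\<alpha> / 2 * SS)"
    using trigonometric_bound[OF \<beta> N \<alpha>_def, of M x y]
    unfolding SA_def SS_def Q_def[abs_def] xy by (simp add: x_def y_def)
  \<comment> \<open>The factor 1 / 2 in \<alpha>^2 / (2 * n) is given away here; \<alpha>^2 / n is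
    the constant 4 / (\<beta>^2 * n) of the claim.\<close>
  have mono: "\<alpha>\<^sup>2 / (2 * real n) * SA * exp (\<alpha> / 2 * SS) \<le> \<alpha>\<^sup>2 / real n * A' * exp (\<alpha> / 2 * S')"
  proof -
    have "SA \<ge> 0" unfolding SA_def by (intro add_nonneg_nonneg sum_nonneg) auto
    moreover have "\<alpha>\<^sup>2 / (2 * real n) \<le> \<alpha>\<^sup>2 / real n" using N by (simp add: field_simps)
    moreover have "\<alpha> / 2 * SS \<le> \<alpha> / 2 * S'" using SS \<beta> by (intro mult_left_mono) (auto simp: \<alpha>_def)
    ultimately show ?thesis using SA by (intro mult_mono) auto
  qed
  have \<alpha>: "\<alpha>\<^sup>2 / real n = 4 / (\<beta>\<^sup>2 * real n)" "\<alpha> / 2 = 1 / \<beta>"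
    by (simp_all add: \<alpha>_def power_divide)
  show ?thesis
    unfolding \<alpha>_def[symmetric] A'_def[symmetric] S'_def[symmetric] \<alpha>[symmetric] eq
    by (rule order.trans[OF bound mono])
qed

text \<open>The sum over the integers is unordered, so the limit of partial sums is identified with
  it by absolute summability, which follows from p * q \<le> p^2 + q^2 and k \<le> k^2.\<close>

lemma infsum_pairing:
  fixes c :: "int \<Rightarrow> complex"
  assumes A: "(\<lambda>k. (real_of_int k)\<^sup>2 * (cmod (c k))\<^sup>2) summable_on UNIV"
  shows "(\<lambda>M. \<Sum>k=1..M. of_nat k * (c (int k) * c (- int k))) \<longlonglongrightarrow> (\<Sum>\<^sub>\<infinity>k\<in>{1::int..}. of_int k * c k * c (- k))"
proof -
  define t where "t k = of_nat k * (c (int k) * c (- int k))" for k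
  have "summable (\<lambda>k. (real_of_int (int k))\<^sup>2 * (cmod (c (int k)))\<^sup>2 + (real_of_int (- int k))\<^sup>2 * (cmod (c (- int k)))\<^sup>2)"
    by (intro summable_add; rule summable_nat_of_int[OF A]) (auto simp: inj_def)
  then have s: "summable (\<lambda>k. cmod (t k))"
  proof (rule summable_comparison_test')
    fix k :: nat
    define p q where "p = cmod (c (int k))" and "q = cmod (c (- int k))"
    have "0 \<le> (p - q)\<^sup>2" by simp
    then have "2 * (p * q) \<le> p\<^sup>2 + q\<^sup>2" by (simp add: power2_diff)
    moreover have "p * q \<ge> 0" by (simp add: p_def q_def)
    ultimately have "p * q \<le> p\<^sup>2 + q\<^sup>2" by linarith
    moreover have "real k \<le> (real k)\<^sup>2" by (cases k) (auto simp: power2_eq_square)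
    ultimately have "real k * (p * q) \<le> (real k)\<^sup>2 * (p\<^sup>2 + q\<^sup>2)"
      using \<open>p * q \<ge> 0\<close> by (intro mult_mono) auto
    then show "norm (cmod (t k)) \<le> (real_of_int (int k))\<^sup>2 * (cmod (c (int k)))\<^sup>2 + (real_of_int (- int k))\<^sup>2 * (cmod (c (- int k)))\<^sup>2"
      using \<open>p * q \<ge> 0\<close> by (simp add: t_def norm_mult distrib_left flip: p_def q_def)
  qed
  have t: "t sums suminf t" by (rule summable_sums[OF summable_norm_cancel[OF s]])
  have "(t has_sum suminf t) UNIV" by (rule norm_summable_imp_has_sum[OF s t])
  then have "(t has_sum suminf t) {1..}"
    by (subst has_sum_cong_neutral[of UNIV _ t t]) (auto simp: t_def Suc_le_eq)
  then have "((\<lambda>k. of_int k * c k * c (- k)) has_sum suminf t) {1::int..}"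
    by (subst has_sum_reindex_bij_witness[where i = int and j = nat and T = "{1..}" and h = t]) (auto simp: t_def)
  then have "(\<Sum>\<^sub>\<infinity>k\<in>{1::int..}. of_int k * c k * c (- k)) = suminf t" by (rule infsumI)
  moreover have "(\<Sum>k\<le>M. t k) = (\<Sum>k=1..M. t k)" for M
    by (rule sum.mono_neutral_right) (auto simp: t_def Suc_le_eq)
  ultimately show ?thesis using t by (simp add: sums_def_le t_def)
qed

theorem theorem1p4:
  fixes f :: "real \<Rightarrow> complex" and \<beta> :: real and n :: nat
  assumes "f \<in> sobolev_circle 1"
    and "0 < \<beta>" and "\<beta> \<le> 2"
    and "n \<ge> 1"
  shows "cmod (circular_expectation \<beta> (2 * n) (\<lambda>\<theta>. \<Prod>j<2 * n. exp (f (\<theta> j)))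
             * exp (- (of_nat (2 * n) * fourier_coeff f 0)
                 - complex_of_real (2 / \<beta>)
                   * (\<Sum>\<^sub>\<infinity>k\<in>{1::int..}. of_int k * fourier_coeff f k * fourier_coeff f (- k)))
             - 1)
      \<le> 4 / (\<beta>\<^sup>2 * real n)
         * exp (1 / \<beta> * (sobolev_seminorm (1 / 2) f)\<^sup>2
             - 2 / \<beta> * Re (\<Sum>\<^sub>\<infinity>k\<in>{1::int..}. of_int k * fourier_coeff f k * fourier_coeff f (- k)))
         * (sobolev_seminorm 1 f)\<^sup>2"
proof -
  define c where "c = fourier_coeff f"
  define N where "N = 2 * n"
  define T where "T = (\<Sum>\<^sub>\<infinity>k\<in>{1::int..}. of_int k * c k * c (- k))"
  define A' where "A' = (\<Sum>\<^sub>\<infinity>k\<in>UNIV. (real_of_int k)\<^sup>2 * (cmod (c k))\<^sup>2)"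
  define S' where "S' = (\<Sum>\<^sub>\<infinity>k\<in>UNIV. \<bar>real_of_int k\<bar> * (cmod (c k))\<^sup>2)"
  define Z where "Z = complex_of_real (circular_partition \<beta> N)"
  have f: "f \<in> L2_circle" using assms(1) by (simp add: sobolev_circle_def)
  have fm: "f \<in> borel_measurable arc_measure" using f by (simp add: L2_circle_def)
  have pw: "\<bar>real_of_int k\<bar> powr (2 * 1) = (real_of_int k)\<^sup>2" for k
    using powr_realpow[of "\<bar>real_of_int k\<bar>" 2] by (cases "k = 0") simp_all
  have pw': "\<bar>real_of_int k\<bar> powr (2 * (1 / 2)) = \<bar>real_of_int k\<bar>" for k by simp
  have A: "(\<lambda>k. (real_of_int k)\<^sup>2 * (cmod (c k))\<^sup>2) summable_on UNIV"
    using assms(1) unfolding sobolev_circle_def pw c_def by simp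
  have S: "(\<lambda>k. \<bar>real_of_int k\<bar> * (cmod (c k))\<^sup>2) summable_on UNIV"
  proof (rule summable_on_comparison_test[OF A])
    fix k :: int
    have "\<bar>real_of_int k\<bar> \<le> (real_of_int k)\<^sup>2"
    proof (cases "k = 0")
      case False
      then have "1 \<le> \<bar>real_of_int k\<bar>" by linarith
      then have "\<bar>real_of_int k\<bar> * 1 \<le> \<bar>real_of_int k\<bar> * \<bar>real_of_int k\<bar>" by (intro mult_left_mono) auto
      then show ?thesis by (simp add: power2_eq_square)
    qed simp
    then show "\<bar>real_of_int k\<bar> * (cmod (c k))\<^sup>2 \<le> (real_of_int k)\<^sup>2 * (cmod (c k))\<^sup>2"
      by (intro mult_right_mono) auto
  qed auto
  have semi: "(sobolev_seminorm 1 f)\<^sup>2 = A'" "(sobolev_seminorm (1 / 2) f)\<^sup>2 = S'"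
    unfolding sobolev_seminorm_def pw pw' A'_def S'_def c_def
    by (intro real_sqrt_pow2 infsum_nonneg; simp)+
  have "summable (\<lambda>k. cmod (c (g k)))" if g: "inj g" "\<And>k. (real_of_int (g k))\<^sup>2 = (real k)\<^sup>2" for g
  proof (rule summable_of_weighted_squares)
    have "summable (\<lambda>k. (real_of_int (g k))\<^sup>2 * (cmod (c (g k)))\<^sup>2)"
      by (rule summable_nat_of_int[OF A _ g(1)]) simp
    then show "summable (\<lambda>k. (real k)\<^sup>2 * (cmod (c (g k)))\<^sup>2)" by (simp only: g(2))
  qed simp
  from this[of int] this[of "\<lambda>k. - int k"]
  have "summable (\<lambda>k. cmod (c (int k)))" "summable (\<lambda>k. cmod (c (- int k)))" by (auto simp: inj_def)
  then obtain g B where g: "\<And>\<theta>. (\<lambda>M. fsum c M \<theta>) \<longlonglongrightarrow> g \<theta>" "\<And>M \<theta>. cmod (fsum c M \<theta>) \<le> B"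
    using fsum_converges by blast
  have fg: "AE \<theta> in arc_measure. f \<theta> = g \<theta>"
    by (rule fourier_series_AE[OF f]) (use g in \<open>simp_all add: c_def\<close>)
  have pm: "(\<lambda>\<theta>. \<Prod>j<N. exp (u (\<theta> j))) \<in> borel_measurable (torus N)"
    if u: "u \<in> borel_measurable arc_measure" for u :: "real \<Rightarrow> complex"
  proof -
    have "(\<lambda>\<theta>. u (\<theta> j)) \<in> borel_measurable (torus N)" if "j < N" for j
    proof -
      have "(\<lambda>\<theta>. \<theta> j) \<in> measurable (torus N) arc_measure"
        using that by (intro measurable_component_singleton) simp
      then show ?thesis by (rule measurable_compose) (rule u)
    qed
    moreover have "exp \<in> borel_measurable (borel :: complex measure)"
      by (intro borel_measurable_continuous_onI continuous_intros)
    ultimately show ?thesis by (intro borel_measurable_prod) (auto intro: measurable_compose)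
  qed
  have wm: "(\<lambda>\<theta>. of_real (circular_weight \<beta> N \<theta>) * F \<theta>) \<in> borel_measurable (torus N)"
    if "F \<in> borel_measurable (torus N)" for F :: "(nat \<Rightarrow> real) \<Rightarrow> complex"
    using that circular_weight_measurable by measurable
  have gm: "g \<in> borel_measurable arc_measure"
    by (rule borel_measurable_LIMSEQ_metric[OF fsum_measurable g(1)])
  \<comment> \<open>f itself may be unbounded on a null set; the limit g of its Fourier sums is
    bounded, and dominated convergence is applied to g.\<close>
  have "Jint \<beta> N (\<lambda>\<theta>. \<Prod>j<N. exp (f (\<theta> j))) = Jint \<beta> N (\<lambda>\<theta>. \<Prod>j<N. exp (g (\<theta> j)))"
    unfolding Jint_def
  proof (intro integral_cong_AE wm pm fm gm)
    show "AE \<theta> in torus N. of_real (circular_weight \<beta> N \<theta>) * (\<Prod>j<N. exp (f (\<theta> j))) =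
        of_real (circular_weight \<beta> N \<theta>) * (\<Prod>j<N. exp (g (\<theta> j)))"
      using AE_torus[OF fg, of N] by (rule eventually_mono) simp
  qed
  then have E: "circular_expectation \<beta> N (\<lambda>\<theta>. \<Prod>j<N. exp (f (\<theta> j))) = Jint \<beta> N (\<lambda>\<theta>. \<Prod>j<N. exp (g (\<theta> j))) / Z"
    using circular_expectation_eq[OF _ pm[OF fm], of \<beta>] assms(2) by (simp add: Z_def)
  define W where "W = (5 powr (\<beta> / 2)) ^ card (pairs N)"
  have J: "(\<lambda>M. Jint \<beta> N (\<lambda>\<theta>. \<Prod>j<N. exp (fsum c M (\<theta> j)))) \<longlonglongrightarrow> Jint \<beta> N (\<lambda>\<theta>. \<Prod>j<N. exp (g (\<theta> j)))"
    unfolding Jint_def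
  proof (rule integral_dominated_convergence[where w = "\<lambda>_. W * exp B ^ N"])
    show "(\<lambda>\<theta>. of_real (circular_weight \<beta> N \<theta>) * (\<Prod>j<N. exp (g (\<theta> j)))) \<in> borel_measurable (torus N)"
      by (intro wm pm gm)
    show "(\<lambda>\<theta>. of_real (circular_weight \<beta> N \<theta>) * (\<Prod>j<N. exp (fsum c M (\<theta> j)))) \<in> borel_measurable (torus N)" for M
      by (intro wm pm fsum_measurable)
    show "integrable (torus N) (\<lambda>_. W * exp B ^ N)" by (rule integrable_torus_bounded) auto
    show "AE \<theta> in torus N. (\<lambda>M. of_real (circular_weight \<beta> N \<theta>) * (\<Prod>j<N. exp (fsum c M (\<theta> j))))
        \<longlonglongrightarrow> of_real (circular_weight \<beta> N \<theta>) * (\<Prod>j<N. exp (g (\<theta> j)))"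
      by (intro AE_I2 tendsto_intros g)
    fix M
    have "cmod (of_real (circular_weight \<beta> N \<theta>) * (\<Prod>j<N. exp (fsum c M (\<theta> j)))) \<le> W * exp B ^ N" for \<theta>
    proof -
      have "cmod (\<Prod>j<N. exp (fsum c M (\<theta> j))) \<le> (\<Prod>j<N. exp B)"
        unfolding prod_norm[symmetric]
        by (intro prod_mono conjI norm_ge_zero) (use order.trans[OF complex_Re_le_cmod g(2)] in simp)
      then show ?thesis
        using circular_weight_bounds[of \<beta> N \<theta>] assms(2)
        unfolding norm_mult norm_of_real W_def by (intro mult_mono) auto
    qed
    then show "AE \<theta> in torus N. cmod (of_real (circular_weight \<beta> N \<theta>) * (\<Prod>j<N. exp (fsum c M (\<theta> j)))) \<le> W * exp B ^ N"
      by simp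
  qed
  have Z: "Z \<noteq> 0" using circular_partition_pos[of \<beta> N] assms(2) by (simp add: Z_def)
  define R where "R = 4 / (\<beta>\<^sup>2 * real n) * A' * exp (1 / \<beta> * S')"
  have "(\<lambda>M. cmod (Jint \<beta> N (\<lambda>\<theta>. \<Prod>j<N. exp (fsum c M (\<theta> j))) / Z * exp (- (of_nat N * c 0))
         - exp (of_real (2 / \<beta>) * (\<Sum>k=1..M. of_nat k * (c (int k) * c (- int k))))))
     \<longlonglongrightarrow> cmod (Jint \<beta> N (\<lambda>\<theta>. \<Prod>j<N. exp (g (\<theta> j))) / Z * exp (- (of_nat N * c 0)) - exp (of_real (2 / \<beta>) * T))"
    unfolding T_def by (intro tendsto_intros J Z infsum_pairing A)
  then have "cmod (Jint \<beta> N (\<lambda>\<theta>. \<Prod>j<N. exp (g (\<theta> j))) / Z * exp (- (of_nat N * c 0)) - exp (of_real (2 / \<beta>) * T)) \<le> R"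
    by (rule LIMSEQ_le_const2)
      (use truncated_bound[OF assms(2,3) N_def assms(4) A S] in \<open>auto simp: R_def A'_def S'_def Z_def\<close>)
  \<comment> \<open>Multiplying by |exp (- (2 / \<beta>) * T)| normalises the main term to 1 and is
    the source of - 2 / \<beta> * Re T in the exponent.\<close>
  then have bound: "cmod (Jint \<beta> N (\<lambda>\<theta>. \<Prod>j<N. exp (g (\<theta> j))) / Z * exp (- (of_nat N * c 0)) - exp (of_real (2 / \<beta>) * T))
     * cmod (exp (- (of_real (2 / \<beta>) * T))) \<le> R * cmod (exp (- (of_real (2 / \<beta>) * T)))"
    by (rule mult_right_mono) simp
  have normalize: "(e * exp u - exp v) * exp (- v) = e * exp (u - v) - 1" for e u v :: complex
    by (simp add: left_diff_distrib mult.assoc exp_diff exp_minus divide_inverse)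
  have "cmod (Jint \<beta> N (\<lambda>\<theta>. \<Prod>j<N. exp (g (\<theta> j))) / Z * exp (- (of_nat N * c 0) - of_real (2 / \<beta>) * T) - 1)
     \<le> R * cmod (exp (- (of_real (2 / \<beta>) * T)))"
    using bound unfolding norm_mult[symmetric] normalize by (simp only: norm_mult)
  also have "cmod (exp (- (of_real (2 / \<beta>) * T))) = exp (- (2 / \<beta> * Re T))" by simp
  also have "R * exp (- (2 / \<beta> * Re T)) = 4 / (\<beta>\<^sup>2 * real n) * exp (1 / \<beta> * S' - 2 / \<beta> * Re T) * A'"
    by (simp add: R_def exp_diff exp_minus divide_inverse mult_ac)
  finally show ?thesis
    unfolding semi T_def c_def[symmetric] N_def[symmetric] E .
qed

end
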